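(* For each $n\ge 1$ let $f=\sum_{k=0}^n \varepsilon_k z^k$, where $\varepsilon_0,\dots,\varepsilon_n$ are i.i.d. standard (real) Gaussian random variables. Let $Z(f)$ denote the set of complex zeros of $f$, and let $\mathbb{S}$ denote the unit circle in $\mathbb{C}$. Then $$n^2\, d(Z(f),\mathbb{S})\to \mathrm{Exp}(1/6)$$ in distribution as $n\to\infty$.
   Context: For $A,B\subseteq\mathbb{C}$, $d(A,B)=\inf\{|x-y|: x\in A,\ y\in B\}$. For $\lambda>0$, $\mathrm{Exp}(\lambda)$ denotes an exponential random variable with mean $\lambda^{-1}$. *)

theory Defs
  imports "HOL-Probability.Probability"
begin

definition rand_poly :: "(nat \<Rightarrow> 'a \<Rightarrow> real) \<Rightarrow> nat \<Rightarrow> 'a \<Rightarrow> complex \<Rightarrow> complex" where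
  "rand_poly \<epsilon> n \<omega> z = (\<Sum>k\<le>n. complex_of_real (\<epsilon> k \<omega>) * z ^ k)"

definition zero_set :: "(complex \<Rightarrow> complex) \<Rightarrow> complex set" where
  "zero_set f = {z. f z = 0}"

(* The distance d(A,B) is the library's setdist; it differs from the infimum in the extended reals
   only when a set is empty (setdist is then 0, not infinity).  For n >= 1 the polynomial above has
   no zeros only on the null event that it is a nonzero constant. *)

end

theory Submission
  imports Defs "HOL-Computational_Algebra.Polynomial" "HOL-Real_Asymp.Real_Asymp"
    "HOL-Complex_Analysis.Cauchy_Integral_Formula"
begin

text \<open>
  Substitute \<open>z = exp (\<i> w)\<close>, so that zeros near the circle become zeros of
  \<open>g w = (\<Sum>k\<le>n. \<epsilon>\<^sub>k exp (\<i> k w))\<close> with \<open>Im w\<close> of order \<open>1 / n\<^sup>2\<close>; as the coefficients are real,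
  \<open>0 \<le> Re w \<le> \<pi>\<close> suffices. Cut this range into \<open>n\<^sup>2\<close> cells around grid points \<open>t\<close>. Inside a cell \<open>g\<close> is linear
  up to a negligible error, so whether it has a zero there is decided
    by \<open>g t\<close> and \<open>g' t\<close>. Away from the real axis
  these are, after normalisation, almost four independent normal variables, and a zero with horizontal
  offset at most \<open>a / n\<^sup>2\<close> and \<open>\<bar>Im w\<bar> \<le> b / n\<^sup>2\<close> occurs with probability asymptotic to \<open>ab / (3 \<pi> n\<^sup>2)\<close>.

  Cells at mutual distance at least \<open>1 / \<surd>n\<close> are almost independent, tuples with closer cells are few, and two
  very close cells cannot both contain a zero. So the factorial moments of the number of occupied cells converge to those
  of a Poisson variable, and the probability of no occupied cell tends to \<open>exp (- ab / (3 \<pi>))\<close>. Taking \<open>b = y\<close> and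
  letting \<open>a\<close> approach \<open>\<pi> / 2\<close>, half the cell width in units of \<open>1 / n\<^sup>2\<close>, from both sides gives \<open>exp (- y / 6)\<close>.
\<close>

section \<open>Gaussian vectors\<close>

text \<open>A cell is occupied with probability of order n^-2, and such probabilities are multiplied
  over k cells, so an additive normal approximation is useless. Nearly orthonormal forms are instead
  compared with independent ones through a density ratio, which is uniform only on a bounded box;
  hence the truncation of |H| between 1/ln n and ln n. Conditionally on the normalised derivative H,
  the window with half-sides a/n^2 and b/n^2 contains a zero with probability about 4ab|H|^2/(pi
  n^2), and |H|^2 has mean about 1/12, the mean square of k/n - 1/2; this is the origin of ab/(3
  pi). The factorial moments need a < pi/2: then different cells hold different zeros, which bounds
  on g' and g'' keep apart. Windows that cover the whole range have a > pi/2, overlap, and escape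
  this argument.\<close>

definition gauss :: "nat set \<Rightarrow> (nat \<Rightarrow> real) measure" where
  "gauss I = PiM I (\<lambda>_. std_normal_distribution)"

definition inner_on :: "nat set \<Rightarrow> (nat \<Rightarrow> real) \<Rightarrow> (nat \<Rightarrow> real) \<Rightarrow> real" where
  "inner_on I a b = (\<Sum>k\<in>I. a k * b k)"

interpretation std_normal: prob_space std_normal_distribution
  using prob_space_normal_density by simp

interpretation std_normal_prod: product_sigma_finite "\<lambda>_::nat. std_normal_distribution"
  by standard

lemma prob_space_gauss: "prob_space (gauss I)"
  unfolding gauss_def by (rule prob_space_PiM) (rule std_normal.prob_space_axioms)

lemma sets_gauss [measurable_cong]: "sets (gauss I) = sets (PiM I (\<lambda>_. borel))"
  unfolding gauss_def by (rule sets_PiM_cong) auto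

lemma space_gauss: "space (gauss I) = (\<Pi>\<^sub>E i\<in>I. UNIV)"
  unfolding gauss_def by (simp add: space_PiM)

lemma inner_on_measurable [measurable]: "finite I \<Longrightarrow> inner_on I a \<in> borel_measurable (gauss I)"
  unfolding inner_on_def by measurable

text \<open>The density \<open>(2 + Z) / (2 + \<kappa>)\<close> tilts \<open>M\<close> to a probability measure under which \<open>X\<close> is again standard normal,
  by uniqueness of characteristic functions.\<close>

lemma (in prob_space) std_normal_test_real:
  fixes Z X :: "'a \<Rightarrow> real"
  assumes [measurable]: "Z \<in> borel_measurable M" "X \<in> borel_measurable M"
    and bd: "\<And>\<omega>. \<bar>Z \<omega>\<bar> \<le> 1"
    and Z: "\<And>s. (CLINT \<omega>|M. of_real (Z \<omega>) * iexp (s * X \<omega>)) = of_real (\<kappa> * exp (- s\<^sup>2 / 2))"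
    and X: "\<And>s. (CLINT \<omega>|M. iexp (s * X \<omega>)) = of_real (exp (- s\<^sup>2 / 2))"
    and A: "A \<in> sets borel"
  shows "expectation (\<lambda>\<omega>. Z \<omega> * indicator A (X \<omega>)) = \<kappa> * measure std_normal_distribution A"
proof -
  have intZ: "integrable M Z"
    by (rule integrable_const_bound[where B=1]) (auto simp: bd)
  have EZ: "expectation Z = \<kappa>"
  proof -
    have "of_real (expectation Z) = (CLINT \<omega>|M. of_real (Z \<omega>) * iexp (0 * X \<omega>))"
      by (simp)
    also have "\<dots> = of_real \<kappa>" by (subst Z) simp
    finally show ?thesis using of_real_eq_iff by blast
  qed
  have "\<bar>\<kappa>\<bar> \<le> expectation (\<lambda>_. 1)"
    unfolding EZ[symmetric] by (rule integral_abs_bound[THEN order_trans], rule integral_mono) (auto simp: bd intZ)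
  hence k: "2 + \<kappa> > 0" by (auto simp: prob_space)
  \<comment> \<open>The shift is 2 and not 1 because \<open>\<kappa>\<close> may equal -1, and then
    1 + \<open>\<kappa>\<close> could not serve as normalising factor.\<close>
  define w where "w \<omega> = (2 + Z \<omega>) / (2 + \<kappa>)" for \<omega>
  have [measurable]: "w \<in> borel_measurable M" unfolding w_def by measurable
  have w0: "w \<omega> \<ge> 0" for \<omega> using bd[of \<omega>] k by (auto simp: w_def)
  have intw: "integrable M w" unfolding w_def using intZ by auto
  have "expectation w = 1" unfolding w_def using intZ k by (simp add: EZ prob_space)
  hence ew: "(\<integral>\<^sup>+ \<omega>. ennreal (w \<omega>) \<partial>M) = 1"
    using nn_integral_eq_integral[OF intw] w0 by simp
  define N where "N = density M (\<lambda>\<omega>. ennreal (w \<omega>))"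
  have [measurable_cong]: "sets N = sets M" by (simp add: N_def)
  have pN: "prob_space N"
    by standard (simp add: N_def emeasure_density ew cong: nn_integral_cong)
  interpret N: prob_space N by (rule pN)
  have rd: "real_distribution (distr N borel X)"
    by (simp add: N.prob_space_distr real_distribution.intro real_distribution_axioms.intro)
  have "char (distr N borel X) = char std_normal_distribution"
  proof
    fix t
    have "char (distr N borel X) t = (CLINT \<omega>|M. w \<omega> *\<^sub>R iexp (t * X \<omega>))"
      unfolding char_def N_def
      by (subst integral_distr, simp, simp, subst integral_density) (auto simp: w0)
    also have "\<dots> = (CLINT \<omega>|M. (2 / (2 + \<kappa>)) *\<^sub>R iexp (t * X \<omega>) + (1 / (2 + \<kappa>)) *\<^sub>R (of_real (Z \<omega>) * iexp (t * X \<omega>)))"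
      by (rule Bochner_Integration.integral_cong) (auto simp: w_def scaleR_conv_of_real add_divide_distrib algebra_simps)
    also have "\<dots> = (2 / (2 + \<kappa>)) *\<^sub>R (CLINT \<omega>|M. iexp (t * X \<omega>)) + (1 / (2 + \<kappa>)) *\<^sub>R (CLINT \<omega>|M. of_real (Z \<omega>) * iexp (t * X \<omega>))"
    proof -
      have "integrable M (\<lambda>\<omega>. iexp (t * X \<omega>))"
        by (auto intro!: integrable_const_bound[where B=1])
      moreover have "integrable M (\<lambda>\<omega>. of_real (Z \<omega>) * iexp (t * X \<omega>))"
        by (auto intro!: integrable_const_bound[where B=1] simp: bd norm_mult)
      ultimately show ?thesis by simp
    qed
    also have "\<dots> = of_real ((2 / (2 + \<kappa>)) * exp (- t\<^sup>2 / 2) + (1 / (2 + \<kappa>)) * (\<kappa> * exp (- t\<^sup>2 / 2)))"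
      unfolding X Z by (simp add: scaleR_conv_of_real)
    also have "(2 / (2 + \<kappa>)) * exp (- t\<^sup>2 / 2) + (1 / (2 + \<kappa>)) * (\<kappa> * exp (- t\<^sup>2 / 2))
        = (2 + \<kappa>) / (2 + \<kappa>) * exp (- t\<^sup>2 / 2)"
      by (simp only: add_divide_distrib ring_distribs) simp
    also have "\<dots> = exp (- t\<^sup>2 / 2)" using k by simp
    finally show "char (distr N borel X) t = char std_normal_distribution t"
      by (simp add: char_std_normal_distribution)
  qed
  from Levy_uniqueness[OF rd real_dist_normal_dist this]
  have eN: "distr N borel X = std_normal_distribution" .
  have rd': "real_distribution (distr M borel X)"
    by (simp add: prob_space_distr real_distribution.intro real_distribution_axioms.intro)
  have "char (distr M borel X) = char std_normal_distribution"
    unfolding char_std_normal_distribution char_def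
    using X by (subst integral_distr) (auto simp: fun_eq_iff)
  from Levy_uniqueness[OF rd' real_dist_normal_dist this]
  have eM: "distr M borel X = std_normal_distribution" .
  have 1: "expectation (\<lambda>\<omega>. indicator A (X \<omega>)) = measure std_normal_distribution A"
  proof -
    have "measure std_normal_distribution A = (\<integral>x. indicator A x \<partial>distr M borel X)"
      unfolding eM using A by simp
    also have "\<dots> = expectation (\<lambda>\<omega>. indicator A (X \<omega>))"
      using A by (subst integral_distr) auto
    finally show ?thesis ..
  qed
  have "measure std_normal_distribution A = (\<integral>x. indicator A x \<partial>distr N borel X)"
    unfolding eN using A by simp
  also have "\<dots> = expectation (\<lambda>\<omega>. w \<omega> * indicator A (X \<omega>))"
    unfolding N_def using A by (subst integral_distr, simp, simp, subst integral_density) (auto simp: w0)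
  also have "\<dots> = expectation (\<lambda>\<omega>. (2 / (2 + \<kappa>)) * indicator A (X \<omega>) + (1 / (2 + \<kappa>)) * (Z \<omega> * indicator A (X \<omega>)))"
    by (rule Bochner_Integration.integral_cong) (auto simp: w_def add_divide_distrib algebra_simps)
  also have "\<dots> = (2 / (2 + \<kappa>)) * expectation (\<lambda>\<omega>. indicator A (X \<omega>)) + (1 / (2 + \<kappa>)) * expectation (\<lambda>\<omega>. Z \<omega> * indicator A (X \<omega>))"
  proof -
    have "integrable M (\<lambda>\<omega>. indicator A (X \<omega>) :: real)"
      using A by (auto intro!: integrable_const_bound[where B=1])
    moreover have "integrable M (\<lambda>\<omega>. Z \<omega> * indicator A (X \<omega>))"
      using A bd by (auto intro!: integrable_const_bound[where B=1] simp: abs_mult indicator_def)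
    ultimately show ?thesis by simp
  qed
  finally have "(2 + \<kappa>) * measure std_normal_distribution A = (2 + \<kappa>) * ((2 / (2 + \<kappa>)) * measure std_normal_distribution A
      + (1 / (2 + \<kappa>)) * expectation (\<lambda>\<omega>. Z \<omega> * indicator A (X \<omega>)))"
    unfolding 1 by simp
  also have "\<dots> = 2 * measure std_normal_distribution A + expectation (\<lambda>\<omega>. Z \<omega> * indicator A (X \<omega>))"
    using k by (simp add: distrib_left)
  finally show ?thesis by (simp add: distrib_right)
qed

text \<open>The prescribed value is real and even in \<open>s\<close>, so \<open>cnj Z\<close>
  satisfies the same identity as \<open>Z\<close>. Hence the real part of \<open>Z\<close> obeys the
  real version with \<open>\<kappa>\<close>, and the imaginary part obeys it with 0.\<close>

lemma (in prob_space) std_normal_test_complex: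
  fixes Z :: "'a \<Rightarrow> complex" and X :: "'a \<Rightarrow> real"
  assumes [measurable]: "Z \<in> borel_measurable M" "X \<in> borel_measurable M"
    and bd: "\<And>\<omega>. norm (Z \<omega>) \<le> 1"
    and Z: "\<And>s. (CLINT \<omega>|M. Z \<omega> * iexp (s * X \<omega>)) = of_real (\<kappa> * exp (- s\<^sup>2 / 2))"
    and X: "\<And>s. (CLINT \<omega>|M. iexp (s * X \<omega>)) = of_real (exp (- s\<^sup>2 / 2))"
    and A: "A \<in> sets borel"
  shows "(CLINT \<omega>|M. Z \<omega> * indicator A (X \<omega>)) = of_real (\<kappa> * measure std_normal_distribution A)"
proof -
  have int: "integrable M (\<lambda>\<omega>. Z \<omega> * iexp (s * X \<omega>))" for s
    by (auto intro!: integrable_const_bound[where B=1] simp: bd norm_mult)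
  have [measurable]: "(\<lambda>\<omega>. cnj (Z \<omega>)) \<in> borel_measurable M"
    using assms(1) by (rule borel_measurable_continuous_on[rotated]) (intro continuous_intros)
  have int': "integrable M (\<lambda>\<omega>. cnj (Z \<omega>) * iexp (s * X \<omega>))" for s
    by (auto intro!: integrable_const_bound[where B=1] simp: bd norm_mult)
  have Z': "(CLINT \<omega>|M. cnj (Z \<omega>) * iexp (s * X \<omega>)) = of_real (\<kappa> * exp (- s\<^sup>2 / 2))" for s
  proof -
    have "(CLINT \<omega>|M. cnj (Z \<omega>) * iexp (s * X \<omega>)) = (CLINT \<omega>|M. cnj (Z \<omega> * iexp (- s * X \<omega>)))"
      by (simp add: exp_cnj)
    also have "\<dots> = cnj (CLINT \<omega>|M. Z \<omega> * iexp (- s * X \<omega>))"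
      by (rule integral_bounded_linear[OF bounded_linear_cnj int])
    also have "\<dots> = of_real (\<kappa> * exp (- s\<^sup>2 / 2))" by (subst Z) simp
    finally show ?thesis .
  qed
  have re: "of_real (Re (Z \<omega>)) * iexp u = (Z \<omega> * iexp u + cnj (Z \<omega>) * iexp u) / 2" for \<omega> u
    using complex_add_cnj[of "Z \<omega>"] by (simp add: distrib_right[symmetric])
  have im: "of_real (Im (Z \<omega>)) * iexp u = (Z \<omega> * iexp u - cnj (Z \<omega>) * iexp u) / (2 * \<i>)" for \<omega> u
    using complex_diff_cnj[of "Z \<omega>"] by (simp add: left_diff_distrib[symmetric] mult.left_commute)
  have 1: "expectation (\<lambda>\<omega>. Re (Z \<omega>) * indicator A (X \<omega>)) = \<kappa> * measure std_normal_distribution A"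
  proof (rule std_normal_test_real[OF _ _ _ _ X A])
    show "\<bar>Re (Z \<omega>)\<bar> \<le> 1" for \<omega>
      using abs_Re_le_cmod[of "Z \<omega>"] bd[of \<omega>] by linarith
    show "(CLINT \<omega>|M. of_real (Re (Z \<omega>)) * iexp (s * X \<omega>)) = of_real (\<kappa> * exp (- s\<^sup>2 / 2))" for s
      unfolding re using int[of s] int'[of s] Z[of s] Z'[of s] by simp
  qed auto
  have 2: "expectation (\<lambda>\<omega>. Im (Z \<omega>) * indicator A (X \<omega>)) = 0 * measure std_normal_distribution A"
  proof (rule std_normal_test_real[OF _ _ _ _ X A])
    show "\<bar>Im (Z \<omega>)\<bar> \<le> 1" for \<omega>
      using abs_Im_le_cmod[of "Z \<omega>"] bd[of \<omega>] by linarith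
    show "(CLINT \<omega>|M. of_real (Im (Z \<omega>)) * iexp (s * X \<omega>)) = of_real (0 * exp (- s\<^sup>2 / 2))" for s
      unfolding im using int[of s] int'[of s] Z[of s] Z'[of s] by simp
  qed auto
  have i: "integrable M (\<lambda>\<omega>. Z \<omega> * indicator A (X \<omega>))"
    using A bd by (auto intro!: integrable_const_bound[where B=1] simp: norm_mult indicator_def)
  have ind: "Re (indicator A u) = indicator A u" "Im (indicator A u) = 0" for u
    by (auto simp: indicator_def)
  show ?thesis
    by (rule complex_eqI) (use 1 2 i in \<open>simp_all add: ind flip: integral_Re integral_Im\<close>)
qed

lemma inner_on_sum_left:
  "inner_on I (\<lambda>k. \<Sum>l\<in>D. c l * e l k) x = (\<Sum>l\<in>D. c l * inner_on I (e l) x)"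
  unfolding inner_on_def sum_distrib_left sum_distrib_right
  by (subst sum.swap) (simp add: mult.assoc)

lemma inner_on_commute: "inner_on I a b = inner_on I b a"
  by (simp add: inner_on_def mult.commute)

lemma gauss_char_linear:
  assumes "finite I"
  shows "(CLINT x|gauss I. iexp (inner_on I a x)) = of_real (exp (- inner_on I a a / 2))"
proof -
  have "(CLINT x|gauss I. iexp (inner_on I a x)) = (CLINT x|gauss I. (\<Prod>k\<in>I. iexp (a k * x k)))"
    by (simp add: inner_on_def assms sum_distrib_left exp_sum)
  also have "\<dots> = (\<Prod>k\<in>I. (CLINT y|std_normal_distribution. iexp (a k * y)))"
    unfolding gauss_def
    by (rule std_normal_prod.product_integral_prod[where f="\<lambda>k y. iexp (a k * y)"])
       (auto simp: assms intro!: std_normal.integrable_const_bound[where B=1])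
  also have "\<dots> = (\<Prod>k\<in>I. of_real (exp (- (a k)\<^sup>2 / 2)))"
    using char_std_normal_distribution by (intro prod.cong refl) (auto simp: char_def fun_eq_iff)
  also have "\<dots> = of_real (exp (- inner_on I a a / 2))"
    by (simp add: inner_on_def assms sum_divide_distrib power2_eq_square flip: exp_sum sum_negf of_real_prod)
  finally show ?thesis .
qed

definition orthonormal_on :: "nat set \<Rightarrow> nat \<Rightarrow> (nat \<Rightarrow> nat \<Rightarrow> real) \<Rightarrow> bool" where
  "orthonormal_on I d e \<longleftrightarrow> (\<forall>l<d. \<forall>m<d. inner_on I (e l) (e m) = (if l = m then 1 else 0))"

lemma inner_on_orthonormal_combination:
  assumes "orthonormal_on I d e" "D \<subseteq> {..<d}"
  shows "inner_on I (\<lambda>k. \<Sum>l\<in>D. c l * e l k) (\<lambda>k. \<Sum>l\<in>D. c l * e l k) = (\<Sum>l\<in>D. (c l)\<^sup>2)"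
proof -
  have "finite D" using assms(2) finite_subset by blast
  have "inner_on I (e l) (\<lambda>k. \<Sum>l\<in>D. c l * e l k) = c l" if "l \<in> D" for l
  proof -
    have "inner_on I (e l) (\<lambda>k. \<Sum>l\<in>D. c l * e l k) = (\<Sum>m\<in>D. c m * inner_on I (e m) (e l))"
      by (subst inner_on_commute, subst inner_on_sum_left) simp
    also have "\<dots> = (\<Sum>m\<in>D. if m = l then c m else 0)"
      using assms that by (intro sum.cong) (auto simp: orthonormal_on_def subset_iff)
    also have "\<dots> = c l" using that \<open>finite D\<close> by simp
    finally show ?thesis .
  qed
  thus ?thesis by (simp add: inner_on_sum_left power2_eq_square cong: sum.cong)
qed

text \<open>Indicators are tested in the first \<open>j\<close> coordinates and characters in the
  others: j = 0 is the joint characteristic function, j = d gives probabilities of boxes. Each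
  induction step trades one character for an indicator, so only the one-dimensional uniqueness
  theorem is used.\<close>

lemma gauss_orthonormal_test:
  assumes I: "finite I" and e: "orthonormal_on I d e" and "j \<le> d" and A: "\<And>l. A l \<in> sets borel"
  shows "(CLINT x|gauss I. (\<Prod>l<j. indicator (A l) (inner_on I (e l) x)) *
            iexp (\<Sum>l=j..<d. t l * inner_on I (e l) x))
       = of_real ((\<Prod>l<j. measure std_normal_distribution (A l)) * exp (- (\<Sum>l=j..<d. (t l)\<^sup>2) / 2))"
  using \<open>j \<le> d\<close>
proof (induction j arbitrary: t)
  case 0
  show ?case
  proof -
    have "(CLINT x|gauss I. iexp (inner_on I (\<lambda>k. \<Sum>l=0..<d. t l * e l k) x))
        = of_real (exp (- (\<Sum>l=0..<d. (t l)\<^sup>2) / 2))"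
      by (subst gauss_char_linear[OF I], subst inner_on_orthonormal_combination[OF e]) auto
    thus ?thesis by (simp add: inner_on_sum_left)
  qed
next
  case (Suc j)
  interpret prob_space "gauss I" by (rule prob_space_gauss)
  note [measurable] = A inner_on_measurable[OF I]
  define Z where "Z x = (\<Prod>l<j. indicator (A l) (inner_on I (e l) x)) *
            iexp (\<Sum>l=Suc j..<d. t l * inner_on I (e l) x)" for x
  have [measurable]: "Z \<in> borel_measurable (gauss I)" unfolding Z_def by measurable
  have bd: "norm (Z x) \<le> 1" for x
    unfolding Z_def norm_mult prod_norm[symmetric] by (auto intro!: prod_le_1 simp: indicator_def)
  have Zs: "(CLINT x|gauss I. Z x * iexp (s * inner_on I (e j) x)) =
     of_real ((\<Prod>l<j. measure std_normal_distribution (A l)) * exp (- (\<Sum>l=Suc j..<d. (t l)\<^sup>2) / 2) * exp (- s\<^sup>2 / 2))" for s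
  proof -
    have s1: "(\<Sum>l=j..<d. (t(j:=s)) l * inner_on I (e l) x) = s * inner_on I (e j) x + (\<Sum>l=Suc j..<d. t l * inner_on I (e l) x)" for x
      using Suc.prems by (subst sum.atLeast_Suc_lessThan) (auto intro!: sum.cong)
    have s2: "(\<Sum>l=j..<d. ((t(j:=s)) l)\<^sup>2) = s\<^sup>2 + (\<Sum>l=Suc j..<d. (t l)\<^sup>2)"
      using Suc.prems by (subst sum.atLeast_Suc_lessThan) (auto intro!: sum.cong)
    have e: "exp (- (s\<^sup>2 + S) / 2) = exp (- S / 2) * exp (- s\<^sup>2 / 2)" for S :: real
      by (simp add: field_simps flip: exp_add)
    show ?thesis
      using Suc.IH[of "t(j:=s)"] Suc.prems unfolding s1 s2 e Z_def
      by (simp add: exp_add algebra_simps)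
  qed
  have Xs: "(CLINT x|gauss I. iexp (s * inner_on I (e j) x)) = of_real (exp (- s\<^sup>2 / 2))" for s
    using gauss_char_linear[OF I, of "\<lambda>k. \<Sum>l\<in>{j}. s * e l k"]
      inner_on_orthonormal_combination[OF e, of "{j}" "\<lambda>_. s"] Suc.prems
      inner_on_sum_left[of I "\<lambda>_. s" e "{j}"] by simp
  have "(CLINT x|gauss I. Z x * indicator (A j) (inner_on I (e j) x)) =
     of_real ((\<Prod>l<j. measure std_normal_distribution (A l)) * exp (- (\<Sum>l=Suc j..<d. (t l)\<^sup>2) / 2) *
       measure std_normal_distribution (A j))"
    by (rule std_normal_test_complex) (auto simp: bd Zs Xs simp del: of_real_mult of_real_exp)
  thus ?case unfolding Z_def by (simp add: mult_ac)
qed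

text \<open>Rotation invariance, in a form that also covers directions spanning a proper subspace.
  Boxes determine the law, and their probabilities are the case j = d of the previous lemma.\<close>

lemma distr_gauss_orthonormal:
  assumes I: "finite I" and e: "orthonormal_on I d e"
  shows "distr (gauss I) (gauss {..<d}) (\<lambda>x. \<lambda>l\<in>{..<d}. inner_on I (e l) x) = gauss {..<d}"
  unfolding gauss_def[of "{..<d}"]
proof (rule std_normal_prod.PiM_eqI)
  interpret prob_space "gauss I" by (rule prob_space_gauss)
  note [measurable] = inner_on_measurable[OF I]
  fix A :: "nat \<Rightarrow> real set" assume A: "\<And>i. i \<in> {..<d} \<Longrightarrow> A i \<in> sets std_normal_distribution"
  \<comment> \<open>Filling up with the whole line makes the sets Borel for every index, as
    \<open>gauss_orthonormal_test\<close> asks.\<close>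
  define B where "B i = (if i < d then A i else UNIV)" for i
  have B [measurable]: "B i \<in> sets borel" for i using A[of i] by (auto simp: B_def)
  have eq: "Pi\<^sub>E {..<d} A = Pi\<^sub>E {..<d} B" by (auto simp: B_def PiE_def Pi_def)
  let ?X = "\<lambda>x. \<lambda>l\<in>{..<d}. inner_on I (e l) x"
  have Xm: "?X \<in> measurable (gauss I) (PiM {..<d} (\<lambda>_. std_normal_distribution))" by measurable
  have "of_real (prob (?X -` Pi\<^sub>E {..<d} B \<inter> space (gauss I)))
      = (CLINT x|gauss I. complex_of_real (indicator (?X -` Pi\<^sub>E {..<d} B \<inter> space (gauss I)) x))"
    using Xm by (subst integral_complex_of_real) (simp add: measurable_sets)
  also have "\<dots> = (CLINT x|gauss I. (\<Prod>l<d. indicator (B l) (inner_on I (e l) x)) *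
            iexp (\<Sum>l=d..<d. 0 * inner_on I (e l) x))"
    by (rule Bochner_Integration.integral_cong) (auto simp: indicator_def PiE_def Pi_def)
  also have "\<dots> = of_real (\<Prod>l<d. measure std_normal_distribution (B l))"
    by (subst gauss_orthonormal_test[OF I e]) (auto simp: B)
  finally have "prob (?X -` Pi\<^sub>E {..<d} B \<inter> space (gauss I)) = (\<Prod>l<d. measure std_normal_distribution (B l))"
    using of_real_eq_iff by blast
  hence "emeasure (distr (gauss I) (PiM {..<d} (\<lambda>_. std_normal_distribution)) ?X) (Pi\<^sub>E {..<d} B)
     = (\<Prod>l<d. emeasure std_normal_distribution (B l))"
    using Xm by (subst emeasure_distr) (auto simp: emeasure_eq_measure std_normal.emeasure_eq_measure prod_ennreal)
  thus "emeasure (distr (gauss I) (PiM {..<d} (\<lambda>_. std_normal_distribution)) ?X) (Pi\<^sub>E {..<d} A)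
     = (\<Prod>i\<in>{..<d}. emeasure std_normal_distribution (A i))"
    unfolding eq by (auto simp: B_def intro!: prod.cong)
qed auto

section \<open>Gram-Schmidt orthogonalisation\<close>

lemma inner_on_cong: "(\<And>k. k \<in> I \<Longrightarrow> a k = a' k) \<Longrightarrow> (\<And>k. k \<in> I \<Longrightarrow> b k = b' k) \<Longrightarrow> inner_on I a b = inner_on I a' b'"
  unfolding inner_on_def by (intro sum.cong) auto

lemma inner_on_linear:
  "inner_on I (\<lambda>k. a k + b k) c = inner_on I a c + inner_on I b c"
  "inner_on I (\<lambda>k. a k - b k) c = inner_on I a c - inner_on I b c"
  "inner_on I (\<lambda>k. s * a k) c = s * inner_on I a c"
  "inner_on I c (\<lambda>k. a k + b k) = inner_on I c a + inner_on I c b"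
  "inner_on I c (\<lambda>k. a k - b k) = inner_on I c a - inner_on I c b"
  "inner_on I c (\<lambda>k. s * a k) = s * inner_on I c a"
  by (simp_all add: inner_on_def algebra_simps sum.distrib sum_subtractf sum_distrib_left)

lemma inner_on_sum_right:
  "inner_on I x (\<lambda>k. \<Sum>l\<in>D. c l * e l k) = (\<Sum>l\<in>D. c l * inner_on I x (e l))"
  by (subst inner_on_commute, subst inner_on_sum_left) (simp add: inner_on_commute)

lemma inner_on_nonneg: "inner_on I a a \<ge> 0"
  unfolding inner_on_def by (intro sum_nonneg) auto

text \<open>The number \<open>a j\<close> is the length of the part of \<open>y j\<close> orthogonal
  to its predecessors. The other coefficients are not stored, since orthonormality forces them to be
  inner products. Equality is demanded on \<open>I\<close> only, which is all that
  \<open>inner_on I\<close> sees.\<close>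

definition gram_schmidt_on ::
  "nat set \<Rightarrow> nat \<Rightarrow> (nat \<Rightarrow> nat \<Rightarrow> real) \<Rightarrow> (nat \<Rightarrow> nat \<Rightarrow> real) \<Rightarrow> (nat \<Rightarrow> real) \<Rightarrow> bool" where
  "gram_schmidt_on I d y e a \<longleftrightarrow> orthonormal_on I d e \<and>
     (\<forall>j<d. a j > 0 \<and> (\<forall>k\<in>I. y j k = (\<Sum>l<j. inner_on I (y j) (e l) * e l k) + a j * e j k))"

lemma gram_residual:
  assumes on: "orthonormal_on I d e"
    and v: "\<And>k. v k = u k - (\<Sum>l<d. inner_on I u (e l) * e l k)"
  shows "\<And>m. m < d \<Longrightarrow> inner_on I v (e m) = 0"
    and "inner_on I v v = inner_on I u u - (\<Sum>l<d. (inner_on I u (e l))\<^sup>2)"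
proof -
  have v': "v = (\<lambda>k. u k - (\<Sum>l<d. inner_on I u (e l) * e l k))" using v by auto
  show ve: "inner_on I v (e m) = 0" if "m < d" for m
  proof -
    have "(\<Sum>l<d. inner_on I u (e l) * inner_on I (e l) (e m)) = (\<Sum>l<d. if l = m then inner_on I u (e l) else 0)"
      using on that by (intro sum.cong) (auto simp: orthonormal_on_def)
    thus ?thesis using that unfolding v' inner_on_linear inner_on_sum_left by simp
  qed
  have "inner_on I v v = inner_on I v (\<lambda>k. u k - (\<Sum>l<d. inner_on I u (e l) * e l k))"
    using v by (intro inner_on_cong) auto
  also have "\<dots> = inner_on I v u"
    unfolding inner_on_linear inner_on_sum_right using ve by simp
  also have "\<dots> = inner_on I u u - (\<Sum>l<d. (inner_on I u (e l))\<^sup>2)"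
    unfolding v' inner_on_linear inner_on_sum_left
    by (simp add: power2_eq_square inner_on_commute)
  finally show "inner_on I v v = inner_on I u u - (\<Sum>l<d. (inner_on I u (e l))\<^sup>2)" .
qed

lemma gram_schmidt_step:
  assumes gs: "gram_schmidt_on I d y e a"
    and pos: "inner_on I (y d) (y d) - (\<Sum>l<d. (inner_on I (y d) (e l))\<^sup>2) > 0"
  shows "\<exists>e' a'. gram_schmidt_on I (Suc d) y e' a' \<and> (\<forall>l<d. e' l = e l \<and> a' l = a l) \<and>
     a' d = sqrt (inner_on I (y d) (y d) - (\<Sum>l<d. (inner_on I (y d) (e l))\<^sup>2))"
proof -
  define r where "r l = inner_on I (y d) (e l)" for l
  define v where "v k = y d k - (\<Sum>l<d. r l * e l k)" for k
  have on: "orthonormal_on I d e" using gs by (simp add: gram_schmidt_on_def)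
  note res = gram_residual[OF on v_def[unfolded r_def]]
  have ve: "inner_on I v (e m) = 0" if "m < d" for m
    using res(1) that by blast
  have vv: "inner_on I v v = inner_on I (y d) (y d) - (\<Sum>l<d. (r l)\<^sup>2)"
    using res(2) by (simp add: r_def)
  define s where "s = sqrt (inner_on I v v)"
  have s: "s > 0" "s * s = inner_on I v v" using pos by (simp_all add: s_def vv r_def)
  define e' where "e' = e(d := (\<lambda>k. (1/s) * v k))"
  define a' where "a' = a(d := s)"
  have e's: "e' l = e l" "a' l = a l" if "l < d" for l using that by (auto simp: e'_def a'_def)
  have e'd: "e' d = (\<lambda>k. (1/s) * v k)" "a' d = s" by (auto simp: e'_def a'_def)
  have "orthonormal_on I (Suc d) e'"
    unfolding orthonormal_on_def
  proof (intro allI impI)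
    fix l m assume "l < Suc d" "m < Suc d"
    then consider "l < d" "m < d" | "l = d" "m < d" | "l < d" "m = d" | "l = d" "m = d" by linarith
    thus "inner_on I (e' l) (e' m) = (if l = m then 1 else 0)"
    proof cases
      case 1 thus ?thesis using on by (simp add: e's orthonormal_on_def)
    next
      case 2
      have "inner_on I (\<lambda>k. (1/s) * v k) (e m) = 0" unfolding inner_on_linear using 2 by (simp add: ve)
      thus ?thesis using 2 by (simp only: e'd e's) simp
    next
      case 3
      have "inner_on I (e l) (\<lambda>k. (1/s) * v k) = 0"
        unfolding inner_on_linear inner_on_commute[of I "e l"] using 3 by (simp add: ve)
      thus ?thesis using 3 by (simp only: e'd e's) simp
    next
      case 4 thus ?thesis unfolding 4 e'd by (simp only: inner_on_linear) (use s in \<open>simp flip: s(2)\<close>)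
    qed
  qed
  moreover have "a' j > 0 \<and> (\<forall>k\<in>I. y j k = (\<Sum>l<j. inner_on I (y j) (e' l) * e' l k) + a' j * e' j k)"
    if "j < Suc d" for j
  proof (cases "j < d")
    case True
    have "(\<Sum>l<j. inner_on I (y j) (e' l) * e' l k) = (\<Sum>l<j. inner_on I (y j) (e l) * e l k)" for k
      using True by (intro sum.cong) (auto simp: e's)
    thus ?thesis using gs True by (simp add: gram_schmidt_on_def e's)
  next
    case False
    hence j: "j = d" using that by simp
    have "(\<Sum>l<j. inner_on I (y j) (e' l) * e' l k) = (\<Sum>l<d. r l * e l k)" for k
      unfolding j by (intro sum.cong) (auto simp: e's r_def)
    thus ?thesis using s unfolding j by (auto simp: e'd v_def)
  qed
  ultimately have "gram_schmidt_on I (Suc d) y e' a'" by (simp add: gram_schmidt_on_def)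
  thus ?thesis using e's e'd by (intro exI[of _ e'] exI[of _ a']) (auto simp: s_def vv r_def)
qed

lemma gram_schmidt_inner_right:
  assumes "gram_schmidt_on I d y e a" "j < d"
  shows "inner_on I w (y j) = (\<Sum>l<j. inner_on I (y j) (e l) * inner_on I w (e l)) + a j * inner_on I w (e j)"
proof -
  have "inner_on I w (y j) = inner_on I w (\<lambda>k. (\<Sum>l<j. inner_on I (y j) (e l) * e l k) + a j * e j k)"
    using assms by (intro inner_on_cong) (auto simp: gram_schmidt_on_def)
  thus ?thesis by (simp add: inner_on_linear inner_on_sum_right)
qed

text \<open>Because the diagonal entries are positive, the triangular system can be solved for
  \<open>e l\<close> in terms of the \<open>y m\<close> with m \<le> l, so orthogonality to these
  passes to \<open>e l\<close>.\<close>

lemma gram_schmidt_orthogonal: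
  assumes gs: "gram_schmidt_on I d y e a" and w: "\<And>l. l < j \<Longrightarrow> inner_on I w (y l) = 0" and "l < j" "j \<le> d"
  shows "inner_on I w (e l) = 0"
  using \<open>l < j\<close>
proof (induction l rule: less_induct)
  case (less l)
  have "0 = (\<Sum>m<l. inner_on I (y l) (e m) * inner_on I w (e m)) + a l * inner_on I w (e l)"
    using gram_schmidt_inner_right[OF gs, of l w] w[of l] less.prems \<open>j \<le> d\<close> by simp
  also have "(\<Sum>m<l. inner_on I (y l) (e m) * inner_on I w (e m)) = 0"
    using less by (intro sum.neutral) auto
  finally have "a l * inner_on I w (e l) = 0" by simp
  moreover have "a l > 0" using gs less.prems \<open>j \<le> d\<close> by (simp add: gram_schmidt_on_def)
  ultimately show ?case by simp
qed

text \<open>A dual vector \<open>w\<close> that annihilates the earlier \<open>y l\<close> and pairs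
  to 1 with \<open>y j\<close> also pairs to 1 with the Gram-Schmidt residual of \<open>y j\<close>.
  By Cauchy-Schwarz that residual has length at least 1/\<open>s j\<close>. So a lower bound on a
  conditional standard deviation is reduced to exhibiting one short vector.\<close>

lemma gram_schmidt_witness:
  assumes w: "\<And>j. j < d \<Longrightarrow> \<exists>w. (\<forall>l<j. inner_on I w (y l) = 0) \<and> inner_on I w (y j) = 1 \<and> inner_on I w w \<le> (s j)\<^sup>2"
    and s: "\<And>j. j < d \<Longrightarrow> s j > 0"
  shows "\<exists>e a. gram_schmidt_on I d y e a \<and> (\<forall>j<d. 1 / s j \<le> a j)"
  using assms
proof (induction d)
  case 0
  show ?case by (auto simp: gram_schmidt_on_def orthonormal_on_def)
next
  case (Suc d)
  then obtain e a where gs: "gram_schmidt_on I d y e a" and a: "\<forall>j<d. 1 / s j \<le> a j" by (metis less_SucI)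
  obtain w where w: "\<forall>l<d. inner_on I w (y l) = 0" "inner_on I w (y d) = 1" "inner_on I w w \<le> (s d)\<^sup>2"
    using Suc.prems(1)[of d] by auto
  define v where "v k = y d k - (\<Sum>l<d. inner_on I (y d) (e l) * e l k)" for k
  define S where "S = inner_on I (y d) (y d) - (\<Sum>l<d. (inner_on I (y d) (e l))\<^sup>2)"
  have on: "orthonormal_on I d e" using gs by (simp add: gram_schmidt_on_def)
  have vv: "inner_on I v v = S"
    using gram_residual(2)[OF on v_def] by (simp add: S_def)
  have "inner_on I w v = 1"
    unfolding v_def inner_on_linear inner_on_sum_right
    using gram_schmidt_orthogonal[OF gs, of d w] w by simp
  hence "1 = (\<Sum>k\<in>I. w k * v k)\<^sup>2" by (simp add: inner_on_def)
  also have "\<dots> \<le> inner_on I w w * inner_on I v v"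
    using Cauchy_Schwarz_ineq_sum[of w v I] by (simp add: inner_on_def power2_eq_square)
  also have "\<dots> \<le> (s d)\<^sup>2 * S"
    unfolding vv using w inner_on_nonneg[of I v] by (intro mult_right_mono) (auto simp: vv)
  finally have S: "1 \<le> (s d)\<^sup>2 * S" .
  have sd: "s d > 0" using Suc.prems by simp
  have S': "1 / (s d)\<^sup>2 \<le> S" using S sd by (simp add: field_simps)
  hence "S > 0" using sd by (meson less_le_trans zero_less_divide_1_iff zero_less_power)
  from gram_schmidt_step[OF gs, folded S_def, OF this] obtain e' a' where
    "gram_schmidt_on I (Suc d) y e' a'" "\<forall>l<d. a' l = a l" "a' d = sqrt S" by blast
  moreover have "1 / s d \<le> sqrt S"
    using S' sd by (intro real_le_rsqrt) (simp add: power_divide)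
  ultimately show ?case using a by (auto simp: less_Suc_eq intro!: exI[of _ e'] exI[of _ a'])
qed

text \<open>The assumption 8 D \<eta> \<le> 1 closes the induction: the quadratic corrections are at
  most 4 D \<eta>^2 \<le> \<eta>/2, so a new squared diagonal entry and the products before division
  err by at most 3\<eta>/2, and division by a diagonal entry of at least 3/4 gives 2\<eta>. The
  bound \<open>D\<close> stays fixed while \<open>d\<close> grows, because the inner products with
  later \<open>y j\<close> are part of the invariant.\<close>

lemma gram_schmidt_near_identity:
  assumes G: "\<And>i j. i < D \<Longrightarrow> j < D \<Longrightarrow> \<bar>inner_on I (y i) (y j) - (if i = j then 1 else 0)\<bar> \<le> \<eta>"
    and \<eta>: "8 * real D * \<eta> \<le> 1" and "\<eta> \<ge> 0"
  shows "d \<le> D \<Longrightarrow> \<exists>e a. gram_schmidt_on I d y e a \<and>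
     (\<forall>l<d. (\<forall>j<D. l < j \<longrightarrow> \<bar>inner_on I (y j) (e l)\<bar> \<le> 2 * \<eta>) \<and> \<bar>a l - 1\<bar> \<le> 2 * \<eta>)"
proof (induction d)
  case 0
  show ?case by (auto simp: gram_schmidt_on_def orthonormal_on_def)
next
  case (Suc d)
  then obtain e a where gs: "gram_schmidt_on I d y e a"
    and e: "\<And>l j. l < d \<Longrightarrow> j < D \<Longrightarrow> l < j \<Longrightarrow> \<bar>inner_on I (y j) (e l)\<bar> \<le> 2 * \<eta>"
    and a: "\<And>l. l < d \<Longrightarrow> \<bar>a l - 1\<bar> \<le> 2 * \<eta>" by auto
  have d: "d < D" using Suc.prems by simp
  have "1 * (8 * \<eta>) \<le> real D * (8 * \<eta>)"
    using d \<open>\<eta> \<ge> 0\<close> by (intro mult_right_mono) auto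
  hence \<eta>8: "8 * \<eta> \<le> 1" using \<eta> by (simp add: mult_ac)
  have cross: "\<bar>\<Sum>l<d. inner_on I (y i) (e l) * inner_on I (y j) (e l)\<bar> \<le> \<eta> / 2"
    if "i < D" "j < D" "d \<le> i" "d \<le> j" for i j
  proof -
    have "\<bar>\<Sum>l<d. inner_on I (y i) (e l) * inner_on I (y j) (e l)\<bar> \<le> (\<Sum>l<d. (2 * \<eta>) * (2 * \<eta>))"
    proof (intro order_trans[OF sum_abs] sum_mono)
      fix l assume "l \<in> {..<d}"
      thus "\<bar>inner_on I (y i) (e l) * inner_on I (y j) (e l)\<bar> \<le> (2 * \<eta>) * (2 * \<eta>)"
        unfolding abs_mult using e[of l i] e[of l j] that \<open>\<eta> \<ge> 0\<close> by (intro mult_mono) auto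
    qed
    also have "\<dots> = (real d * (8 * \<eta>)) * \<eta> / 2" by simp
    also have "\<dots> \<le> (real D * (8 * \<eta>)) * \<eta> / 2"
      using d \<open>\<eta> \<ge> 0\<close> by (intro divide_right_mono mult_right_mono) auto
    also have "\<dots> \<le> 1 * \<eta> / 2"
      using \<eta> \<open>\<eta> \<ge> 0\<close> by (intro divide_right_mono mult_right_mono) (auto simp: mult_ac)
    finally show ?thesis by simp
  qed
  define S where "S = inner_on I (y d) (y d) - (\<Sum>l<d. (inner_on I (y d) (e l))\<^sup>2)"
  have S: "\<bar>S - 1\<bar> \<le> 3 / 2 * \<eta>"
    using G[OF d d] cross[OF d d order.refl order.refl] unfolding S_def power2_eq_square by (simp only: refl if_True)
  have "S > 0" using S \<eta>8 by linarith
  from gram_schmidt_step[OF gs, folded S_def, OF this] obtain e' a' where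
    gs': "gram_schmidt_on I (Suc d) y e' a'" and ea: "\<And>l. l < d \<Longrightarrow> e' l = e l \<and> a' l = a l" and ad: "a' d = sqrt S" by blast
  have "\<bar>sqrt S - 1\<bar> * 1 \<le> \<bar>sqrt S - 1\<bar> * (sqrt S + 1)"
    using \<open>S > 0\<close> by (intro mult_left_mono) auto
  also have "\<dots> = \<bar>(sqrt S - 1) * (sqrt S + 1)\<bar>" using \<open>S > 0\<close> by (simp add: abs_mult)
  also have "(sqrt S - 1) * (sqrt S + 1) = S - 1" using \<open>S > 0\<close> by (simp add: algebra_simps)
  finally have ad1: "\<bar>a' d - 1\<bar> \<le> 3 / 2 * \<eta>" using S by (simp add: ad)
  have ad2: "a' d \<ge> 3 / 4" using ad1 \<eta>8 by linarith
  have new: "\<bar>inner_on I (y j) (e' d)\<bar> \<le> 2 * \<eta>" if "j < D" "d < j" for j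
  proof -
    have "inner_on I (y j) (y d) = (\<Sum>l<d. inner_on I (y d) (e' l) * inner_on I (y j) (e' l)) + a' d * inner_on I (y j) (e' d)"
      by (rule gram_schmidt_inner_right[OF gs']) simp
    also have "(\<Sum>l<d. inner_on I (y d) (e' l) * inner_on I (y j) (e' l)) = (\<Sum>l<d. inner_on I (y d) (e l) * inner_on I (y j) (e l))"
      using ea by simp
    finally have "\<bar>a' d * inner_on I (y j) (e' d)\<bar> \<le> 3 / 2 * \<eta>"
      using G[OF that(1) d] that cross[OF d that(1)] by simp
    moreover have "3 / 4 * \<bar>inner_on I (y j) (e' d)\<bar> \<le> \<bar>a' d * inner_on I (y j) (e' d)\<bar>"
      using ad2 unfolding abs_mult by (intro mult_right_mono) auto
    ultimately show ?thesis by linarith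
  qed
  have "\<bar>inner_on I (y j) (e' l)\<bar> \<le> 2 * \<eta>" if "l < Suc d" "j < D" "l < j" for l j
    using that new[of j] e[of l j] ea[of l] by (cases "l = d") auto
  moreover have "\<bar>a' l - 1\<bar> \<le> 2 * \<eta>" if "l < Suc d" for l
    using that ad1 a[of l] ea[of l] \<open>\<eta> \<ge> 0\<close> by (cases "l = d") auto
  ultimately show ?case using gs' by blast
qed

section \<open>Nearly orthonormal linear forms\<close>

text \<open>Recovers the values of the original forms from independent coordinates along their
  Gram-Schmidt system; of \<open>r j l\<close> only the entries with l < j are read.\<close>

definition lower_tri :: "(nat \<Rightarrow> nat \<Rightarrow> real) \<Rightarrow> (nat \<Rightarrow> real) \<Rightarrow> nat \<Rightarrow> (nat \<Rightarrow> real) \<Rightarrow> nat \<Rightarrow> real" where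
  "lower_tri r a d x = (\<lambda>j\<in>{..<d}. (\<Sum>l<j. r j l * x l) + a j * x j)"

lemma lower_tri_measurable [measurable]: "lower_tri r a d \<in> measurable (gauss {..<d}) (gauss {..<d})"
  unfolding measurable_cong_sets[OF sets_gauss sets_gauss] lower_tri_def
  by (intro measurable_restrict borel_measurable_add borel_measurable_sum borel_measurable_times
      borel_measurable_const measurable_component_singleton) auto

lemma lower_tri_Suc:
  assumes "x \<in> space (gauss {..<d})"
  shows "lower_tri r a (Suc d) (x(d := t)) = (lower_tri r a d x)(d := (\<Sum>l<d. r d l * x l) + a d * t)"
  unfolding lower_tri_def by (auto simp: fun_eq_iff restrict_def less_Suc_eq intro!: sum.cong)

lemma gauss_gram_schmidt_nn_integral:
  assumes I: "finite I" and gs: "gram_schmidt_on I d y e a"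
    and F: "F \<in> borel_measurable (gauss {..<d})"
  shows "(\<integral>\<^sup>+x. F (\<lambda>j\<in>{..<d}. inner_on I (y j) x) \<partial>gauss I) =
    (\<integral>\<^sup>+x. F (lower_tri (\<lambda>j l. inner_on I (y j) (e l)) a d x) \<partial>gauss {..<d})"
proof -
  have on: "orthonormal_on I d e" using gs by (simp add: gram_schmidt_on_def)
  note [measurable] = inner_on_measurable[OF I] F
  let ?E = "\<lambda>x. \<lambda>l\<in>{..<d}. inner_on I (e l) x"
  have E [measurable]: "?E \<in> measurable (gauss I) (gauss {..<d})" by measurable
  have "(\<integral>\<^sup>+x. F (lower_tri (\<lambda>j l. inner_on I (y j) (e l)) a d x) \<partial>gauss {..<d})
     = (\<integral>\<^sup>+x. F (lower_tri (\<lambda>j l. inner_on I (y j) (e l)) a d (?E x)) \<partial>gauss I)"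
    by (subst distr_gauss_orthonormal[OF I on, symmetric], subst nn_integral_distr) (auto intro: E)
  also have "\<dots> = (\<integral>\<^sup>+x. F (\<lambda>j\<in>{..<d}. inner_on I (y j) x) \<partial>gauss I)"
  proof (intro nn_integral_cong arg_cong[of _ _ F])
    fix x
    have "inner_on I (y j) x = (\<Sum>l<j. inner_on I (y j) (e l) * inner_on I (e l) x) + a j * inner_on I (e j) x"
      if "j < d" for j
      using gram_schmidt_inner_right[OF gs that, of x]
      by (simp only: inner_on_commute[of I x])
    thus "lower_tri (\<lambda>j l. inner_on I (y j) (e l)) a d (?E x) = (\<lambda>j\<in>{..<d}. inner_on I (y j) x)"
      by (auto simp: lower_tri_def fun_eq_iff restrict_def intro!: sum.cong)
  qed
  finally show ?thesis ..
qed

lemma std_normal_nn_integral_affine: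
  assumes [measurable]: "f \<in> borel_measurable borel" and a: "a > 0"
  shows "(\<integral>\<^sup>+t. f (c + a * t) \<partial>std_normal_distribution)
       = (\<integral>\<^sup>+s. ennreal (std_normal_density ((s - c) / a) / a) * f s \<partial>lborel)"
proof -
  have "(\<integral>\<^sup>+s. ennreal (std_normal_density ((s - c) / a) / a) * f s \<partial>lborel)
    = ennreal \<bar>a\<bar> * (\<integral>\<^sup>+t. ennreal (std_normal_density ((c + a * t - c) / a) / a) * f (c + a * t) \<partial>lborel)"
    by (rule nn_integral_real_affine) (use a in auto)
  also have "\<dots> = (\<integral>\<^sup>+t. ennreal a * (ennreal (std_normal_density t / a) * f (c + a * t)) \<partial>lborel)"
    using a by (subst nn_integral_cmult) auto
  also have "\<dots> = (\<integral>\<^sup>+t. ennreal (std_normal_density t) * f (c + a * t) \<partial>lborel)"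
  proof (intro nn_integral_cong)
    fix t
    have "ennreal a * ennreal (std_normal_density t / a) = ennreal (std_normal_density t)"
      using a by (subst ennreal_mult[symmetric]) auto
    thus "ennreal a * (ennreal (std_normal_density t / a) * f (c + a * t)) = ennreal (std_normal_density t) * f (c + a * t)"
      by (simp add: mult.assoc[symmetric])
  qed
  finally show ?thesis by (subst nn_integral_density) auto
qed

text \<open>The exponents of the normal densities with mean \<open>c\<close> and deviation
  \<open>a\<close> and with mean 0 and deviation 1 differ by (y^2 (a^2 - 1) + 2 y c - c^2) / (2
  a^2), where 2 a^2 \<ge> 1. On |y| \<le> L this yields the first three terms of \<theta>; the last
  one, 4\<eta>, bounds |ln a| from the normalising factor.\<close>

lemma std_normal_density_ratio:
  assumes a: "\<bar>a - 1\<bar> \<le> 2 * \<eta>" and \<eta>: "0 \<le> \<eta>" "8 * \<eta> \<le> 1" and c: "\<bar>c\<bar> \<le> \<kappa>" and y: "\<bar>y\<bar> \<le> L"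
    and \<theta>: "\<theta> = 5 * \<eta> * L\<^sup>2 + 2 * L * \<kappa> + \<kappa>\<^sup>2 + 4 * \<eta>"
  shows "std_normal_density ((y - c) / a) / a \<le> exp \<theta> * std_normal_density y"
    and "exp (- \<theta>) * std_normal_density y \<le> std_normal_density ((y - c) / a) / a"
proof -
  have a34: "a \<ge> 3/4" using a \<eta> by linarith
  hence a0: "a > 0" by simp
  have L: "L \<ge> 0" using y by linarith
  have k: "\<kappa> \<ge> 0" using c by linarith
  have a2: "2 * a\<^sup>2 \<ge> 1" using mult_mono[OF a34 a34] a0 by (simp add: power2_eq_square)
  have "\<bar>a\<^sup>2 - 1\<bar> = \<bar>a - 1\<bar> * \<bar>a + 1\<bar>"
    by (simp add: abs_mult[symmetric] power2_eq_square algebra_simps)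
  also have "\<dots> \<le> (2 * \<eta>) * (9/4)" using a \<eta> by (intro mult_mono) auto
  finally have a21: "\<bar>a\<^sup>2 - 1\<bar> \<le> 5 * \<eta>" using \<eta> by simp
  define E where "E = y\<^sup>2 / 2 - ((y - c) / a)\<^sup>2 / 2"
  have yL: "y\<^sup>2 \<le> L\<^sup>2" using y L by (simp add: abs_le_square_iff[symmetric])
  have cK: "c\<^sup>2 \<le> \<kappa>\<^sup>2" using c k by (simp add: abs_le_square_iff[symmetric])
  have "E = (y\<^sup>2 * (a\<^sup>2 - 1) + 2 * y * c - c\<^sup>2) / (2 * a\<^sup>2)"
    using a0 unfolding E_def by (simp add: field_simps power2_eq_square)
  hence "\<bar>E\<bar> = \<bar>y\<^sup>2 * (a\<^sup>2 - 1) + 2 * y * c - c\<^sup>2\<bar> / (2 * a\<^sup>2)"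
    by (simp add: abs_mult)
  also have "\<dots> \<le> \<bar>y\<^sup>2 * (a\<^sup>2 - 1) + 2 * y * c - c\<^sup>2\<bar> / 1"
    using a2 by (intro divide_left_mono) auto
  also have "\<dots> \<le> \<bar>y\<^sup>2 * (a\<^sup>2 - 1)\<bar> + \<bar>2 * y * c\<bar> + c\<^sup>2"
    using zero_le_power2[of c] by (simp only: div_by_1)
  also have "\<bar>y\<^sup>2 * (a\<^sup>2 - 1)\<bar> \<le> L\<^sup>2 * (5 * \<eta>)"
    unfolding abs_mult using yL a21 by (intro mult_mono) auto
  also have "\<bar>2 * y * c\<bar> \<le> 2 * (L * \<kappa>)"
    unfolding abs_mult mult.assoc using y c L by (intro mult_mono) auto
  finally have E: "\<bar>E\<bar> \<le> 5 * \<eta> * L\<^sup>2 + 2 * L * \<kappa> + \<kappa>\<^sup>2"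
    using cK by (simp add: mult_ac)
  have lna: "\<bar>ln a\<bar> \<le> 4 * \<eta>"
  proof -
    have "ln a \<le> a - 1" using a0 by (rule ln_le_minus_one)
    moreover have "ln (inverse a) \<le> inverse a - 1" using a0 by (intro ln_le_minus_one) simp
    moreover have "inverse a - 1 \<le> 4 * \<eta>"
    proof -
      have "1 - a \<le> 2 * \<eta>" using a by linarith
      also have "\<dots> \<le> 4 * \<eta> * a" using mult_left_mono[OF a34, of "4 * \<eta>"] \<eta> by simp
      finally have "(1 - a) / a \<le> 4 * \<eta>" using a0 by (simp add: divide_le_eq)
      thus ?thesis using a0 by (simp add: field_simps)
    qed
    ultimately show ?thesis using a \<eta> a0 by (simp add: ln_inverse)
  qed
  have "std_normal_density ((y - c) / a) / a = exp (E - ln a) * std_normal_density y"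
  proof -
    have 1: "exp (E - ln a) = exp E / a" using a0 by (simp add: exp_diff)
    have 2: "exp E * exp (- y\<^sup>2 / 2) = exp (- ((y - c) / a)\<^sup>2 / 2)"
      unfolding E_def exp_add[symmetric] by simp
    show ?thesis unfolding 1 std_normal_density_def 2[symmetric] by simp
  qed
  moreover have "exp (E - ln a) \<le> exp \<theta>" "exp (- \<theta>) \<le> exp (E - ln a)"
    using E lna unfolding \<theta> by auto
  ultimately show "std_normal_density ((y - c) / a) / a \<le> exp \<theta> * std_normal_density y"
    "exp (- \<theta>) * std_normal_density y \<le> std_normal_density ((y - c) / a) / a"
    by (auto intro: mult_right_mono)
qed

lemma nn_integral_gauss_Suc:
  assumes "F \<in> borel_measurable (gauss {..<Suc d})"
  shows "(\<integral>\<^sup>+x. F x \<partial>gauss {..<Suc d}) = (\<integral>\<^sup>+x. (\<integral>\<^sup>+t. F (x(d := t)) \<partial>std_normal_distribution) \<partial>gauss {..<d})"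
  using assms unfolding gauss_def lessThan_Suc by (subst std_normal_prod.product_nn_integral_insert) auto

lemma gauss_fun_upd_measurable:
  assumes "F \<in> borel_measurable (gauss {..<Suc d})"
  shows "(\<lambda>(x, t). F (x(d := t))) \<in> borel_measurable (gauss {..<d} \<Otimes>\<^sub>M borel)"
proof -
  have eq: "sets (gauss {..<d} \<Otimes>\<^sub>M borel) = sets (PiM {..<d} (\<lambda>_. borel) \<Otimes>\<^sub>M borel)"
    by (intro sets_pair_measure_cong sets_gauss refl)
  have "(\<lambda>(x, t). x(d := t)) \<in> measurable (gauss {..<d} \<Otimes>\<^sub>M borel) (PiM {..<Suc d} (\<lambda>_. borel))"
    unfolding lessThan_Suc measurable_cong_sets[OF eq refl] by (rule measurable_add_dim)
  moreover have "F \<in> borel_measurable (PiM {..<Suc d} (\<lambda>_. borel))"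
    using assms unfolding measurable_cong_sets[OF sets_gauss refl] .
  ultimately have "(\<lambda>p. F ((\<lambda>(x, t). x(d := t)) p)) \<in> borel_measurable (gauss {..<d} \<Otimes>\<^sub>M borel)"
    by (rule measurable_compose)
  thus ?thesis by (simp add: case_prod_beta')
qed

text \<open>Given the earlier coordinates, the last one is normal with small mean and deviation
  close to 1. On the box |x j| \<le> L, outside of which \<open>F\<close> vanishes, its density is
  within a factor exp \<theta> of the standard one. Integrating the coordinates out from the last to
  the first costs one such factor each.\<close>

lemma lower_tri_nn_integral_compare:
  fixes F :: "(nat \<Rightarrow> real) \<Rightarrow> ennreal"
  assumes r: "\<And>j l. l < j \<Longrightarrow> j < D \<Longrightarrow> \<bar>r j l\<bar> \<le> 2 * \<eta>" and a: "\<And>j. j < D \<Longrightarrow> \<bar>a j - 1\<bar> \<le> 2 * \<eta>"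
    and \<eta>: "8 * real D * \<eta> \<le> 1" "\<eta> \<ge> 0" and L: "L \<ge> 1"
    and \<theta>: "\<theta> = (9 + 10 * real D) * \<eta> * L\<^sup>2"
  shows "d \<le> D \<Longrightarrow> F \<in> borel_measurable (gauss {..<d}) \<Longrightarrow> (\<And>x. F x \<noteq> 0 \<Longrightarrow> \<forall>j<d. \<bar>x j\<bar> \<le> L) \<Longrightarrow>
     (\<integral>\<^sup>+x. F (lower_tri r a d x) \<partial>gauss {..<d}) \<le> ennreal (exp (real d * \<theta>)) * (\<integral>\<^sup>+x. F x \<partial>gauss {..<d}) \<and>
     ennreal (exp (- real d * \<theta>)) * (\<integral>\<^sup>+x. F x \<partial>gauss {..<d}) \<le> (\<integral>\<^sup>+x. F (lower_tri r a d x) \<partial>gauss {..<d})"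
proof (induction d arbitrary: F)
  case 0
  have "lower_tri r a 0 x = x" if "x \<in> space (gauss {..<0})" for x
    using that by (auto simp: lower_tri_def space_gauss)
  hence "(\<integral>\<^sup>+x. F (lower_tri r a 0 x) \<partial>gauss {..<0}) = (\<integral>\<^sup>+x. F x \<partial>gauss {..<0})"
    by (intro nn_integral_cong) simp
  thus ?case by simp
next
  case (Suc d)
  note [measurable] = Suc.prems(2)
  have d: "d < D" using Suc.prems by simp
  have "1 * (8 * \<eta>) \<le> real D * (8 * \<eta>)" using d \<eta> by (intro mult_right_mono) auto
  hence \<eta>8: "8 * \<eta> \<le> 1" using \<eta> by (simp add: mult_ac)
  have dD: "8 * (real d * \<eta>) \<le> 1"
    using mult_right_mono[of "real d" "real D" \<eta>] d \<eta> by simp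
  \<comment> \<open>\<open>G\<close> integrates the last coordinate against the standard density,
    \<open>G'\<close> against the true conditional density given the independent coordinates
    \<open>z\<close>. The induction hypothesis is applied to \<open>G\<close>.\<close>
  define G where "G x = (\<integral>\<^sup>+s. ennreal (std_normal_density s) * F (x(d := s)) \<partial>lborel)" for x
  define G' where "G' x z = (\<integral>\<^sup>+s. ennreal (std_normal_density ((s - (\<Sum>l<d. r d l * z l)) / a d) / a d) * F (x(d := s)) \<partial>lborel)" for x z
  have Fm: "(\<lambda>(x, t). F (x(d := t))) \<in> borel_measurable (gauss {..<d} \<Otimes>\<^sub>M borel)"
    by (rule gauss_fun_upd_measurable) fact
  have Fm': "(\<lambda>s. F (x(d := s))) \<in> borel_measurable borel" if "x \<in> space (gauss {..<d})" for x
    using measurable_Pair2[OF Fm that] by simp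
  have Gm: "G \<in> borel_measurable (gauss {..<d})"
  proof -
    have [measurable]: "(\<lambda>(x, t). F (x(d := t))) \<in> borel_measurable (gauss {..<d} \<Otimes>\<^sub>M lborel)"
      using Fm by (simp cong: measurable_cong_sets)
    show ?thesis unfolding G_def by measurable
  qed
  have ad: "a d > 0" using a[OF d] \<eta>8 by linarith
  have lt: "lower_tri r a d z \<in> space (gauss {..<d})" for z by (simp add: lower_tri_def space_gauss)
  have eqG: "(\<integral>\<^sup>+x. F x \<partial>gauss {..<Suc d}) = (\<integral>\<^sup>+x. G x \<partial>gauss {..<d})"
    unfolding G_def by (subst nn_integral_gauss_Suc) (auto intro!: nn_integral_cong simp: nn_integral_density Fm')
  have eqG': "(\<integral>\<^sup>+z. F (lower_tri r a (Suc d) z) \<partial>gauss {..<Suc d}) = (\<integral>\<^sup>+z. G' (lower_tri r a d z) z \<partial>gauss {..<d})"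
    unfolding G'_def
    by (subst nn_integral_gauss_Suc)
       (auto intro!: nn_integral_cong simp: lower_tri_Suc std_normal_nn_integral_affine[OF Fm'[OF lt] ad, symmetric])
  have G0: "\<forall>j<d. \<bar>x j\<bar> \<le> L" if "G x \<noteq> 0" for x
  proof (rule ccontr)
    assume "\<not> (\<forall>j<d. \<bar>x j\<bar> \<le> L)"
    then obtain j where "j < d" "\<bar>x j\<bar> > L" by auto
    hence "\<not> \<bar>(x(d := s)) j\<bar> \<le> L" "j < Suc d" for s by auto
    hence "F (x(d := s)) = 0" for s using Suc.prems(3)[of "x(d := s)"] by blast
    hence "G x = 0" by (simp add: G_def)
    thus False using that by simp
  qed
  \<comment> \<open>The triangular system is inverted on the box: if all images are at most
    \<open>L\<close>, then successively |z l| \<le> 2 L, because the earlier terms contribute at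
    most L/2 and the diagonal entry is at least 3/4.\<close>
  have ctr: "\<bar>\<Sum>l<d. r d l * z l\<bar> \<le> 4 * real d * \<eta> * L"
    if "\<forall>j<d. \<bar>lower_tri r a d z j\<bar> \<le> L" for z
  proof -
    have z: "\<bar>z l\<bar> \<le> 2 * L" if "l < d" for l
      using that
    proof (induction l rule: less_induct)
      case (less l)
      have al: "a l \<ge> 3 / 4" using a[of l] less.prems d \<eta>8 by linarith
      have "\<bar>\<Sum>m<l. r l m * z m\<bar> \<le> (\<Sum>m<l. (2 * \<eta>) * (2 * L))"
      proof (intro order_trans[OF sum_abs] sum_mono)
        fix m assume "m \<in> {..<l}"
        thus "\<bar>r l m * z m\<bar> \<le> (2 * \<eta>) * (2 * L)"
          unfolding abs_mult using less d L \<eta> r[of m l] by (intro mult_mono) auto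
      qed
      also have "\<dots> = real l * (4 * \<eta> * L)" by simp
      also have "\<dots> \<le> real d * (4 * \<eta> * L)" using less.prems \<eta> L by (intro mult_right_mono) auto
      also have "\<dots> \<le> L / 2" using mult_right_mono[OF dD, of L] L by (simp add: mult_ac)
      finally have "\<bar>\<Sum>m<l. r l m * z m\<bar> \<le> L / 2" .
      moreover have "\<bar>(\<Sum>m<l. r l m * z m) + a l * z l\<bar> \<le> L"
        using \<open>\<forall>j<d. \<bar>lower_tri r a d z j\<bar> \<le> L\<close> less.prems
          by (simp add: lower_tri_def)
      ultimately have "\<bar>a l * z l\<bar> \<le> 3 / 2 * L" by linarith
      moreover have "3 / 4 * \<bar>z l\<bar> \<le> \<bar>a l * z l\<bar>"
        using al unfolding abs_mult by (intro mult_right_mono) auto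
      ultimately show ?case by linarith
    qed
    have "\<bar>\<Sum>l<d. r d l * z l\<bar> \<le> (\<Sum>l<d. (2 * \<eta>) * (2 * L))"
    proof (intro order_trans[OF sum_abs] sum_mono)
      fix m assume "m \<in> {..<d}"
      thus "\<bar>r d m * z m\<bar> \<le> (2 * \<eta>) * (2 * L)"
        unfolding abs_mult using z d L \<eta> r[of m d] by (intro mult_mono) auto
    qed
    thus ?thesis by (simp add: mult_ac)
  qed
  define \<kappa> where "\<kappa> = 4 * real d * \<eta> * L"
  have k: "0 \<le> \<kappa>" "\<kappa> \<le> L / 2"
    using \<eta> L mult_right_mono[OF dD, of L] by (auto simp: \<kappa>_def mult_ac)
  have \<theta>': "5 * \<eta> * L\<^sup>2 + 2 * L * \<kappa> + \<kappa>\<^sup>2 + 4 * \<eta> \<le> \<theta>"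
  proof -
    have "\<kappa>\<^sup>2 \<le> \<kappa> * (L / 2)" using k unfolding power2_eq_square by (intro mult_left_mono) auto
    hence "2 * L * \<kappa> + \<kappa>\<^sup>2 \<le> 5 / 2 * (L * \<kappa>)" by (simp add: algebra_simps)
    also have "\<dots> = 10 * real d * \<eta> * L\<^sup>2" by (simp add: \<kappa>_def power2_eq_square)
    also have "\<dots> \<le> 10 * real D * \<eta> * L\<^sup>2" using d \<eta> by (intro mult_right_mono) auto
    finally have 1: "2 * L * \<kappa> + \<kappa>\<^sup>2 \<le> 10 * real D * \<eta> * L\<^sup>2" .
    have "4 * \<eta> * 1 \<le> 4 * \<eta> * L\<^sup>2" using \<eta> L by (intro mult_left_mono) auto
    thus ?thesis using 1 unfolding \<theta> by (simp add: algebra_simps)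
  qed
  have GG: "G' (lower_tri r a d z) z \<le> ennreal (exp \<theta>) * G (lower_tri r a d z) \<and>
      ennreal (exp (-\<theta>)) * G (lower_tri r a d z) \<le> G' (lower_tri r a d z) z" for z
  proof -
    let ?x = "lower_tri r a d z"
    note [measurable] = Fm'[OF lt[of z]]
    have pt: "ennreal (std_normal_density ((s - (\<Sum>l<d. r d l * z l)) / a d) / a d) * F (?x(d := s))
           \<le> ennreal (exp \<theta>) * (ennreal (std_normal_density s) * F (?x(d := s))) \<and>
        ennreal (exp (-\<theta>)) * (ennreal (std_normal_density s) * F (?x(d := s)))
         \<le> ennreal (std_normal_density ((s - (\<Sum>l<d. r d l * z l)) / a d) / a d) * F (?x(d := s))" for s
    proof (cases "F (?x(d := s)) = 0")
      case False
      from Suc.prems(3)[OF this] have b: "\<forall>j<Suc d. \<bar>(?x(d := s)) j\<bar> \<le> L" .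
      hence b1: "\<forall>j<d. \<bar>?x j\<bar> \<le> L" by (metis fun_upd_other less_SucI nat_neq_iff)
      have b2: "\<bar>s\<bar> \<le> L" using b by auto
      note ratio = std_normal_density_ratio[OF a[OF d] \<eta>(2) \<eta>8 ctr[OF b1, folded \<kappa>_def] b2 refl]
      have up: "std_normal_density ((s - (\<Sum>l<d. r d l * z l)) / a d) / a d \<le> exp \<theta> * std_normal_density s"
        by (rule order_trans[OF ratio(1)]) (use \<theta>' in \<open>auto intro!: mult_right_mono\<close>)
      have lo: "exp (- \<theta>) * std_normal_density s \<le> std_normal_density ((s - (\<Sum>l<d. r d l * z l)) / a d) / a d"
        by (rule order_trans[OF _ ratio(2)]) (use \<theta>' in \<open>auto intro!: mult_right_mono\<close>)
      show ?thesis unfolding mult.assoc[symmetric]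
        using ennreal_leI[OF up] ennreal_leI[OF lo]
        by (auto intro!: mult_right_mono simp: ennreal_mult)
    qed simp
    show ?thesis unfolding G_def G'_def
      by (subst (1 2) nn_integral_cmult[symmetric]) (use pt in \<open>auto intro!: nn_integral_mono\<close>)
  qed
  have G'm: "(\<integral>\<^sup>+z. ennreal K * G (lower_tri r a d z) \<partial>gauss {..<d}) = ennreal K * (\<integral>\<^sup>+z. G (lower_tri r a d z) \<partial>gauss {..<d})" for K
    by (rule nn_integral_cmult) (rule measurable_compose[OF lower_tri_measurable Gm])
  note IH = Suc.IH[OF less_imp_le[OF d] Gm G0]
  have "(\<integral>\<^sup>+z. F (lower_tri r a (Suc d) z) \<partial>gauss {..<Suc d}) \<le> ennreal (exp \<theta>) * (\<integral>\<^sup>+z. G (lower_tri r a d z) \<partial>gauss {..<d})"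
    unfolding eqG' G'm[symmetric] using GG by (intro nn_integral_mono) auto
  also have "\<dots> \<le> ennreal (exp \<theta>) * (ennreal (exp (real d * \<theta>)) * (\<integral>\<^sup>+x. G x \<partial>gauss {..<d}))"
    using IH by (intro mult_left_mono) auto
  also have "\<dots> = ennreal (exp (real (Suc d) * \<theta>)) * (\<integral>\<^sup>+x. F x \<partial>gauss {..<Suc d})"
    unfolding eqG by (simp add: mult.assoc[symmetric] ennreal_mult[symmetric] exp_add[symmetric] algebra_simps)
  finally have 1: "(\<integral>\<^sup>+z. F (lower_tri r a (Suc d) z) \<partial>gauss {..<Suc d}) \<le> ennreal (exp (real (Suc d) * \<theta>)) * (\<integral>\<^sup>+x. F x \<partial>gauss {..<Suc d})" .
  have "ennreal (exp (- real (Suc d) * \<theta>)) * (\<integral>\<^sup>+x. F x \<partial>gauss {..<Suc d}) = ennreal (exp (- \<theta>)) * (ennreal (exp (- real d * \<theta>)) * (\<integral>\<^sup>+x. G x \<partial>gauss {..<d}))"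
    unfolding eqG by (simp add: mult.assoc[symmetric] ennreal_mult[symmetric] exp_add[symmetric] algebra_simps)
  also have "\<dots> \<le> ennreal (exp (- \<theta>)) * (\<integral>\<^sup>+z. G (lower_tri r a d z) \<partial>gauss {..<d})"
    using IH by (intro mult_left_mono) auto
  also have "\<dots> \<le> (\<integral>\<^sup>+z. F (lower_tri r a (Suc d) z) \<partial>gauss {..<Suc d})"
    unfolding eqG' G'm[symmetric] using GG by (intro nn_integral_mono) auto
  finally show ?case using 1 by simp
qed

text \<open>The error is a factor and not a summand, so the comparison stays meaningful for events
  whose probability is a high negative power of n. The box assumption on \<open>B\<close> is what
  makes a uniform factor possible.\<close>

theorem
  fixes d :: nat
  assumes I: "finite I"
    and G: "\<And>i j. i < d \<Longrightarrow> j < d \<Longrightarrow> \<bar>inner_on I (y i) (y j) - (if i = j then 1 else 0)\<bar> \<le> \<eta>"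
    and \<eta>: "8 * real d * \<eta> \<le> 1" "\<eta> \<ge> 0" and L: "L \<ge> 1"
    and B: "B \<in> sets (gauss {..<d})" and BL: "\<And>x j. x \<in> B \<Longrightarrow> j < d \<Longrightarrow> \<bar>x j\<bar> \<le> L"
    and \<theta>: "\<theta> = real d * (9 + 10 * real d) * \<eta> * L\<^sup>2"
  shows gauss_near_identity_le: "\<P>(x in gauss I. (\<lambda>j\<in>{..<d}. inner_on I (y j) x) \<in> B) \<le> exp \<theta> * measure (gauss {..<d}) B"
    and gauss_near_identity_ge: "exp (- \<theta>) * measure (gauss {..<d}) B \<le> \<P>(x in gauss I. (\<lambda>j\<in>{..<d}. inner_on I (y j) x) \<in> B)"
proof -
  interpret I: prob_space "gauss I" by (rule prob_space_gauss)
  interpret d: prob_space "gauss {..<d}" by (rule prob_space_gauss)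
  obtain e :: "nat \<Rightarrow> nat \<Rightarrow> real" and a where gs: "gram_schmidt_on I d y e a" and
    ea: "\<And>l j. l < d \<Longrightarrow> j < d \<Longrightarrow> l < j \<Longrightarrow> \<bar>inner_on I (y j) (e l)\<bar> \<le> 2 * \<eta>"
      "\<And>l. l < d \<Longrightarrow> \<bar>a l - 1\<bar> \<le> 2 * \<eta>"
    using gram_schmidt_near_identity[OF G \<eta> order.refl] by blast
  note [measurable] = B inner_on_measurable[OF I]
  have m: "(\<lambda>x. \<lambda>j\<in>{..<d}. inner_on I (y j) x) \<in> measurable (gauss I) (gauss {..<d})"
    by measurable
  let ?S = "{x \<in> space (gauss I). (\<lambda>j\<in>{..<d}. inner_on I (y j) x) \<in> B}"
  have S [measurable]: "?S \<in> sets (gauss I)" using m by measurable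
  have "emeasure (gauss I) ?S = (\<integral>\<^sup>+x. indicator B (\<lambda>j\<in>{..<d}. inner_on I (y j) x) \<partial>gauss I)"
    by (subst nn_integral_indicator[symmetric, OF S], rule nn_integral_cong) (auto simp: indicator_def)
  also have "\<dots> = (\<integral>\<^sup>+x. indicator B (lower_tri (\<lambda>j l. inner_on I (y j) (e l)) a d x) \<partial>gauss {..<d})"
    by (rule gauss_gram_schmidt_nn_integral[OF I gs]) measurable
  finally have eq: "ennreal (measure (gauss I) ?S) = \<dots>" by (simp add: I.emeasure_eq_measure)
  have "(\<integral>\<^sup>+x. indicator B (lower_tri (\<lambda>j l. inner_on I (y j) (e l)) a d x) \<partial>gauss {..<d})
      \<le> ennreal (exp (real d * ((9 + 10 * real d) * \<eta> * L\<^sup>2))) * (\<integral>\<^sup>+x. indicator B x \<partial>gauss {..<d}) \<and>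
     ennreal (exp (- real d * ((9 + 10 * real d) * \<eta> * L\<^sup>2))) * (\<integral>\<^sup>+x. indicator B x \<partial>gauss {..<d})
      \<le> (\<integral>\<^sup>+x. indicator B (lower_tri (\<lambda>j l. inner_on I (y j) (e l)) a d x) \<partial>gauss {..<d})"
    by (rule lower_tri_nn_integral_compare[where D=d, OF _ _ \<eta> L refl])
       (auto simp: ea BL indicator_def split: if_splits)
  thus "measure (gauss I) ?S \<le> exp \<theta> * measure (gauss {..<d}) B"
    "exp (- \<theta>) * measure (gauss {..<d}) B \<le> measure (gauss I) ?S"
    unfolding eq[symmetric] by (simp_all add: d.emeasure_eq_measure B ennreal_mult[symmetric] \<theta> mult.assoc)
qed

section \<open>Small-ball and tail bounds for linear forms, without near orthogonality\<close>

lemma std_normal_interval_le: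
  assumes "\<rho> \<ge> 0" "a > 0"
  shows "emeasure std_normal_distribution {t. \<bar>c + a * t\<bar> \<le> \<rho>} \<le> ennreal (\<rho> / a)"
proof -
  have eq: "{t. \<bar>c + a * t\<bar> \<le> \<rho>} = {(- \<rho> - c) / a..(\<rho> - c) / a}"
    using assms by (auto simp: abs_le_iff field_simps)
  have den: "std_normal_density t \<le> 1 / 2" for t
  proof -
    have "2 \<le> sqrt (2 * pi)" using pi_gt3 by (intro real_le_rsqrt) auto
    hence "1 / sqrt (2 * pi) \<le> 1 / 2" by (intro divide_left_mono) auto
    moreover have "exp (- t\<^sup>2 / 2) \<le> 1" by simp
    ultimately have "1 / sqrt (2 * pi) * exp (- t\<^sup>2 / 2) \<le> 1 / 2 * 1" by (intro mult_mono) auto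
    thus ?thesis by (simp add: std_normal_density_def)
  qed
  have "emeasure std_normal_distribution {t. \<bar>c + a * t\<bar> \<le> \<rho>} \<le> (\<integral>\<^sup>+t. ennreal (1/2) * indicator {(- \<rho> - c) / a..(\<rho> - c) / a} t \<partial>lborel)"
    unfolding eq
      by (subst emeasure_density) (auto intro!: nn_integral_mono mult_right_mono ennreal_leI[OF den] simp del: ennreal_half)
  also have "\<dots> = ennreal (1/2) * ennreal ((\<rho> - c) / a - (- \<rho> - c) / a)"
    using assms by (subst nn_integral_cmult_indicator) (auto simp: divide_right_mono)
  also have "\<dots> = ennreal (\<rho> / a)"
    using assms by (subst ennreal_mult[symmetric]) (auto simp: diff_divide_distrib[symmetric])
  finally show ?thesis .
qed

lemma lower_tri_box_measurable:
  "(\<lambda>x. indicator {x. \<forall>j<d. \<bar>x j\<bar> \<le> \<rho> j} (lower_tri r a d x) :: ennreal) \<in> borel_measurable (gauss {..<d})"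
proof -
  have "(\<lambda>x. indicator {x \<in> space (gauss {..<d}). \<forall>j\<in>{..<d}. \<bar>x j\<bar> \<le> \<rho> j} (lower_tri r a d x) :: ennreal) \<in> borel_measurable (gauss {..<d})"
    by (rule measurable_compose[OF lower_tri_measurable]) measurable
  also have "(\<lambda>x. indicator {x \<in> space (gauss {..<d}). \<forall>j\<in>{..<d}. \<bar>x j\<bar> \<le> \<rho> j} (lower_tri r a d x) :: ennreal)
      = (\<lambda>x. indicator {x. \<forall>j<d. \<bar>x j\<bar> \<le> \<rho> j} (lower_tri r a d x))"
    by (auto simp: fun_eq_iff indicator_def lower_tri_def space_gauss)
  finally show ?thesis .
qed

text \<open>Given the earlier coordinates, coordinate j is normal with deviation \<open>a j\<close>;
  whatever its mean, it meets the interval of half-length \<open>\<rho> j\<close> with probability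
  at most \<open>\<rho> j / a j\<close>.\<close>

lemma lower_tri_small_ball:
  assumes "\<And>j. j < d \<Longrightarrow> a j > 0" "\<And>j. j < d \<Longrightarrow> \<rho> j \<ge> 0"
  shows "(\<integral>\<^sup>+x. indicator {x. \<forall>j<d. \<bar>x j\<bar> \<le> \<rho> j} (lower_tri r a d x) \<partial>gauss {..<d}) \<le> ennreal (\<Prod>j<d. \<rho> j / a j)"
  using assms
proof (induction d)
  case 0
  interpret prob_space "gauss {..<0}" by (rule prob_space_gauss)
  show ?case using emeasure_space_1 by simp
next
  case (Suc d)
  have "(\<integral>\<^sup>+x. indicator {x. \<forall>j<Suc d. \<bar>x j\<bar> \<le> \<rho> j} (lower_tri r a (Suc d) x) \<partial>gauss {..<Suc d})
     = (\<integral>\<^sup>+x. \<integral>\<^sup>+t. indicator {x. \<forall>j<Suc d. \<bar>x j\<bar> \<le> \<rho> j} (lower_tri r a (Suc d) (x(d := t))) \<partial>std_normal_distribution \<partial>gauss {..<d})"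
    by (rule nn_integral_gauss_Suc[OF lower_tri_box_measurable])
  also have "\<dots> \<le> (\<integral>\<^sup>+x. indicator {x. \<forall>j<d. \<bar>x j\<bar> \<le> \<rho> j} (lower_tri r a d x) * ennreal (\<rho> d / a d) \<partial>gauss {..<d})"
  proof (rule nn_integral_mono)
    fix x assume x: "x \<in> space (gauss {..<d})"
    have "(\<integral>\<^sup>+t. indicator {x. \<forall>j<Suc d. \<bar>x j\<bar> \<le> \<rho> j} (lower_tri r a (Suc d) (x(d := t))) \<partial>std_normal_distribution)
       = (\<integral>\<^sup>+t. indicator {x. \<forall>j<d. \<bar>x j\<bar> \<le> \<rho> j} (lower_tri r a d x) * indicator {t. \<bar>(\<Sum>l<d. r d l * x l) + a d * t\<bar> \<le> \<rho> d} t \<partial>std_normal_distribution)"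
      by (intro nn_integral_cong) (auto simp: lower_tri_Suc[OF x] indicator_def less_Suc_eq)
    also have "\<dots> = indicator {x. \<forall>j<d. \<bar>x j\<bar> \<le> \<rho> j} (lower_tri r a d x) * emeasure std_normal_distribution {t. \<bar>(\<Sum>l<d. r d l * x l) + a d * t\<bar> \<le> \<rho> d}"
      by (subst nn_integral_cmult) (auto)
    also have "\<dots> \<le> indicator {x. \<forall>j<d. \<bar>x j\<bar> \<le> \<rho> j} (lower_tri r a d x) * ennreal (\<rho> d / a d)"
      by (intro mult_left_mono std_normal_interval_le) (auto simp: Suc.prems)
    finally show "(\<integral>\<^sup>+t. indicator {x. \<forall>j<Suc d. \<bar>x j\<bar> \<le> \<rho> j} (lower_tri r a (Suc d) (x(d := t))) \<partial>std_normal_distribution)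
        \<le> indicator {x. \<forall>j<d. \<bar>x j\<bar> \<le> \<rho> j} (lower_tri r a d x) * ennreal (\<rho> d / a d)" .
  qed
  also have "\<dots> = (\<integral>\<^sup>+x. indicator {x. \<forall>j<d. \<bar>x j\<bar> \<le> \<rho> j} (lower_tri r a d x) \<partial>gauss {..<d}) * ennreal (\<rho> d / a d)"
    by (rule nn_integral_multc[OF lower_tri_box_measurable])
  also have "\<dots> \<le> ennreal (\<Prod>j<d. \<rho> j / a j) * ennreal (\<rho> d / a d)"
    using Suc by (intro mult_right_mono) auto
  also have "\<dots> = ennreal (\<Prod>j<Suc d. \<rho> j / a j)"
    using Suc.prems by (subst ennreal_mult[symmetric]) (auto intro!: prod_nonneg divide_nonneg_pos)
  finally show ?case .
qed

text \<open>Serves for strongly correlated forms. Short dual vectors bound the diagonal of the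
  Gram-Schmidt system from below, and each form then costs one factor
  \<open>s j * \<rho> j\<close>.\<close>

theorem gauss_small_ball:
  fixes d :: nat
  assumes I: "finite I"
    and w: "\<And>j. j < d \<Longrightarrow> \<exists>w. (\<forall>l<j. inner_on I w (y l) = 0) \<and> inner_on I w (y j) = 1 \<and> inner_on I w w \<le> (s j)\<^sup>2"
    and s: "\<And>j. j < d \<Longrightarrow> s j > 0" and \<rho>: "\<And>j. j < d \<Longrightarrow> \<rho> j \<ge> 0"
  shows "\<P>(x in gauss I. \<forall>j<d. \<bar>inner_on I (y j) x\<bar> \<le> \<rho> j) \<le> (\<Prod>j<d. s j * \<rho> j)"
proof -
  interpret I: prob_space "gauss I" by (rule prob_space_gauss)
  note [measurable] = inner_on_measurable[OF I]
  obtain e a where gs: "gram_schmidt_on I d y e a" and a: "\<And>j. j < d \<Longrightarrow> 1 / s j \<le> a j"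
    using gram_schmidt_witness[of d I y s] w s by blast
  have apos: "a j > 0" if "j < d" for j using gs that by (auto simp: gram_schmidt_on_def)
  let ?S = "{x \<in> space (gauss I). \<forall>j\<in>{..<d}. \<bar>inner_on I (y j) x\<bar> \<le> \<rho> j}"
  have S: "?S \<in> sets (gauss I)" by measurable
  have B: "(indicator {x \<in> space (gauss {..<d}). \<forall>j\<in>{..<d}. \<bar>x j\<bar> \<le> \<rho> j} :: _ \<Rightarrow> ennreal) \<in> borel_measurable (gauss {..<d})"
    by measurable
  have "emeasure (gauss I) ?S = (\<integral>\<^sup>+x. indicator {x \<in> space (gauss {..<d}). \<forall>j\<in>{..<d}. \<bar>x j\<bar> \<le> \<rho> j} (\<lambda>j\<in>{..<d}. inner_on I (y j) x) \<partial>gauss I)"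
    by (subst nn_integral_indicator[symmetric, OF S], rule nn_integral_cong) (auto simp: indicator_def space_gauss[of "{..<d}"])
  also have "\<dots> = (\<integral>\<^sup>+x. indicator {x. \<forall>j<d. \<bar>x j\<bar> \<le> \<rho> j} (lower_tri (\<lambda>j l. inner_on I (y j) (e l)) a d x) \<partial>gauss {..<d})"
    by (subst gauss_gram_schmidt_nn_integral[OF I gs B])
       (auto intro!: nn_integral_cong simp: indicator_def space_gauss lower_tri_def)
  also have "\<dots> \<le> ennreal (\<Prod>j<d. \<rho> j / a j)" by (rule lower_tri_small_ball) (auto simp: apos \<rho>)
  finally have "measure (gauss I) ?S \<le> (\<Prod>j<d. \<rho> j / a j)"
    by (subst (asm) I.emeasure_eq_measure, subst (asm) ennreal_le_iff)
       (auto intro!: prod_nonneg divide_nonneg_pos simp: apos \<rho>)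
  also have "\<dots> \<le> (\<Prod>j<d. s j * \<rho> j)"
  proof (intro prod_mono conjI)
    fix j assume j: "j \<in> {..<d}"
    have "1 / a j \<le> s j" using a[of j] s[of j] apos[of j] j by (simp add: field_simps)
    from mult_right_mono[OF this \<rho>[of j]] j show "\<rho> j / a j \<le> s j * \<rho> j" by simp
    show "0 \<le> \<rho> j / a j" using j \<rho>[of j] apos[of j] by simp
  qed
  finally show ?thesis by (simp only: Ball_def lessThan_iff)
qed

text \<open>The standard density equals sqrt 2 exp (- t^2/4) times the normal density of variance 2;
  on the tail the prefactor is at most 2 exp (- L^2/4), and the remaining density has total mass
  1.\<close>

lemma std_normal_tail:
  assumes "L \<ge> 0"
  shows "measure std_normal_distribution {t. \<bar>t\<bar> > L} \<le> 2 * exp (- L\<^sup>2 / 4)"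
proof -
  have "emeasure std_normal_distribution {t. \<bar>t\<bar> > L} = (\<integral>\<^sup>+t. ennreal (std_normal_density t) * indicator {t. \<bar>t\<bar> > L} t \<partial>lborel)"
    by (subst emeasure_density) auto
  also have "\<dots> \<le> (\<integral>\<^sup>+t. ennreal (2 * exp (- L\<^sup>2 / 4)) * ennreal (normal_density 0 (sqrt 2) t) \<partial>lborel)"
  proof (rule nn_integral_mono)
    fix t :: real
    show "ennreal (std_normal_density t) * indicator {t. \<bar>t\<bar> > L} t \<le> ennreal (2 * exp (- L\<^sup>2 / 4)) * ennreal (normal_density 0 (sqrt 2) t)"
    proof (cases "\<bar>t\<bar> > L")
      case True
      hence "L\<^sup>2 \<le> t\<^sup>2" using assms by (simp add: abs_le_square_iff[symmetric])
      hence "exp (- t\<^sup>2 / 4) \<le> exp (- L\<^sup>2 / 4)" by simp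
      moreover have "sqrt 2 \<le> 2" by (simp add: real_sqrt_le_iff real_le_lsqrt)
      ultimately have "sqrt 2 * exp (- t\<^sup>2 / 4) \<le> 2 * exp (- L\<^sup>2 / 4)" by (intro mult_mono) auto
      hence "(sqrt 2 * exp (- t\<^sup>2 / 4)) * normal_density 0 (sqrt 2) t \<le> (2 * exp (- L\<^sup>2 / 4)) * normal_density 0 (sqrt 2) t"
        by (intro mult_right_mono) auto
      moreover have "(sqrt 2 * exp (- t\<^sup>2 / 4)) * normal_density 0 (sqrt 2) t = std_normal_density t"
        by (simp add: normal_density_def real_sqrt_mult field_simps flip: exp_add)
      ultimately show ?thesis using True by (simp add: ennreal_mult[symmetric] ennreal_leI)
    qed simp
  qed
  also have "\<dots> = ennreal (2 * exp (- L\<^sup>2 / 4)) * (\<integral>\<^sup>+t. ennreal (normal_density 0 (sqrt 2) t) \<partial>lborel)"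
    by (rule nn_integral_cmult) auto
  also have "(\<integral>\<^sup>+t. ennreal (normal_density 0 (sqrt 2) t) \<partial>lborel) = 1"
    by (subst nn_integral_eq_integral) (auto simp: integrable_normal_density integral_normal_density)
  finally show ?thesis by (simp add: std_normal.emeasure_eq_measure)
qed

theorem gauss_tail:
  assumes I: "finite I" and c: "inner_on I c c \<le> s\<^sup>2" "s > 0" and L: "L \<ge> 0"
  shows "\<P>(x in gauss I. \<bar>inner_on I c x\<bar> > s * L) \<le> 2 * exp (- L\<^sup>2 / 4)"
proof (cases "inner_on I c c = 0")
  case True
  have "c k = 0" if "k \<in> I" for k
    using True I that unfolding inner_on_def by (subst (asm) sum_nonneg_eq_0_iff) auto
  hence "inner_on I c x = 0" for x by (simp add: inner_on_def)
  moreover have "\<not> s * L < 0" using c L by (simp add: not_less)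
  ultimately show ?thesis by simp
next
  case False
  interpret prob_space "gauss I" by (rule prob_space_gauss)
  note [measurable] = inner_on_measurable[OF I]
  define \<sigma> where "\<sigma> = sqrt (inner_on I c c)"
  have \<sigma>: "\<sigma> > 0" "\<sigma> * \<sigma> = inner_on I c c" "\<sigma> \<le> s"
    using False inner_on_nonneg[of I c] c
    by (auto simp: \<sigma>_def less_le real_le_lsqrt)
  define e where "e = (\<lambda>_::nat. \<lambda>k. (1 / \<sigma>) * c k)"
  have on: "orthonormal_on I 1 e"
    unfolding orthonormal_on_def e_def inner_on_linear using \<sigma> by (simp flip: \<sigma>(2))
  have ce: "inner_on I c x = \<sigma> * inner_on I (e 0) x" for x unfolding e_def inner_on_linear using \<sigma> by simp
  let ?E = "\<lambda>x. \<lambda>l\<in>{..<1::nat}. inner_on I (e l) x"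
  have E: "?E \<in> measurable (gauss I) (gauss {..<1})" by measurable
  have "\<P>(x in gauss I. \<bar>inner_on I c x\<bar> > s * L) \<le> \<P>(x in gauss I. inner_on I (e 0) x \<in> {t. \<bar>t\<bar> > L})"
  proof (rule finite_measure_mono)
    have "L < \<bar>inner_on I (e 0) x\<bar>" if "s * L < \<bar>inner_on I c x\<bar>" for x
    proof -
      have "\<sigma> * L \<le> s * L" using \<sigma> L by (intro mult_right_mono) auto
      moreover have "s * L < \<sigma> * \<bar>inner_on I (e 0) x\<bar>"
        using that \<sigma>(1) unfolding ce by (simp add: abs_mult)
      ultimately show ?thesis using \<sigma>(1) by (meson le_less_trans mult_less_cancel_left_pos)
    qed
    thus "{x \<in> space (gauss I). \<bar>inner_on I c x\<bar> > s * L} \<subseteq> {x \<in> space (gauss I). inner_on I (e 0) x \<in> {t. \<bar>t\<bar> > L}}" by auto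
  qed measurable
  also have "\<dots> = measure (distr (gauss I) (gauss {..<1}) ?E) {x \<in> space (gauss {..<1}). x 0 \<in> {t. \<bar>t\<bar> > L}}"
    using E by (subst measure_distr) (auto intro!: arg_cong[of _ _ prob] simp: space_gauss)
  also have "\<dots> = \<P>(x in gauss {..<1}. x 0 \<in> {t. \<bar>t\<bar> > L})"
    by (simp only: distr_gauss_orthonormal[OF I on])
  also have "{x \<in> space (gauss {..<1}). x 0 \<in> {t. \<bar>t\<bar> > L}} = Pi\<^sub>E {..<1::nat} (\<lambda>_. {t. \<bar>t\<bar> > L})"
    by (auto simp: space_gauss PiE_def Pi_def)
  also have "measure (gauss {..<1}) \<dots> = measure std_normal_distribution {t. \<bar>t\<bar> > L}"
    unfolding gauss_def measure_def by (subst std_normal_prod.emeasure_PiM) auto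
  also have "\<dots> \<le> 2 * exp (- L\<^sup>2 / 4)" using L by (rule std_normal_tail)
  finally show ?thesis .
qed

section \<open>Small balls for trigonometric sums\<close>

text \<open>If every power up to \<open>M\<close> stays within 1/2 of 1, then the geometric sum of
  the first \<open>M\<close> powers has real part at least M/2, and u^M - 1 is that sum times u - 1.
  So the exponent \<open>M\<close> itself works.\<close>

lemma unit_power_far_from_one:
  fixes u :: complex
  assumes u: "norm u = 1" and M: "M \<ge> 1"
  shows "\<exists>s\<in>{1..M}. norm (u ^ s - 1) \<ge> min (1/2) (real M * norm (u - 1) / 2)"
proof (cases "\<exists>s\<in>{1..M}. norm (u ^ s - 1) > 1/2")
  case True
  then obtain s where "s \<in> {1..M}" "norm (u ^ s - 1) > 1/2" by blast
  thus ?thesis by (intro bexI[of _ s]) auto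
next
  case small: False
  have re: "Re (u ^ s) \<ge> 1/2" if "s < M" for s
  proof (cases "s = 0")
    case False
    with that have "s \<in> {1..M}" by auto
    with small have "norm (u ^ s - 1) \<le> 1/2" by (meson not_less)
    thus ?thesis using abs_Re_le_cmod[of "u ^ s - 1"] by simp
  qed simp
  have "real M / 2 = (\<Sum>s<M. 1/2)" by simp
  also have "\<dots> \<le> (\<Sum>s<M. Re (u ^ s))" by (intro sum_mono) (use re in auto)
  also have "\<dots> = Re (\<Sum>s<M. u ^ s)" by simp
  also have "\<dots> \<le> norm (\<Sum>s<M. u ^ s)" by (rule complex_Re_le_cmod)
  finally have "norm (u - 1) * (real M / 2) \<le> norm (u - 1) * norm (\<Sum>s<M. u ^ s)" by (intro mult_left_mono) auto
  also have "\<dots> = norm (u ^ M - 1)" by (simp add: power_diff_1_eq norm_mult)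
  finally show ?thesis using M by (intro bexI[of _ M]) (auto simp: mult.commute)
qed

definition coeff_l2 :: "nat \<Rightarrow> complex poly \<Rightarrow> real" where
  "coeff_l2 N p = (\<Sum>k\<le>N. (norm (coeff p k))\<^sup>2)"

lemma coeff_l2_nonneg: "coeff_l2 N p \<ge> 0"
  by (simp add: coeff_l2_def sum_nonneg)

lemma coeff_l2_monom_mult_le: "coeff_l2 N (monom 1 s * p) \<le> coeff_l2 N p"
proof -
  have "coeff_l2 N (monom 1 s * p) = (\<Sum>k\<in>{k\<in>{..N}. s \<le> k}. (norm (coeff p (k - s)))\<^sup>2)"
    unfolding coeff_l2_def by (rule sum.mono_neutral_cong_right) (auto simp: coeff_monom_mult)
  also have "\<dots> = (\<Sum>k\<in>(\<lambda>k. k - s) ` {k\<in>{..N}. s \<le> k}. (norm (coeff p k))\<^sup>2)"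
    by (subst sum.reindex) (auto simp: inj_on_def)
  also have "\<dots> \<le> coeff_l2 N p" unfolding coeff_l2_def by (intro sum_mono2) auto
  finally show ?thesis .
qed

lemma coeff_l2_diff_le: "coeff_l2 N (p - q) \<le> 2 * coeff_l2 N p + 2 * coeff_l2 N q"
proof -
  have "(norm (a - b))\<^sup>2 \<le> 2 * (norm a)\<^sup>2 + 2 * (norm b)\<^sup>2" for a b :: complex
  proof -
    have "(norm (a - b))\<^sup>2 \<le> (norm a + norm b)\<^sup>2" by (intro power_mono norm_triangle_ineq4) auto
    also have "\<dots> \<le> 2 * (norm a)\<^sup>2 + 2 * (norm b)\<^sup>2"
      using zero_le_power2[of "norm a - norm b"] by (simp add: power2_eq_square algebra_simps)
    finally show ?thesis .
  qed
  thus ?thesis unfolding coeff_l2_def sum_distrib_left sum.distrib[symmetric] by (intro sum_mono) simp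
qed

lemma coeff_l2_smult: "coeff_l2 N (smult c p) = (norm c)\<^sup>2 * coeff_l2 N p"
  by (simp add: coeff_l2_def norm_mult power_mult_distrib sum_distrib_left)

text \<open>The start is the normalised geometric kernel at \<open>z0\<close>, with value 1 there
  and squared coefficient norm at most 1/(M+1). A node z is removed by the factor (x^s - z^s)/(z0^s
  - z^s). Allowing an exponent s \<le> M instead of 1 keeps the denominator above \<open>m\<close>,
  so that each node costs degree \<open>M\<close> and a factor 4/m^2 in the squared norm.\<close>

lemma interpolation_poly_exists:
  fixes z0 :: complex
  assumes z0: "norm z0 = 1" and Z: "finite Z" "\<And>z. z \<in> Z \<Longrightarrow> norm z = 1 \<and> norm (z0 - z) \<ge> \<Delta>"
    and \<Delta>: "\<Delta> > 0" and M: "M \<ge> 1" and m: "m = min (1/2) (real M * \<Delta> / 2)"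
  shows "\<exists>p. degree p \<le> M * (card Z + 1) \<and> poly p z0 = 1 \<and> (\<forall>z\<in>Z. poly p z = 0) \<and>
    coeff_l2 N p \<le> (1 / real (M + 1)) * (4 / m\<^sup>2) ^ card Z"
  using Z
proof (induction Z rule: finite_induct)
  case empty
  define p where "p = (\<Sum>k\<le>M. monom (inverse z0 ^ k / of_nat (M + 1)) k)"
  have "degree p \<le> M" unfolding p_def
    by (intro degree_sum_le) (auto intro: order_trans[OF degree_monom_le])
  moreover have "poly p z0 = 1"
  proof -
    have "inverse z0 ^ k * z0 ^ k = 1" for k
      unfolding power_mult_distrib[symmetric] using z0 by (subst left_inverse) auto
    hence "poly p z0 = (\<Sum>k\<le>M. 1 / of_nat (M + 1))"
      unfolding p_def poly_sum poly_monom by (intro sum.cong) auto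
    also have "\<dots> = (of_nat (M + 1) :: complex) / of_nat (M + 1)" by simp
    also have "\<dots> = 1" by (rule divide_self) (use of_nat_neq_0 in auto)
    finally show ?thesis .
  qed
  moreover have "coeff_l2 N p \<le> 1 / real (M + 1)"
  proof -
    have c: "coeff p k = (if k \<le> M then inverse z0 ^ k / of_nat (M + 1) else 0)" for k
      by (simp add: p_def coeff_sum)
    have "coeff_l2 N p = (\<Sum>k\<le>N. if k \<in> {..M} then (1 / real (M + 1))\<^sup>2 else 0)"
      unfolding coeff_l2_def using z0
      by (intro sum.cong) (auto simp: c norm_divide norm_power norm_inverse simp del: of_nat_add of_nat_Suc)
    also have "\<dots> = (\<Sum>k\<in>{..N} \<inter> {..M}. (1 / real (M + 1))\<^sup>2)"
      by (rule sum.inter_restrict[symmetric]) simp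
    also have "\<dots> \<le> (\<Sum>k\<in>{..M}. (1 / real (M + 1))\<^sup>2)" by (intro sum_mono2) auto
    also have "\<dots> = 1 / real (M + 1)" by (simp add: power2_eq_square)
    finally show ?thesis .
  qed
  ultimately show ?case by (intro exI[of _ p]) auto
next
  case (insert z Z)
  then obtain p where p: "degree p \<le> M * (card Z + 1)" "poly p z0 = 1" "\<forall>z\<in>Z. poly p z = 0"
    "coeff_l2 N p \<le> (1 / real (M + 1)) * (4 / m\<^sup>2) ^ card Z" by auto
  have z: "norm z = 1" "norm (z0 - z) \<ge> \<Delta>" using insert.prems by auto
  have "norm (z0 / z - 1) = norm (z0 - z)"
    using z by (metis diff_divide_distrib div_by_1 divide_self_if norm_divide norm_zero zero_neq_one)
  obtain s where s: "s \<in> {1..M}" "norm ((z0 / z) ^ s - 1) \<ge> min (1/2) (real M * norm (z0 / z - 1) / 2)"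
    using unit_power_far_from_one[of "z0 / z" M] z z0 M by (auto simp: norm_divide)
  have "m \<le> min (1/2) (real M * norm (z0 / z - 1) / 2)"
    unfolding m \<open>norm (z0 / z - 1) = norm (z0 - z)\<close> using mult_left_mono[OF z(2), of "real M"]
    by (intro min.mono order.refl) simp
  hence "m \<le> norm ((z0 / z) ^ s - 1)" using s by linarith
  moreover have "norm ((z0 / z) ^ s - 1) = norm (z0 ^ s - z ^ s)"
  proof -
    have "z ^ s \<noteq> 0" "norm (z ^ s) = 1" using z by (auto simp: norm_power)
    hence "norm ((z0 / z) ^ s - 1) = norm ((z0 ^ s - z ^ s) / z ^ s)" by (simp add: power_divide diff_divide_distrib)
    thus ?thesis using \<open>norm (z ^ s) = 1\<close> by (simp add: norm_divide)
  qed
  ultimately have mz: "m \<le> norm (z0 ^ s - z ^ s)" by simp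
  have m0: "m > 0" using \<Delta> M by (auto simp: m)
  hence nz: "z0 ^ s - z ^ s \<noteq> 0" using mz by auto
  define q where "q = smult (1 / (z0 ^ s - z ^ s)) (monom 1 s * p - smult (z ^ s) p)"
  have "degree (monom 1 s * p) \<le> s + degree p"
    using degree_mult_le[of "monom 1 s" p] degree_monom_le[of 1 s] by (meson add_le_mono1 order_trans)
  hence "degree q \<le> s + degree p"
    unfolding q_def by (intro order_trans[OF degree_smult_le] degree_diff_le) auto
  also have "\<dots> \<le> M * (card (insert z Z) + 1)" using s p(1) insert.hyps by auto
  finally have 1: "degree q \<le> M * (card (insert z Z) + 1)" .
  have pq: "poly q x = (x ^ s - z ^ s) * poly p x / (z0 ^ s - z ^ s)" for x
    by (simp add: q_def poly_monom left_diff_distrib diff_divide_distrib)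
  have "coeff_l2 N q \<le> (norm (1 / (z0 ^ s - z ^ s)))\<^sup>2 * (2 * coeff_l2 N (monom 1 s * p) + 2 * coeff_l2 N (smult (z ^ s) p))"
    unfolding q_def coeff_l2_smult[of _ "1 / (z0 ^ s - z ^ s)"] by (intro mult_left_mono coeff_l2_diff_le) auto
  also have "\<dots> \<le> (1 / m)\<^sup>2 * (4 * coeff_l2 N p)"
  proof (intro mult_mono power_mono)
    show "norm (1 / (z0 ^ s - z ^ s)) \<le> 1 / m" using mz m0 unfolding norm_divide by (intro frac_le) auto
    show "2 * coeff_l2 N (monom 1 s * p) + 2 * coeff_l2 N (smult (z ^ s) p) \<le> 4 * coeff_l2 N p"
      using coeff_l2_monom_mult_le[of N s p] z by (simp add: coeff_l2_smult norm_power)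
  qed (use coeff_l2_nonneg[of N "monom 1 s * p"] coeff_l2_nonneg[of N "smult (z ^ s) p"] in auto)
  also have "\<dots> = (4 / m\<^sup>2) * coeff_l2 N p" by (simp add: power_divide)
  also have "\<dots> \<le> (4 / m\<^sup>2) * ((1 / real (M + 1)) * (4 / m\<^sup>2) ^ card Z)"
    by (intro mult_left_mono p(4)) auto
  also have "\<dots> = (1 / real (M + 1)) * (4 / m\<^sup>2) ^ card (insert z Z)" using insert.hyps by simp
  finally have 2: "coeff_l2 N q \<le> (1 / real (M + 1)) * (4 / m\<^sup>2) ^ card (insert z Z)" .
  show ?case using 1 2 pq p nz by (intro exI[of _ q]) auto
qed

definition trig_form :: "nat \<Rightarrow> (nat \<Rightarrow> real) \<Rightarrow> real \<Rightarrow> complex" where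
  "trig_form n x t = (\<Sum>k\<le>n. of_real (x k) * cis (real k * t))"

lemma Re_trig_form: "Re (trig_form n x t) = inner_on {..n} (\<lambda>k. cos (real k * t)) x"
  and Im_trig_form: "Im (trig_form n x t) = inner_on {..n} (\<lambda>k. sin (real k * t)) x"
  by (simp_all add: trig_form_def inner_on_def mult.commute)

lemma poly_eq_sum_coeff:
  fixes p :: "'a :: comm_semiring_1 poly"
  assumes "degree p \<le> n"
  shows "poly p x = (\<Sum>i\<le>n. coeff p i * x ^ i)"
  unfolding poly_altdef using assms by (intro sum.mono_neutral_left) (auto simp: coeff_eq_0)

text \<open>The witness must be real, so twice the real part of c times the coefficients of p is
  taken. Its trigonometric sum at s is c p(e^(is)) plus the conjugate of c p(e^(-is)). Hence p has
  to be 1 at e^(i t_i) and to vanish at the other points and at all conjugate points, including that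
  of t_i itself; this is where \<open>sep2\<close> enters.\<close>

lemma trig_witness:
  fixes t :: "nat \<Rightarrow> real"
  assumes i: "i < k" and sep1: "\<And>l. l < k \<Longrightarrow> l \<noteq> i \<Longrightarrow> norm (cis (t i) - cis (t l)) \<ge> \<Delta>"
    and sep2: "\<And>l. l < k \<Longrightarrow> norm (cis (t i) - cis (- t l)) \<ge> \<Delta>"
    and \<Delta>: "\<Delta> > 0" and n: "n \<ge> 2 * k" and \<mu>: "\<mu> = min 1 (real n * \<Delta>)"
  shows "\<exists>w. (\<forall>l<k. trig_form n w (t l) = (if l = i then c else 0)) \<and>
     inner_on {..n} w w \<le> (norm c)\<^sup>2 * (8 * real k / real n * (256 * (real k)\<^sup>2 / \<mu>\<^sup>2) ^ (2 * k))"
proof -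
  define Z where "Z = (\<lambda>l. cis (t l)) ` ({..<k} - {i}) \<union> (\<lambda>l. cis (- t l)) ` {..<k}"
  have Z: "finite Z" "\<And>z. z \<in> Z \<Longrightarrow> norm z = 1 \<and> norm (cis (t i) - z) \<ge> \<Delta>"
    using sep1 sep2 by (auto simp: Z_def)
  have cZ: "card Z \<le> 2 * k - 1"
  proof -
    have "card Z \<le> card ({..<k} - {i}) + card {..<k}"
      unfolding Z_def by (intro order_trans[OF card_Un_le] add_mono card_image_le) auto
    thus ?thesis using i by simp
  qed
  have k: "k \<ge> 1" using i by simp
  \<comment> \<open>At most 2k - 1 nodes have to be removed; together with the initial kernel these
    are 2k blocks of degree \<open>M\<close>, which fit into degree \<open>n\<close>.\<close>
  define M where "M = n div (2 * k)"
  have M1: "M \<ge> 1" unfolding M_def using n k by (simp add: div_greater_zero_iff Suc_le_eq)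
  have nM: "n < 2 * k * (M + 1)" unfolding M_def using k
    dividend_less_times_div[of "2 * k" n] by (simp add: algebra_simps)
  define m where "m = min (1/2) (real M * \<Delta> / 2)"
  obtain p where p: "degree p \<le> M * (card Z + 1)" "poly p (cis (t i)) = 1" "\<forall>z\<in>Z. poly p z = 0"
    "coeff_l2 n p \<le> (1 / real (M + 1)) * (4 / m\<^sup>2) ^ card Z"
    using interpolation_poly_exists[OF _ Z \<Delta> M1 m_def, of n] by auto
  have "M * (card Z + 1) \<le> M * (2 * k)" using cZ k by (intro mult_left_mono) auto
  also have "\<dots> \<le> n" by (simp add: M_def mult.commute)
  finally have deg: "degree p \<le> n" using p(1) by simp
  define w where "w j = 2 * Re (c * coeff p j)" for j
  have tw: "trig_form n w s = c * poly p (cis s) + cnj (c * poly p (cis (- s)))" for s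
  proof -
    have "of_real (w j) * cis (real j * s) = c * (coeff p j * cis s ^ j) + cnj (c * (coeff p j * cis (- s) ^ j))" for j
    proof -
      have "of_real (w j) = c * coeff p j + cnj (c * coeff p j)" by (simp only: w_def complex_add_cnj)
      moreover have "cis s ^ j = cis (real j * s)" "cnj (cis (- s) ^ j) = cis (real j * s)"
        by (simp_all add: Complex.DeMoivre cis_cnj)
      ultimately show ?thesis by (simp add: algebra_simps)
    qed
    thus ?thesis by (simp add: trig_form_def poly_eq_sum_coeff[OF deg] sum.distrib sum_distrib_left)
  qed
  have 1: "trig_form n w (t l) = (if l = i then c else 0)" if "l < k" for l
    using that p i by (auto simp: tw Z_def)
  have m0: "m > 0" "m \<le> 1/2" using \<Delta> M1 by (auto simp: m_def)
  have \<mu>0: "\<mu> > 0" using \<mu> \<Delta> n k by auto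
  have mm: "m \<ge> \<mu> / (8 * real k)"
  proof -
    have "real n < real (2 * k * (M + 1))" using nM by (simp only: of_nat_less_iff)
    hence "real n < 2 * real k * (real M + 1)" by (simp add: distrib_left)
    also have "\<dots> \<le> 2 * real k * (real M + real M)" using M1 by (intro mult_left_mono add_left_mono) auto
    finally have "real n / (4 * real k) \<le> real M" using k by (simp add: field_simps)
    hence "real n / (4 * real k) * \<Delta> / 2 \<le> real M * \<Delta> / 2"
      using \<Delta> by (intro divide_right_mono mult_right_mono) auto
    moreover have "\<mu> / (8 * real k) \<le> real n / (4 * real k) * \<Delta> / 2"
    proof -
      have "\<mu> / (8 * real k) \<le> (real n * \<Delta>) / (8 * real k)"
        using k \<mu> by (intro divide_right_mono) auto
      thus ?thesis by simp
    qed
    moreover have "\<mu> / (8 * real k) \<le> 1 / 2"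
    proof -
      have "\<mu> / (8 * real k) \<le> 1 / (8 * real k)" using k \<mu> by (intro divide_right_mono) auto
      also have "\<dots> \<le> 1 / 2" using k by (intro divide_left_mono) auto
      finally show ?thesis .
    qed
    ultimately show ?thesis unfolding m_def by (intro min.boundedI) linarith+
  qed
  have "4 / m\<^sup>2 \<le> 4 / (\<mu> / (8 * real k))\<^sup>2"
    using mm \<mu>0 m0 k by (intro divide_left_mono power_mono) auto
  also have "\<dots> = 256 * (real k)\<^sup>2 / \<mu>\<^sup>2" by (simp add: power_divide power_mult_distrib)
  finally have A: "4 / m\<^sup>2 \<le> 256 * (real k)\<^sup>2 / \<mu>\<^sup>2" .
  have "m\<^sup>2 \<le> 1" using m0 by (intro power_le_one) auto
  hence m4: "1 \<le> 4 / m\<^sup>2" using m0 by (simp add: field_simps)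
  have "inner_on {..n} w w \<le> (\<Sum>j\<le>n. 4 * (norm c)\<^sup>2 * (norm (coeff p j))\<^sup>2)"
  proof -
    have "w j * w j \<le> 4 * (norm c)\<^sup>2 * (norm (coeff p j))\<^sup>2" for j
    proof -
      have "2 * z * (2 * z) = 4 * \<bar>z\<bar>\<^sup>2" for z :: real by (simp add: power2_eq_square)
      hence "w j * w j = 4 * (\<bar>Re (c * coeff p j)\<bar>)\<^sup>2" unfolding w_def .
      also have "\<dots> \<le> 4 * (norm (c * coeff p j))\<^sup>2"
        by (intro mult_left_mono power_mono abs_Re_le_cmod) auto
      finally show ?thesis by (simp add: norm_mult power_mult_distrib)
    qed
    thus ?thesis unfolding inner_on_def by (intro sum_mono)
  qed
  also have "\<dots> = (norm c)\<^sup>2 * (4 * coeff_l2 n p)" by (simp add: coeff_l2_def sum_distrib_left mult_ac)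
  also have "\<dots> \<le> (norm c)\<^sup>2 * (8 * real k / real n * (256 * (real k)\<^sup>2 / \<mu>\<^sup>2) ^ (2 * k))"
  proof (rule mult_left_mono)
    have "(4 / m\<^sup>2) ^ card Z \<le> (4 / m\<^sup>2) ^ (2 * k)" using cZ m4 by (intro power_increasing) auto
    also have "\<dots> \<le> (256 * (real k)\<^sup>2 / \<mu>\<^sup>2) ^ (2 * k)" using A by (intro power_mono) auto
    finally have B: "(4 / m\<^sup>2) ^ card Z \<le> (256 * (real k)\<^sup>2 / \<mu>\<^sup>2) ^ (2 * k)" .
    have "real n \<le> real (2 * k * (M + 1))" using nM by (simp only: of_nat_le_iff)
    hence "real n \<le> 2 * real k * real (M + 1)" by (simp only: of_nat_mult of_nat_numeral)
    hence C: "1 / real (M + 1) \<le> 2 * real k / real n" using n k by (simp add: field_simps)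
    have "4 * coeff_l2 n p \<le> 4 * ((1 / real (M + 1)) * (4 / m\<^sup>2) ^ card Z)" using p(4) by simp
    also have "\<dots> \<le> 4 * ((2 * real k / real n) * (256 * (real k)\<^sup>2 / \<mu>\<^sup>2) ^ (2 * k))"
      using B C by (intro mult_left_mono mult_mono) auto
    finally show "4 * coeff_l2 n p \<le> 8 * real k / real n * (256 * (real k)\<^sup>2 / \<mu>\<^sup>2) ^ (2 * k)"
      by simp
  qed auto
  finally show ?thesis using 1 by blast
qed

text \<open>The real and imaginary parts are 2k real forms. The dual vector of each has the value 1
  or \<i> at its own point and 0 at the other points, with squared norm of order 1/n up to powers of
  1/\<mu>. So each point costs a factor of order \<rho>^2/n, and points closer than 1/n are paid for
  by powers of 1/\<mu>.\<close>

theorem trig_small_ball: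
  fixes t :: "nat \<Rightarrow> real"
  assumes sep1: "\<And>i l. i < k \<Longrightarrow> l < k \<Longrightarrow> l \<noteq> i \<Longrightarrow> norm (cis (t i) - cis (t l)) \<ge> \<Delta>"
    and sep2: "\<And>i l. i < k \<Longrightarrow> l < k \<Longrightarrow> norm (cis (t i) - cis (- t l)) \<ge> \<Delta>"
    and \<Delta>: "\<Delta> > 0" and n: "n \<ge> 2 * k" "n \<ge> 1" and \<mu>: "\<mu> = min 1 (real n * \<Delta>)" and \<rho>: "\<rho> \<ge> 0"
  shows "\<P>(x in gauss {..n}. \<forall>i<k. norm (trig_form n x (t i)) \<le> \<rho>)
    \<le> (8 * real k / real n * (256 * (real k)\<^sup>2 / \<mu>\<^sup>2) ^ (2 * k) * \<rho>\<^sup>2) ^ k"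
proof (cases "k = 0")
  case True
  thus ?thesis using prob_space.prob_le_1[OF prob_space_gauss] by simp
next
  case False
  interpret prob_space "gauss {..n}" by (rule prob_space_gauss)
  note [measurable] = inner_on_measurable[of "{..n}", simplified]
  define s where "s = sqrt (8 * real k / real n * (256 * (real k)\<^sup>2 / \<mu>\<^sup>2) ^ (2 * k))"
  have \<mu>0: "\<mu> > 0" using \<mu> \<Delta> n by auto
  have s: "s > 0" using False n \<mu>0 by (auto simp: s_def)
  have s2: "s\<^sup>2 = 8 * real k / real n * (256 * (real k)\<^sup>2 / \<mu>\<^sup>2) ^ (2 * k)" by (simp add: s_def)
  define y where "y j = (\<lambda>q::nat. if even j then cos (real q * t (j div 2)) else sin (real q * t (j div 2)))" for j :: nat
  have yw: "inner_on {..n} w (y j) = (if even j then Re (trig_form n w (t (j div 2))) else Im (trig_form n w (t (j div 2))))" for w j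
    by (simp add: Re_trig_form Im_trig_form y_def inner_on_commute)
  have "\<P>(x in gauss {..n}. \<forall>i<k. norm (trig_form n x (t i)) \<le> \<rho>)
    \<le> \<P>(x in gauss {..n}. \<forall>j\<in>{..<2*k}. \<bar>inner_on {..n} (y j) x\<bar> \<le> \<rho>)"
  proof (rule finite_measure_mono)
    show "{x \<in> space (gauss {..n}). \<forall>i<k. norm (trig_form n x (t i)) \<le> \<rho>} \<subseteq> {x \<in> space (gauss {..n}). \<forall>j\<in>{..<2*k}. \<bar>inner_on {..n} (y j) x\<bar> \<le> \<rho>}"
    proof safe
      fix x j assume "\<forall>i<k. norm (trig_form n x (t i)) \<le> \<rho>" "j < 2 * k"
      hence "norm (trig_form n x (t (j div 2))) \<le> \<rho>" by auto
      thus "\<bar>inner_on {..n} (y j) x\<bar> \<le> \<rho>"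
        unfolding inner_on_commute[of _ "y j"] yw
        using abs_Re_le_cmod[of "trig_form n x (t (j div 2))"] abs_Im_le_cmod[of "trig_form n x (t (j div 2))"] by auto
    qed
  qed measurable
  also have "\<dots> \<le> (\<Prod>j<2*k. s * \<rho>)"
    unfolding Ball_def lessThan_iff
  proof (rule gauss_small_ball)
    fix j assume j: "j < 2 * k"
    define i where "i = j div 2"
    have i: "i < k" using j by (simp add: i_def)
    obtain w where w: "\<forall>l<k. trig_form n w (t l) = (if l = i then (if even j then 1 else \<i>) else 0)"
      "inner_on {..n} w w \<le> (norm (if even j then 1 else \<i>))\<^sup>2 * (8 * real k / real n * (256 * (real k)\<^sup>2 / \<mu>\<^sup>2) ^ (2 * k))"
      using trig_witness[where t=t and c="if even j then 1 else \<i>", OF i sep1[OF i] sep2[OF i] \<Delta> n(1) \<mu>]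
        by blast
    have "inner_on {..n} w (y l) = 0" if "l < j" for l
    proof (cases "l div 2 = i")
      case True
      \<comment> \<open>The only earlier form at the same point is the real part, and the prescribed
        value \<i> has real part 0.\<close>
      hence "l = 2 * i" "j = Suc (2 * i)" using that unfolding i_def by presburger+
      thus ?thesis using w(1) i True by (simp add: yw)
    next
      case False
      have "l div 2 < k" using that j by simp
      thus ?thesis using w(1) False by (simp add: yw)
    qed
    moreover have "inner_on {..n} w (y j) = 1" using w(1) i by (simp add: yw flip: i_def)
    ultimately show "\<exists>w. (\<forall>l<j. inner_on {..n} w (y l) = 0) \<and> inner_on {..n} w (y j) = 1 \<and> inner_on {..n} w w \<le> s\<^sup>2"
      using w(2) unfolding s2 by (intro exI[of _ w]) (auto split: if_splits)
  qed (use s \<rho> in auto)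
  also have "\<dots> = (s\<^sup>2 * \<rho>\<^sup>2) ^ k" by (simp add: power_mult power_mult_distrib)
  finally show ?thesis unfolding s2 .
qed

section \<open>Values and derivatives at separated points\<close>

text \<open>Summation by parts: all partial sums of the powers of \<open>z\<close> are bounded by
  2/|1 - z|, which leaves the last coefficient and the total variation.\<close>

lemma abel_geometric_bound:
  fixes z :: complex
  assumes z: "norm z = 1" "z \<noteq> 1"
  shows "norm (\<Sum>k\<le>n. of_real (c k) * z ^ k) \<le> (\<bar>c n\<bar> + (\<Sum>k<n. \<bar>c (Suc k) - c k\<bar>)) * (2 / norm (1 - z))"
proof -
  define Z where "Z m = (\<Sum>k\<le>m. z ^ k)" for m
  have Z: "norm (Z m) \<le> 2 / norm (1 - z)" for m
  proof -
    have "Z m = (1 - z ^ Suc m) / (1 - z)"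
      using z unfolding Z_def by (simp only: sum_gp0 if_False)
    moreover have "norm (1 - z ^ Suc m) \<le> 2"
      using norm_triangle_ineq4[of 1 "z ^ Suc m"] z by (simp add: norm_power norm_mult)
    ultimately show ?thesis by (simp add: norm_divide divide_right_mono)
  qed
  have "(\<Sum>k\<le>n. of_real (c k) * z ^ k) = of_real (c n) * Z n - (\<Sum>k<n. of_real (c (Suc k) - c k) * Z k)"
  proof (induction n)
    case (Suc n)
    have "Z (Suc n) = Z n + z ^ Suc n" by (simp add: Z_def)
    thus ?case using Suc by (simp add: algebra_simps)
  qed (simp add: Z_def)
  also have "norm \<dots> \<le> \<bar>c n\<bar> * (2 / norm (1 - z)) + (\<Sum>k<n. \<bar>c (Suc k) - c k\<bar> * (2 / norm (1 - z)))"
  proof (intro order_trans[OF norm_triangle_ineq4] add_mono order_trans[OF norm_sum] sum_mono)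
    show "norm (of_real (c n) * Z n) \<le> \<bar>c n\<bar> * (2 / norm (1 - z))"
      unfolding norm_mult norm_of_real by (intro mult_left_mono Z) auto
    show "norm (of_real (c (Suc k) - c k) * Z k) \<le> \<bar>c (Suc k) - c k\<bar> * (2 / norm (1 - z))" for k
      unfolding norm_mult norm_of_real by (intro mult_left_mono Z) auto
  qed
  finally show ?thesis by (simp only: distrib_right sum_distrib_right)
qed

text \<open>The weights \<open>\<surd>(24/n) (k/n - 1/2)\<close> and \<open>\<surd>(2/n)\<close> are orthogonal, so that the derivative
  of the random trigonometric sum, corrected by its value, is asymptotically independent of the value.\<close>

definition frame_weight :: "nat \<Rightarrow> nat \<Rightarrow> nat \<Rightarrow> real" where
  "frame_weight n s k = (if s < 2 then sqrt (24 / real n) * (real k / real n - 1/2) else sqrt (2 / real n))"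

definition frame_vec :: "nat \<Rightarrow> real \<Rightarrow> nat \<Rightarrow> nat \<Rightarrow> real" where
  "frame_vec n t s k = frame_weight n s k * (if even s then cos (real k * t) else sin (real k * t))"

text \<open>By the product-to-sum formulas every Gram entry of two frame vectors is half a sum or
  difference of real or imaginary parts of this function, taken at the sum and at the difference of
  the two angles.\<close>

definition weight_sum :: "nat \<Rightarrow> nat \<Rightarrow> nat \<Rightarrow> real \<Rightarrow> complex" where
  "weight_sum n s s' \<phi> = (\<Sum>k\<le>n. of_real (frame_weight n s k * frame_weight n s' k) * cis (real k * \<phi>))"

lemma weight_sum_bound:
  assumes n: "n \<ge> 1" and \<Delta>: "norm (1 - cis \<phi>) \<ge> \<Delta>" "\<Delta> > 0"
  shows "norm (weight_sum n s s' \<phi>) \<le> 96 / (real n * \<Delta>)"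
proof -
  \<comment> \<open>A product of two weights is a constant times (k/n - 1/2)^b. The constant is at
    most 24/n, and the last value plus the total variation of the power is at most 2; with the
    factor 2/\<Delta> from summation by parts this makes 96/(n \<Delta>).\<close>
  define b where "b = (if s < 2 then 1 else 0) + (if s' < 2 then 1 else 0 :: nat)"
  define K where "K = (if s < 2 then sqrt (24 / real n) else sqrt (2 / real n)) * (if s' < 2 then sqrt (24 / real n) else sqrt (2 / real n))"
  define c where "c k = (real k / real n - 1/2) ^ b" for k
  have W: "frame_weight n s k * frame_weight n s' k = K * c k" for k
    by (simp add: frame_weight_def K_def b_def c_def power2_eq_square)
  have K: "0 \<le> K" "K \<le> 24 / real n"
  proof -
    have "K \<le> sqrt (24 / real n) * sqrt (24 / real n)"
      unfolding K_def by (intro mult_mono) (auto intro!: divide_right_mono)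
    thus "K \<le> 24 / real n" by simp
  qed (auto simp: K_def)
  have cb: "\<bar>c n\<bar> \<le> 1"
    unfolding c_def power_abs using n by (intro power_le_one) auto
  have inc: "\<bar>c (Suc k) - c k\<bar> \<le> 1 / real n" if "k < n" for k
  proof -
    have b: "b = 0 \<or> b = 1 \<or> b = 2" by (auto simp: b_def)
    define u where "u = real k / real n"
    have u: "u \<ge> 0" "u + 1 / real n \<le> 1" using that n by (auto simp: u_def field_simps)
    have n0: "1 / real n \<ge> 0" by simp
    have s: "real (Suc k) / real n = u + 1 / real n" by (simp add: u_def add_divide_distrib)
    have "(u + 1 / real n - 1/2)\<^sup>2 - (u - 1/2)\<^sup>2 = 1 / real n * (2 * u + 1 / real n - 1)"
      by (simp add: power2_eq_square algebra_simps)
    moreover have "\<bar>2 * u + 1 / real n - 1\<bar> \<le> 1" using u n0 by (simp only: abs_le_iff) linarith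
    ultimately have "\<bar>(u + 1 / real n - 1/2)\<^sup>2 - (u - 1/2)\<^sup>2\<bar> \<le> 1 / real n"
      using mult_left_mono[of "\<bar>2 * u + 1 / real n - 1\<bar>" 1 "1 / real n"] by (simp add: abs_mult)
    thus ?thesis using b unfolding c_def s u_def[symmetric] by auto
  qed
  have "(\<Sum>k<n. \<bar>c (Suc k) - c k\<bar>) \<le> (\<Sum>k<n. 1 / real n)" by (intro sum_mono) (use inc in auto)
  hence tv: "\<bar>c n\<bar> + (\<Sum>k<n. \<bar>c (Suc k) - c k\<bar>) \<le> 2" using cb n by simp
  have "weight_sum n s s' \<phi> = of_real K * (\<Sum>k\<le>n. of_real (c k) * cis \<phi> ^ k)"
    by (simp add: weight_sum_def W sum_distrib_left Complex.DeMoivre mult_ac)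
  hence "norm (weight_sum n s s' \<phi>) = K * norm (\<Sum>k\<le>n. of_real (c k) * cis \<phi> ^ k)"
    using K by (simp add: norm_mult)
  also have "\<dots> \<le> (24 / real n) * (2 * (2 / \<Delta>))"
  proof (intro mult_mono K)
    have "cis \<phi> \<noteq> 1" using \<Delta> by auto
    from abel_geometric_bound[OF _ this, of c n]
    have "norm (\<Sum>k\<le>n. of_real (c k) * cis \<phi> ^ k) \<le> (\<bar>c n\<bar> + (\<Sum>k<n. \<bar>c (Suc k) - c k\<bar>)) * (2 / norm (1 - cis \<phi>))" by simp
    also have "\<dots> \<le> 2 * (2 / \<Delta>)"
      using tv \<Delta> by (intro mult_mono divide_left_mono) (auto intro!: mult_pos_pos)
    finally show "norm (\<Sum>k\<le>n. of_real (c k) * cis \<phi> ^ k) \<le> 2 * (2 / \<Delta>)" .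
  qed auto
  finally show ?thesis by (simp add: mult_ac)
qed

text \<open>The value 2 is halved to 1 by the product-to-sum formulas. It arises from 24/n times the
  sum of (k/n - 1/2)^2, which is about n/12, and from 2/n times n + 1; the mixed sum vanishes
  because k/n - 1/2 is odd under k \<mapsto> n - k.\<close>

lemma weight_sum_0:
  assumes n: "n \<ge> 1"
  shows "Im (weight_sum n s s' 0) = 0"
    and "\<bar>Re (weight_sum n s s' 0) - (if (s < 2) = (s' < 2) then 2 else 0)\<bar> \<le> 10 / real n"
proof -
  show "Im (weight_sum n s s' 0) = 0" by (simp add: weight_sum_def)
  have n0: "real n > 0" using n by simp
  have S1: "(\<Sum>k\<le>n. real k) = real n * (real n + 1) / 2" 
    by (induction n) (auto simp: field_simps)
  have S2: "(\<Sum>k\<le>n. (real k)\<^sup>2) = real n * (real n + 1) * (2 * real n + 1) / 6"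
    by (induction n) (auto simp: field_simps power2_eq_square)
  have T1: "(\<Sum>k\<le>n. real k / real n - 1/2) = 0"
  proof -
    have "(\<Sum>k\<le>n. real k / real n - 1/2) = (\<Sum>k\<le>n. real k) / real n - (real n + 1) / 2"
      by (simp add: sum_subtractf sum_divide_distrib)
    also have "\<dots> = 0" unfolding S1 using n0 by (simp add: field_simps)
    finally show ?thesis .
  qed
  have T2: "(\<Sum>k\<le>n. (real k / real n - 1/2)\<^sup>2) = (real n + 1) * (real n + 2) / (12 * real n)"
  proof -
    have "(\<Sum>k\<le>n. (real k / real n - 1/2)\<^sup>2) = (\<Sum>k\<le>n. (real k)\<^sup>2 / (real n)\<^sup>2 - real k / real n + 1/4)"
      using n0 by (intro sum.cong) (auto simp: power2_eq_square field_simps)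
    also have "\<dots> = (\<Sum>k\<le>n. (real k)\<^sup>2) / (real n)\<^sup>2 - (\<Sum>k\<le>n. real k) / real n + (real n + 1) / 4"
      by (simp add: sum.distrib sum_subtractf sum_divide_distrib)
    also have "\<dots> = (real n + 1) * (real n + 2) / (12 * real n)"
      unfolding S1 S2 using n0 by (simp add: field_simps power2_eq_square)
    finally show ?thesis .
  qed
  have R: "Re (weight_sum n s s' 0) = (\<Sum>k\<le>n. frame_weight n s k * frame_weight n s' k)"
    by (simp add: weight_sum_def)
  consider "s < 2" "s' < 2" | "s < 2" "\<not> s' < 2" | "\<not> s < 2" "s' < 2" | "\<not> s < 2" "\<not> s' < 2"
    by blast
  thus "\<bar>Re (weight_sum n s s' 0) - (if (s < 2) = (s' < 2) then 2 else 0)\<bar> \<le> 10 / real n"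
  proof cases
    case 1
    have "Re (weight_sum n s s' 0) = (\<Sum>k\<le>n. 24 / real n * (real k / real n - 1/2)\<^sup>2)"
    proof -
      have "sqrt c * x * (sqrt c * x) = c * x\<^sup>2" if "c \<ge> 0" for c x :: real
        using that by (metis power2_eq_square power_mult_distrib real_sqrt_pow2)
      thus ?thesis unfolding R frame_weight_def using 1 n0 by (intro sum.cong) auto
    qed
    also have "\<dots> = 24 / real n * ((real n + 1) * (real n + 2) / (12 * real n))"
      by (simp only: sum_distrib_left[symmetric] T2)
    also have "\<dots> = 2 + 6 / real n + 4 / (real n)\<^sup>2" using n0 by (simp add: field_simps power2_eq_square)
    finally have "Re (weight_sum n s s' 0) - 2 = 6 / real n + 4 / (real n)\<^sup>2" by simp
    moreover have "4 / (real n)\<^sup>2 \<le> 4 / real n"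
      using n by (intro divide_left_mono) (auto simp: power2_eq_square)
    moreover have "6 / real n + 4 / real n = 10 / real n" by (simp add: add_divide_distrib[symmetric])
    ultimately show ?thesis using 1 n0 by simp
  next
    case 2
    have "Re (weight_sum n s s' 0) = (\<Sum>k\<le>n. sqrt (24 / real n) * sqrt (2 / real n) * (real k / real n - 1/2))"
      unfolding R using 2 by (intro sum.cong) (auto simp: frame_weight_def)
    also have "\<dots> = 0" by (simp only: sum_distrib_left[symmetric] T1 mult_zero_right)
    finally show ?thesis using 2 by simp
  next
    case 3
    have "Re (weight_sum n s s' 0) = (\<Sum>k\<le>n. sqrt (24 / real n) * sqrt (2 / real n) * (real k / real n - 1/2))"
      unfolding R using 3 by (intro sum.cong) (auto simp: frame_weight_def)
    also have "\<dots> = 0" by (simp only: sum_distrib_left[symmetric] T1 mult_zero_right)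
    finally show ?thesis using 3 by simp
  next
    case 4
    have "Re (weight_sum n s s' 0) = (\<Sum>k\<le>n. 2 / real n)"
      unfolding R using 4 n0 by (intro sum.cong) (auto simp: frame_weight_def)
    also have "\<dots> = 2 + 2 / real n" using n0 by (simp add: field_simps)
    finally show ?thesis using 4 n0 by (simp add: divide_right_mono)
  qed
qed

lemma frame_vec_inner:
  "inner_on {..n} (frame_vec n a s) (frame_vec n b s') =
    (if even s \<and> even s' then (Re (weight_sum n s s' (a - b)) + Re (weight_sum n s s' (a + b))) / 2
     else if odd s \<and> odd s' then (Re (weight_sum n s s' (a - b)) - Re (weight_sum n s s' (a + b))) / 2
     else if odd s then (Im (weight_sum n s s' (a + b)) + Im (weight_sum n s s' (a - b))) / 2
     else (Im (weight_sum n s s' (a + b)) - Im (weight_sum n s s' (a - b))) / 2)"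
proof -
  have tr: "cos (u * a) * cos (u * b) = (cos (u * (a - b)) + cos (u * (a + b))) / 2"
    "sin (u * a) * sin (u * b) = (cos (u * (a - b)) - cos (u * (a + b))) / 2"
    "sin (u * a) * cos (u * b) = (sin (u * (a + b)) + sin (u * (a - b))) / 2"
    "cos (u * a) * sin (u * b) = (sin (u * (a + b)) - sin (u * (a - b))) / 2" for u :: real
    by (simp_all add: distrib_left right_diff_distrib cos_add cos_diff sin_add sin_diff)
  have eq: "frame_vec n a s k * frame_vec n b s' k = frame_weight n s k * frame_weight n s' k *
     ((if even s then cos (real k * a) else sin (real k * a)) * (if even s' then cos (real k * b) else sin (real k * b)))" for k
    by (simp add: frame_vec_def)
  show ?thesis
    unfolding inner_on_def eq weight_sum_def
    by (cases "even s"; cases "even s'")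
       (simp_all add: tr sum.distrib[symmetric] sum_subtractf[symmetric] distrib_left[symmetric] right_diff_distrib[symmetric]
          sum_divide_distrib[symmetric])
qed

lemma norm_cis_diff: "norm (cis a - cis b) = norm (1 - cis (a - b))"
proof -
  have "cis a - cis b = cis b * (cis (a - b) - 1)" by (simp add: algebra_simps cis_mult)
  thus ?thesis by (simp add: norm_mult norm_minus_commute)
qed

text \<open>Index 4p + s stands for form s at point p. The angle 0 arises only as a difference at
  equal points, where parity and weight class together determine s. Every other contribution is an
  oscillating sum at an angle kept away from 0 by \<open>sep1\<close> or
  \<open>sep2\<close>.\<close>

theorem frame_gram:
  fixes t :: "nat \<Rightarrow> real"
  assumes sep1: "\<And>i l. i < k \<Longrightarrow> l < k \<Longrightarrow> l \<noteq> i \<Longrightarrow> norm (cis (t i) - cis (t l)) \<ge> \<Delta>"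
    and sep2: "\<And>i l. i < k \<Longrightarrow> l < k \<Longrightarrow> norm (cis (t i) - cis (- t l)) \<ge> \<Delta>"
    and \<Delta>: "\<Delta> > 0" and n: "n \<ge> 1" and ij: "i < 4 * k" "j < 4 * k"
  shows "\<bar>inner_on {..n} (frame_vec n (t (i div 4)) (i mod 4)) (frame_vec n (t (j div 4)) (j mod 4)) - (if i = j then 1 else 0)\<bar>
     \<le> 96 / (real n * \<Delta>)"
proof -
  define p q s s' where "p = i div 4" and "q = j div 4" and "s = i mod 4" and "s' = j mod 4"
  have pq: "p < k" "q < k" using ij by (auto simp: p_def q_def)
  have ss: "s < 4" "s' < 4" by (auto simp: s_def s'_def)
  have eq: "i = j \<longleftrightarrow> p = q \<and> s = s'" unfolding p_def q_def s_def s'_def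
    by (metis div_mult_mod_eq)
  let ?W = "weight_sum n s s'"
  have plus: "norm (?W (t p + t q)) \<le> 96 / (real n * \<Delta>)"
    using sep2[OF pq] by (intro weight_sum_bound n \<Delta>) (simp add: norm_cis_diff)
  have "\<Delta> \<le> 2" using sep2[OF pq(1) pq(1)] norm_triangle_ineq4[of "cis (t p)" "cis (- t p)"] by simp
  have half: "\<bar>x\<bar> \<le> c \<Longrightarrow> \<bar>y\<bar> \<le> c \<Longrightarrow> \<bar>(x + y) / 2\<bar> \<le> c \<and> \<bar>(x - y) / 2\<bar> \<le> c" for x y c :: real by auto
  note Pl = order_trans[OF abs_Re_le_cmod plus] order_trans[OF abs_Im_le_cmod plus]
  show ?thesis unfolding eq p_def[symmetric] q_def[symmetric] s_def[symmetric] s'_def[symmetric]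
  proof (cases "p = q")
    case False
    have minus: "norm (?W (t p - t q)) \<le> 96 / (real n * \<Delta>)"
      using sep1[OF pq] False by (intro weight_sum_bound n \<Delta>) (simp add: norm_cis_diff)
    note Mi = order_trans[OF abs_Re_le_cmod minus] order_trans[OF abs_Im_le_cmod minus]
    show "\<bar>inner_on {..n} (frame_vec n (t p) s) (frame_vec n (t q) s') - (if p = q \<and> s = s' then 1 else 0)\<bar> \<le> 96 / (real n * \<Delta>)"
      unfolding frame_vec_inner using False half[OF Mi(1) Pl(1)] half[OF Pl(2) Mi(2)] by simp
  next
    case True
    have "10 / real n \<le> 20 / (real n * \<Delta>)"
      using n \<Delta> \<open>\<Delta> \<le> 2\<close> by (simp add: field_simps)
    hence w0: "\<bar>Re (?W 0) - (if (s < 2) = (s' < 2) then 2 else 0)\<bar> \<le> 96 / (real n * \<Delta>)" "Im (?W 0) = 0"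
      using weight_sum_0[OF n, of s s'] n \<Delta> divide_right_mono[of 20 96 "real n * \<Delta>"] by auto
    have w1: "\<bar>Im (?W 0)\<bar> \<le> 96 / (real n * \<Delta>)" using w0(2) n \<Delta> by simp
    have par: "(s = s') = ((even s = even s') \<and> ((s < 2) = (s' < 2)))"
    proof -
      have "s = 0 \<or> s = 1 \<or> s = 2 \<or> s = 3" "s' = 0 \<or> s' = 1 \<or> s' = 2 \<or> s' = 3"
        using ss by linarith+
      thus ?thesis by auto
    qed
    show "\<bar>inner_on {..n} (frame_vec n (t p) s) (frame_vec n (t q) s') - (if p = q \<and> s = s' then 1 else 0)\<bar> \<le> 96 / (real n * \<Delta>)"
      unfolding frame_vec_inner par
        using True half[OF w0(1) Pl(1)[unfolded True]] half[OF Pl(2)[unfolded True] w1] w0(2)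
      by (auto simp: diff_divide_distrib add_divide_distrib)
  qed
qed

section \<open>Linearised roots\<close>

lemma gauss_split:
  assumes F: "F \<in> borel_measurable (gauss {..<d + e})"
  shows "(\<integral>\<^sup>+x. F x \<partial>gauss {..<d + e}) =
    (\<integral>\<^sup>+x. (\<integral>\<^sup>+y. F (\<lambda>i\<in>{..<d + e}.
      if i < d then x i else y (i - d)) \<partial>gauss {..<e}) \<partial>gauss {..<d})"
proof -
  let ?J = "{d..<d + e}"
  have un: "{..<d + e} = {..<d} \<union> ?J" by auto
  have "(\<integral>\<^sup>+x. F x \<partial>gauss {..<d + e}) = (\<integral>\<^sup>+x. (\<integral>\<^sup>+y. F (merge {..<d} ?J (x, y)) \<partial>gauss ?J) \<partial>gauss {..<d})"
    using F unfolding gauss_def un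
    by (intro std_normal_prod.product_nn_integral_fold) auto
  also have "\<dots> = (\<integral>\<^sup>+x. (\<integral>\<^sup>+y. F (\<lambda>i\<in>{..<d + e}. if i < d then x i else y (i - d)) \<partial>gauss {..<e}) \<partial>gauss {..<d})"
  proof (rule nn_integral_cong)
    fix x assume x: "x \<in> space (gauss {..<d})"
    let ?f = "\<lambda>\<omega>. \<lambda>m\<in>{..<e}. \<omega> (d + m) :: real"
    let ?G = "\<lambda>y. F (\<lambda>i\<in>{..<d + e}. if i < d then x i else y (i - d))"
    have re: "distr (gauss ?J) (gauss {..<e}) ?f = gauss {..<e}"
      unfolding gauss_def
      by (rule distr_PiM_reindex[where M="\<lambda>_. std_normal_distribution", simplified])
         (auto simp: inj_on_def std_normal.prob_space_axioms)
    have f: "?f \<in> measurable (gauss ?J) (gauss {..<e})"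
      unfolding measurable_cong_sets[OF sets_gauss sets_gauss]
      by (intro measurable_restrict measurable_component_singleton) auto
    have h: "(\<lambda>y. \<lambda>i\<in>{..<d + e}. if i < d then x i else y (i - d)) \<in> measurable (gauss {..<e}) (gauss {..<d + e})"
      unfolding measurable_cong_sets[OF sets_gauss sets_gauss]
    proof (rule measurable_restrict)
      fix i assume "i \<in> {..<d + e}"
      thus "(\<lambda>y. if i < d then x i else y (i - d)) \<in> borel_measurable (PiM {..<e} (\<lambda>_. borel))"
        by (cases "i < d") auto
    qed
    have "(\<integral>\<^sup>+y. ?G y \<partial>gauss {..<e}) = (\<integral>\<^sup>+y. ?G (?f y) \<partial>gauss ?J)"
      by (subst re[symmetric], subst nn_integral_distr[OF f]) (use measurable_compose[OF h F] in auto)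
    also have "\<dots> = (\<integral>\<^sup>+y. F (merge {..<d} ?J (x, y)) \<partial>gauss ?J)"
      by (intro nn_integral_cong arg_cong[of _ _ F]) (auto simp: merge_def fun_eq_iff space_gauss PiE_def extensional_def)
    finally show "(\<integral>\<^sup>+y. F (merge {..<d} ?J (x, y)) \<partial>gauss ?J) = (\<integral>\<^sup>+y. ?G y \<partial>gauss {..<e})" ..
  qed
  finally show ?thesis .
qed

lemma measure_gauss_blocks:
  assumes P: "Measurable.pred (gauss {..<4}) (\<lambda>y. P (y 0) (y 1) (y 2) (y 3))"
  shows "{y \<in> space (gauss {..<4 * k}). \<forall>i<k. P (y (4*i)) (y (4*i+1)) (y (4*i+2)) (y (4*i+3))} \<in> sets (gauss {..<4 * k})"
    and "\<P>(y in gauss {..<4 * k}. \<forall>i<k. P (y (4*i)) (y (4*i+1)) (y (4*i+2)) (y (4*i+3)))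
     = \<P>(y in gauss {..<4}. P (y 0) (y 1) (y 2) (y 3)) ^ k"
proof -
  let ?B = "\<lambda>k. {y \<in> space (gauss {..<4 * k}). \<forall>i\<in>{..<k}. P (y (4*i)) (y (4*i+1)) (y (4*i+2)) (y (4*i+3))}"
  let ?Q = "{y \<in> space (gauss {..<4}). P (y 0) (y 1) (y 2) (y 3)}"
  have Q: "?Q \<in> sets (gauss {..<4})" using P by measurable
  have m: "Measurable.pred (gauss {..<4 * k}) (\<lambda>y. P (y (4*i)) (y (4*i+1)) (y (4*i+2)) (y (4*i+3)))"
    if "i < k" for i k
  proof -
    have "(\<lambda>y. \<lambda>j\<in>{..<4}. y (4 * i + j)) \<in> measurable (gauss {..<4 * k}) (gauss {..<4})"
      unfolding measurable_cong_sets[OF sets_gauss sets_gauss]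
      using that by (intro measurable_restrict measurable_component_singleton) auto
    from measurable_compose[OF this P] show ?thesis by simp
  qed
  have B: "?B k \<in> sets (gauss {..<4 * k})" for k using m by measurable
  thus "{y \<in> space (gauss {..<4 * k}). \<forall>i<k. P (y (4*i)) (y (4*i+1)) (y (4*i+2)) (y (4*i+3))} \<in> sets (gauss {..<4 * k})"
    by (simp only: Ball_def lessThan_iff)
  interpret q: prob_space "gauss {..<4}" by (rule prob_space_gauss)
  have "emeasure (gauss {..<4 * k}) (?B k) = emeasure (gauss {..<4}) ?Q ^ k"
  proof (induction k)
    case 0
    show ?case using prob_space.emeasure_space_1[OF prob_space_gauss, of "{}"] by simp
  next
    case (Suc k)
    have eq: "4 * Suc k = 4 * k + 4" by simp
    have "emeasure (gauss {..<4 * Suc k}) (?B (Suc k)) = (\<integral>\<^sup>+y. indicator (?B (Suc k)) y \<partial>gauss {..<4 * k + 4})"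
      using B[of "Suc k"] unfolding eq by simp
    also have "\<dots> = (\<integral>\<^sup>+x. (\<integral>\<^sup>+y. indicator (?B (Suc k)) (\<lambda>i\<in>{..<4 * k + 4}. if i < 4 * k then x i else y (i - 4 * k)) \<partial>gauss {..<4}) \<partial>gauss {..<4 * k})"
      using B[of "Suc k"] unfolding eq by (intro gauss_split) simp
    also have "\<dots> = (\<integral>\<^sup>+x. (\<integral>\<^sup>+y. indicator (?B k) x * indicator ?Q y \<partial>gauss {..<4}) \<partial>gauss {..<4 * k})"
    proof (intro nn_integral_cong)
      fix x y assume "x \<in> space (gauss {..<4 * k})" "y \<in> space (gauss {..<4})"
      note xy = this
      define z where "z = (\<lambda>i\<in>{..<4 * k + 4}. if i < 4 * k then x i else y (i - 4 * k))"
      have zs: "z \<in> space (gauss {..<4 * Suc k})"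
        unfolding eq space_gauss z_def by auto
      have z1: "z (4*i) = x (4*i)" "z (4*i+1) = x (4*i+1)" "z (4*i+2) = x (4*i+2)" "z (4*i+3) = x (4*i+3)"
        if "i < k" for i using that by (auto simp: z_def)
      have z2: "z (4*k) = y 0" "z (4*k+1) = y 1" "z (4*k+2) = y 2" "z (4*k+3) = y 3"
        by (simp_all add: z_def)
      have "z \<in> ?B (Suc k) \<longleftrightarrow> (\<forall>i\<in>{..<k}. P (z (4*i)) (z (4*i+1)) (z (4*i+2)) (z (4*i+3))) \<and>
           P (z (4*k)) (z (4*k+1)) (z (4*k+2)) (z (4*k+3))"
        unfolding lessThan_Suc using zs by blast
      also have "\<dots> \<longleftrightarrow> x \<in> ?B k \<and> y \<in> ?Q"
        using xy z1 z2 by simp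
      finally show "indicator (?B (Suc k)) (\<lambda>i\<in>{..<4 * k + 4}. if i < 4 * k then x i else y (i - 4 * k)) = (indicator (?B k) x * indicator ?Q y :: ennreal)"
        unfolding z_def[symmetric] indicator_def by simp
    qed
    also have "\<dots> = emeasure (gauss {..<4 * k}) (?B k) * emeasure (gauss {..<4}) ?Q"
      using B[of k] Q by (simp add: nn_integral_cmult nn_integral_multc)
    finally show ?case using Suc by (simp add: mult.commute)
  qed
  thus "\<P>(y in gauss {..<4 * k}. \<forall>i<k. P (y (4*i)) (y (4*i+1)) (y (4*i+2)) (y (4*i+3)))
     = measure (gauss {..<4}) ?Q ^ k"
    by (intro measure_eq_emeasure_eq_ennreal) (simp_all add: Ball_def q.emeasure_eq_measure ennreal_power)
qed

text \<open>With \<open>g w = (\<Sum>k\<le>n. x k * exp (\<i> k w))\<close>, the arguments \<open>U\<close> and \<open>H\<close> stand for \<open>g t / \<surd>n\<close> and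
  \<open>(g' t - \<i> n g t / 2) / (\<i> n \<surd>n)\<close>. Where \<open>g t\<close> is small, the linearised equation \<open>g w = 0\<close> has the solution
  \<open>w = t + \<i> U / (n H)\<close>, and the condition places it within \<open>a / n\<^sup>2\<close> of \<open>t\<close> horizontally and within
  \<open>b / n\<^sup>2\<close> vertically.\<close>

definition root_cond :: "nat \<Rightarrow> real \<Rightarrow> real \<Rightarrow> complex \<Rightarrow> complex \<Rightarrow> bool" where
  "root_cond n a b U H \<longleftrightarrow> 1 / ln (real n) \<le> norm H \<and> norm H \<le> ln (real n) \<and>
     \<bar>Re (\<i> * U / H)\<bar> \<le> a / real n \<and> \<bar>Im (\<i> * U / H)\<bar> \<le> b / real n"

text \<open>The probability of \<open>root_cond\<close> in the limiting model. As in
  \<open>frame_vec\<close>, coordinates 0 and 1 carry the corrected derivative and 2 and 3 the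
  value; the divisions by sqrt 24 and sqrt 2 undo the normalisation of the frame.\<close>

definition cell_prob :: "nat \<Rightarrow> real \<Rightarrow> real \<Rightarrow> real" where
  "cell_prob n a b = measure (gauss {..<4}) {y \<in> space (gauss {..<4}).
     root_cond n a b (Complex (y 2) (y 3) / of_real (sqrt 2)) (Complex (y 0) (y 1) / of_real (sqrt 24))}"

section \<open>Asymptotics of the probability of one cell in the limiting model\<close>

lemma Complex_measurable [measurable (raw)]:
  assumes "f \<in> borel_measurable M" "g \<in> borel_measurable M"
  shows "(\<lambda>x. Complex (f x) (g x)) \<in> borel_measurable M"
  unfolding Complex_eq using assms by measurable

lemma std_normal_symmetric_interval:
  assumes R: "R \<ge> 0"
  shows "measure std_normal_distribution {t. \<bar>t\<bar> \<le> R} \<le> 2 * R / sqrt (2 * pi)"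
    and "2 * R / sqrt (2 * pi) * exp (- R\<^sup>2 / 2) \<le> measure std_normal_distribution {t. \<bar>t\<bar> \<le> R}"
proof -
  have eq: "{t. \<bar>t\<bar> \<le> R} = {-R..R}" by auto
  have em: "emeasure std_normal_distribution {-R..R} = (\<integral>\<^sup>+t. ennreal (std_normal_density t) * indicator {-R..R} t \<partial>lborel)"
    by (subst emeasure_density) auto
  have c: "(\<integral>\<^sup>+t. ennreal K * indicator {-R..R} t \<partial>lborel) = ennreal (K * (2 * R))"
    if "K \<ge> 0" for K
    using R that by (subst nn_integral_cmult_indicator) (auto simp: ennreal_mult[symmetric])
  have "emeasure std_normal_distribution {-R..R} \<le> (\<integral>\<^sup>+t. ennreal (1 / sqrt (2 * pi)) * indicator {-R..R} t \<partial>lborel)"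
    unfolding em
      by (intro nn_integral_mono mult_right_mono ennreal_leI) (auto simp: std_normal_density_def intro!: divide_right_mono)
  also have "\<dots> = ennreal (2 * R / sqrt (2 * pi))" by (subst c) auto
  finally show "measure std_normal_distribution {t. \<bar>t\<bar> \<le> R} \<le> 2 * R / sqrt (2 * pi)"
    unfolding eq std_normal.emeasure_eq_measure using R by (subst (asm) ennreal_le_iff) auto
  have "ennreal (1 / sqrt (2 * pi) * exp (- R\<^sup>2 / 2) * (2 * R)) = (\<integral>\<^sup>+t. ennreal (1 / sqrt (2 * pi) * exp (- R\<^sup>2 / 2)) * indicator {-R..R} t \<partial>lborel)"
    by (subst c) auto
  also have "\<dots> \<le> emeasure std_normal_distribution {-R..R}"
    unfolding em
  proof (intro nn_integral_mono)
    fix t :: real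
    have "t\<^sup>2 \<le> R\<^sup>2" if "t \<in> {-R..R}"
    proof -
      have "\<bar>t\<bar> \<le> \<bar>R\<bar>" using that R by auto
      thus ?thesis by (simp only: abs_le_square_iff)
    qed
    thus "ennreal (1 / sqrt (2 * pi) * exp (- R\<^sup>2 / 2)) * indicator {-R..R} t \<le> ennreal (std_normal_density t) * indicator {-R..R} t"
      by (auto simp: indicator_def std_normal_density_def intro!: ennreal_leI divide_right_mono)
  qed
  finally show "2 * R / sqrt (2 * pi) * exp (- R\<^sup>2 / 2) \<le> measure std_normal_distribution {t. \<bar>t\<bar> \<le> R}"
    unfolding eq std_normal.emeasure_eq_measure by (subst (asm) ennreal_le_iff) (auto simp: mult_ac)
qed

text \<open>Multiplication by \<i>/H is a rotation followed by a scaling, and the planar Gaussian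
  law is rotation invariant. So the real and imaginary parts of the quotient are independent and the
  probability factors.\<close>

lemma gauss2_rotated_box:
  assumes H: "H \<noteq> 0" and a: "a \<ge> 0" "b \<ge> 0"
  shows "\<P>(u in gauss {..<2}. \<bar>Re (\<i> * (Complex (u 0) (u 1) / of_real (sqrt 2)) / H)\<bar> \<le> a \<and>
       \<bar>Im (\<i> * (Complex (u 0) (u 1) / of_real (sqrt 2)) / H)\<bar> \<le> b)
     = measure std_normal_distribution {t. \<bar>t\<bar> \<le> sqrt 2 * norm H * a} * measure std_normal_distribution {t. \<bar>t\<bar> \<le> sqrt 2 * norm H * b}"
proof -
  interpret g: prob_space "gauss {..<2}" by (rule prob_space_gauss)
  define c s where "c = Re H / norm H" and "s = Im H / norm H"
  have n0: "norm H > 0" using H by simp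
  have cs: "c * c + s * s = 1"
  proof -
    have "c * c + s * s = (Re H * Re H + Im H * Im H) / (norm H * norm H)"
      by (simp add: c_def s_def add_divide_distrib)
    also have "Re H * Re H + Im H * Im H = norm H * norm H"
      using cmod_power2[of H] by (simp add: power2_eq_square)
    finally show ?thesis using n0 by simp
  qed
  have Hcs: "H = of_real (norm H) * Complex c s" using n0 by (simp add: complex_eq_iff c_def s_def)
  have "Complex c s * Complex c (- s) = 1" using cs by (simp add: complex_eq_iff)
  hence inv: "inverse (Complex c s) = Complex c (- s)" by (rule inverse_unique)
  have iU: "\<i> * Complex p q = Complex (- q) p" for p q by (simp add: complex_eq_iff)
  \<comment> \<open>\<open>e 0\<close> yields the imaginary part and \<open>e 1\<close> minus the
    real part, up to scaling; hence \<open>b\<close> comes before \<open>a\<close> in the box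
    below.\<close>
  define e :: "nat \<Rightarrow> nat \<Rightarrow> real" where "e l k = (if l = 0 then (if k = 0 then c else s) else (if k = 0 then - s else c))" for l k
  have l2: "{..<2} = {0, 1::nat}" by auto
  have on: "orthonormal_on {..<2} 2 e"
    using cs unfolding orthonormal_on_def inner_on_def l2 by (auto simp: e_def less_2_cases_iff)
  let ?E = "\<lambda>x. \<lambda>l\<in>{..<2}. inner_on {..<2} (e l) x"
  let ?B = "Pi\<^sub>E {..<2::nat} (\<lambda>l. {t. \<bar>t\<bar> \<le> sqrt 2 * norm H * (if l = 0 then b else a)})"
  have E: "?E \<in> measurable (gauss {..<2}) (gauss {..<2})"
    using inner_on_measurable[of "{..<2}"] by measurable
  have ev: "\<bar>Re (\<i> * (Complex (u 0) (u 1) / of_real (sqrt 2)) / H)\<bar> \<le> a \<longleftrightarrow> \<bar>inner_on {..<2} (e 1) u\<bar> \<le> sqrt 2 * norm H * a"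
    "\<bar>Im (\<i> * (Complex (u 0) (u 1) / of_real (sqrt 2)) / H)\<bar> \<le> b \<longleftrightarrow> \<bar>inner_on {..<2} (e 0) u\<bar> \<le> sqrt 2 * norm H * b" for u
  proof -
    have eq: "\<i> * (Complex (u 0) (u 1) / of_real (sqrt 2)) / H = (Complex (- u 1) (u 0) * Complex c (- s)) / of_real (sqrt 2 * norm H)"
      by (subst Hcs, simp only: iU[symmetric] divide_inverse inverse_mult_distrib inv of_real_mult of_real_inverse mult_ac)
    have "Re (\<i> * (Complex (u 0) (u 1) / of_real (sqrt 2)) / H) = - inner_on {..<2} (e 1) u / (sqrt 2 * norm H)"
      unfolding eq Re_divide_of_real by (simp add: inner_on_def l2 e_def algebra_simps)
    thus "\<bar>Re (\<i> * (Complex (u 0) (u 1) / of_real (sqrt 2)) / H)\<bar> \<le> a \<longleftrightarrow> \<bar>inner_on {..<2} (e 1) u\<bar> \<le> sqrt 2 * norm H * a"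
      using n0 by (simp add: abs_mult abs_divide divide_le_eq mult_ac)
    have "Im (\<i> * (Complex (u 0) (u 1) / of_real (sqrt 2)) / H) = inner_on {..<2} (e 0) u / (sqrt 2 * norm H)"
      unfolding eq Im_divide_of_real by (simp add: inner_on_def l2 e_def algebra_simps)
    thus "\<bar>Im (\<i> * (Complex (u 0) (u 1) / of_real (sqrt 2)) / H)\<bar> \<le> b \<longleftrightarrow> \<bar>inner_on {..<2} (e 0) u\<bar> \<le> sqrt 2 * norm H * b"
      using n0 by (simp add: abs_mult abs_divide divide_le_eq mult_ac)
  qed
  have Bs: "?B \<in> sets (gauss {..<2})" unfolding sets_gauss by (intro sets_PiM_I_finite) auto
  have "{u \<in> space (gauss {..<2}). \<bar>Re (\<i> * (Complex (u 0) (u 1) / of_real (sqrt 2)) / H)\<bar> \<le> a \<and>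
       \<bar>Im (\<i> * (Complex (u 0) (u 1) / of_real (sqrt 2)) / H)\<bar> \<le> b} = ?E -` ?B \<inter> space (gauss {..<2})"
  proof -
    have 1: "?E u \<in> ?B \<longleftrightarrow> (\<forall>l\<in>{..<2}. \<bar>inner_on {..<2} (e l) u\<bar> \<le> sqrt 2 * norm H * (if l = 0 then b else a))" for u
      by (simp add: PiE_iff)
    have 2: "(\<forall>l\<in>{..<2}. \<bar>inner_on {..<2} (e l) u\<bar> \<le> sqrt 2 * norm H * (if l = 0 then b else a)) \<longleftrightarrow>
        \<bar>inner_on {..<2} (e 0) u\<bar> \<le> sqrt 2 * norm H * b \<and> \<bar>inner_on {..<2} (e 1) u\<bar> \<le> sqrt 2 * norm H * a" for u
      unfolding l2 by simp
    show ?thesis unfolding ev by (rule set_eqI) (unfold Int_iff mem_Collect_eq vimage_eq 1 2, blast)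
  qed
  hence "\<P>(u in gauss {..<2}. \<bar>Re (\<i> * (Complex (u 0) (u 1) / of_real (sqrt 2)) / H)\<bar> \<le> a \<and>
       \<bar>Im (\<i> * (Complex (u 0) (u 1) / of_real (sqrt 2)) / H)\<bar> \<le> b) = measure (distr (gauss {..<2}) (gauss {..<2}) ?E) ?B"
    using E Bs by (simp add: measure_distr)
  also have "\<dots> = measure (gauss {..<2}) ?B" by (simp only: distr_gauss_orthonormal[OF finite_lessThan on])
  also have "\<dots> = measure std_normal_distribution {t. \<bar>t\<bar> \<le> sqrt 2 * norm H * a} * measure std_normal_distribution {t. \<bar>t\<bar> \<le> sqrt 2 * norm H * b}"
    unfolding gauss_def measure_def
    by (subst std_normal_prod.emeasure_PiM) (auto simp: l2 enn2real_mult mult.commute)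
  finally show ?thesis .
qed

lemma gauss_second_moment:
  assumes "i \<in> I" "finite I"
  shows "integrable (gauss I) (\<lambda>x. (x i)\<^sup>2)" and "(\<integral>x. (x i)\<^sup>2 \<partial>gauss I) = 1"
proof -
  have d: "distr (gauss I) std_normal_distribution (\<lambda>x. x i) = std_normal_distribution"
    unfolding gauss_def using assms by (intro distr_PiM_component std_normal.prob_space_axioms)
  have m: "(\<lambda>x. x i) \<in> measurable (gauss I) std_normal_distribution"
    unfolding gauss_def using assms by simp
  have sq: "(\<lambda>x::real. x\<^sup>2) \<in> borel_measurable std_normal_distribution" by simp
  show "integrable (gauss I) (\<lambda>x. (x i)\<^sup>2)"
    using integrable_distr_eq[OF m sq] std_normal_distribution_even_moments(2)[of 1] by (simp add: d)
  show "(\<integral>x. (x i)\<^sup>2 \<partial>gauss I) = 1"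
    using integral_distr[OF m sq] std_normal_distribution_even_moments(1)[of 1] by (simp add: d fact_numeral)
qed

text \<open>The four coordinates are split into the pair that makes up H and the pair that makes up
  U, and U is integrated out first. Since ln n > 0 for n \<ge> 3, the truncation rules out H =
  0.\<close>

lemma cell_prob_eq_integral:
  assumes ab: "a \<ge> 0" "b \<ge> 0" and n: "n \<ge> 3"
  defines "H \<equiv> \<lambda>h. Complex (h 0) (h (1::nat)) / of_real (sqrt 24)"
    and "\<gamma> \<equiv> \<lambda>R. measure std_normal_distribution {t. \<bar>t\<bar> \<le> R}"
  shows "(\<lambda>h. indicator {h. 1 / ln (real n) \<le> norm (H h) \<and> norm (H h) \<le> ln (real n)} h *
       (\<gamma> (sqrt 2 * norm (H h) * (a / real n)) * \<gamma> (sqrt 2 * norm (H h) * (b / real n)))) \<in> borel_measurable (gauss {..<2})"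
    and "cell_prob n a b = (\<integral>h. indicator {h. 1 / ln (real n) \<le> norm (H h) \<and> norm (H h) \<le> ln (real n)} h *
       (\<gamma> (sqrt 2 * norm (H h) * (a / real n)) * \<gamma> (sqrt 2 * norm (H h) * (b / real n))) \<partial>gauss {..<2})"
proof -
  interpret g2: prob_space "gauss {..<2}" by (rule prob_space_gauss)
  interpret g4: prob_space "gauss {..<4}" by (rule prob_space_gauss)
  let ?U = "\<lambda>u. Complex (u 0) (u (1::nat)) / of_real (sqrt 2)"
  let ?S = "{h. 1 / ln (real n) \<le> norm (H h) \<and> norm (H h) \<le> ln (real n)}"
  let ?f = "\<lambda>h. indicator ?S h * (\<gamma> (sqrt 2 * norm (H h) * (a / real n)) * \<gamma> (sqrt 2 * norm (H h) * (b / real n)))"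
  have "mono \<gamma>" unfolding \<gamma>_def by (intro monoI std_normal.finite_measure_mono) auto
  hence [measurable]: "\<gamma> \<in> borel_measurable borel" by (rule borel_measurable_mono)
  have c2 [measurable]: "(\<lambda>h. h 0) \<in> borel_measurable (gauss {..<2})" "(\<lambda>h. h (1::nat)) \<in> borel_measurable (gauss {..<2})"
    by (simp_all add: measurable_cong_sets[OF sets_gauss refl])
  have c4 [measurable]: "(\<lambda>h. h 0) \<in> borel_measurable (gauss {..<4})" "(\<lambda>h. h (1::nat)) \<in> borel_measurable (gauss {..<4})"
     "(\<lambda>h. h 2) \<in> borel_measurable (gauss {..<4})" "(\<lambda>h. h (3::nat)) \<in> borel_measurable (gauss {..<4})"
    by (simp_all add: measurable_cong_sets[OF sets_gauss refl])
  have Hm [measurable]: "H \<in> borel_measurable (gauss {..<2})" unfolding H_def by measurable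
  have "(\<lambda>h. (if 1 / ln (real n) \<le> norm (H h) \<and> norm (H h) \<le> ln (real n) then 1 else 0) *
      (\<gamma> (sqrt 2 * norm (H h) * (a / real n)) * \<gamma> (sqrt 2 * norm (H h) * (b / real n)))) \<in> borel_measurable (gauss {..<2})"
    by measurable
  thus fm: "?f \<in> borel_measurable (gauss {..<2})" by (simp add: indicator_def of_bool_def)
  let ?Q = "{y \<in> space (gauss {..<4}).
     root_cond n a b (Complex (y 2) (y 3) / of_real (sqrt 2)) (Complex (y 0) (y 1) / of_real (sqrt 24))}"
  have Q: "?Q \<in> sets (gauss {..<4})" unfolding root_cond_def by measurable
  have "ennreal (cell_prob n a b) = (\<integral>\<^sup>+y. indicator ?Q y \<partial>gauss {..<2 + 2})"
    using Q unfolding cell_prob_def g4.emeasure_eq_measure[symmetric] by simp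
  also have "\<dots> = (\<integral>\<^sup>+h. (\<integral>\<^sup>+u. indicator ?Q (\<lambda>i\<in>{..<2 + 2}. if i < 2 then h i else u (i - 2)) \<partial>gauss {..<2}) \<partial>gauss {..<2})"
    using Q by (intro gauss_split) simp
  also have "\<dots> = (\<integral>\<^sup>+h. ennreal (?f h) \<partial>gauss {..<2})"
  proof (rule nn_integral_cong)
    fix h assume h: "h \<in> space (gauss {..<2})"
    let ?C = "{u \<in> space (gauss {..<2}). \<bar>Re (\<i> * ?U u / H h)\<bar> \<le> a / real n \<and> \<bar>Im (\<i> * ?U u / H h)\<bar> \<le> b / real n}"
    have C: "?C \<in> sets (gauss {..<2})" by measurable
    have "(\<integral>\<^sup>+u. indicator ?Q (\<lambda>i\<in>{..<2 + 2}. if i < 2 then h i else u (i - 2)) \<partial>gauss {..<2})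
       = (\<integral>\<^sup>+u. indicator ?S h * indicator ?C u \<partial>gauss {..<2})"
    proof (rule nn_integral_cong)
      fix u assume u: "u \<in> space (gauss {..<2})"
      define z where "z = (\<lambda>i\<in>{..<2 + 2}. if i < 2 then h i else u (i - 2))"
      have z: "z 0 = h 0" "z 1 = h 1" "z 2 = u 0" "z 3 = u 1" "z \<in> space (gauss {..<4})"
        by (simp_all add: z_def space_gauss)
      have "z \<in> ?Q \<longleftrightarrow> h \<in> ?S \<and> u \<in> ?C"
        using u z(5) unfolding mem_Collect_eq z(1-4) root_cond_def H_def by blast
      thus "indicator ?Q (\<lambda>i\<in>{..<2 + 2}. if i < 2 then h i else u (i - 2)) = (indicator ?S h * indicator ?C u :: ennreal)"
        unfolding z_def[symmetric] indicator_def by simp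
    qed
    also have "\<dots> = indicator ?S h * emeasure (gauss {..<2}) ?C"
      using C by (simp add: nn_integral_cmult)
    also have "\<dots> = ennreal (?f h)"
    proof (cases "h \<in> ?S")
      case True
      have "0 < ln (real n)" using n by simp
      hence "0 < norm (H h)" using True by (auto intro: less_le_trans[OF divide_pos_pos])
      hence "H h \<noteq> 0" by auto
      from gauss2_rotated_box[OF this, of "a / real n" "b / real n"] ab
      have "measure (gauss {..<2}) ?C = \<gamma> (sqrt 2 * norm (H h) * (a / real n)) * \<gamma> (sqrt 2 * norm (H h) * (b / real n))"
        by (simp add: \<gamma>_def)
      thus ?thesis using True by (simp add: g2.emeasure_eq_measure)
    qed simp
    finally show "(\<integral>\<^sup>+u. indicator ?Q (\<lambda>i\<in>{..<2 + 2}. if i < 2 then h i else u (i - 2)) \<partial>gauss {..<2}) = ennreal (?f h)" .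
  qed
  also have "\<dots> = ennreal (\<integral>h. ?f h \<partial>gauss {..<2})"
  proof (rule nn_integral_eq_integral)
    have g1: "0 \<le> \<gamma> R \<and> \<gamma> R \<le> 1" for R by (simp add: \<gamma>_def)
    show "integrable (gauss {..<2}) ?f"
      by (rule g2.integrable_const_bound[where B=1, OF _ fm])
         (auto simp: g1 abs_mult indicator_def intro!: mult_le_one AE_I2)
  qed (auto simp: \<gamma>_def)
  finally show "cell_prob n a b = (\<integral>h. ?f h \<partial>gauss {..<2})"
    by (subst (asm) ennreal_inj) (auto simp: cell_prob_def \<gamma>_def intro!: integral_nonneg_AE AE_I2)
qed

text \<open>For small intervals the two factors together are about K |H|^2/n^2 with K = 4ab/pi. The
  same expression is an upper bound for every n, hence a dominating function, and the truncation of
  H disappears in the limit. The mean of |H|^2 is 2/24 = 1/12, and K/12 = ab/(3 pi).\<close>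

lemma cell_prob_asymptotics:
  assumes ab: "a \<ge> 0" "b \<ge> 0"
  shows "(\<lambda>n. (real n)\<^sup>2 * cell_prob n a b) \<longlonglongrightarrow> a * b / (3 * pi)"
proof -
  interpret g2: prob_space "gauss {..<2}" by (rule prob_space_gauss)
  define H where "H h = Complex (h 0) (h (1::nat)) / of_real (sqrt 24)" for h
  define \<gamma> where "\<gamma> R = measure std_normal_distribution {t. \<bar>t\<bar> \<le> R}" for R
  define S where "S n = {h. 1 / ln (real n) \<le> norm (H h) \<and> norm (H h) \<le> ln (real n)}" for n
  define f where "f n h = indicator (S n) h * (\<gamma> (sqrt 2 * norm (H h) * (a / real n)) * \<gamma> (sqrt 2 * norm (H h) * (b / real n)))" for n h
  define K where "K = 4 * a * b / pi"
  have K0: "K \<ge> 0" using ab by (simp add: K_def)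
  have nH: "(norm (H h))\<^sup>2 = ((h 0)\<^sup>2 + (h 1)\<^sup>2) / 24" for h
    by (simp add: H_def norm_divide power_divide cmod_power2)
  have up: "(real n)\<^sup>2 * f n h \<le> K * (norm (H h))\<^sup>2" if "n \<ge> 1" for n h
  proof -
    have "\<gamma> (sqrt 2 * norm (H h) * (a / real n)) * \<gamma> (sqrt 2 * norm (H h) * (b / real n)) \<le>
      (2 * (sqrt 2 * norm (H h) * (a / real n)) / sqrt (2 * pi)) * (2 * (sqrt 2 * norm (H h) * (b / real n)) / sqrt (2 * pi))"
      unfolding \<gamma>_def using ab by (intro mult_mono std_normal_symmetric_interval) auto
    also have "\<dots> = K * (norm (H h))\<^sup>2 / (real n)\<^sup>2"
      by (simp add: K_def field_simps power2_eq_square flip: real_sqrt_mult)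
    finally have "f n h \<le> K * (norm (H h))\<^sup>2 / (real n)\<^sup>2"
      using K0 by (auto simp: f_def indicator_def)
    thus ?thesis using that by (simp add: field_simps)
  qed
  have lo: "K * (norm (H h))\<^sup>2 * exp (- ((norm (H h))\<^sup>2 * (a\<^sup>2 + b\<^sup>2)) / (real n)\<^sup>2) \<le> (real n)\<^sup>2 * f n h" if "n \<ge> 1" "h \<in> S n" for n h
  proof -
    let ?A = "sqrt 2 * norm (H h) * (a / real n)" and ?B = "sqrt 2 * norm (H h) * (b / real n)"
    have "(2 * ?A / sqrt (2 * pi) * exp (- ?A\<^sup>2 / 2)) * (2 * ?B / sqrt (2 * pi) * exp (- ?B\<^sup>2 / 2)) \<le> \<gamma> ?A * \<gamma> ?B"
      unfolding \<gamma>_def using ab by (intro mult_mono std_normal_symmetric_interval) auto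
    also have "(2 * ?A / sqrt (2 * pi) * exp (- ?A\<^sup>2 / 2)) * (2 * ?B / sqrt (2 * pi) * exp (- ?B\<^sup>2 / 2))
       = (2 * ?A / sqrt (2 * pi) * (2 * ?B / sqrt (2 * pi))) * exp (- ?A\<^sup>2 / 2 + - ?B\<^sup>2 / 2)"
      by (simp only: exp_add mult_ac)
    also have "2 * ?A / sqrt (2 * pi) * (2 * ?B / sqrt (2 * pi)) = K * (norm (H h))\<^sup>2 / (real n)\<^sup>2"
      by (simp add: K_def field_simps power2_eq_square flip: real_sqrt_mult)
    also have "- ?A\<^sup>2 / 2 + - ?B\<^sup>2 / 2 = - ((norm (H h))\<^sup>2 * (a\<^sup>2 + b\<^sup>2)) / (real n)\<^sup>2"
      by (simp add: power_mult_distrib power_divide distrib_left add_divide_distrib diff_divide_distrib)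
    finally show ?thesis using that by (simp add: f_def field_simps)
  qed
  have f0: "f n h \<ge> 0" for n h by (simp add: f_def \<gamma>_def)
  have int: "integrable (gauss {..<2}) (\<lambda>h. (norm (H h))\<^sup>2)"
    unfolding nH using gauss_second_moment(1)[of _ "{..<2}"] by auto
  have val: "(\<integral>h. (norm (H h))\<^sup>2 \<partial>gauss {..<2}) = 1 / 12"
    unfolding nH using gauss_second_moment[of _ "{..<2}"] by simp
  \<comment> \<open>The shift by 3 gives \<open>cell_prob_eq_integral\<close> its hypothesis n \<ge>
    3 for every index, as dominated convergence asks for measurability of all terms.\<close>
  have lim: "(\<lambda>n. \<integral>h. (real (n + 3))\<^sup>2 * f (n + 3) h \<partial>gauss {..<2}) \<longlonglongrightarrow> (\<integral>h. K * (norm (H h))\<^sup>2 \<partial>gauss {..<2})"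
  proof (rule integral_dominated_convergence)
    show w: "integrable (gauss {..<2}) (\<lambda>h. K * (norm (H h))\<^sup>2)" using int by simp
    show "(\<lambda>h. K * (norm (H h))\<^sup>2) \<in> borel_measurable (gauss {..<2})"
      by (rule borel_measurable_integrable[OF w])
    show "(\<lambda>h. (real (n + 3))\<^sup>2 * f (n + 3) h) \<in> borel_measurable (gauss {..<2})" for n
    proof -
      have "(\<lambda>h. f (n + 3) h) \<in> borel_measurable (gauss {..<2})"
        unfolding f_def S_def H_def \<gamma>_def by (rule cell_prob_eq_integral(1)[OF ab]) simp
      thus ?thesis by (rule borel_measurable_times[OF borel_measurable_const])
    qed
    show "AE h in gauss {..<2}. norm ((real (n + 3))\<^sup>2 * f (n + 3) h) \<le> K * (norm (H h))\<^sup>2" for n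
      using up[of "n + 3"] f0[of "n + 3"] by (intro AE_I2) simp
    show "AE h in gauss {..<2}. (\<lambda>n. (real (n + 3))\<^sup>2 * f (n + 3) h) \<longlonglongrightarrow> K * (norm (H h))\<^sup>2"
    proof (intro AE_I2)
      fix h
      show "(\<lambda>n. (real (n + 3))\<^sup>2 * f (n + 3) h) \<longlonglongrightarrow> K * (norm (H h))\<^sup>2"
      proof (rule LIMSEQ_ignore_initial_segment[of "\<lambda>n. (real n)\<^sup>2 * f n h"], cases "H h = 0")
        case True
        have z: "(real n)\<^sup>2 * f n h = 0" if "n \<ge> 1" for n
        proof -
          have "(real n)\<^sup>2 * f n h \<le> 0" using up[OF that, of h] True by simp
          moreover have "0 \<le> (real n)\<^sup>2 * f n h" using f0[of n h] by simp
          ultimately show ?thesis by linarith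
        qed
        have "eventually (\<lambda>n. (real n)\<^sup>2 * f n h = 0) sequentially"
          using eventually_ge_at_top[of 1] by eventually_elim (rule z)
        hence "(\<lambda>n. (real n)\<^sup>2 * f n h) \<longlonglongrightarrow> 0" by (rule tendsto_eventually)
        thus "(\<lambda>n. (real n)\<^sup>2 * f n h) \<longlonglongrightarrow> K * (norm (H h))\<^sup>2"
          using True by simp
      next
        case False
        hence n0: "norm (H h) > 0" by simp
        have "eventually (\<lambda>n. 1 / ln (real n) < norm (H h)) sequentially"
          by (rule order_tendstoD(2)[OF _ n0]) real_asymp
        moreover have "eventually (\<lambda>n. norm (H h) \<le> ln (real n)) sequentially"
          using filterlim_compose[OF ln_at_top filterlim_real_sequentially] by (simp add: filterlim_at_top)
        ultimately have ev: "eventually (\<lambda>n. K * (norm (H h))\<^sup>2 * exp (- ((norm (H h))\<^sup>2 * (a\<^sup>2 + b\<^sup>2)) / (real n)\<^sup>2) \<le> (real n)\<^sup>2 * f n h) sequentially"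
          using eventually_ge_at_top[of 1]
        proof eventually_elim
          case (elim n)
          thus ?case by (intro lo) (auto simp: S_def)
        qed
        have ev2: "eventually (\<lambda>n. (real n)\<^sup>2 * f n h \<le> K * (norm (H h))\<^sup>2) sequentially"
          using eventually_ge_at_top[of 1] by eventually_elim (rule up)
        have "(\<lambda>n. 1 / (real n)\<^sup>2) \<longlonglongrightarrow> 0" by real_asymp
        from tendsto_mult_right_zero[OF this, of "- ((norm (H h))\<^sup>2 * (a\<^sup>2 + b\<^sup>2))"]
        have "(\<lambda>n. - ((norm (H h))\<^sup>2 * (a\<^sup>2 + b\<^sup>2)) / (real n)\<^sup>2) \<longlonglongrightarrow> 0" by simp
        from tendsto_mult_left[OF tendsto_exp[OF this], of "K * (norm (H h))\<^sup>2"]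
        have "(\<lambda>n. K * (norm (H h))\<^sup>2 * exp (- ((norm (H h))\<^sup>2 * (a\<^sup>2 + b\<^sup>2)) / (real n)\<^sup>2)) \<longlonglongrightarrow> K * (norm (H h))\<^sup>2"
          by simp
        from tendsto_sandwich[OF ev ev2 this tendsto_const] show "(\<lambda>n. (real n)\<^sup>2 * f n h) \<longlonglongrightarrow> K * (norm (H h))\<^sup>2" .
      qed
    qed
  qed
  hence lim: "(\<lambda>n. \<integral>h. (real n)\<^sup>2 * f n h \<partial>gauss {..<2}) \<longlonglongrightarrow> (\<integral>h. K * (norm (H h))\<^sup>2 \<partial>gauss {..<2})"
    by (rule LIMSEQ_offset)
  have v: "(\<integral>h. K * (norm (H h))\<^sup>2 \<partial>gauss {..<2}) = a * b / (3 * pi)"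
    by (simp add: val K_def)
  have "eventually (\<lambda>n. (\<integral>h. (real n)\<^sup>2 * f n h \<partial>gauss {..<2}) = (real n)\<^sup>2 * cell_prob n a b) sequentially"
    using eventually_ge_at_top[of 3]
  proof eventually_elim
    case (elim n)
    show ?case using cell_prob_eq_integral(2)[OF ab elim] by (simp add: f_def S_def H_def \<gamma>_def)
  qed
  from Lim_transform_eventually[OF lim this] show ?thesis unfolding v .
qed

section \<open>Tuples of separated cells compared with the independent model\<close>

definition root_near :: "nat \<Rightarrow> real \<Rightarrow> real \<Rightarrow> real \<Rightarrow> (nat \<Rightarrow> real) \<Rightarrow> bool" where
  "root_near n a b t x \<longleftrightarrow> root_cond n a b (trig_form n x t / of_real (sqrt (real n)))
     (trig_form n (\<lambda>k. (real k / real n - 1/2) * x k) t / of_real (sqrt (real n)))"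

lemma trig_form_measurable [measurable]: "(\<lambda>x. trig_form n (\<lambda>k. c k * x k) t) \<in> borel_measurable (gauss {..n})"
  "(\<lambda>x. trig_form n x t) \<in> borel_measurable (gauss {..n})"
proof -
  have [measurable]: "(\<lambda>x. x k) \<in> borel_measurable (gauss {..n})" if "k \<in> {..n}" for k
    using that by (simp add: measurable_cong_sets[OF sets_gauss refl])
  show "(\<lambda>x. trig_form n (\<lambda>k. c k * x k) t) \<in> borel_measurable (gauss {..n})"
    "(\<lambda>x. trig_form n x t) \<in> borel_measurable (gauss {..n})"
    unfolding trig_form_def
      by (intro borel_measurable_sum borel_measurable_times borel_measurable_const borel_measurable_of_real; measurable)+
qed

lemma root_near_measurable [measurable]: "Measurable.pred (gauss {..n}) (root_near n a b t)"
  unfolding root_near_def root_cond_def by measurable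

lemma trig_form_frame:
  assumes "n \<ge> 1"
  shows "trig_form n x t / of_real (sqrt (real n)) =
      Complex (inner_on {..n} (frame_vec n t 2) x) (inner_on {..n} (frame_vec n t 3) x) / of_real (sqrt 2)"
    and "trig_form n (\<lambda>k. (real k / real n - 1/2) * x k) t / of_real (sqrt (real n)) =
      Complex (inner_on {..n} (frame_vec n t 0) x) (inner_on {..n} (frame_vec n t 1) x) / of_real (sqrt 24)"
proof -
  have s: "sqrt (2 / real n) = sqrt 2 / sqrt (real n)" "sqrt (24 / real n) = sqrt 24 / sqrt (real n)"
    by (simp_all add: real_sqrt_divide)
  have 2: "inner_on {..n} (frame_vec n t 2) x = sqrt 2 / sqrt (real n) * Re (trig_form n x t)"
    "inner_on {..n} (frame_vec n t 3) x = sqrt 2 / sqrt (real n) * Im (trig_form n x t)"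
    unfolding Re_trig_form Im_trig_form inner_on_def sum_distrib_left
    by (intro sum.cong; simp add: frame_vec_def frame_weight_def s)+
  have 0: "inner_on {..n} (frame_vec n t 0) x = sqrt 24 / sqrt (real n) * Re (trig_form n (\<lambda>k. (real k / real n - 1/2) * x k) t)"
    "inner_on {..n} (frame_vec n t 1) x = sqrt 24 / sqrt (real n) * Im (trig_form n (\<lambda>k. (real k / real n - 1/2) * x k) t)"
    unfolding Re_trig_form Im_trig_form inner_on_def sum_distrib_left
    by (intro sum.cong; simp add: frame_vec_def frame_weight_def s)+
  show "trig_form n x t / of_real (sqrt (real n)) =
      Complex (inner_on {..n} (frame_vec n t 2) x) (inner_on {..n} (frame_vec n t 3) x) / of_real (sqrt 2)"
    unfolding 2 using assms by (simp add: complex_eq_iff Re_divide_of_real Im_divide_of_real)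
  show "trig_form n (\<lambda>k. (real k / real n - 1/2) * x k) t / of_real (sqrt (real n)) =
      Complex (inner_on {..n} (frame_vec n t 0) x) (inner_on {..n} (frame_vec n t 1) x) / of_real (sqrt 24)"
    unfolding 0 using assms by (simp add: complex_eq_iff Re_divide_of_real Im_divide_of_real)
qed

text \<open>The event depends only on 4k forms whose Gram matrix is within 96/(n \<Delta>) of the
  identity, and \<open>root_cond\<close> confines all of them to absolute value at most 5 ln n. So
  the density comparison applies, and in the independent model the k blocks of four coordinates
  factor.\<close>

theorem
  fixes t :: "nat \<Rightarrow> real"
  assumes sep1: "\<And>i l. i < k \<Longrightarrow> l < k \<Longrightarrow> l \<noteq> i \<Longrightarrow> norm (cis (t i) - cis (t l)) \<ge> \<Delta>"
    and sep2: "\<And>i l. i < k \<Longrightarrow> l < k \<Longrightarrow> norm (cis (t i) - cis (- t l)) \<ge> \<Delta>"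
    and \<Delta>: "\<Delta> > 0" and n: "n \<ge> 3" and ab: "a \<ge> 0" "b \<ge> 0" "a + b \<le> real n"
    and small: "8 * real (4 * k) * (96 / (real n * \<Delta>)) \<le> 1"
    and \<theta>: "\<theta> = real (4 * k) * (9 + 10 * real (4 * k)) * (96 / (real n * \<Delta>)) * (5 * ln (real n))\<^sup>2"
  shows root_near_tuple_le: "\<P>(x in gauss {..n}. \<forall>i<k. root_near n a b (t i) x) \<le> exp \<theta> * cell_prob n a b ^ k"
    and root_near_tuple_ge: "exp (- \<theta>) * cell_prob n a b ^ k \<le> \<P>(x in gauss {..n}. \<forall>i<k. root_near n a b (t i) x)"
proof -
  define P where "P y0 y1 y2 y3 = root_cond n a b (Complex y2 y3 / of_real (sqrt 2)) (Complex y0 y1 / of_real (sqrt 24))" for y0 y1 y2 y3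
  have [measurable]: "(\<lambda>h. h 0) \<in> borel_measurable (gauss {..<4})" "(\<lambda>h. h (1::nat)) \<in> borel_measurable (gauss {..<4})"
     "(\<lambda>h. h 2) \<in> borel_measurable (gauss {..<4})" "(\<lambda>h. h (3::nat)) \<in> borel_measurable (gauss {..<4})"
    by (simp_all add: measurable_cong_sets[OF sets_gauss refl])
  have Pm: "Measurable.pred (gauss {..<4}) (\<lambda>y. P (y 0) (y 1) (y 2) (y 3))"
    unfolding P_def root_cond_def by measurable
  define B where "B = {y \<in> space (gauss {..<4 * k}). \<forall>i<k. P (y (4*i)) (y (4*i+1)) (y (4*i+2)) (y (4*i+3))}"
  note blocks = measure_gauss_blocks[of P k, OF Pm, folded B_def]
  have ln1: "ln (real n) \<ge> 1"
    using n exp_le by (subst ln_ge_iff) (auto intro: order_trans[OF exp_le])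
  \<comment> \<open>From a + b \<le> n it follows that |U| \<le> |H| \<le> ln n; the factor 5 covers
    the scalings sqrt 2 and sqrt 24.\<close>
  have bound: "\<bar>y j\<bar> \<le> 5 * ln (real n)" if "y \<in> B" "j < 4 * k" for y j
  proof -
    define i where "i = j div 4"
    define U H where "U = Complex (y (4*i+2)) (y (4*i+3)) / of_real (sqrt 2)" and "H = Complex (y (4*i)) (y (4*i+1)) / of_real (sqrt 24)"
    have "i < k" using that(2) by (simp add: i_def)
    hence P: "root_cond n a b U H" using that(1) by (auto simp: B_def P_def U_def H_def)
    have H: "norm H \<le> ln (real n)" "norm H > 0"
      using P ln1 by (auto simp: root_cond_def intro: less_le_trans[OF divide_pos_pos[OF zero_less_one]])
    have "norm (\<i> * U / H) \<le> \<bar>Re (\<i> * U / H)\<bar> + \<bar>Im (\<i> * U / H)\<bar>" by (rule cmod_le)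
    also have "\<dots> \<le> a / real n + b / real n" using P by (auto simp: root_cond_def)
    also have "\<dots> \<le> 1" using ab n by (simp add: add_divide_distrib[symmetric])
    finally have "norm U \<le> norm H" using H by (simp add: norm_mult norm_divide)
    hence U: "norm U \<le> ln (real n)" using H by simp
    have c: "\<bar>p\<bar> \<le> 5 * ln (real n) \<and> \<bar>q\<bar> \<le> 5 * ln (real n)"
      if "norm (Complex p q / of_real (sqrt c)) \<le> ln (real n)" "1 \<le> c" "c \<le> 25" for p q c
    proof -
      have "sqrt c \<le> 5" using that(3) by (intro real_le_lsqrt) auto
      have "norm (Complex p q) \<le> ln (real n) * sqrt c" using that by (simp add: norm_divide divide_le_eq)
      also have "\<dots> \<le> ln (real n) * 5" using \<open>sqrt c \<le> 5\<close> ln1 by (intro mult_left_mono) auto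
      finally show ?thesis using abs_Re_le_cmod[of "Complex p q"] abs_Im_le_cmod[of "Complex p q"] by auto
    qed
    have "j mod 4 = 0 \<or> j mod 4 = 1 \<or> j mod 4 = 2 \<or> j mod 4 = 3" by linarith
    moreover have "j = 4 * i + j mod 4" by (simp add: i_def)
    ultimately have "j = 4*i \<or> j = 4*i+1 \<or> j = 4*i+2 \<or> j = 4*i+3" by presburger
    thus ?thesis using c[OF U[unfolded U_def]] c[OF H(1)[unfolded H_def]] by auto
  qed
  define y where "y j = frame_vec n (t (j div 4)) (j mod 4)" for j
  have div: "(4 * i + r) div 4 = i" "(4 * i + r) mod 4 = r" if "r < 4" for i r :: nat using that by auto
  have yv: "y (4 * i + r) = frame_vec n (t i) r" if "r < 4" for i r
    unfolding y_def div[OF that] ..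
  have n1: "n \<ge> 1" using n by simp
  have ev: "(\<lambda>j\<in>{..<4 * k}. inner_on {..n} (y j) x) \<in> B \<longleftrightarrow> (\<forall>i<k. root_near n a b (t i) x)" for x
  proof -
    have "(\<lambda>j\<in>{..<4 * k}. inner_on {..n} (y j) x) \<in> B \<longleftrightarrow>
      (\<forall>i<k. P (inner_on {..n} (y (4*i+0)) x) (inner_on {..n} (y (4*i+1)) x) (inner_on {..n} (y (4*i+2)) x) (inner_on {..n} (y (4*i+3)) x))"
      by (auto simp: B_def space_gauss)
    also have "\<dots> \<longleftrightarrow> (\<forall>i<k. root_near n a b (t i) x)"
    proof (intro all_cong)
      fix i
      have y4: "y (4*i+0) = frame_vec n (t i) 0" "y (4*i+1) = frame_vec n (t i) 1"
        "y (4*i+2) = frame_vec n (t i) 2" "y (4*i+3) = frame_vec n (t i) 3"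
        by (rule yv; simp)+
      show "P (inner_on {..n} (y (4*i+0)) x) (inner_on {..n} (y (4*i+1)) x) (inner_on {..n} (y (4*i+2)) x) (inner_on {..n} (y (4*i+3)) x)
         \<longleftrightarrow> root_near n a b (t i) x"
        unfolding y4 P_def root_near_def
          trig_form_frame(1)[OF n1, of x "t i"] trig_form_frame(2)[OF n1, of x "t i"] ..
    qed
    finally show ?thesis .
  qed
  have cp: "measure (gauss {..<4 * k}) B = cell_prob n a b ^ k"
    unfolding blocks(2) by (simp add: cell_prob_def P_def)
  have gram: "\<bar>inner_on {..n} (y i) (y j) - (if i = j then 1 else 0)\<bar> \<le> 96 / (real n * \<Delta>)"
    if "i < 4 * k" "j < 4 * k" for i j
    unfolding y_def by (rule frame_gram[where t=t and k=k, OF sep1 sep2 \<Delta>]) (use that n in auto)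
  show "\<P>(x in gauss {..n}. \<forall>i<k. root_near n a b (t i) x) \<le> exp \<theta> * cell_prob n a b ^ k"
    unfolding cp[symmetric] ev[symmetric]
  proof (rule gauss_near_identity_le[where y=y and d="4 * k" and \<eta>="96 / (real n * \<Delta>)" and L="5 * ln (real n)" and I="{..n}" and B=B and \<theta>=\<theta>])
    show "\<And>i j. i < 4 * k \<Longrightarrow> j < 4 * k \<Longrightarrow> \<bar>inner_on {..n} (y i) (y j) - (if i = j then 1 else 0)\<bar> \<le> 96 / (real n * \<Delta>)" by (rule gram)
    show "\<And>x j. x \<in> B \<Longrightarrow> j < 4 * k \<Longrightarrow> \<bar>x j\<bar> \<le> 5 * ln (real n)"
      by (rule bound)
  qed (use \<Delta> ln1 small blocks(1) \<theta> in auto)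
  show "exp (- \<theta>) * cell_prob n a b ^ k \<le> \<P>(x in gauss {..n}. \<forall>i<k. root_near n a b (t i) x)"
    unfolding cp[symmetric] ev[symmetric]
  proof (rule gauss_near_identity_ge[where y=y and d="4 * k" and \<eta>="96 / (real n * \<Delta>)" and L="5 * ln (real n)" and I="{..n}" and B=B and \<theta>=\<theta>])
    show "\<And>i j. i < 4 * k \<Longrightarrow> j < 4 * k \<Longrightarrow> \<bar>inner_on {..n} (y i) (y j) - (if i = j then 1 else 0)\<bar> \<le> 96 / (real n * \<Delta>)" by (rule gram)
    show "\<And>x j. x \<in> B \<Longrightarrow> j < 4 * k \<Longrightarrow> \<bar>x j\<bar> \<le> 5 * ln (real n)"
      by (rule bound)
  qed (use \<Delta> ln1 small blocks(1) \<theta> in auto)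
qed

section \<open>Exact roots on the good event\<close>

text \<open>The indices 0 to n^2 include both ends 0 and pi, so every angle in this range is within
  half a spacing, pi/(2 n^2), of a grid point.\<close>

definition grid :: "nat \<Rightarrow> nat \<Rightarrow> real" where
  "grid n j = pi * real j / (real n)\<^sup>2"

text \<open>The three weights control the value, the corrected derivative and the second derivative
  at the grid points. The first is written with an explicit factor 1 so that all three have the
  shape treated by \<open>trig_form_tail\<close>.\<close>

definition good_event :: "nat \<Rightarrow> (nat \<Rightarrow> real) \<Rightarrow> bool" where
  "good_event n x \<longleftrightarrow> (\<forall>k\<le>n. \<bar>x k\<bar> \<le> ln (real n)) \<and>
     (\<forall>j\<le>n\<^sup>2. norm (trig_form n (\<lambda>k. 1 * x k) (grid n j)) \<le> sqrt (real n) * ln (real n) \<and>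
        norm (trig_form n (\<lambda>k. (real k / real n - 1/2) * x k) (grid n j)) \<le> sqrt (real n) * ln (real n) \<and>
        norm (trig_form n (\<lambda>k. (real k / real n)\<^sup>2 * x k) (grid n j)) \<le> sqrt (real n) * ln (real n))"

definition exp_form :: "nat \<Rightarrow> (nat \<Rightarrow> real) \<Rightarrow> complex \<Rightarrow> complex" where
  "exp_form n x w = (\<Sum>k\<le>n. of_real (x k) * exp (\<i> * of_nat k * w))"

lemma exp_form_of_real: "exp_form n x (of_real t) = trig_form n x t"
  by (simp add: exp_form_def trig_form_def cis_conv_exp mult_ac)

text \<open>\<open>C\<close> bounds the strip and the displacements in units of n^-2, and
  \<open>\<epsilon>\<close> is the tolerated error of a root position in the same units. The
  assumption \<open>big\<close> holds for all large n, since powers of ln n are small against sqrt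
  n, and it absorbs the error terms of the Taylor expansions.\<close>

locale good_sample =
  fixes n :: nat and x :: "nat \<Rightarrow> real" and C \<epsilon> L :: real
  assumes good: "good_event n x"
    and L: "L = ln (real n)" "L \<ge> 10"
    and C: "C \<ge> 1" and \<epsilon>: "0 < \<epsilon>" "\<epsilon> \<le> 1"
    and big: "100 * (C + 4)\<^sup>2 * L ^ 3 \<le> \<epsilon> * sqrt (real n)"
begin

definition g where "g = exp_form n x"
definition g' where "g' w = (\<Sum>k\<le>n. of_real (x k) * (\<i> * of_nat k) * exp (\<i> * of_nat k * w))"
definition g'' where "g'' w = (\<Sum>k\<le>n. of_real (x k) * (\<i> * of_nat k)\<^sup>2 * exp (\<i> * of_nat k * w))"
definition H where "H t = trig_form n (\<lambda>k. (real k / real n - 1/2) * x k) t / of_real (sqrt (real n))"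
definition U where "U t = trig_form n x t / of_real (sqrt (real n))"
text \<open>The slope of the linearisation. It differs from the derivative of \<open>g\<close> at
  \<open>t\<close> by \<i> n/2 times \<open>g t\<close> (see \<open>g'_grid\<close>), which is
  negligible where \<open>g t\<close> is small; in exchange it is asymptotically independent of the
  value.\<close>

definition c where "c t = \<i> * of_nat n * of_real (sqrt (real n)) * H t"
text \<open>One half bounds \<open>g''\<close> at the grid points of a good sample, the other half
  pays for its variation between them.\<close>

definition B where "B = 2 * (real n)\<^sup>2 * sqrt (real n) * L"
definition strip where "strip = {w. 0 \<le> Re w \<and> Re w \<le> pi \<and> \<bar>Im w\<bar> \<le> C / (real n)\<^sup>2}"

lemma n0: "real n > 0" "n \<ge> 1" using L by (cases n; auto)+

lemma C_plus_4: "(C + 4)\<^sup>2 \<ge> (C + 4)" "C + 4 \<ge> 5" "(C + 4)\<^sup>2 \<ge> 25"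
proof -
  show "C + 4 \<ge> 5" using C by simp
  hence "(C + 4) * 1 \<le> (C + 4) * (C + 4)" by (intro mult_left_mono) auto
  thus "(C + 4)\<^sup>2 \<ge> (C + 4)" by (simp add: power2_eq_square)
  have "5\<^sup>2 \<le> (C + 4)\<^sup>2" using \<open>C + 4 \<ge> 5\<close> by (intro power_mono) auto
  thus "(C + 4)\<^sup>2 \<ge> 25" by simp
qed

lemma L_powers: "L \<le> L ^ 3" "L\<^sup>2 \<le> L ^ 3" "1 \<le> L ^ 3"
  using L(2) by (auto intro: self_le_power power_increasing one_le_power)

lemma n_large: "100 * (C + 4)\<^sup>2 * L ^ 3 \<le> \<epsilon> * real n" "100 * (C + 4)\<^sup>2 * L ^ 3 \<le> sqrt (real n)"
    "100 * (C + 4)\<^sup>2 * L\<^sup>2 \<le> \<epsilon> * real n" "100 * (C + 4) \<le> sqrt (real n)" "sqrt (real n) \<le> real n"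
    "100 * (C + 4) \<le> real n" "100 * (C + 4)\<^sup>2 * L\<^sup>2 \<le> real n"
proof -
  have "sqrt (real n) * 1 \<le> sqrt (real n) * sqrt (real n)" using n0 by (intro mult_left_mono) auto
  thus sn: "sqrt (real n) \<le> real n" by simp
  have "\<epsilon> * sqrt (real n) \<le> \<epsilon> * real n" using sn \<epsilon> by (intro mult_left_mono) auto
  thus 1: "100 * (C + 4)\<^sup>2 * L ^ 3 \<le> \<epsilon> * real n" using big by linarith
  have "\<epsilon> * sqrt (real n) \<le> 1 * sqrt (real n)" using \<epsilon> by (intro mult_right_mono) auto
  thus 2: "100 * (C + 4)\<^sup>2 * L ^ 3 \<le> sqrt (real n)" using big by linarith
  have "100 * (C + 4)\<^sup>2 * L\<^sup>2 \<le> 100 * (C + 4)\<^sup>2 * L ^ 3"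
    using L_powers by (intro mult_left_mono) auto
  thus 3: "100 * (C + 4)\<^sup>2 * L\<^sup>2 \<le> \<epsilon> * real n" using 1 by linarith
  have "100 * (C + 4) \<le> 100 * (C + 4)\<^sup>2 * 1" using C_plus_4 by simp
  also have "\<dots> \<le> 100 * (C + 4)\<^sup>2 * L ^ 3" using L_powers by (intro mult_left_mono) auto
  finally show 4: "100 * (C + 4) \<le> sqrt (real n)" using 2 by linarith
  show "100 * (C + 4) \<le> real n" using 4 sn by linarith
  have "\<epsilon> * real n \<le> 1 * real n" using \<epsilon> by (intro mult_right_mono) auto
  thus "100 * (C + 4)\<^sup>2 * L\<^sup>2 \<le> real n" using 3 by linarith
qed

lemma deriv_g: "(g has_field_derivative g' w) (at w within S)"
  unfolding g_def exp_form_def g'_def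
  by (rule derivative_eq_intros | simp)+ (simp add: mult_ac)

lemma deriv_g': "(g' has_field_derivative g'' w) (at w within S)"
  unfolding g'_def g''_def
  by (rule derivative_eq_intros | simp)+ (simp add: mult_ac power2_eq_square)

lemma g'_grid: "g' (of_real t) = c t + \<i> * of_nat n / 2 * g (of_real t)"
proof -
  have "c t = \<i> * of_nat n * trig_form n (\<lambda>k. (real k / real n - 1/2) * x k) t"
    using n0 by (simp add: c_def H_def)
  also have "\<dots> = (\<Sum>k\<le>n. of_real (x k) * (\<i> * of_nat k) * exp (\<i> * of_nat k * of_real t)) -
     \<i> * of_nat n / 2 * (\<Sum>k\<le>n. of_real (x k) * exp (\<i> * of_nat k * of_real t))"
    unfolding trig_form_def sum_distrib_left sum_subtractf[symmetric] cis_conv_exp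
    using n0 by (intro sum.cong refl) (simp add: field_simps)
  finally show ?thesis by (simp add: g'_def g_def exp_form_def)
qed

lemma sample_bound: "k \<le> n \<Longrightarrow> \<bar>x k\<bar> \<le> L"
  using good by (simp add: good_event_def L)

lemma grid_bounds:
  assumes "j \<le> n\<^sup>2"
  shows "norm (g (of_real (grid n j))) \<le> sqrt (real n) * L" "norm (H (grid n j)) \<le> L"
    "norm (g'' (of_real (grid n j))) \<le> (real n)\<^sup>2 * (sqrt (real n) * L)"
    "norm (U (grid n j)) = norm (g (of_real (grid n j))) / sqrt (real n)"
proof -
  note gd = good[unfolded good_event_def, THEN conjunct2, rule_format, OF assms, folded L(1)]
  show "norm (g (of_real (grid n j))) \<le> sqrt (real n) * L"
    using gd by (simp add: g_def exp_form_of_real)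
  show "norm (H (grid n j)) \<le> L"
    using gd n0 by (simp add: H_def norm_divide field_simps)
  show "norm (U (grid n j)) = norm (g (of_real (grid n j))) / sqrt (real n)"
    by (simp add: U_def g_def exp_form_of_real norm_divide)
  have "g'' (of_real (grid n j)) = - (of_nat n)\<^sup>2 * trig_form n (\<lambda>k. (real k / real n)\<^sup>2 * x k) (grid n j)"
    unfolding g''_def trig_form_def sum_distrib_left cis_conv_exp using n0
    by (intro sum.cong refl) (simp add: field_simps power_mult_distrib)
  thus "norm (g'' (of_real (grid n j))) \<le> (real n)\<^sup>2 * (sqrt (real n) * L)"
    using gd by (simp add: norm_mult norm_power mult_left_mono)
qed

lemma nearest_grid:
  assumes "0 \<le> r" "r \<le> pi"
  shows "\<exists>j\<le>n\<^sup>2. \<bar>r - grid n j\<bar> \<le> pi / (2 * (real n)\<^sup>2)"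
proof -
  have n2: "(real n)\<^sup>2 > 0" using n0 by simp
  define u where "u = r * (real n)\<^sup>2 / pi"
  have u: "0 \<le> u" "u \<le> (real n)\<^sup>2" using assms n2 by (auto simp: u_def field_simps)
  define j where "j = nat (round u)"
  have r0: "round u \<ge> 0" using u round_mono[of 0 u] by simp
  have "round u \<le> int (n\<^sup>2)" using round_mono[OF u(2)] by (simp add: round_of_nat flip: of_nat_power)
  hence "j \<le> n\<^sup>2" by (simp add: j_def nat_le_iff)
  moreover have "\<bar>real j - u\<bar> \<le> 1 / 2" using of_int_round_abs_le[of u] r0 by (simp add: j_def)
  moreover have "r - grid n j = (u - real j) * (pi / (real n)\<^sup>2)"
    using n2 by (simp add: u_def grid_def field_simps)
  ultimately have "\<bar>r - grid n j\<bar> \<le> 1 / 2 * (pi / (real n)\<^sup>2)"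
    using n2 by (simp only: abs_mult abs_minus_commute[of u]) (intro mult_mono, auto)
  thus ?thesis using \<open>j \<le> n\<^sup>2\<close> by (intro exI[of _ j]) auto
qed

text \<open>The nearest grid point is so close that each exponential changes only by a relative
  error of order (C+4)/n. Summing the changes term by term, with no cancellation, costs about 6
  (C+4) n^2 L, which is still below n^2 sqrt n L because sqrt n \<ge> 100 (C+4).\<close>

lemma g''_strip:
  assumes w: "w \<in> strip"
  shows "norm (g'' w) \<le> B"
proof -
  obtain j where j: "j \<le> n\<^sup>2" "\<bar>Re w - grid n j\<bar> \<le> pi / (2 * (real n)\<^sup>2)"
    using nearest_grid[of "Re w"] w by (auto simp: strip_def)
  define v where "v = w - of_real (grid n j)"
  have n2: "(real n)\<^sup>2 > 0" using n0 by simp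
  have "norm v \<le> \<bar>Re v\<bar> + \<bar>Im v\<bar>" by (rule cmod_le)
  also have "\<dots> \<le> pi / (2 * (real n)\<^sup>2) + C / (real n)\<^sup>2" using j w by (auto simp: v_def strip_def)
  also have "\<dots> = (pi / 2 + C) / (real n)\<^sup>2" by (simp add: add_divide_distrib)
  also have "\<dots> \<le> (C + 4) / (real n)\<^sup>2" using pi_less_4 n2 by (intro divide_right_mono) auto
  finally have v: "norm v \<le> (C + 4) / (real n)\<^sup>2" .
  have kv: "norm (\<i> * of_nat k * v) \<le> (C + 4) / real n" if "k \<le> n" for k
  proof -
    have "norm (\<i> * of_nat k * v) = real k * norm v" by (simp add: norm_mult)
    also have "\<dots> \<le> real n * ((C + 4) / (real n)\<^sup>2)" using that v by (intro mult_mono) auto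
    also have "\<dots> = (C + 4) / real n" using n0 by (simp add: power2_eq_square)
    finally show ?thesis .
  qed
  have Cn: "(C + 4) / real n \<le> 1" using n_large(6) C_plus_4 n0 by (simp add: field_simps)
  have e: "norm (exp z - 1) \<le> 3 * norm z" if "norm z \<le> 1" for z :: complex
  proof -
    have "norm (exp z - exp 0) \<le> exp 1 * norm (z - 0)"
    proof (rule field_differentiable_bound[OF convex_cball])
      fix u :: complex assume "u \<in> cball 0 1"
      thus "norm (exp u) \<le> exp 1"
        using complex_Re_le_cmod[of u] by (simp only: norm_exp_eq_Re mem_cball_0 exp_le_cancel_iff)
      show "(exp has_field_derivative exp u) (at u within cball 0 1)" by (rule DERIV_subset[OF DERIV_exp]) simp
    qed (use that in auto)
    also have "\<dots> \<le> 3 * norm (z - 0)" using exp_le by (intro mult_right_mono) auto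
    finally show ?thesis by simp
  qed
  have "norm (g'' w - g'' (of_real (grid n j))) \<le> (\<Sum>k\<le>n. L * (real n)\<^sup>2 * (3 * ((C + 4) / real n)))"
  proof -
    have "g'' w - g'' (of_real (grid n j)) = (\<Sum>k\<le>n. of_real (x k) * (\<i> * of_nat k)\<^sup>2 * cis (real k * grid n j) * (exp (\<i> * of_nat k * v) - 1))"
      unfolding g''_def sum_subtractf[symmetric]
      by (intro sum.cong refl) (simp add: v_def cis_conv_exp algebra_simps exp_diff exp_add)
    also have "norm \<dots> \<le> (\<Sum>k\<le>n. L * (real n)\<^sup>2 * (3 * ((C + 4) / real n)))"
    proof (intro order_trans[OF norm_sum] sum_mono)
      fix k assume k: "k \<in> {..n}"
      have "norm (exp (\<i> * of_nat k * v) - 1) \<le> 3 * ((C + 4) / real n)"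
      proof -
        have "norm (\<i> * of_nat k * v) \<le> (C + 4) / real n" using kv k by simp
        moreover from this have "norm (exp (\<i> * of_nat k * v) - 1) \<le> 3 * norm (\<i> * of_nat k * v)"
          using Cn by (intro e) linarith
        ultimately show ?thesis by (simp only: mult_le_cancel_left_pos)
      qed
      moreover have "norm (of_real (x k) * (\<i> * of_nat k)\<^sup>2 * cis (real k * grid n j)) \<le> L * (real n)\<^sup>2"
        using sample_bound[of k] k L(2) by (auto simp: norm_mult norm_power intro!: mult_mono power_mono)
      ultimately show "norm (of_real (x k) * (\<i> * of_nat k)\<^sup>2 * cis (real k * grid n j) * (exp (\<i> * of_nat k * v) - 1))
          \<le> L * (real n)\<^sup>2 * (3 * ((C + 4) / real n))"
        unfolding norm_mult[of _ "exp (\<i> * of_nat k * v) - 1"] using L(2) by (intro mult_mono) auto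
    qed
    finally show ?thesis .
  qed
  also have "\<dots> = (real n + 1) / real n * (3 * (C + 4)) * ((real n)\<^sup>2 * L)" by simp
  also have "\<dots> \<le> 2 * (3 * (C + 4)) * ((real n)\<^sup>2 * L)"
    using n0 C L(2) by (intro mult_right_mono) (auto simp: field_simps)
  also have "\<dots> \<le> sqrt (real n) * ((real n)\<^sup>2 * L)"
    using n_large(4) C_plus_4 L(2) by (intro mult_right_mono) auto
  finally have "norm (g'' w - g'' (of_real (grid n j))) \<le> (real n)\<^sup>2 * sqrt (real n) * L"
    by (simp add: mult_ac)
  moreover have "norm (g'' w) \<le> norm (g'' w - g'' (of_real (grid n j))) + norm (g'' (of_real (grid n j)))"
    using norm_triangle_ineq[of "g'' w - g'' (of_real (grid n j))" "g'' (of_real (grid n j))"] by simp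
  ultimately show ?thesis using grid_bounds(3)[OF j(1)] by (simp add: B_def mult_ac)
qed

lemma convex_strip: "convex strip"
proof -
  have "strip = {w. 0 \<le> Re w} \<inter> {w. Re w \<le> pi} \<inter> {w. Im w \<le> C / (real n)\<^sup>2} \<inter> {w. - (C / (real n)\<^sup>2) \<le> Im w}"
    by (auto simp: strip_def)
  thus ?thesis
    by (simp add: convex_Int convex_halfspace_Re_ge convex_halfspace_Re_le convex_halfspace_Im_ge convex_halfspace_Im_le)
qed

lemma taylor1:
  assumes "w \<in> strip" "z \<in> strip"
  shows "norm (g z - g w - g' w * (z - w)) \<le> B * (norm (z - w))\<^sup>2"
proof -
  have "norm (g z - (\<Sum>i\<le>1. (if i = 0 then g else if i = 1 then g' else g'') w * (z - w) ^ i / fact i)) \<le> B * norm (z - w) ^ Suc 1 / fact 1"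
    by (rule order_trans[OF eq_refl complex_Taylor[where f="\<lambda>i. if i = 0 then g else if i = 1 then g' else g''" and n=1, OF convex_strip _ _ assms]])
       (auto intro: deriv_g deriv_g' g''_strip simp: le_Suc_eq)
  thus ?thesis by (simp add: diff_diff_eq[symmetric] numeral_2_eq_2)
qed

lemma taylor0:
  assumes "w \<in> strip" "z \<in> strip"
  shows "norm (g' z - g' w) \<le> B * norm (z - w)"
  by (rule field_differentiable_bound[OF convex_strip deriv_g' g''_strip assms(2,1)])

text \<open>Replacing the derivative by \<open>c t\<close> adds the term \<i> n/2
  \<open>g t\<close>. The smallness of \<open>g t\<close> assumed here makes it as small as the
  variation of the derivative over the displacement (C+4)/n^2, namely at most 2 L (C+4) sqrt n; the
  two add up to the factor 4.\<close>

lemma taylor_proxy: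
  assumes t: "of_real t \<in> strip" "t = grid n j" "j \<le> n\<^sup>2" and w: "w \<in> strip"
    and d: "norm (w - of_real t) \<le> (C + 4) / (real n)\<^sup>2"
    and g: "norm (g (of_real t)) \<le> 4 * L * (C + 4) / sqrt (real n)"
  shows "norm (g w - g (of_real t) - c t * (w - of_real t)) \<le> 4 * L * (C + 4)\<^sup>2 / (real n * sqrt (real n))"
    and "norm (g' w - c t) \<le> 4 * L * (C + 4) * sqrt (real n)"
proof -
  let ?D = "C + 4"
  have D: "?D \<ge> 0" using C by simp
  have B0: "B \<ge> 0" using L(2) by (simp add: B_def)
  have gn: "norm (\<i> * of_nat n / 2 * g (of_real t)) \<le> 2 * L * ?D * sqrt (real n)"
  proof -
    have "norm (\<i> * of_nat n / 2 * g (of_real t)) = real n / 2 * norm (g (of_real t))" by (simp add: norm_mult)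
    also have "\<dots> \<le> real n / 2 * (4 * L * ?D / sqrt (real n))" using g by (intro mult_left_mono) auto
    also have "\<dots> = 2 * L * ?D * (real n / sqrt (real n))" by simp
    also have "real n / sqrt (real n) = sqrt (real n)" by (rule real_div_sqrt) simp
    finally show ?thesis .
  qed
  have Bd: "B * norm (w - of_real t) \<le> 2 * L * ?D * sqrt (real n)"
  proof -
    have "B * norm (w - of_real t) \<le> B * (?D / (real n)\<^sup>2)" using d B0 by (intro mult_left_mono) auto
    thus ?thesis using n0 by (simp add: B_def mult_ac)
  qed
  have "norm (g' w - c t) \<le> norm (g' w - g' (of_real t)) + norm (g' (of_real t) - c t)"
    using norm_triangle_ineq[of "g' w - g' (of_real t)" "g' (of_real t) - c t"] by simp
  also have "norm (g' (of_real t) - c t) = norm (\<i> * of_nat n / 2 * g (of_real t))" unfolding g'_grid by simp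
  finally show "norm (g' w - c t) \<le> 4 * L * ?D * sqrt (real n)" using taylor0[OF t(1) w] Bd gn by simp
  have "g w - g (of_real t) - c t * (w - of_real t) = (g w - g (of_real t) - g' (of_real t) * (w - of_real t)) + (\<i> * of_nat n / 2 * g (of_real t)) * (w - of_real t)"
    unfolding g'_grid by (simp add: algebra_simps)
  also have "norm \<dots> \<le> norm (g w - g (of_real t) - g' (of_real t) * (w - of_real t)) + norm (\<i> * of_nat n / 2 * g (of_real t)) * norm (w - of_real t)"
    by (intro order_trans[OF norm_triangle_ineq] add_left_mono) (simp only: norm_mult)
  also have "\<dots> \<le> (B * norm (w - of_real t)) * norm (w - of_real t) + (2 * L * ?D * sqrt (real n)) * norm (w - of_real t)"
    using taylor1[OF t(1) w] gn by (intro add_mono mult_right_mono) (auto simp: power2_eq_square mult.assoc)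
  also have "\<dots> \<le> (2 * L * ?D * sqrt (real n)) * norm (w - of_real t) + (2 * L * ?D * sqrt (real n)) * norm (w - of_real t)"
    using Bd by (intro add_right_mono mult_right_mono) auto
  also have "\<dots> = (4 * L * ?D * sqrt (real n)) * norm (w - of_real t)" by simp
  also have "\<dots> \<le> (4 * L * ?D * sqrt (real n)) * (?D / (real n)\<^sup>2)"
    using d L(2) D by (intro mult_left_mono) auto
  also have "\<dots> = 4 * L * ?D\<^sup>2 * (sqrt (real n) / (real n)\<^sup>2)" by (simp add: power2_eq_square)
  also have "sqrt (real n) / (real n)\<^sup>2 = 1 / (real n * sqrt (real n))"
    using n0 by (simp add: field_simps power2_eq_square)
  finally show "norm (g w - g (of_real t) - c t * (w - of_real t)) \<le> 4 * L * ?D\<^sup>2 / (real n * sqrt (real n))"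
    by simp
qed

lemma norm_c: "norm (c t) = real n * sqrt (real n) * norm (H t)"
  by (simp add: c_def norm_mult)

text \<open>Turns an error in the value into an error in the position of a root: |c t| is at least
  n^(3/2)/L, so the quotient is of order L^2/n^3, which \<open>big\<close> makes smaller than
  \<epsilon>/n^2.\<close>

lemma error_ratio:
  assumes "norm (H t) \<ge> 1 / L"
  shows "4 * L * (C + 4)\<^sup>2 / (real n * sqrt (real n)) / norm (c t) \<le> \<epsilon> / (real n)\<^sup>2"
proof -
  have nn: "sqrt (real n) * sqrt (real n) = real n" by simp
  have "4 * L * (C + 4)\<^sup>2 / (real n * sqrt (real n)) / norm (c t) \<le> 4 * L * (C + 4)\<^sup>2 / (real n * sqrt (real n)) / (real n * sqrt (real n) * (1 / L))"
    unfolding norm_c using assms L(2) n0 C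
    by (intro divide_left_mono mult_left_mono mult_pos_pos) (auto intro: less_le_trans[of 0 "1 / L"])
  also have "\<dots> = (4 * (C + 4)\<^sup>2 * L\<^sup>2 / real n) / (real n)\<^sup>2"
    using n0 L(2) nn by (simp add: field_simps power2_eq_square)
  also have "\<dots> \<le> \<epsilon> / (real n)\<^sup>2"
  proof (rule divide_right_mono)
    have "4 * (C + 4)\<^sup>2 * L\<^sup>2 \<le> 100 * (C + 4)\<^sup>2 * L\<^sup>2" by (intro mult_right_mono) auto
    hence "4 * (C + 4)\<^sup>2 * L\<^sup>2 \<le> \<epsilon> * real n" using n_large(3) by linarith
    thus "4 * (C + 4)\<^sup>2 * L\<^sup>2 / real n \<le> \<epsilon>" using n0 by (simp add: field_simps)
  qed auto
  finally show ?thesis .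
qed

lemma g_eq_proxy: "H t \<noteq> 0 \<Longrightarrow> g (of_real t) = - c t * (\<i> * U t / H t / of_nat n)"
  using n0 by (simp add: c_def U_def g_def exp_form_of_real field_simps)

lemma root_near_cond:
  assumes "root_cond n a b (U t) (H t)"
  shows "H t \<noteq> 0" "norm (H t) \<ge> 1 / L" "\<bar>Re (\<i> * U t / H t / of_nat n)\<bar> \<le> a / (real n)\<^sup>2"
    "\<bar>Im (\<i> * U t / H t / of_nat n)\<bar> \<le> b / (real n)\<^sup>2"
proof -
  have c: "1 / L \<le> norm (H t)" "\<bar>Re (\<i> * U t / H t)\<bar> \<le> a / real n" "\<bar>Im (\<i> * U t / H t)\<bar> \<le> b / real n"
    using assms by (auto simp: root_cond_def L)
  show "norm (H t) \<ge> 1 / L" by (rule c)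
  have "0 < 1 / L" using L(2) by simp
  thus "H t \<noteq> 0" using c by auto
  have d: "Re (z / of_nat n) = Re z / real n" "Im (z / of_nat n) = Im z / real n" for z
    using Re_divide_of_real[of z "real n"] Im_divide_of_real[of z "real n"] by simp_all
  have "\<bar>y\<bar> / real n \<le> (v / real n) / real n" if "\<bar>y\<bar> \<le> v / real n" for y v
    using that by (intro divide_right_mono) auto
  thus "\<bar>Re (\<i> * U t / H t / of_nat n)\<bar> \<le> a / (real n)\<^sup>2" "\<bar>Im (\<i> * U t / H t / of_nat n)\<bar> \<le> b / (real n)\<^sup>2"
    using c unfolding d abs_divide by (simp_all add: power2_eq_square)
qed

text \<open>On a good sample the Newton-type map \<open>w - g w / c\<close> maps a small ball around the predicted root
  to itself, so Brouwer's theorem provides an actual root.\<close>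

lemma root_exists:
  assumes j: "j \<le> n\<^sup>2" "1 / sqrt (real n) \<le> grid n j" "grid n j \<le> pi - 1 / sqrt (real n)"
    and rc: "root_cond n a b (U (grid n j)) (H (grid n j))" and ab: "0 \<le> a" "0 \<le> b" "a + b + 1 \<le> C"
  shows "\<exists>w\<in>strip. g w = 0 \<and> \<bar>Re w - grid n j\<bar> \<le> (a + \<epsilon>) / (real n)\<^sup>2 \<and> \<bar>Im w\<bar> \<le> (b + \<epsilon>) / (real n)\<^sup>2 \<and>
     norm (g' w) \<ge> real n * sqrt (real n) / (2 * L)"
proof -
  define t where "t = grid n j"
  define q where "q = \<i> * U t / H t / of_nat n"
  note rn = root_near_cond[OF rc, folded t_def, folded q_def]
  have n2: "(real n)\<^sup>2 > 0" using n0 by simp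
  have nn: "sqrt (real n) * sqrt (real n) = real n" by simp
  have qn: "norm q \<le> (a + b) / (real n)\<^sup>2"
    using cmod_le[of q] rn by (simp add: add_divide_distrib)
  have c0: "c t \<noteq> 0" using rn n0 by (simp add: c_def)
  have gt: "g (of_real t) = - c t * q" using g_eq_proxy[OF rn(1)] by (simp add: q_def)
  have gb: "norm (g (of_real t)) \<le> 4 * L * (C + 4) / sqrt (real n)"
  proof -
    have "norm (g (of_real t)) = (real n * sqrt (real n) * norm (H t)) * norm q" by (simp add: gt norm_mult norm_c)
    also have "\<dots> \<le> (real n * sqrt (real n) * L) * ((C + 4) / (real n)\<^sup>2)"
    proof (intro mult_mono)
      show "norm (H t) \<le> L" using grid_bounds(2)[OF j(1)] by (simp add: t_def)
      have "(a + b) / (real n)\<^sup>2 \<le> (C + 4) / (real n)\<^sup>2" using ab n2 by (intro divide_right_mono) auto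
      thus "norm q \<le> (C + 4) / (real n)\<^sup>2" using qn by linarith
    qed (use L(2) C in auto)
    also have "\<dots> = L * (C + 4) * (sqrt (real n) / real n)" using n0 by (simp add: power2_eq_square)
    also have "sqrt (real n) / real n = 1 / sqrt (real n)" using n0 nn by (simp add: field_simps)
    also have "L * (C + 4) * (1 / sqrt (real n)) \<le> 4 * L * (C + 4) / sqrt (real n)"
    proof -
      have "1 * (L * (C + 4)) \<le> 4 * (L * (C + 4))" using L(2) C by (intro mult_right_mono) auto
      thus ?thesis by (simp add: divide_right_mono mult.assoc)
    qed
    finally show ?thesis .
  qed
  have tb: "1 / sqrt (real n) \<le> t" "t \<le> pi - 1 / sqrt (real n)" using j by (auto simp: t_def)
  have ts: "of_real t \<in> strip" 
  proof -
    have "0 \<le> 1 / sqrt (real n)" by simp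
    hence "0 \<le> t" "t \<le> pi" using tb by linarith+
    thus ?thesis using C by (simp add: strip_def)
  qed
  \<comment> \<open>The grid point keeps distance 1/sqrt n from 0 and pi, so a ball of radius C/n^2
    around it does not leave the strip.\<close>
  have room: "C / (real n)\<^sup>2 \<le> 1 / sqrt (real n)"
  proof -
    have "C \<le> 100 * (C + 4)" using C by simp
    also have "\<dots> \<le> real n" by (rule n_large(6))
    finally have "C \<le> real n" .
    hence "C / (real n)\<^sup>2 \<le> real n / (real n)\<^sup>2" by (intro divide_right_mono) auto
    also have "\<dots> = 1 / real n" using n0 by (simp add: power2_eq_square)
    also have "\<dots> \<le> 1 / sqrt (real n)" using n_large(5) n0 by (intro divide_left_mono) auto
    finally show ?thesis .
  qed
  let ?r = "\<epsilon> / (real n)\<^sup>2"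
  have ball: "\<bar>Re w - t\<bar> \<le> (a + \<epsilon>) / (real n)\<^sup>2" "\<bar>Im w\<bar> \<le> (b + \<epsilon>) / (real n)\<^sup>2"
     "norm (w - of_real t) \<le> C / (real n)\<^sup>2" "w \<in> strip"
    if "w \<in> cball (of_real t + q) ?r" for w
  proof -
    have d: "norm (w - (of_real t + q)) \<le> ?r" using that by (simp add: dist_norm norm_minus_commute)
    show 1: "\<bar>Re w - t\<bar> \<le> (a + \<epsilon>) / (real n)\<^sup>2"
      using abs_Re_le_cmod[of "w - (of_real t + q)"] d rn(3) by (simp add: add_divide_distrib)
    show 2: "\<bar>Im w\<bar> \<le> (b + \<epsilon>) / (real n)\<^sup>2"
      using abs_Im_le_cmod[of "w - (of_real t + q)"] d rn(4) by (simp add: add_divide_distrib)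
    have "norm (w - of_real t) \<le> norm (w - (of_real t + q)) + norm q"
      using norm_triangle_ineq[of "w - (of_real t + q)" q] by simp
    also have "\<dots> \<le> (\<epsilon> + (a + b)) / (real n)\<^sup>2" using d qn by (simp add: add_divide_distrib)
    also have "\<dots> \<le> C / (real n)\<^sup>2" using ab \<epsilon> n2 by (intro divide_right_mono) auto
    finally show 3: "norm (w - of_real t) \<le> C / (real n)\<^sup>2" .
    have "\<bar>Re w - t\<bar> \<le> C / (real n)\<^sup>2" "\<bar>Im w\<bar> \<le> C / (real n)\<^sup>2"
      using abs_Re_le_cmod[of "w - of_real t"] abs_Im_le_cmod[of "w - of_real t"] 3 by auto
    thus "w \<in> strip" using tb room by (auto simp: strip_def abs_le_iff)
  qed
  define F where "F w = w - g w / c t" for w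
  have "\<exists>w\<in>cball (of_real t + q) ?r. F w = w"
  proof -
    have "F \<in> cball (of_real t + q) ?r \<rightarrow> cball (of_real t + q) ?r"
    proof
      fix w assume w: "w \<in> cball (of_real t + q) ?r"
      have D: "norm (w - of_real t) \<le> (C + 4) / (real n)\<^sup>2"
        by (rule order_trans[OF ball(3)[OF w]]) (auto intro: divide_right_mono)
      have "F w - (of_real t + q) = - (g w - g (of_real t) - c t * (w - of_real t)) / c t"
        using c0 by (simp add: F_def gt field_simps)
      hence "norm (F w - (of_real t + q)) = norm (g w - g (of_real t) - c t * (w - of_real t)) / norm (c t)"
        by (simp add: norm_divide norm_minus_commute)
      also have "\<dots> \<le> 4 * L * (C + 4)\<^sup>2 / (real n * sqrt (real n)) / norm (c t)"
        using taylor_proxy(1)[OF ts t_def j(1) ball(4)[OF w] D gb] by (intro divide_right_mono) auto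
      also have "\<dots> \<le> ?r" by (rule error_ratio[OF rn(2)])
      finally show "F w \<in> cball (of_real t + q) ?r" by (simp add: dist_norm norm_minus_commute)
    qed
    moreover have "continuous_on (cball (of_real t + q) ?r) F"
    proof -
      have "continuous_on S g" for S using deriv_g by (intro DERIV_continuous_on) auto
      thus ?thesis unfolding F_def using c0 by (intro continuous_intros) auto
    qed
    moreover have "?r > 0" using \<epsilon> n2 by simp
    ultimately show ?thesis using brouwer_ball by metis
  qed
  then obtain w where w: "w \<in> cball (of_real t + q) ?r" "F w = w" by blast
  have g0: "g w = 0" using w(2) c0 by (simp add: F_def)
  have D: "norm (w - of_real t) \<le> (C + 4) / (real n)\<^sup>2"
    by (rule order_trans[OF ball(3)[OF w(1)]]) (auto intro: divide_right_mono)
  \<comment> \<open>At the root the derivative keeps at least half of the lower bound n^(3/2)/L for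
    |c t|. Exclusivity of close cells rests on this.\<close>
  have "norm (c t) \<le> norm (g' w) + norm (g' w - c t)"
    using norm_triangle_ineq4[of "g' w" "g' w - c t"] by simp
  moreover have "real n * sqrt (real n) * (1 / L) \<le> norm (c t)"
    unfolding norm_c using rn(2) by (intro mult_left_mono) auto
  moreover have "norm (g' w - c t) \<le> 4 * L * (C + 4) * sqrt (real n)"
    by (rule taylor_proxy(2)[OF ts t_def j(1) ball(4)[OF w(1)] D gb])
  moreover have "4 * L * (C + 4) * sqrt (real n) \<le> real n * sqrt (real n) / (2 * L)"
  proof -
    have "8 * (C + 4) * L\<^sup>2 \<le> 100 * (C + 4)\<^sup>2 * L\<^sup>2"
      using C_plus_4 by (intro mult_right_mono) auto
    hence "8 * (C + 4) * L\<^sup>2 \<le> real n" using n_large(7) by linarith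
    hence "8 * (C + 4) * L\<^sup>2 * sqrt (real n) \<le> real n * sqrt (real n)" by (intro mult_right_mono) auto
    thus ?thesis using L(2) by (simp add: field_simps power2_eq_square)
  qed
  moreover have "real n * sqrt (real n) * (1 / L) = real n * sqrt (real n) / (2 * L) + real n * sqrt (real n) / (2 * L)"
    using L(2) by simp
  ultimately have "norm (g' w) \<ge> real n * sqrt (real n) / (2 * L)" by linarith
  thus ?thesis using g0 ball[OF w(1)] by (intro bexI[of _ w]) (auto simp: t_def)
qed

text \<open>The two cells yield different roots w and z, because a + \<epsilon> < pi/2 puts their
  real parts into disjoint intervals. Since g vanishes at both, |g' w| \<le> B |z - w|. With |g' w|
  at least n^(3/2)/(2L) this forces a distance of at least 1/(4 n L^2), more than two cells closer
  than 1/(n L^3) can provide.\<close>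

lemma close_cells_exclusive:
  assumes i: "i \<le> n\<^sup>2" "1 / sqrt (real n) \<le> grid n i" "grid n i \<le> pi - 1 / sqrt (real n)"
    and j: "j \<le> n\<^sup>2" "1 / sqrt (real n) \<le> grid n j" "grid n j \<le> pi - 1 / sqrt (real n)"
    and ri: "root_cond n a b (U (grid n i)) (H (grid n i))"
    and rj: "root_cond n a b (U (grid n j)) (H (grid n j))"
    and ab: "0 \<le> a" "0 \<le> b" "a + b + 1 \<le> C" "a + \<epsilon> < pi / 2" and ij: "i \<noteq> j"
  shows "\<bar>grid n i - grid n j\<bar> \<ge> 1 / (real n * L ^ 3)"
proof (rule ccontr)
  assume "\<not> \<bar>grid n i - grid n j\<bar> \<ge> 1 / (real n * L ^ 3)"
  hence near: "\<bar>grid n i - grid n j\<bar> < 1 / (real n * L ^ 3)" by simp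
  have n2: "(real n)\<^sup>2 > 0" using n0 by simp
  obtain w where w: "w \<in> strip" "g w = 0" "\<bar>Re w - grid n i\<bar> \<le> (a + \<epsilon>) / (real n)\<^sup>2" "\<bar>Im w\<bar> \<le> (b + \<epsilon>) / (real n)\<^sup>2"
     "norm (g' w) \<ge> real n * sqrt (real n) / (2 * L)"
    using root_exists[OF i ri ab(1-3)] by blast
  obtain z where z: "z \<in> strip" "g z = 0" "\<bar>Re z - grid n j\<bar> \<le> (a + \<epsilon>) / (real n)\<^sup>2" "\<bar>Im z\<bar> \<le> (b + \<epsilon>) / (real n)\<^sup>2"
    using root_exists[OF j rj ab(1-3)] by blast
  have gd: "pi / (real n)\<^sup>2 \<le> \<bar>grid n i - grid n j\<bar>"
  proof -
    have "grid n i - grid n j = pi / (real n)\<^sup>2 * (real i - real j)"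
      by (simp add: grid_def right_diff_distrib diff_divide_distrib)
    hence "\<bar>grid n i - grid n j\<bar> = pi / (real n)\<^sup>2 * \<bar>real i - real j\<bar>"
      by (simp add: abs_mult)
    moreover have "pi / (real n)\<^sup>2 * 1 \<le> pi / (real n)\<^sup>2 * \<bar>real i - real j\<bar>"
      using ij by (intro mult_left_mono) auto
    ultimately show ?thesis by simp
  qed
  have "(a + \<epsilon>) / (real n)\<^sup>2 + (a + \<epsilon>) / (real n)\<^sup>2 < pi / (real n)\<^sup>2"
    using ab(4) n2 unfolding add_divide_distrib[symmetric] by (intro divide_strict_right_mono) auto
  hence "Re w \<noteq> Re z" using w(3) z(3) gd by linarith
  hence wz: "norm (z - w) > 0" by auto
  have dist: "norm (z - w) \<le> 1 / (real n * L ^ 3) + 4 * C / (real n)\<^sup>2"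
  proof -
    have "norm (z - w) \<le> \<bar>Re (z - w)\<bar> + \<bar>Im (z - w)\<bar>" by (rule cmod_le)
    also have "\<dots> \<le> 1 / (real n * L ^ 3) + 2 * ((a + \<epsilon>) / (real n)\<^sup>2) + 2 * ((b + \<epsilon>) / (real n)\<^sup>2)"
      using w(3,4) z(3,4) near by (simp only: minus_complex.sel)
    finally have 1: "norm (z - w) \<le> 1 / (real n * L ^ 3) + 2 * ((a + \<epsilon>) / (real n)\<^sup>2) + 2 * ((b + \<epsilon>) / (real n)\<^sup>2)" .
    have "2 * ((a + \<epsilon>) / (real n)\<^sup>2) + 2 * ((b + \<epsilon>) / (real n)\<^sup>2) = (2 * (a + \<epsilon>) + 2 * (b + \<epsilon>)) / (real n)\<^sup>2"
      by (simp add: add_divide_distrib)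
    also have "\<dots> \<le> 4 * C / (real n)\<^sup>2"
      using ab \<epsilon> by (intro divide_right_mono) auto
    finally show ?thesis using 1 by linarith
  qed
  have "norm (g' w) * norm (z - w) \<le> B * norm (z - w) * norm (z - w)"
    using taylor1[OF w(1) z(1)] w(2) z(2) by (simp add: norm_mult power2_eq_square)
  hence "norm (g' w) \<le> B * norm (z - w)" using wz by simp
  also have "\<dots> \<le> B * (1 / (real n * L ^ 3) + 4 * C / (real n)\<^sup>2)"
    using dist L(2) by (intro mult_left_mono) (auto simp: B_def)
  also have "\<dots> = real n * sqrt (real n) / (2 * L) * (4 / L + 16 * C * L\<^sup>2 / real n)"
    using n0 L(2) by (simp add: B_def field_simps power2_eq_square power3_eq_cube)
  finally have "real n * sqrt (real n) / (2 * L) * 1 \<le> real n * sqrt (real n) / (2 * L) * (4 / L + 16 * C * L\<^sup>2 / real n)"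
    using w(5) by simp
  moreover have "real n * sqrt (real n) / (2 * L) > 0" using n0 L(2) by simp
  ultimately have "1 \<le> 4 / L + 16 * C * L\<^sup>2 / real n" by (simp only: mult_le_cancel_left_pos)
  moreover have "4 / L < 1 / 2" using L(2) by (simp add: field_simps)
  moreover have "16 * C * L\<^sup>2 / real n \<le> 1 / 2"
  proof -
    have "32 * C * L\<^sup>2 \<le> 100 * (C + 4)\<^sup>2 * L\<^sup>2" using C_plus_4 C by (intro mult_right_mono) auto
    hence "32 * C * L\<^sup>2 \<le> real n" using n_large(7) by linarith
    thus ?thesis using n0 by (simp add: field_simps)
  qed
  ultimately show False by linarith
qed

text \<open>The converse of \<open>root_exists\<close>. The linear prediction is reliable unless |H|
  < 1/L; then the slope is so flat that U must be smaller than its general bound by a factor 2 L^2,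
  and such cells are rare. The general bound on U is recorded as well, because it alone is used for
  cells near the real axis.\<close>

lemma root_detected:
  assumes w: "g w = 0" "0 \<le> Re w" "Re w \<le> pi" "\<bar>Im w\<bar> \<le> b / (real n)\<^sup>2" and b: "0 \<le> b" "b \<le> C"
  shows "\<exists>j\<le>n\<^sup>2. \<bar>Re w - grid n j\<bar> \<le> pi / (2 * (real n)\<^sup>2) \<and> norm (U (grid n j)) \<le> 4 * L * (C + 4) / real n \<and>
     (root_cond n (pi / 2 + \<epsilon>) (b + \<epsilon>) (U (grid n j)) (H (grid n j)) \<or>
      norm (H (grid n j)) < 1 / L \<and> norm (U (grid n j)) \<le> 2 * (C + 4) / (real n * L))"
proof -
  have n2: "(real n)\<^sup>2 > 0" using n0 by simp
  have nn: "sqrt (real n) * sqrt (real n) = real n" by simp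
  obtain j where j: "j \<le> n\<^sup>2" "\<bar>Re w - grid n j\<bar> \<le> pi / (2 * (real n)\<^sup>2)"
    using nearest_grid w by blast
  define t where "t = grid n j"
  have "\<bar>Im w\<bar> \<le> C / (real n)\<^sup>2"
    using w(4) b by (rule_tac order_trans) (auto intro: divide_right_mono)
  hence ws: "w \<in> strip" using w by (simp add: strip_def)
  have "grid n j \<le> pi * (real n)\<^sup>2 / (real n)\<^sup>2" using j(1) unfolding grid_def
    by (intro divide_right_mono mult_left_mono) (auto simp flip: of_nat_power)
  hence ts: "of_real t \<in> strip" using C n2 by (auto simp: strip_def t_def grid_def)
  have "norm (w - of_real t) \<le> \<bar>Re (w - of_real t)\<bar> + \<bar>Im (w - of_real t)\<bar>" by (rule cmod_le)
  also have "\<dots> \<le> pi / (2 * (real n)\<^sup>2) + C / (real n)\<^sup>2"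
    using j(2) \<open>\<bar>Im w\<bar> \<le> C / (real n)\<^sup>2\<close> by (simp add: t_def)
  also have "\<dots> = (pi / 2 + C) / (real n)\<^sup>2" by (simp add: add_divide_distrib)
  also have "\<dots> \<le> (C + 4) / (real n)\<^sup>2" using pi_less_4 by (intro divide_right_mono) auto
  finally have d: "norm (w - of_real t) \<le> (C + 4) / (real n)\<^sup>2" .
  \<comment> \<open>A first, crude expansion with |g'| of order n^(3/2) L shows that g is small at
    the grid point. This is the hypothesis under which \<open>taylor_proxy\<close> may replace the
    derivative by \<open>c t\<close>.\<close>
  have gb: "norm (g (of_real t)) \<le> 4 * L * (C + 4) / sqrt (real n)"
  proof -
    have g'b: "norm (g' (of_real t)) \<le> 3 / 2 * (real n * sqrt (real n) * L)"
    proof -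
      have "norm (g' (of_real t)) \<le> norm (c t) + real n / 2 * norm (g (of_real t))"
        unfolding g'_grid by (rule order_trans[OF norm_triangle_ineq]) (simp add: norm_mult)
      also have "\<dots> \<le> real n * sqrt (real n) * L + real n / 2 * (sqrt (real n) * L)"
        unfolding norm_c t_def using grid_bounds(1,2)[OF j(1)] by (intro add_mono mult_left_mono) auto
      finally show ?thesis by (simp add: mult_ac)
    qed
    have Bd: "B * norm (of_real t - w) \<le> 2 * L * (C + 4) * sqrt (real n)"
    proof -
      have "B * norm (of_real t - w) \<le> B * ((C + 4) / (real n)\<^sup>2)"
        using d L(2) by (intro mult_left_mono) (auto simp: B_def norm_minus_commute)
      thus ?thesis using n0 by (simp add: B_def mult_ac)
    qed
    have "norm (g w - g (of_real t)) \<le> (3 / 2 * (real n * sqrt (real n) * L) + 2 * L * (C + 4) * sqrt (real n)) * norm (w - of_real t)"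
    proof -
      have "g w - g (of_real t) = (g w - g (of_real t) - g' (of_real t) * (w - of_real t)) + g' (of_real t) * (w - of_real t)" by simp
      also have "norm \<dots> \<le> B * (norm (w - of_real t))\<^sup>2 + norm (g' (of_real t)) * norm (w - of_real t)"
        by (intro order_trans[OF norm_triangle_ineq] add_mono taylor1[OF ts ws]) (simp add: norm_mult)
      also have "\<dots> = (B * norm (of_real t - w) + norm (g' (of_real t))) * norm (w - of_real t)"
        by (simp add: power2_eq_square algebra_simps norm_minus_commute)
      also have "\<dots> \<le> (2 * L * (C + 4) * sqrt (real n) + 3 / 2 * (real n * sqrt (real n) * L)) * norm (w - of_real t)"
        using Bd g'b by (intro mult_right_mono add_mono) auto
      finally show ?thesis by (simp add: add.commute)
    qed
    also have "\<dots> \<le> (4 * (real n * sqrt (real n) * L)) * ((C + 4) / (real n)\<^sup>2)"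
    proof (intro mult_mono d)
      have "2 * (C + 4) * (L * sqrt (real n)) \<le> 2 * real n * (L * sqrt (real n))"
        using n_large(6) C_plus_4 L(2) by (intro mult_right_mono) auto
      moreover have "0 \<le> real n * sqrt (real n) * L" using L(2) by simp
      ultimately show "3 / 2 * (real n * sqrt (real n) * L) + 2 * L * (C + 4) * sqrt (real n) \<le> 4 * (real n * sqrt (real n) * L)"
        by (simp add: algebra_simps) 
    qed (use L(2) in auto)
    also have "\<dots> = 4 * L * (C + 4) * (sqrt (real n) / real n)" using n0 by (simp add: power2_eq_square)
    also have "sqrt (real n) / real n = 1 / sqrt (real n)" using n0 nn by (simp add: field_simps)
    finally show ?thesis using w(1) by simp
  qed
  have Ub: "norm (U t) \<le> 4 * L * (C + 4) / real n"
  proof -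
    have "norm (U t) \<le> 4 * L * (C + 4) / sqrt (real n) / sqrt (real n)"
      unfolding t_def grid_bounds(4)[OF j(1)] using gb by (intro divide_right_mono) (auto simp: t_def)
    thus ?thesis by simp
  qed
  have err: "norm (- g (of_real t) - c t * (w - of_real t)) \<le> 4 * L * (C + 4)\<^sup>2 / (real n * sqrt (real n))"
    using taylor_proxy(1)[OF ts t_def j(1) ws d gb] w(1) by simp
  have "root_cond n (pi / 2 + \<epsilon>) (b + \<epsilon>) (U t) (H t) \<or> norm (H t) < 1 / L \<and> norm (U t) \<le> 2 * (C + 4) / (real n * L)"
  proof (cases "norm (H t) < 1 / L")
    case False
    hence H: "norm (H t) \<ge> 1 / L" by simp
    have "0 < 1 / L" using L(2) by simp
    hence H0: "H t \<noteq> 0" using H by auto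
    define q where "q = \<i> * U t / H t / of_nat n"
    have c0: "c t \<noteq> 0" using H0 n0 by (simp add: c_def)
    have "- g (of_real t) - c t * (w - of_real t) = c t * (q - (w - of_real t))"
      using g_eq_proxy[OF H0] by (simp add: q_def right_diff_distrib)
    hence "norm (q - (w - of_real t)) = norm (- g (of_real t) - c t * (w - of_real t)) / norm (c t)"
      using c0 by (simp add: norm_mult)
    also have "\<dots> \<le> 4 * L * (C + 4)\<^sup>2 / (real n * sqrt (real n)) / norm (c t)"
      using err by (intro divide_right_mono) auto
    also have "\<dots> \<le> \<epsilon> / (real n)\<^sup>2" by (rule error_ratio[OF H])
    finally have qd: "norm (q - (w - of_real t)) \<le> \<epsilon> / (real n)\<^sup>2" .
    have iq: "\<i> * U t / H t = of_nat n * q" using n0 by (simp add: q_def)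
    have "\<bar>Re q\<bar> \<le> pi / (2 * (real n)\<^sup>2) + \<epsilon> / (real n)\<^sup>2"
      using abs_Re_le_cmod[of "q - (w - of_real t)"] qd j(2) by (simp add: t_def)
    hence "real n * \<bar>Re q\<bar> \<le> real n * ((pi / 2 + \<epsilon>) / (real n)\<^sup>2)"
      by (intro mult_left_mono) (auto simp: add_divide_distrib)
    moreover have "\<bar>Im q\<bar> \<le> b / (real n)\<^sup>2 + \<epsilon> / (real n)\<^sup>2"
      using abs_Im_le_cmod[of "q - (w - of_real t)"] qd w(4) by simp
    hence "real n * \<bar>Im q\<bar> \<le> real n * ((b + \<epsilon>) / (real n)\<^sup>2)"
      by (intro mult_left_mono) (auto simp: add_divide_distrib)
    ultimately have "root_cond n (pi / 2 + \<epsilon>) (b + \<epsilon>) (U t) (H t)"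
      using H grid_bounds(2)[OF j(1)] n0 unfolding root_cond_def iq L(1)[symmetric] t_def[symmetric]
      by (simp add: abs_mult power2_eq_square)
    thus ?thesis ..
  next
    case True
    have "norm (g (of_real t)) \<le> norm (- g (of_real t) - c t * (w - of_real t)) + norm (c t * (w - of_real t))"
      using norm_triangle_ineq[of "- g (of_real t) - c t * (w - of_real t)" "c t * (w - of_real t)"] by simp
    also have "norm (c t * (w - of_real t)) \<le> (real n * sqrt (real n) * (1 / L)) * ((C + 4) / (real n)\<^sup>2)"
      unfolding norm_mult norm_c using True d C L(2) by (intro mult_mono) auto
    also have "(real n * sqrt (real n) * (1 / L)) * ((C + 4) / (real n)\<^sup>2) = (C + 4) / L * (sqrt (real n) / real n)"
      using n0 by (simp add: power2_eq_square)
    also have "sqrt (real n) / real n = 1 / sqrt (real n)" using n0 nn by (simp add: field_simps)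
    finally have "norm (g (of_real t)) \<le> 4 * L * (C + 4)\<^sup>2 / (real n * sqrt (real n)) + (C + 4) / L * (1 / sqrt (real n))"
      using err by simp
    also have "4 * L * (C + 4)\<^sup>2 / (real n * sqrt (real n)) \<le> (C + 4) / L * (1 / sqrt (real n))"
    proof -
      have "4 * (C + 4)\<^sup>2 * L\<^sup>2 \<le> 100 * (C + 4)\<^sup>2 * L\<^sup>2" by (intro mult_right_mono) auto
      hence "4 * (C + 4)\<^sup>2 * L\<^sup>2 \<le> real n * 1" using n_large(7) by linarith
      also have "\<dots> \<le> real n * (C + 4)" using C by (intro mult_left_mono) auto
      finally have "4 * L * (C + 4)\<^sup>2 * L \<le> (C + 4) * real n" by (simp only: power2_eq_square mult_ac)
      hence "4 * L * (C + 4)\<^sup>2 / real n \<le> (C + 4) / L" using n0 L(2) by (simp add: field_simps)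
      from divide_right_mono[OF this, of "sqrt (real n)"] show ?thesis by simp
    qed
    finally have "norm (g (of_real t)) \<le> 2 * (C + 4) / L / sqrt (real n)" by simp
    hence "norm (g (of_real t)) / sqrt (real n) \<le> 2 * (C + 4) / L / sqrt (real n) / sqrt (real n)"
      by (intro divide_right_mono) auto
    hence "norm (U t) \<le> 2 * (C + 4) / (real n * L)"
      unfolding t_def grid_bounds(4)[OF j(1)] divide_divide_eq_left mult.assoc nn by (simp only: mult.commute)
    thus ?thesis using True by simp
  qed
  thus ?thesis using j Ub by (intro exI[of _ j]) (auto simp: t_def)
qed

end

section \<open>Poisson limits from factorial moments\<close>

lemma card_distinct_lists:
  assumes "finite A"
  shows "card {xs. length xs = k \<and> distinct xs \<and> set xs \<subseteq> A} = fact k * (card A choose k)"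
proof (cases "k \<le> card A")
  case True
  have "fact (card A - k) * card {xs. length xs = k \<and> distinct xs \<and> set xs \<subseteq> A} = fact (card A)"
    using True unfolding card_lists_distinct_length_eq[OF assms True]
    by (subst fact_eq_fact_times[of "card A - k" "card A"]) auto
  also have "\<dots> = fact (card A - k) * (fact k * (card A choose k))"
    using binomial_fact_lemma[OF True] by (simp add: mult_ac)
  finally show ?thesis by simp
next
  case False
  have "{xs. length xs = k \<and> distinct xs \<and> set xs \<subseteq> A} = {}"
  proof -
    have False if "length xs = k" "distinct xs" "set xs \<subseteq> A" for xs
      using card_mono[OF assms that(3)] distinct_card[OF that(2)] that(1) False by simp
    thus ?thesis by blast
  qed
  hence "card {xs. length xs = k \<and> distinct xs \<and> set xs \<subseteq> A} = 0" by (simp only: card.empty)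
  thus ?thesis using False by (simp add: binomial_eq_0)
qed

lemma alternating_binomial_sum:
  "(\<Sum>k\<le>K. (-1) ^ k * real (Suc N choose k)) = (-1) ^ K * real (N choose K)"
  by (induction K) (auto simp: algebra_simps)

text \<open>For N \<ge> 1 the truncated alternating sum is, up to sign, N - 1 over K, and by
  Pascal's rule this is at most N over K + 1.\<close>

lemma bonferroni_count:
  "\<bar>(if N = 0 then 1 else 0) - (\<Sum>k\<le>K. (-1) ^ k * real (N choose k))\<bar> \<le> real (N choose Suc K)"
proof (cases N)
  case 0
  have "(\<Sum>k\<le>K. (-1) ^ k * real (0 choose k)) = (\<Sum>k\<in>{0}. (-1) ^ k * real (0 choose k))"
    by (rule sum.mono_neutral_right) (auto simp: binomial_eq_0)
  thus ?thesis using 0 by simp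
next
  case (Suc m)
  show ?thesis unfolding Suc alternating_binomial_sum by (simp add: abs_mult power_abs)
qed

text \<open>\<open>W k\<close> is the factorial moment of order k of the number of events that
  occur: the ordered lists of k distinct occurring indices number k! times a binomial coefficient.
  Taking expectations in \<open>bonferroni_count\<close> gives the claim.\<close>

lemma (in prob_space) bonferroni_prob:
  fixes A :: "nat \<Rightarrow> 'a set"
  assumes J: "finite J" and A: "\<And>j. j \<in> J \<Longrightarrow> A j \<in> events"
  defines "W \<equiv> \<lambda>k. (\<Sum>l | length l = k \<and> distinct l \<and> set l \<subseteq> J. prob {x \<in> space M. \<forall>j\<in>set l. x \<in> A j})"
  shows "\<bar>prob {x \<in> space M. \<forall>j\<in>J. x \<notin> A j} - (\<Sum>k\<le>K. (-1) ^ k * (W k / fact k))\<bar> \<le> W (Suc K) / fact (Suc K)"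
proof -
  define N where "N x = card {j \<in> J. x \<in> A j}" for x
  let ?D = "\<lambda>k. {l. length l = k \<and> distinct l \<and> set l \<subseteq> J}"
  have fD: "finite (?D k)" for k
    by (rule finite_subset[OF _ finite_lists_length_eq[OF J, of k]]) auto
  have evj: "{x \<in> space M. x \<in> A j} \<in> events" if "j \<in> J" for j
  proof -
    have "{x \<in> space M. x \<in> A j} = A j" using sets.sets_into_space[OF A[OF that]] by blast
    thus ?thesis using A[OF that] by simp
  qed
  have ev: "{x \<in> space M. \<forall>j\<in>set l. x \<in> A j} \<in> events" if "l \<in> ?D k" for l k
    using that evj by (intro sets.sets_Collect_finite_All) auto
  have cnt: "(\<Sum>l\<in>?D k. indicator {x \<in> space M. \<forall>j\<in>set l. x \<in> A j} x) = fact k * real (N x choose k)" if "x \<in> space M" for x k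
  proof -
    have "(\<Sum>l\<in>?D k. indicator {x \<in> space M. \<forall>j\<in>set l. x \<in> A j} x :: real) = real (card {l \<in> ?D k. \<forall>j\<in>set l. x \<in> A j})"
    proof -
      have "(\<Sum>l\<in>?D k. indicator {x \<in> space M. \<forall>j\<in>set l. x \<in> A j} x :: real) = (\<Sum>l\<in>?D k. if \<forall>j\<in>set l. x \<in> A j then 1 else 0)"
        using that by (intro sum.cong refl) (simp add: indicator_def)
      also have "\<dots> = (\<Sum>l\<in>{l \<in> ?D k. \<forall>j\<in>set l. x \<in> A j}. 1)"
        by (rule sum.inter_filter[symmetric, OF fD])
      finally show ?thesis by simp
    qed
    also have "{l \<in> ?D k. \<forall>j\<in>set l. x \<in> A j} = {l. length l = k \<and> distinct l \<and> set l \<subseteq> {j \<in> J. x \<in> A j}}" by auto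
    also have "real (card \<dots>) = fact k * real (N x choose k)"
      using J by (subst card_distinct_lists) (auto simp: N_def)
    finally show ?thesis .
  qed
  have int: "integrable M (\<lambda>x. \<Sum>l\<in>?D k. indicator {x \<in> space M. \<forall>j\<in>set l. x \<in> A j} x :: real)" for k
    using ev by (intro Bochner_Integration.integrable_sum) (auto simp: emeasure_eq_measure)
  have W: "W k / fact k = expectation (\<lambda>x. real (N x choose k))" and iN: "integrable M (\<lambda>x. real (N x choose k))" for k
  proof -
    have "expectation (\<lambda>x. \<Sum>l\<in>?D k. indicator {x \<in> space M. \<forall>j\<in>set l. x \<in> A j} x) = W k"
      unfolding W_def using ev by (subst Bochner_Integration.integral_sum) (auto simp: emeasure_eq_measure)
    moreover have "expectation (\<lambda>x. \<Sum>l\<in>?D k. indicator {x \<in> space M. \<forall>j\<in>set l. x \<in> A j} x) = expectation (\<lambda>x. fact k * real (N x choose k))"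
      by (intro Bochner_Integration.integral_cong refl cnt)
    ultimately show "W k / fact k = expectation (\<lambda>x. real (N x choose k))" by (simp add: field_simps)
    have "integrable M (\<lambda>x. fact k * real (N x choose k))"
      by (rule Bochner_Integration.integrable_cong[THEN iffD1, OF refl _ int[of k]]) (rule cnt)
    thus "integrable M (\<lambda>x. real (N x choose k))" by simp
  qed
  have E0: "{x \<in> space M. \<forall>j\<in>J. x \<notin> A j} \<in> events"
    using evj J by (intro sets.sets_Collect_finite_All sets.sets_Collect_neg) auto
  have "prob {x \<in> space M. \<forall>j\<in>J. x \<notin> A j} = expectation (\<lambda>x. if N x = 0 then 1 else 0)"
  proof -
    have "prob {x \<in> space M. \<forall>j\<in>J. x \<notin> A j} = expectation (indicator {x \<in> space M. \<forall>j\<in>J. x \<notin> A j})"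
      using E0 by simp
    also have "\<dots> = expectation (\<lambda>x. if N x = 0 then 1 else 0)"
      using J by (intro Bochner_Integration.integral_cong) (auto simp: N_def indicator_def)
    finally show ?thesis .
  qed
  moreover have i0: "integrable M (\<lambda>x. if N x = 0 then 1 else 0 :: real)"
  proof -
    have "integrable M (indicator {x \<in> space M. \<forall>j\<in>J. x \<notin> A j} :: _ \<Rightarrow> real)"
      using E0 by (simp add: emeasure_eq_measure)
    also have "?this \<longleftrightarrow> ?thesis"
      using J by (intro Bochner_Integration.integrable_cong) (auto simp: N_def indicator_def)
    finally show ?thesis .
  qed
  moreover have iS: "integrable M (\<lambda>x. \<Sum>k\<le>K. (-1) ^ k * real (N x choose k))"
    using iN by auto
  moreover have "(\<Sum>k\<le>K. (-1) ^ k * (W k / fact k)) = expectation (\<lambda>x. \<Sum>k\<le>K. (-1) ^ k * real (N x choose k))"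
    using iN by (simp add: W)
  ultimately have "prob {x \<in> space M. \<forall>j\<in>J. x \<notin> A j} - (\<Sum>k\<le>K. (-1) ^ k * (W k / fact k))
      = expectation (\<lambda>x. (if N x = 0 then 1 else 0) - (\<Sum>k\<le>K. (-1) ^ k * real (N x choose k)))"
    by simp
  also have "\<bar>\<dots>\<bar> \<le> expectation (\<lambda>x. real (N x choose Suc K))"
  proof (rule order_trans[OF integral_abs_bound integral_mono])
    show "integrable M (\<lambda>x. \<bar>(if N x = 0 then 1 else 0) - (\<Sum>k\<le>K. (-1) ^ k * real (N x choose k))\<bar>)"
      using i0 iS by (intro Bochner_Integration.integrable_abs Bochner_Integration.integrable_diff)
  qed (use iN bonferroni_count in auto)
  finally show ?thesis by (simp only: W)
qed

text \<open>The truncation level K is fixed before n. The Bonferroni error is the factorial moment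
  of order K + 1 divided by (K+1)!, whose limit is small for large K, so only finitely many moments
  pass to the limit at once.\<close>

theorem poisson_void_probability:
  fixes A :: "nat \<Rightarrow> nat \<Rightarrow> 'a set" and M :: "nat \<Rightarrow> 'a measure"
  assumes P: "\<And>n. prob_space (M n)" and J: "\<And>n. finite (J n)" and A: "\<And>n j. j \<in> J n \<Longrightarrow> A n j \<in> sets (M n)"
    and lim: "\<And>k. (\<lambda>n. \<Sum>l | length l = k \<and> distinct l \<and> set l \<subseteq> J n.
        measure (M n) {x \<in> space (M n). \<forall>j\<in>set l. x \<in> A n j}) \<longlonglongrightarrow> \<nu> ^ k"
  shows "(\<lambda>n. measure (M n) {x \<in> space (M n). \<forall>j\<in>J n. x \<notin> A n j}) \<longlonglongrightarrow> exp (- \<nu>)"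
proof (rule LIMSEQ_I)
  fix r :: real assume r: "r > 0"
  define W where "W n k = (\<Sum>l | length l = k \<and> distinct l \<and> set l \<subseteq> J n.
        measure (M n) {x \<in> space (M n). \<forall>j\<in>set l. x \<in> A n j})" for n k
  define p where "p n = measure (M n) {x \<in> space (M n). \<forall>j\<in>J n. x \<notin> A n j}" for n
  have W: "(\<lambda>n. W n k) \<longlonglongrightarrow> \<nu> ^ k" for k using lim unfolding W_def .
  have "(\<lambda>k. (- \<nu>) ^ k / fact k) sums exp (- \<nu>)"
    using exp_converges[of "- \<nu>"] by (simp add: scaleR_conv_of_real divide_inverse mult.commute)
  hence s: "(\<lambda>K. \<Sum>k\<le>K. (- \<nu>) ^ k / fact k) \<longlonglongrightarrow> exp (- \<nu>)"
    by (simp add: sums_def_le)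
  have t: "(\<lambda>k. \<nu> ^ Suc k / fact (Suc k)) \<longlonglongrightarrow> 0"
    using summable_LIMSEQ_zero[OF summable_exp[of \<nu>]] by (intro LIMSEQ_Suc) (simp add: divide_inverse mult.commute)
  have "eventually (\<lambda>K. \<bar>(\<Sum>k\<le>K. (- \<nu>) ^ k / fact k) - exp (- \<nu>)\<bar> < r / 4 \<and> \<nu> ^ Suc K / fact (Suc K) < r / 4) sequentially"
    using tendstoD[OF s, of "r / 4"] order_tendstoD(2)[OF t, of "r / 4"] r
    by (auto simp: dist_real_def elim: eventually_elim2)
  then obtain K where K: "\<bar>(\<Sum>k\<le>K. (- \<nu>) ^ k / fact k) - exp (- \<nu>)\<bar> < r / 4" "\<nu> ^ Suc K / fact (Suc K) < r / 4"
    using eventually_happens'[OF sequentially_bot] by blast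
  have "(\<lambda>n. \<Sum>k\<le>K. (-1) ^ k * (W n k / fact k)) \<longlonglongrightarrow> (\<Sum>k\<le>K. (-1) ^ k * (\<nu> ^ k / fact k))"
    by (intro tendsto_intros W) auto
  also have "(\<Sum>k\<le>K. (-1) ^ k * (\<nu> ^ k / fact k)) = (\<Sum>k\<le>K. (- \<nu>) ^ k / fact k)"
    by (intro sum.cong refl) (simp add: power_minus[of \<nu>])
  finally have e1: "eventually (\<lambda>n. \<bar>(\<Sum>k\<le>K. (-1) ^ k * (W n k / fact k)) - (\<Sum>k\<le>K. (- \<nu>) ^ k / fact k)\<bar> < r / 4) sequentially"
    using r by (auto dest!: tendstoD[where e="r/4"] simp: dist_real_def)
  have "(\<lambda>n. W n (Suc K) / fact (Suc K)) \<longlonglongrightarrow> \<nu> ^ Suc K / fact (Suc K)"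
    by (intro tendsto_intros W) auto
  hence e2: "eventually (\<lambda>n. W n (Suc K) / fact (Suc K) < r / 4) sequentially"
    using K(2) by (rule order_tendstoD)
  have "eventually (\<lambda>n. norm (p n - exp (- \<nu>)) < r) sequentially"
    using e1 e2
  proof eventually_elim
    case (elim n)
    have "\<bar>p n - (\<Sum>k\<le>K. (-1) ^ k * (W n k / fact k))\<bar> \<le> W n (Suc K) / fact (Suc K)"
      unfolding p_def W_def by (rule prob_space.bonferroni_prob[OF P J A])
    thus ?case using elim K(1) r by (simp only: real_norm_def)
  qed
  thus "\<exists>no. \<forall>n\<ge>no. norm (measure (M n) {x \<in> space (M n). \<forall>j\<in>J n. x \<notin> A n j} - exp (- \<nu>)) < r"
    unfolding p_def eventually_sequentially .
qed

text \<open>The extra factor \<open>N\<close> on the left avoids the exponent k - 1 on the right.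
  When a head is added, either the tail is already bad or the head is near one of k entries, which
  adds at most k c N^k lists; the recursion closes because k^2 + k \<le> (k+1)^2.\<close>

lemma card_lists_nonseparated:
  fixes J :: "nat set"
  assumes J: "finite J" and c: "\<And>i. i \<in> J \<Longrightarrow> real (card {m \<in> J. near i m}) \<le> c" and sym: "\<And>i m. near i m = near m i"
    and N: "real (card J) \<le> N" and c0: "c \<ge> 0"
  shows "real (card {l. length l = k \<and> set l \<subseteq> J \<and> \<not> sorted_wrt (\<lambda>i m. \<not> near i m) l}) * N \<le> (real k)\<^sup>2 * c * N ^ k"
proof (induction k)
  case 0
  have "{l. length l = 0 \<and> set l \<subseteq> J \<and> \<not> sorted_wrt (\<lambda>i m. \<not> near i m) l} = {}"
    by auto
  thus ?case by (simp only: card.empty) simp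
next
  case (Suc k)
  have N0: "N \<ge> 0" using N by linarith
  let ?ns = "\<lambda>k. {l. length l = k \<and> set l \<subseteq> J \<and> \<not> sorted_wrt (\<lambda>i m. \<not> near i m) l}"
  let ?L = "\<lambda>k. {l. set l \<subseteq> J \<and> length l = k}"
  have fL: "finite (?L k)" for k using J by (rule finite_lists_length_eq)
  have fns: "finite (?ns k)" for k by (rule finite_subset[OF _ fL[of k]]) auto
  have "?ns (Suc k) \<subseteq> (\<lambda>(i, l). i # l) ` (J \<times> ?ns k) \<union> (\<lambda>(i, l). i # l) ` (SIGMA i:J. {l \<in> ?L k. \<exists>m\<in>set l. near i m}) "
    by (auto simp: length_Suc_conv image_iff)
  also have "(SIGMA i:J. {l \<in> ?L k. \<exists>m\<in>set l. near i m}) = (\<lambda>(l, i). (i, l)) ` (SIGMA l:?L k. {i \<in> J. \<exists>m\<in>set l. near i m})"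
    by (auto simp: image_iff)
  finally have sub: "?ns (Suc k) \<subseteq> (\<lambda>(i, l). i # l) ` (J \<times> ?ns k) \<union> (\<lambda>(i, l). i # l) ` (\<lambda>(l, i). (i, l)) ` (SIGMA l:?L k. {i \<in> J. \<exists>m\<in>set l. near i m})" .
  have fS: "finite (SIGMA l:?L k. {i \<in> J. \<exists>m\<in>set l. near i m})" using fL J by auto
  have "card (?ns (Suc k)) \<le> card J * card (?ns k) + card (SIGMA l:?L k. {i \<in> J. \<exists>m\<in>set l. near i m})"
    by (rule order_trans[OF card_mono[OF _ sub]], use J fns fS in blast,
        rule order_trans[OF card_Un_le add_mono])
       (auto intro!: order_trans[OF card_image_le] card_image_le fS simp: J fns card_cartesian_product)
  also have "card (SIGMA l:?L k. {i \<in> J. \<exists>m\<in>set l. near i m}) = (\<Sum>l\<in>?L k. card {i \<in> J. \<exists>m\<in>set l. near i m})"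
    using fL J by (intro card_SigmaI) auto
  finally have 1: "real (card (?ns (Suc k))) \<le> real (card J) * real (card (?ns k)) + (\<Sum>l\<in>?L k. real (card {i \<in> J. \<exists>m\<in>set l. near i m}))"
    by (simp only: of_nat_add[symmetric] of_nat_mult[symmetric] of_nat_sum[symmetric] of_nat_le_iff)
  have "real (card {i \<in> J. \<exists>m\<in>set l. near i m}) \<le> real k * c" if "l \<in> ?L k" for l
  proof -
    have "{i \<in> J. \<exists>m\<in>set l. near i m} = (\<Union>m\<in>set l. {i \<in> J. near m i})" using sym by auto
    hence "card {i \<in> J. \<exists>m\<in>set l. near i m} \<le> (\<Sum>m\<in>set l. card {i \<in> J. near m i})"
      by (simp add: card_UN_le)
    hence "real (card {i \<in> J. \<exists>m\<in>set l. near i m}) \<le> (\<Sum>m\<in>set l. real (card {i \<in> J. near m i}))"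
      by (simp only: of_nat_sum[symmetric] of_nat_le_iff)
    also have "\<dots> \<le> (\<Sum>m\<in>set l. c)" using that c by (intro sum_mono) auto
    also have "\<dots> \<le> real k * c" using that card_length[of l] c0 by (auto intro!: mult_right_mono)
    finally show ?thesis .
  qed
  hence "(\<Sum>l\<in>?L k. real (card {i \<in> J. \<exists>m\<in>set l. near i m})) \<le> (\<Sum>l\<in>?L k. real k * c)"
    by (intro sum_mono)
  also have "\<dots> = real (card J) ^ k * (real k * c)" using J by (simp add: card_lists_length_eq)
  also have "\<dots> \<le> N ^ k * (real k * c)" using N c0 by (intro mult_right_mono power_mono) auto
  finally have 2: "(\<Sum>l\<in>?L k. real (card {i \<in> J. \<exists>m\<in>set l. near i m})) \<le> N ^ k * (real k * c)" .
  have "real (card (?ns (Suc k))) * N \<le> (N * real (card (?ns k)) + N ^ k * (real k * c)) * N"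
    using 1 2 mult_right_mono[OF N, of "real (card (?ns k))"] N0 by (intro mult_right_mono) auto
  also have "\<dots> = N * (real (card (?ns k)) * N) + real k * c * N ^ Suc k" by (simp add: algebra_simps)
  also have "\<dots> \<le> N * ((real k)\<^sup>2 * c * N ^ k) + real k * c * N ^ Suc k"
    using Suc N0 by (intro add_right_mono mult_left_mono) auto
  also have "\<dots> = ((real k)\<^sup>2 + real k) * (c * N ^ Suc k)" by (simp add: algebra_simps)
  also have "\<dots> \<le> (real (Suc k))\<^sup>2 * (c * N ^ Suc k)"
    using c0 N0 by (intro mult_right_mono) (auto simp: power2_eq_square algebra_simps)
  finally show ?case by (simp add: mult_ac)
qed

section \<open>The grid\<close>

text \<open>The Maclaurin bound x - x^3/6 suffices, because x^2 \<le> 3 on this range.\<close>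

lemma sin_ge_half:
  assumes "0 \<le> x" "x \<le> pi / 2"
  shows "x / 2 \<le> sin x"
proof -
  obtain t where "sin x = (\<Sum>m<3. sin_coeff m * x ^ m) + sin (t + 1/2 * real 3 * pi) / fact 3 * x ^ 3"
    using Maclaurin_sin_expansion[of x 3] by blast
  hence t: "sin x = x + sin (t + 1/2 * real 3 * pi) / 6 * x ^ 3"
    by (simp add: sin_coeff_def numeral_eq_Suc)
  have "- 1 / 6 * x ^ 3 \<le> sin (t + 1/2 * real 3 * pi) / 6 * x ^ 3"
    using assms sin_ge_minus_one[of "t + 1/2 * real 3 * pi"] by (intro mult_right_mono) auto
  moreover have "x ^ 3 \<le> 3 * x"
  proof -
    have "x \<le> 17 / 10" using assms pi_approx by simp
    hence "x * x \<le> (17/10) * (17/10)" using assms by (intro mult_mono) auto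
    hence "x * x \<le> 3" by simp
    hence "x * x * x \<le> 3 * x" using assms by (intro mult_right_mono) auto
    thus ?thesis by (simp add: power3_eq_cube)
  qed
  ultimately show ?thesis using t by linarith
qed

lemma cis_dist_ge:
  assumes "\<bar>\<alpha> - \<beta>\<bar> \<le> pi"
  shows "norm (cis \<alpha> - cis \<beta>) \<ge> \<bar>\<alpha> - \<beta>\<bar> / 2"
proof -
  have "norm (cis \<alpha> - cis \<beta>) = norm (exp (\<i> * of_real (\<alpha> - \<beta>)) - 1)"
    unfolding norm_cis_diff by (simp add: cis_conv_exp norm_minus_commute mult_ac)
  also have "\<dots> = 2 * \<bar>sin ((\<alpha> - \<beta>) / 2)\<bar>" by (rule dist_exp_i_1)
  also have "\<bar>sin ((\<alpha> - \<beta>) / 2)\<bar> = \<bar>sin (\<bar>\<alpha> - \<beta>\<bar> / 2)\<bar>"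
  proof (cases "\<alpha> - \<beta> \<ge> 0")
    case False
    hence "\<bar>\<alpha> - \<beta>\<bar> / 2 = - ((\<alpha> - \<beta>) / 2)" by linarith
    thus ?thesis by (simp only: sin_minus abs_minus_cancel)
  qed simp
  finally show ?thesis using sin_ge_half[of "\<bar>\<alpha> - \<beta>\<bar> / 2"] assms by simp
qed

text \<open>When the angles add up to more than pi, the shorter arc passes through -1, and the angle
  -\<beta> has to be read as 2 pi - \<beta>.\<close>

lemma cis_dist_conj_ge:
  assumes "\<delta> \<le> \<alpha>" "\<delta> \<le> \<beta>" "\<alpha> \<le> pi - \<delta>" "\<beta> \<le> pi - \<delta>" "\<delta> \<ge> 0"
  shows "norm (cis \<alpha> - cis (- \<beta>)) \<ge> \<delta>"
proof (cases "\<alpha> + \<beta> \<le> pi")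
  case True
  thus ?thesis using cis_dist_ge[of \<alpha> "- \<beta>"] assms by simp
next
  case False
  have "cis (- \<beta>) = cis (2 * pi - \<beta>)" by (simp add: complex_eq_iff cos_diff sin_diff)
  thus ?thesis using cis_dist_ge[of \<alpha> "2 * pi - \<beta>"] assms False by simp
qed

lemma card_nat_near:
  assumes "r \<ge> 0"
  shows "finite {m::nat. \<bar>real i - real m\<bar> < r}" "real (card {m::nat. \<bar>real i - real m\<bar> < r}) \<le> 2 * r + 1"
proof -
  define f where "f = nat \<lfloor>r\<rfloor>"
  have f: "real f \<le> r" "r < real f + 1" using assms by (auto simp: f_def)
  have sub: "{m::nat. \<bar>real i - real m\<bar> < r} \<subseteq> {i - f..i + f}"
    using f by auto
  thus "finite {m::nat. \<bar>real i - real m\<bar> < r}" by (rule finite_subset) auto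
  have "card {m::nat. \<bar>real i - real m\<bar> < r} \<le> card {i - f..i + f}" by (intro card_mono sub) auto
  also have "\<dots> \<le> 2 * f + 1" by auto
  finally show "real (card {m::nat. \<bar>real i - real m\<bar> < r}) \<le> 2 * r + 1" using f by linarith
qed

text \<open>Left out are the cells near 0 and pi, where e^(it) almost coincides with its conjugate
  and the real and imaginary parts of the sum are no longer nearly independent.\<close>

definition bulk :: "nat \<Rightarrow> nat set" where
  "bulk n = {j. j \<le> n\<^sup>2 \<and> 1 / sqrt (real n) \<le> grid n j \<and> grid n j \<le> pi - 1 / sqrt (real n)}"

lemma finite_bulk: "finite (bulk n)"
  unfolding bulk_def by (rule finite_subset[of _ "{..n\<^sup>2}"]) auto

lemma grid_diff:
  "\<bar>grid n i - grid n m\<bar> < d \<Longrightarrow> n \<ge> 1 \<Longrightarrow> \<bar>real i - real m\<bar> < d * (real n)\<^sup>2"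
proof -
  assume d: "\<bar>grid n i - grid n m\<bar> < d" and n: "n \<ge> 1"
  have "grid n i - grid n m = pi / (real n)\<^sup>2 * (real i - real m)"
    by (simp add: grid_def right_diff_distrib diff_divide_distrib)
  hence "pi / (real n)\<^sup>2 * \<bar>real i - real m\<bar> < d" using d by (simp add: abs_mult)
  hence "pi * \<bar>real i - real m\<bar> < d * (real n)\<^sup>2" using n by (simp add: field_simps)
  moreover have "1 * \<bar>real i - real m\<bar> \<le> pi * \<bar>real i - real m\<bar>"
    using pi_gt3 by (intro mult_right_mono) auto
  ultimately show ?thesis by simp
qed

lemma sq_over_sqrt: "1 / sqrt (real n) * (real n)\<^sup>2 = real n * sqrt (real n)"
proof (cases "n = 0")
  case False
  have "real n / sqrt (real n) = sqrt (real n)" by (rule real_div_sqrt) simp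
  thus ?thesis by (simp add: power2_eq_square times_divide_eq_right[symmetric] del: times_divide_eq_right)
qed simp

lemma card_bulk:
  assumes n: "n \<ge> 1"
  shows "real (card (bulk n)) \<le> (real n)\<^sup>2 + 1" and "(real n)\<^sup>2 - 4 * (real n * sqrt (real n)) - 2 \<le> real (card (bulk n))"
    and "real (card {m \<in> bulk n. \<bar>grid n i - grid n m\<bar> < 1 / sqrt (real n)}) \<le> 3 * (real n * sqrt (real n))"
proof -
  have "card (bulk n) \<le> card {..n\<^sup>2}" unfolding bulk_def by (intro card_mono) auto
  thus "real (card (bulk n)) \<le> (real n)\<^sup>2 + 1" by (simp flip: of_nat_power) 
  let ?r = "real n * sqrt (real n)"
  have r0: "?r \<ge> 0" by simp
  have r1: "?r \<ge> 1" using mult_mono[of 1 "real n" 1 "sqrt (real n)"] n by simp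
  have g0: "grid n 0 = 0" by (simp add: grid_def)
  have gn: "grid n (n\<^sup>2) = pi" using n by (simp add: grid_def)
  have "{..n\<^sup>2} \<subseteq> bulk n \<union> ({m. \<bar>real 0 - real m\<bar> < ?r} \<union> {m. \<bar>real (n\<^sup>2) - real m\<bar> < ?r})"
  proof
    fix m assume m: "m \<in> {..n\<^sup>2}"
    have pos: "grid n m \<ge> 0" by (simp add: grid_def)
    have "real m \<le> (real n)\<^sup>2" using m by (simp flip: of_nat_power)
    hence "grid n m \<le> pi * (real n)\<^sup>2 / (real n)\<^sup>2"
      unfolding grid_def by (intro divide_right_mono mult_left_mono) auto
    hence le: "grid n m \<le> pi" using n by simp
    show "m \<in> bulk n \<union> ({m. \<bar>real 0 - real m\<bar> < ?r} \<union> {m. \<bar>real (n\<^sup>2) - real m\<bar> < ?r})"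
    proof (cases "m \<in> bulk n")
      case False
      then consider "grid n m < 1 / sqrt (real n)" | "grid n m > pi - 1 / sqrt (real n)"
        using m by (auto simp: bulk_def)
      thus ?thesis
      proof cases
        case 1
        hence "\<bar>grid n 0 - grid n m\<bar> < 1 / sqrt (real n)" using g0 pos by simp
        from grid_diff[OF this n, unfolded sq_over_sqrt] show ?thesis by simp
      next
        case 2
        hence "\<bar>grid n (n\<^sup>2) - grid n m\<bar> < 1 / sqrt (real n)" using gn le by simp
        from grid_diff[OF this n, unfolded sq_over_sqrt] show ?thesis by simp
      qed
    qed simp
  qed
  hence "card {..n\<^sup>2} \<le> card (bulk n \<union> ({m. \<bar>real 0 - real m\<bar> < ?r} \<union> {m. \<bar>real (n\<^sup>2) - real m\<bar> < ?r}))"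
    by (rule card_mono[rotated]) (use finite_bulk card_nat_near(1)[OF r0] in blast)
  also have "\<dots> \<le> card (bulk n) + (card {m. \<bar>real 0 - real m\<bar> < ?r} + card {m. \<bar>real (n\<^sup>2) - real m\<bar> < ?r})"
    by (intro order_trans[OF card_Un_le] add_left_mono card_Un_le)
  finally have "real (card {..n\<^sup>2}) \<le> real (card (bulk n) + (card {m. \<bar>real 0 - real m\<bar> < ?r} + card {m. \<bar>real (n\<^sup>2) - real m\<bar> < ?r}))"
    by (rule of_nat_mono)
  hence "real (n\<^sup>2) + 1 \<le> real (card (bulk n)) + (real (card {m. \<bar>real 0 - real m\<bar> < ?r}) + real (card {m. \<bar>real (n\<^sup>2) - real m\<bar> < ?r}))"
    by (simp only: of_nat_add card_atMost of_nat_Suc)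
  thus "(real n)\<^sup>2 - 4 * ?r - 2 \<le> real (card (bulk n))"
    using card_nat_near(2)[OF r0, of 0] card_nat_near(2)[OF r0, of "n\<^sup>2"] by simp
  have "card {m \<in> bulk n. \<bar>grid n i - grid n m\<bar> < 1 / sqrt (real n)} \<le> card {m. \<bar>real i - real m\<bar> < ?r}"
  proof (intro card_mono card_nat_near r0 subsetI)
    fix m assume "m \<in> {m \<in> bulk n. \<bar>grid n i - grid n m\<bar> < 1 / sqrt (real n)}"
    hence "\<bar>grid n i - grid n m\<bar> < 1 / sqrt (real n)" by simp
    from grid_diff[OF this n, unfolded sq_over_sqrt] show "m \<in> {m. \<bar>real i - real m\<bar> < ?r}" by simp
  qed
  thus "real (card {m \<in> bulk n. \<bar>grid n i - grid n m\<bar> < 1 / sqrt (real n)}) \<le> 3 * ?r"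
    using card_nat_near(2)[OF r0, of i] r1 by linarith
qed

section \<open>Probability of the good event\<close>

lemma trig_form_tail:
  assumes n: "n \<ge> 1" and c: "\<And>k. k \<le> n \<Longrightarrow> \<bar>c k\<bar> \<le> 1" and L: "L \<ge> 0"
  shows "\<P>(x in gauss {..n}. norm (trig_form n (\<lambda>k. c k * x k) t) > sqrt (real n) * L) \<le> 4 * exp (- L\<^sup>2 / 32)"
proof -
  interpret prob_space "gauss {..n}" by (rule prob_space_gauss)
  note [measurable] = inner_on_measurable[OF finite_atMost]
  define u where "u = (\<lambda>k. c k * cos (real k * t))"
  define v where "v = (\<lambda>k. c k * sin (real k * t))"
  have re: "Re (trig_form n (\<lambda>k. c k * x k) t) = inner_on {..n} u x" "Im (trig_form n (\<lambda>k. c k * x k) t) = inner_on {..n} v x" for x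
    by (simp_all add: Re_trig_form Im_trig_form inner_on_def u_def v_def mult_ac)
  define s where "s = sqrt (2 * real n)"
  have s: "s > 0" "s\<^sup>2 = 2 * real n" using n by (auto simp: s_def)
  have sq: "inner_on {..n} f f \<le> s\<^sup>2" if "\<And>k. k \<le> n \<Longrightarrow> \<bar>f k\<bar> \<le> 1" for f
  proof -
    have "inner_on {..n} f f \<le> (\<Sum>k\<le>n. 1)" unfolding inner_on_def
    proof (rule sum_mono)
      fix k assume "k \<in> {..n}"
      hence "\<bar>f k\<bar> * \<bar>f k\<bar> \<le> 1 * 1" using that by (intro mult_mono) auto
      thus "f k * f k \<le> 1" by (simp add: abs_mult_self_eq)
    qed
    also have "\<dots> \<le> s\<^sup>2" using n by (simp add: s)
    finally show ?thesis .
  qed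
  have u: "inner_on {..n} u u \<le> s\<^sup>2" "inner_on {..n} v v \<le> s\<^sup>2"
    using c by (auto intro!: sq mult_le_one simp: u_def v_def abs_mult)
  \<comment> \<open>With s = sqrt (2n), which dominates the norms sqrt (n+1), the product s L' is
    half of sqrt n L, so one of the two parts must exceed it; the exponent becomes L^2/32.\<close>
  define L' where "L' = L / (2 * sqrt 2)"
  have L': "L' \<ge> 0" "s * L' = sqrt (real n) * L / 2" "- L'\<^sup>2 / 4 = - L\<^sup>2 / 32"
    using L by (auto simp: L'_def s_def real_sqrt_mult power_divide power_mult_distrib)
  have "\<P>(x in gauss {..n}. norm (trig_form n (\<lambda>k. c k * x k) t) > sqrt (real n) * L) \<le>
    measure (gauss {..n}) ({x \<in> space (gauss {..n}). \<bar>inner_on {..n} u x\<bar> > s * L'} \<union> {x \<in> space (gauss {..n}). \<bar>inner_on {..n} v x\<bar> > s * L'})"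
  proof (rule finite_measure_mono)
    show "{x \<in> space (gauss {..n}). norm (trig_form n (\<lambda>k. c k * x k) t) > sqrt (real n) * L} \<subseteq>
      {x \<in> space (gauss {..n}). \<bar>inner_on {..n} u x\<bar> > s * L'} \<union> {x \<in> space (gauss {..n}). \<bar>inner_on {..n} v x\<bar> > s * L'}"
    proof
      fix x assume x: "x \<in> {x \<in> space (gauss {..n}). norm (trig_form n (\<lambda>k. c k * x k) t) > sqrt (real n) * L}"
      have "norm (trig_form n (\<lambda>k. c k * x k) t) \<le> \<bar>inner_on {..n} u x\<bar> + \<bar>inner_on {..n} v x\<bar>"
        using cmod_le[of "trig_form n (\<lambda>k. c k * x k) t"] by (simp add: re)
      thus "x \<in> {x \<in> space (gauss {..n}). \<bar>inner_on {..n} u x\<bar> > s * L'} \<union> {x \<in> space (gauss {..n}). \<bar>inner_on {..n} v x\<bar> > s * L'}"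
        using x L'(2) by auto
    qed
  qed measurable
  also have "\<dots> \<le> \<P>(x in gauss {..n}. \<bar>inner_on {..n} u x\<bar> > s * L') + \<P>(x in gauss {..n}. \<bar>inner_on {..n} v x\<bar> > s * L')"
    by (intro measure_Un_le) measurable
  also have "\<dots> \<le> 2 * exp (- L'\<^sup>2 / 4) + 2 * exp (- L'\<^sup>2 / 4)"
    using u s(1) L'(1) by (intro add_mono gauss_tail) auto
  finally show ?thesis by (simp only: L'(3))
qed

lemma good_event_measurable [measurable]: "Measurable.pred (gauss {..n}) (good_event n)"
proof -
  have x: "(\<lambda>x. x k) \<in> borel_measurable (gauss {..n})" if "k \<in> {..n}" for k
    using that by (simp add: measurable_cong_sets[OF sets_gauss refl])
  have T: "{x \<in> space (gauss {..n}). norm (trig_form n (\<lambda>k. c k * x k) t) \<le> K} \<in> sets (gauss {..n})" for c t K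
    by measurable
  have "{x \<in> space (gauss {..n}). (\<forall>k\<in>{..n}. \<bar>x k\<bar> \<le> ln (real n)) \<and>
     (\<forall>j\<in>{..n\<^sup>2}. norm (trig_form n (\<lambda>k. 1 * x k) (grid n j)) \<le> sqrt (real n) * ln (real n) \<and>
        norm (trig_form n (\<lambda>k. (real k / real n - 1/2) * x k) (grid n j)) \<le> sqrt (real n) * ln (real n) \<and>
        norm (trig_form n (\<lambda>k. (real k / real n)\<^sup>2 * x k) (grid n j)) \<le> sqrt (real n) * ln (real n))} \<in> sets (gauss {..n})"
    using x by (intro sets.sets_Collect_conj sets.sets_Collect_finite_All T finite_atMost) measurable
  thus ?thesis unfolding pred_def good_event_def[abs_def] Ball_def atMost_iff .
qed

text \<open>A union bound over n + 1 coefficients and n^2 + 1 grid points. The threshold ln n is the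
  reason for the bound exp (-(ln n)^2/32), which beats every power of n, while ln n itself costs
  only logarithms elsewhere.\<close>

lemma good_event_prob:
  assumes n: "n \<ge> 1"
  shows "\<P>(x in gauss {..n}. \<not> good_event n x) \<le> 28 * (real n)\<^sup>2 * exp (- (ln (real n))\<^sup>2 / 32)"
proof -
  interpret prob_space "gauss {..n}" by (rule prob_space_gauss)
  define L where "L = ln (real n)"
  have L: "L \<ge> 0" using n by (simp add: L_def)
  let ?T = "\<lambda>c j. {x \<in> space (gauss {..n}). norm (trig_form n (\<lambda>k. c k * x k) (grid n j)) > sqrt (real n) * L}"
  let ?X = "\<lambda>k. {x \<in> space (gauss {..n}). \<bar>inner_on {..n} (\<lambda>l. if l = k then 1 else 0) x\<bar> > 1 * L}"
  let ?c1 = "\<lambda>k::nat. 1 :: real" and ?c2 = "\<lambda>k. real k / real n - 1/2" and ?c3 = "\<lambda>k. (real k / real n)\<^sup>2"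
  have X: "?X k \<in> events" for k using inner_on_measurable[OF finite_atMost] by measurable
  have T: "?T c j \<in> events" for c j by measurable
  have xk: "inner_on {..n} (\<lambda>l. if l = k then 1 else 0) x = x k" if "k \<le> n" for k x
  proof -
    have "inner_on {..n} (\<lambda>l. if l = k then 1 else 0) x = (\<Sum>l\<le>n. if l = k then x l else 0)"
      unfolding inner_on_def by (intro sum.cong) auto
    thus ?thesis using that by simp
  qed
  have "{x \<in> space (gauss {..n}). \<not> good_event n x} \<subseteq> (\<Union>k\<in>{..n}. ?X k) \<union> (\<Union>j\<in>{..n\<^sup>2}. ?T ?c1 j \<union> (?T ?c2 j \<union> ?T ?c3 j))"
    using xk by (auto simp: good_event_def not_le L_def[symmetric])
  hence "prob {x \<in> space (gauss {..n}). \<not> good_event n x} \<le> prob ((\<Union>k\<in>{..n}. ?X k) \<union> (\<Union>j\<in>{..n\<^sup>2}. ?T ?c1 j \<union> (?T ?c2 j \<union> ?T ?c3 j)))"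
    using X T by (intro finite_measure_mono) auto
  also have "\<dots> \<le> prob (\<Union>k\<in>{..n}. ?X k) + prob (\<Union>j\<in>{..n\<^sup>2}. ?T ?c1 j \<union> (?T ?c2 j \<union> ?T ?c3 j))"
    using X T by (intro measure_Un_le) auto
  also have "\<dots> \<le> (\<Sum>k\<in>{..n}. 2 * exp (- L\<^sup>2 / 32)) + (\<Sum>j\<in>{..n\<^sup>2}. 4 * exp (- L\<^sup>2 / 32) + (4 * exp (- L\<^sup>2 / 32) + 4 * exp (- L\<^sup>2 / 32)))"
  proof (intro add_mono)
    have "prob (\<Union>k\<in>{..n}. ?X k) \<le> (\<Sum>k\<in>{..n}. prob (?X k))"
      using X by (intro finite_measure_subadditive_finite) auto
    also have "\<dots> \<le> (\<Sum>k\<in>{..n}. 2 * exp (- L\<^sup>2 / 32))"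
    proof (rule sum_mono)
      fix k assume "k \<in> {..n}"
      have "prob (?X k) \<le> 2 * exp (- L\<^sup>2 / 4)"
        using \<open>k \<in> {..n}\<close> L by (intro gauss_tail) (auto simp: xk)
      also have "\<dots> \<le> 2 * exp (- L\<^sup>2 / 32)" by simp
      finally show "prob (?X k) \<le> 2 * exp (- L\<^sup>2 / 32)" .
    qed
    finally show "prob (\<Union>k\<in>{..n}. ?X k) \<le> (\<Sum>k\<in>{..n}. 2 * exp (- L\<^sup>2 / 32))" .
    have "prob (\<Union>j\<in>{..n\<^sup>2}. ?T ?c1 j \<union> (?T ?c2 j \<union> ?T ?c3 j)) \<le> (\<Sum>j\<in>{..n\<^sup>2}. prob (?T ?c1 j \<union> (?T ?c2 j \<union> ?T ?c3 j)))"
      using T by (intro finite_measure_subadditive_finite) auto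
    also have "\<dots> \<le> (\<Sum>j\<in>{..n\<^sup>2}. 4 * exp (- L\<^sup>2 / 32) + (4 * exp (- L\<^sup>2 / 32) + 4 * exp (- L\<^sup>2 / 32)))"
    proof (rule sum_mono)
      fix j
      have c2: "\<bar>?c2 k\<bar> \<le> 1" "\<bar>?c3 k\<bar> \<le> 1" if "k \<le> n" for k
      proof -
        have "0 \<le> real k / real n" "real k / real n \<le> 1" using that n by auto
        thus "\<bar>?c2 k\<bar> \<le> 1" "\<bar>?c3 k\<bar> \<le> 1" by (linarith, simp add: power_le_one)
      qed
      have "prob (?T ?c1 j \<union> (?T ?c2 j \<union> ?T ?c3 j)) \<le> prob (?T ?c1 j) + (prob (?T ?c2 j) + prob (?T ?c3 j))"
        by (intro order_trans[OF measure_Un_le[OF T sets.Un[OF T T]]] add_left_mono measure_Un_le[OF T T])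
      also have "\<dots> \<le> 4 * exp (- L\<^sup>2 / 32) + (4 * exp (- L\<^sup>2 / 32) + 4 * exp (- L\<^sup>2 / 32))"
        by (intro add_mono trig_form_tail n L c2) auto
      finally show "prob (?T ?c1 j \<union> (?T ?c2 j \<union> ?T ?c3 j)) \<le> 4 * exp (- L\<^sup>2 / 32) + (4 * exp (- L\<^sup>2 / 32) + 4 * exp (- L\<^sup>2 / 32))" .
    qed
    finally show "prob (\<Union>j\<in>{..n\<^sup>2}. ?T ?c1 j \<union> (?T ?c2 j \<union> ?T ?c3 j)) \<le> (\<Sum>j\<in>{..n\<^sup>2}. 4 * exp (- L\<^sup>2 / 32) + (4 * exp (- L\<^sup>2 / 32) + 4 * exp (- L\<^sup>2 / 32)))" .
  qed
  also have "\<dots> = (2 * (real n + 1) + 12 * ((real n)\<^sup>2 + 1)) * exp (- L\<^sup>2 / 32)"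
    by (simp add: algebra_simps)
  also have "\<dots> \<le> (28 * (real n)\<^sup>2) * exp (- L\<^sup>2 / 32)"
  proof (intro mult_right_mono)
    have *: "2 * (u + 1) + 12 * (v + 1) \<le> 28 * v" if "1 \<le> u" "u \<le> v" for u v :: real using that by simp
    have "real n * 1 \<le> real n * real n" using n by (intro mult_left_mono) auto
    thus "2 * (real n + 1) + 12 * ((real n)\<^sup>2 + 1) \<le> 28 * (real n)\<^sup>2"
      using n by (intro *) (auto simp: power2_eq_square)
  qed auto
  finally show ?thesis by (simp add: L_def)
qed

section \<open>Factorial moments of the cells\<close>

lemma ln_power_over_sqrt: "(\<lambda>n. ln (real n) ^ p / sqrt (real n)) \<longlonglongrightarrow> 0"
  by real_asymp

text \<open>The first factor bounds the number of k-tuples of cells; the failure of the good event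
  may be charged to each of them.\<close>

lemma superpoly_small: "(\<lambda>n. (2 * (real n)\<^sup>2) ^ k * (28 * (real n)\<^sup>2 * exp (- (ln (real n))\<^sup>2 / 32))) \<longlonglongrightarrow> 0"
proof -
  have "(\<lambda>n. 28 * 2 ^ k * exp ((2 * real k + 2) * ln (real n) - (ln (real n))\<^sup>2 / 32)) \<longlonglongrightarrow> 0"
    by real_asymp
  moreover have "eventually (\<lambda>n. 28 * 2 ^ k * exp ((2 * real k + 2) * ln (real n) - (ln (real n))\<^sup>2 / 32)
     = (2 * (real n)\<^sup>2) ^ k * (28 * (real n)\<^sup>2 * exp (- (ln (real n))\<^sup>2 / 32))) sequentially"
    using eventually_ge_at_top[of 1]
  proof eventually_elim
    case (elim n)
    have e: "exp (real m * ln (real n)) = real n ^ m" for m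
      using elim by (simp add: exp_of_nat_mult)
    have "(2 * real k + 2) * ln (real n) - (ln (real n))\<^sup>2 / 32 = real (2 * k) * ln (real n) + real 2 * ln (real n) + - (ln (real n))\<^sup>2 / 32"
      by (simp add: algebra_simps)
    thus ?case by (simp only: exp_add e) (simp add: power_mult_distrib power_mult)
  qed
  ultimately show ?thesis by (rule Lim_transform_eventually)
qed

lemma grid_cis_sep:
  assumes i: "i \<in> bulk n" and m: "m \<in> bulk n" and n: "n \<ge> 1"
  shows "norm (cis (grid n i) - cis (grid n m)) \<ge> \<bar>grid n i - grid n m\<bar> / 2"
    and "norm (cis (grid n i) - cis (- grid n m)) \<ge> 1 / sqrt (real n)"
proof -
  have "0 < 1 / sqrt (real n)" using n by simp
  hence "\<bar>grid n i - grid n m\<bar> \<le> pi"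
    using i m unfolding bulk_def mem_Collect_eq by linarith
  thus "norm (cis (grid n i) - cis (grid n m)) \<ge> \<bar>grid n i - grid n m\<bar> / 2"
    by (rule cis_dist_ge)
  show "norm (cis (grid n i) - cis (- grid n m)) \<ge> 1 / sqrt (real n)"
    using i m by (intro cis_dist_conj_ge) (auto simp: bulk_def)
qed

lemma separated_cells:
  assumes n: "n \<ge> 3" and ab: "a \<ge> 0" "b \<ge> 0" "a + b \<le> real n"
    and big: "6144 * real k \<le> sqrt (real n)"
    and l: "length l = k" "set l \<subseteq> bulk n" "sorted_wrt (\<lambda>i m. \<not> \<bar>grid n i - grid n m\<bar> < 1 / sqrt (real n)) l"
    and \<theta>: "\<theta> = 19200 * real k * (9 + 40 * real k) * ln (real n) ^ 2 / sqrt (real n)"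
  shows "\<P>(x in gauss {..n}. \<forall>j\<in>set l. root_near n a b (grid n j) x) \<le> exp \<theta> * cell_prob n a b ^ k"
    and "exp (- \<theta>) * cell_prob n a b ^ k \<le> \<P>(x in gauss {..n}. \<forall>j\<in>set l. root_near n a b (grid n j) x)"
proof -
  \<comment> \<open>The factor 2 is lost in passing from arcs to chords. As n \<Delta> = sqrt n/2,
    the constants are 6144 = 8 x 4 x 96 x 2 and 19200 = 4 x 96 x 2 x 25.\<close>
  define \<Delta> where "\<Delta> = 1 / (2 * sqrt (real n))"
  have s0: "sqrt (real n) > 0" using n by simp
  have \<Delta>: "\<Delta> > 0" using s0 by (simp add: \<Delta>_def)
  have nD: "real n * \<Delta> = sqrt (real n) / 2"
    using s0 real_div_sqrt[of "real n"] by (simp add: \<Delta>_def)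
  have mem: "l ! i \<in> bulk n" if "i < k" for i using l that nth_mem[of i l] by auto
  have far: "1 / sqrt (real n) \<le> \<bar>grid n (l ! i) - grid n (l ! m)\<bar>"
    if "i < k" "m < k" "m \<noteq> i" for i m
  proof (cases "i < m")
    case True
    thus ?thesis using l(1,3) that by (auto simp: sorted_wrt_iff_nth_less not_less)
  next
    case False
    hence "m < i" using that by simp
    hence "1 / sqrt (real n) \<le> \<bar>grid n (l ! m) - grid n (l ! i)\<bar>"
      using l(1,3) that by (auto simp: sorted_wrt_iff_nth_less not_less)
    thus ?thesis by (simp only: abs_minus_commute)
  qed
  have sep1: "norm (cis (grid n (l ! i)) - cis (grid n (l ! m))) \<ge> \<Delta>"
    if "i < k" "m < k" "m \<noteq> i" for i m
    using grid_cis_sep(1)[OF mem[OF that(1)] mem[OF that(2)]] far[OF that] n by (simp add: \<Delta>_def)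
  have sep2: "norm (cis (grid n (l ! i)) - cis (- grid n (l ! m))) \<ge> \<Delta>" if "i < k" "m < k" for i m
  proof -
    have "\<Delta> \<le> 1 / sqrt (real n)" using s0 by (simp add: \<Delta>_def field_simps)
    thus ?thesis using grid_cis_sep(2)[OF mem[OF that(1)] mem[OF that(2)]] n by simp
  qed
  have ev: "(\<forall>j\<in>set l. root_near n a b (grid n j) x) \<longleftrightarrow> (\<forall>i<k. root_near n a b (grid n (l ! i)) x)" for x
    using l(1) by (auto simp: all_set_conv_all_nth)
  have small: "8 * real (4 * k) * (96 / (real n * \<Delta>)) \<le> 1"
    unfolding nD using big s0 by (simp add: field_simps)
  have th: "\<theta> = real (4 * k) * (9 + 10 * real (4 * k)) * (96 / (real n * \<Delta>)) * (5 * ln (real n))\<^sup>2"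
    unfolding nD \<theta> using s0 by (simp add: field_simps power_mult_distrib)
  show "\<P>(x in gauss {..n}. \<forall>j\<in>set l. root_near n a b (grid n j) x) \<le> exp \<theta> * cell_prob n a b ^ k"
    unfolding ev by (rule root_near_tuple_le[where t="\<lambda>i. grid n (l ! i)", OF sep1 sep2 \<Delta> n ab small th])
  show "exp (- \<theta>) * cell_prob n a b ^ k \<le> \<P>(x in gauss {..n}. \<forall>j\<in>set l. root_near n a b (grid n j) x)"
    unfolding ev by (rule root_near_tuple_ge[where t="\<lambda>i. grid n (l ! i)", OF sep1 sep2 \<Delta> n ab small th])
qed

text \<open>The remaining tuples are rare; for them a crude small-ball bound suffices unless two cells
  are so close that they cannot both contain a root on the good event.\<close>

lemma nonseparated_cells:
  assumes L: "L = ln (real n)" "L \<ge> 10" and ab: "0 \<le> a" "0 \<le> b" "a + \<epsilon> < pi / 2" and \<epsilon>: "0 < \<epsilon>" "\<epsilon> \<le> 1"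
    and C: "C = a + b + 1" and big: "100 * (C + 4)\<^sup>2 * L ^ 3 \<le> \<epsilon> * sqrt (real n)"
    and l: "length l = k" "distinct l" "set l \<subseteq> bulk n" and k: "2 * k \<le> n"
  shows "\<P>(x in gauss {..n}. \<forall>j\<in>set l. root_near n a b (grid n j) x)
     \<le> (8 * real k * (1024 * (real k)\<^sup>2 * L ^ 6) ^ (2 * k) * (L\<^sup>2 * (a + b)\<^sup>2) / (real n)\<^sup>2) ^ k
       + \<P>(x in gauss {..n}. \<not> good_event n x)"
proof -
  interpret prob_space "gauss {..n}" by (rule prob_space_gauss)
  have n: "n \<ge> 1" using L by (cases n) auto
  have s0: "sqrt (real n) > 0" using n by simp
  let ?S = "{x \<in> space (gauss {..n}). \<forall>j\<in>set l. root_near n a b (grid n j) x}"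
  have mem: "l ! i \<in> bulk n" if "i < k" for i using l that nth_mem[of i l] by auto
  show ?thesis
  proof (cases "\<forall>i<k. \<forall>m<k. m \<noteq> i \<longrightarrow> 1 / (real n * L ^ 3) \<le> \<bar>grid n (l ! i) - grid n (l ! m)\<bar>")
    case True
    \<comment> \<open>At this separation \<mu> is 1/(2 L^3), so the small-ball bound loses only
      powers of ln n.\<close>
    define \<Delta> where "\<Delta> = 1 / (2 * (real n * L ^ 3))"
    have L3: "L ^ 3 \<ge> 1" using L(2) by (intro one_le_power) auto
    have \<Delta>: "\<Delta> > 0" using n L(2) unfolding \<Delta>_def by (intro divide_pos_pos mult_pos_pos) auto
    have sep1: "norm (cis (grid n (l ! i)) - cis (grid n (l ! m))) \<ge> \<Delta>"
      if "i < k" "m < k" "m \<noteq> i" for i m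
    proof -
      have "1 / (real n * L ^ 3) \<le> \<bar>grid n (l ! i) - grid n (l ! m)\<bar>" using True that by blast
      hence "1 / (real n * L ^ 3) / 2 \<le> norm (cis (grid n (l ! i)) - cis (grid n (l ! m)))"
        by (intro order_trans[OF divide_right_mono grid_cis_sep(1)[OF mem[OF that(1)] mem[OF that(2)] n]]) auto
      thus ?thesis by (simp add: \<Delta>_def mult.commute)
    qed
    have sn: "sqrt (real n) \<le> real n"
    proof -
      have "sqrt (real n) * 1 \<le> sqrt (real n) * sqrt (real n)" using n by (intro mult_left_mono) auto
      thus ?thesis by simp
    qed
    have sep2: "norm (cis (grid n (l ! i)) - cis (- grid n (l ! m))) \<ge> \<Delta>" if "i < k" "m < k" for i m
    proof -
      have "sqrt (real n) * 1 \<le> real n * (2 * L ^ 3)" using sn L3 by (intro mult_mono) auto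
      hence "\<Delta> \<le> 1 / sqrt (real n)"
        unfolding \<Delta>_def using s0 L(2) by (intro divide_left_mono) (auto simp: mult_ac intro!: mult_pos_pos)
      thus ?thesis using grid_cis_sep(2)[OF mem[OF that(1)] mem[OF that(2)] n] by simp
    qed
    \<comment> \<open>\<open>root_cond\<close> gives |U| \<le> |H| (a+b)/n with |H| \<le> L;
      multiplication by sqrt n turns U into the trigonometric sum.\<close>
    define \<rho> where "\<rho> = L * (a + b) / sqrt (real n)"
    have \<rho>: "\<rho> \<ge> 0" using L ab by (simp add: \<rho>_def)
    define \<mu> where "\<mu> = min 1 (real n * \<Delta>)"
    have "real n * \<Delta> = 1 / (2 * L ^ 3)" using n by (simp add: \<Delta>_def)
    moreover have "1 / (2 * y) \<le> 1" if "1 \<le> y" for y :: real using that by (simp add: field_simps)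
    note this[OF L3]
    ultimately have \<mu>: "\<mu> = 1 / (2 * L ^ 3)" by (simp add: \<mu>_def)
    have "prob ?S \<le> prob {x \<in> space (gauss {..n}). \<forall>i<k. norm (trig_form n x (grid n (l ! i))) \<le> \<rho>}"
    proof (rule finite_measure_mono)
      show "?S \<subseteq> {x \<in> space (gauss {..n}). \<forall>i<k. norm (trig_form n x (grid n (l ! i))) \<le> \<rho>}"
      proof safe
        fix x i assume x: "\<forall>j\<in>set l. root_near n a b (grid n j) x" and i: "i < k"
        define U where "U = trig_form n x (grid n (l ! i)) / of_real (sqrt (real n))"
        define H where "H = trig_form n (\<lambda>k. (real k / real n - 1/2) * x k) (grid n (l ! i)) / of_real (sqrt (real n))"
        have rc: "root_cond n a b U H" using x i l(1) by (auto simp: root_near_def U_def H_def)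
        have H: "norm H \<le> L" "norm H > 0"
          using rc L by (auto simp: root_cond_def intro: less_le_trans[OF divide_pos_pos[OF zero_less_one]])
        have "norm (\<i> * U / H) \<le> \<bar>Re (\<i> * U / H)\<bar> + \<bar>Im (\<i> * U / H)\<bar>" by (rule cmod_le)
        also have "\<dots> \<le> (a + b) / real n" using rc by (auto simp: root_cond_def add_divide_distrib)
        finally have "norm U \<le> (a + b) / real n * norm H" using H by (simp add: norm_mult norm_divide divide_le_eq)
        also have "\<dots> \<le> (a + b) / real n * L" using H ab by (intro mult_left_mono) auto
        finally have "norm U * sqrt (real n) \<le> (a + b) / real n * L * sqrt (real n)"
          using s0 by (intro mult_right_mono) auto
        also have "\<dots> = L * (a + b) * (sqrt (real n) / real n)" by simp
        also have "sqrt (real n) / real n = 1 / sqrt (real n)" using s0 by (simp add: field_simps)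
        finally show "norm (trig_form n x (grid n (l ! i))) \<le> \<rho>"
          using s0 by (simp add: U_def \<rho>_def norm_divide)
      qed
      have "{x \<in> space (gauss {..n}). \<forall>i\<in>{..<k}. norm (trig_form n x (grid n (l ! i))) \<le> \<rho>} \<in> events" by measurable
      thus "{x \<in> space (gauss {..n}). \<forall>i<k. norm (trig_form n x (grid n (l ! i))) \<le> \<rho>} \<in> events"
        by (simp only: Ball_def lessThan_iff)
    qed
    also have "\<dots> \<le> (8 * real k / real n * (256 * (real k)\<^sup>2 / \<mu>\<^sup>2) ^ (2 * k) * \<rho>\<^sup>2) ^ k"
      by (rule trig_small_ball[where t="\<lambda>i. grid n (l ! i)", OF sep1 sep2 \<Delta> k n \<mu>_def \<rho>])
    also have "256 * (real k)\<^sup>2 / \<mu>\<^sup>2 = 1024 * (real k)\<^sup>2 * L ^ 6"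
    proof -
      have "(L ^ 3)\<^sup>2 = L ^ 6" by (simp flip: power_mult)
      thus ?thesis by (simp add: \<mu> power_divide power_mult_distrib)
    qed
    also have "\<rho>\<^sup>2 = L\<^sup>2 * (a + b)\<^sup>2 / real n"
      using n by (simp add: \<rho>_def power_divide power_mult_distrib)
    also have "8 * real k / real n * (1024 * (real k)\<^sup>2 * L ^ 6) ^ (2 * k) * (L\<^sup>2 * (a + b)\<^sup>2 / real n)
       = 8 * real k * (1024 * (real k)\<^sup>2 * L ^ 6) ^ (2 * k) * (L\<^sup>2 * (a + b)\<^sup>2) / (real n)\<^sup>2"
      by (simp add: power2_eq_square)
    finally show ?thesis
      using measure_nonneg[of "gauss {..n}" "{x \<in> space (gauss {..n}). \<not> good_event n x}"] by linarith
  next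
    case False
    then obtain i m where im: "i < k" "m < k" "m \<noteq> i" "\<not> 1 / (real n * L ^ 3) \<le> \<bar>grid n (l ! i) - grid n (l ! m)\<bar>" by blast
    have ne: "l ! i \<noteq> l ! m" using l im by (simp add: nth_eq_iff_index_eq)
    have "?S \<subseteq> {x \<in> space (gauss {..n}). \<not> good_event n x}"
    proof safe
      fix x assume x: "\<forall>j\<in>set l. root_near n a b (grid n j) x" and g: "good_event n x"
      interpret gs: good_sample n x C \<epsilon> L
        using g L \<epsilon> big ab C by unfold_locales auto
      have "1 / (real n * L ^ 3) \<le> \<bar>grid n (l ! i) - grid n (l ! m)\<bar>"
      proof (rule gs.close_cells_exclusive[of "l ! i" "l ! m" a b])
        show "root_cond n a b (gs.U (grid n (l ! i))) (gs.H (grid n (l ! i)))"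
             "root_cond n a b (gs.U (grid n (l ! m))) (gs.H (grid n (l ! m)))"
          using x im l(1) by (auto simp: root_near_def gs.U_def gs.H_def)
      qed (use mem[OF im(1)] mem[OF im(2)] ab C ne in \<open>auto simp: bulk_def\<close>)
      thus False using im by blast
    qed
    hence "prob ?S \<le> prob {x \<in> space (gauss {..n}). \<not> good_event n x}" by (intro finite_measure_mono) auto
    moreover have "0 \<le> (8 * real k * (1024 * (real k)\<^sup>2 * L ^ 6) ^ (2 * k) * (L\<^sup>2 * (a + b)\<^sup>2) / (real n)\<^sup>2) ^ k"
      using L by simp
    ultimately show ?thesis by linarith
  qed
qed

text \<open>Separated tuples contribute the number of bulk cells times the cell probability, to the
  power k, up to factors exp (\<plusminus>\<theta>) tending to 1. The other tuples are fewer by a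
  factor of order 1/sqrt n, and each has probability at most n^(-2k) times powers of ln n, plus the
  failure probability of the good event, so their sum vanishes.\<close>

theorem cell_factorial_moments:
  assumes ab: "0 \<le> a" "0 \<le> b" "a < pi / 2"
  shows "(\<lambda>n. \<Sum>l | length l = k \<and> distinct l \<and> set l \<subseteq> bulk n.
      \<P>(x in gauss {..n}. \<forall>j\<in>set l. root_near n a b (grid n j) x)) \<longlonglongrightarrow> (a * b / (3 * pi)) ^ k"
proof -
  define W where "W n = (\<Sum>l | length l = k \<and> distinct l \<and> set l \<subseteq> bulk n.
      \<P>(x in gauss {..n}. \<forall>j\<in>set l. root_near n a b (grid n j) x))" for n
  \<comment> \<open>Half of the gap below pi/2, so that a + \<epsilon> < pi/2 and close cells
    exclude each other.\<close>
  define \<epsilon> where "\<epsilon> = min 1 ((pi / 2 - a) / 2)"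
  have \<epsilon>: "0 < \<epsilon>" "\<epsilon> \<le> 1" "a + \<epsilon> < pi / 2"
    using ab by (auto simp: \<epsilon>_def min_def field_simps)
  define C where "C = a + b + 1"
  define near where "near n i m \<longleftrightarrow> \<bar>grid n i - grid n m\<bar> < 1 / sqrt (real n)" for n i m
  define q where "q n = cell_prob n a b" for n
  have q0: "q n \<ge> 0" for n by (simp add: q_def cell_prob_def)
  define \<theta> where "\<theta> n = 19200 * real k * (9 + 40 * real k) * ln (real n) ^ 2 / sqrt (real n)" for n
  define E where "E n = 8 * real k * (1024 * (real k)\<^sup>2 * ln (real n) ^ 6) ^ (2 * k) * ((ln (real n))\<^sup>2 * (a + b)\<^sup>2)" for n
  define \<omega> where "\<omega> n = 28 * (real n)\<^sup>2 * exp (- (ln (real n))\<^sup>2 / 32)" for n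
  \<comment> \<open>\<open>N\<close> bounds the number of bulk cells and \<open>c\<close> the number
    of cells near a given one; the ratio of \<open>c\<close> to \<open>N\<close> is the saving of
    order 1/sqrt n on nonseparated tuples.\<close>
  define N where "N n = 2 * (real n)\<^sup>2" for n
  define c where "c n = 3 * (real n * sqrt (real n))" for n
  define ns where "ns n = real (card {l. length l = k \<and> set l \<subseteq> bulk n \<and> \<not> sorted_wrt (\<lambda>i m. \<not> near n i m) l})" for n
  define b0 where "b0 n = real (card (bulk n))" for n
  have nsb: "ns n * N n \<le> (real k)\<^sup>2 * c n * N n ^ k" if n: "n \<ge> 1" for n
    unfolding ns_def
  proof (rule card_lists_nonseparated[OF finite_bulk])
    show "real (card {m \<in> bulk n. near n i m}) \<le> c n" for i
      using card_bulk(3)[OF n, of i] by (simp add: near_def c_def)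
    show "near n i m = near n m i" for i m by (simp add: near_def abs_minus_commute)
    have "1 \<le> (real n)\<^sup>2" using n by simp
    thus "real (card (bulk n)) \<le> N n" using card_bulk(1)[OF n] by (simp add: N_def)
    show "c n \<ge> 0" by (simp add: c_def)
  qed
  have nsb': "ns n \<le> (real k)\<^sup>2 * (c n / N n) * N n ^ k" if n: "n \<ge> 1" for n
  proof -
    have "N n > 0" using n by (simp add: N_def)
    thus ?thesis using nsb[OF n] by (simp add: field_simps)
  qed
  have bounds: "(b0 n ^ k - ns n) * (exp (- \<theta> n) * q n ^ k) \<le> W n \<and>
       W n \<le> b0 n ^ k * (exp (\<theta> n) * q n ^ k) + ns n * ((E n / (real n)\<^sup>2) ^ k + \<omega> n)"
    if n: "n \<ge> 3" "a + b \<le> real n" "6144 * real k \<le> sqrt (real n)" "10 \<le> ln (real n)"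
      "100 * (C + 4)\<^sup>2 * ln (real n) ^ 3 \<le> \<epsilon> * sqrt (real n)" "2 * k \<le> n" for n
  proof -
    let ?D = "{l. length l = k \<and> distinct l \<and> set l \<subseteq> bulk n}"
    let ?S = "{l. length l = k \<and> set l \<subseteq> bulk n \<and> sorted_wrt (\<lambda>i m. \<not> near n i m) l}"
    let ?NS = "{l. length l = k \<and> set l \<subseteq> bulk n \<and> \<not> sorted_wrt (\<lambda>i m. \<not> near n i m) l}"
    let ?A = "{l. set l \<subseteq> bulk n \<and> length l = k}"
    let ?P = "\<lambda>l. \<P>(x in gauss {..n}. \<forall>j\<in>set l. root_near n a b (grid n j) x)"
    have fA: "finite ?A" by (rule finite_lists_length_eq[OF finite_bulk])
    have fS: "finite ?S" "finite ?NS" "finite ?D" by (auto intro: finite_subset[OF _ fA])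
    have SD: "?S \<subseteq> ?D"
    proof safe
      fix l assume "sorted_wrt (\<lambda>i m. \<not> near n i m) l"
      moreover have "near n i i" for i using n by (simp add: near_def)
      ultimately show "distinct l" by (induction l) auto
    qed
    have "?A = ?S \<union> ?NS" "?S \<inter> ?NS = {}" by auto
    hence "card ?A = card ?S + card ?NS" using fS by (simp add: card_Un_disjoint)
    hence cS: "real (card ?S) = b0 n ^ k - ns n"
      unfolding b0_def ns_def by (simp add: card_lists_length_eq[OF finite_bulk] flip: of_nat_power)
    have S1: "exp (- \<theta> n) * q n ^ k \<le> ?P l \<and> ?P l \<le> exp (\<theta> n) * q n ^ k"
      if "l \<in> ?S" for l
    proof -
      have l: "length l = k" "set l \<subseteq> bulk n" "sorted_wrt (\<lambda>i m. \<not> \<bar>grid n i - grid n m\<bar> < 1 / sqrt (real n)) l"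
        using that by (auto simp: near_def)
      show ?thesis unfolding q_def
        using separated_cells[OF n(1) ab(1,2) n(2,3) l \<theta>_def] by blast
    qed
    have S2: "?P l \<le> (E n / (real n)\<^sup>2) ^ k + \<omega> n" if "l \<in> ?D" for l
    proof -
      have "?P l \<le> (8 * real k * (1024 * (real k)\<^sup>2 * ln (real n) ^ 6) ^ (2 * k) * ((ln (real n))\<^sup>2 * (a + b)\<^sup>2) / (real n)\<^sup>2) ^ k
       + \<P>(x in gauss {..n}. \<not> good_event n x)"
        by (rule nonseparated_cells[OF refl n(4) ab(1,2) \<epsilon>(3,1,2) C_def n(5)]) (use that n in auto)
      moreover have "\<P>(x in gauss {..n}. \<not> good_event n x) \<le> \<omega> n"
        unfolding \<omega>_def using n by (intro good_event_prob) auto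
      ultimately show ?thesis by (simp add: E_def)
    qed
    have W: "W n = (\<Sum>l\<in>?S. ?P l) + (\<Sum>l\<in>?D - ?S. ?P l)"
      unfolding W_def by (subst sum.subset_diff[OF SD fS(3)]) (rule add.commute)
    have "(\<Sum>l\<in>?D - ?S. ?P l) \<le> real (card (?D - ?S)) * ((E n / (real n)\<^sup>2) ^ k + \<omega> n)"
      by (rule sum_bounded_above) (use S2 in auto)
    also have "\<dots> \<le> ns n * ((E n / (real n)\<^sup>2) ^ k + \<omega> n)"
    proof (rule mult_right_mono)
      have "card (?D - ?S) \<le> card ?NS" by (rule card_mono[OF fS(2)]) auto
      thus "real (card (?D - ?S)) \<le> ns n" by (simp add: ns_def)
    qed (use n in \<open>auto simp: E_def \<omega>_def\<close>)
    finally have u1: "(\<Sum>l\<in>?D - ?S. ?P l) \<le> ns n * ((E n / (real n)\<^sup>2) ^ k + \<omega> n)" .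
    have "(\<Sum>l\<in>?S. ?P l) \<le> real (card ?S) * (exp (\<theta> n) * q n ^ k)"
      by (rule sum_bounded_above) (use S1 in auto)
    also have "\<dots> \<le> b0 n ^ k * (exp (\<theta> n) * q n ^ k)"
      unfolding cS using q0[of n] by (intro mult_right_mono) (auto simp: ns_def)
    finally have u2: "(\<Sum>l\<in>?S. ?P l) \<le> b0 n ^ k * (exp (\<theta> n) * q n ^ k)" .
    have "real (card ?S) * (exp (- \<theta> n) * q n ^ k) \<le> (\<Sum>l\<in>?S. ?P l)"
      by (rule sum_bounded_below) (use S1 in auto)
    moreover have "0 \<le> (\<Sum>l\<in>?D - ?S. ?P l)" by (intro sum_nonneg) auto
    ultimately show ?thesis using u1 u2 unfolding W cS by linarith
  qed
  have lim_q: "(\<lambda>n. (real n)\<^sup>2 * q n) \<longlonglongrightarrow> a * b / (3 * pi)"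
    unfolding q_def by (rule cell_prob_asymptotics[OF ab(1,2)])
  have lim_b: "(\<lambda>n. b0 n / (real n)\<^sup>2) \<longlonglongrightarrow> 1"
  proof (rule tendsto_sandwich)
    show "(\<lambda>n. ((real n)\<^sup>2 - 4 * (real n * sqrt (real n)) - 2) / (real n)\<^sup>2) \<longlonglongrightarrow> 1"
      by real_asymp
    show "(\<lambda>n. ((real n)\<^sup>2 + 1) / (real n)\<^sup>2) \<longlonglongrightarrow> 1" by real_asymp
    show "eventually (\<lambda>n. ((real n)\<^sup>2 - 4 * (real n * sqrt (real n)) - 2) / (real n)\<^sup>2 \<le> b0 n / (real n)\<^sup>2) sequentially"
      using eventually_ge_at_top[of 1] by eventually_elim (auto simp: b0_def intro!: divide_right_mono card_bulk(2))
    show "eventually (\<lambda>n. b0 n / (real n)\<^sup>2 \<le> ((real n)\<^sup>2 + 1) / (real n)\<^sup>2) sequentially"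
      using eventually_ge_at_top[of 1] by eventually_elim (auto simp: b0_def intro!: divide_right_mono card_bulk(1))
  qed
  have lim_\<theta>: "\<theta> \<longlonglongrightarrow> 0"
    using tendsto_mult_right_zero[OF ln_power_over_sqrt[of 2], of "19200 * real k * (9 + 40 * real k)"]
      by (simp add: \<theta>_def[abs_def])
  have bq: "(\<lambda>n. b0 n ^ k * q n ^ k) \<longlonglongrightarrow> (a * b / (3 * pi)) ^ k"
  proof -
    have "(\<lambda>n. (b0 n / (real n)\<^sup>2 * ((real n)\<^sup>2 * q n)) ^ k) \<longlonglongrightarrow> (1 * (a * b / (3 * pi))) ^ k"
      by (intro tendsto_power tendsto_mult lim_b lim_q)
    moreover have "eventually (\<lambda>n. (b0 n / (real n)\<^sup>2 * ((real n)\<^sup>2 * q n)) ^ k = b0 n ^ k * q n ^ k) sequentially"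
      using eventually_ge_at_top[of 1] by eventually_elim (simp add: power_mult_distrib)
    ultimately show ?thesis by (simp add: tendsto_cong)
  qed
  have cN: "(\<lambda>n. c n / N n) \<longlonglongrightarrow> 0" unfolding c_def N_def by real_asymp
  \<comment> \<open>All three error terms have this form: N^k X is bounded for X = q^k,
    polylogarithmic for the small-ball term, and superpolynomially small for the good event.\<close>
  have nsX: "(\<lambda>n. ns n * X n) \<longlonglongrightarrow> 0"
    if X: "(\<lambda>n. (c n / N n) * (N n ^ k * X n)) \<longlonglongrightarrow> 0" "\<And>n. X n \<ge> 0" for X
  proof (rule tendsto_sandwich[OF _ _ tendsto_const tendsto_mult_right_zero[OF X(1), of "(real k)\<^sup>2"]])
    show "eventually (\<lambda>n. 0 \<le> ns n * X n) sequentially" using X(2) by (simp add: ns_def)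
    show "eventually (\<lambda>n. ns n * X n \<le> (real k)\<^sup>2 * ((c n / N n) * (N n ^ k * X n))) sequentially"
      using eventually_ge_at_top[of 1]
    proof eventually_elim
      case (elim n)
      have "ns n * X n \<le> ((real k)\<^sup>2 * (c n / N n) * N n ^ k) * X n"
        using nsb'[OF elim] X(2) by (intro mult_right_mono) auto
      thus ?case by (simp add: mult_ac)
    qed
  qed
  have ns1: "(\<lambda>n. ns n * q n ^ k) \<longlonglongrightarrow> 0"
  proof (rule nsX)
    have "(\<lambda>n. (c n / N n) * (2 * ((real n)\<^sup>2 * q n)) ^ k) \<longlonglongrightarrow> 0 * (2 * (a * b / (3 * pi))) ^ k"
      by (intro tendsto_intros cN lim_q)
    thus "(\<lambda>n. (c n / N n) * (N n ^ k * q n ^ k)) \<longlonglongrightarrow> 0"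
      by (simp add: N_def power_mult_distrib mult_ac)
  qed (simp add: q0)
  have ns2: "(\<lambda>n. ns n * (E n / (real n)\<^sup>2) ^ k) \<longlonglongrightarrow> 0"
  proof (rule nsX)
    define A where "A = 8 * real k * (1024 * (real k)\<^sup>2) ^ (2 * k) * (a + b)\<^sup>2"
    define K where "K = 3 / 2 * (2 * A) ^ k"
    have "(\<lambda>n. K * (ln (real n) ^ ((12 * k + 2) * k) / sqrt (real n))) \<longlonglongrightarrow> 0"
      by (rule tendsto_mult_right_zero[OF ln_power_over_sqrt])
    moreover have "eventually (\<lambda>n. K * (ln (real n) ^ ((12 * k + 2) * k) / sqrt (real n)) = (c n / N n) * (N n ^ k * (E n / (real n)\<^sup>2) ^ k)) sequentially"
      using eventually_ge_at_top[of 1]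
    proof eventually_elim
      case (elim n)
      have cn: "c n / N n = 3 / 2 / sqrt (real n)"
        using elim by (simp add: c_def N_def field_simps power2_eq_square)
      have X: "(ln (real n) ^ 6) ^ (2 * k) * ln (real n) ^ 2 = ln (real n) ^ (12 * k + 2)"
        by (simp add: power_add power2_eq_square flip: power_mult)
      have En: "E n = A * ln (real n) ^ (12 * k + 2)"
        unfolding E_def A_def power_mult_distrib[of _ "ln (real n) ^ 6"] X[symmetric] by (simp only: mult_ac)
      have "(2 * E n) ^ k = (2 * A) ^ k * ln (real n) ^ ((12 * k + 2) * k)"
        unfolding En by (simp only: mult.assoc[symmetric] power_mult_distrib power_mult)
      moreover have "N n ^ k * (E n / (real n)\<^sup>2) ^ k = (2 * E n) ^ k"
        unfolding power_mult_distrib[symmetric] using elim by (simp add: N_def)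
      ultimately show ?case unfolding cn K_def by (simp only: times_divide_eq_left times_divide_eq_right mult.assoc)
    qed
    ultimately show "(\<lambda>n. (c n / N n) * (N n ^ k * (E n / (real n)\<^sup>2) ^ k)) \<longlonglongrightarrow> 0"
      by (rule Lim_transform_eventually)
    show "(E n / (real n)\<^sup>2) ^ k \<ge> 0" for n
      unfolding E_def by (intro zero_le_power divide_nonneg_nonneg mult_nonneg_nonneg zero_le_even_power) auto
  qed
  have ns3: "(\<lambda>n. ns n * \<omega> n) \<longlonglongrightarrow> 0"
  proof (rule nsX)
    have "(\<lambda>n. (c n / N n) * ((2 * (real n)\<^sup>2) ^ k * \<omega> n)) \<longlonglongrightarrow> 0 * 0"
      unfolding \<omega>_def by (intro tendsto_mult cN superpoly_small)
    thus "(\<lambda>n. (c n / N n) * (N n ^ k * \<omega> n)) \<longlonglongrightarrow> 0" by (simp add: N_def)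
  qed (simp add: \<omega>_def)
  have ev: "eventually (\<lambda>n. n \<ge> 3 \<and> a + b \<le> real n \<and> 6144 * real k \<le> sqrt (real n) \<and> 10 \<le> ln (real n) \<and>
      100 * (C + 4)\<^sup>2 * ln (real n) ^ 3 \<le> \<epsilon> * sqrt (real n) \<and> 2 * k \<le> n) sequentially"
  proof (intro eventually_conj)
    show "eventually (\<lambda>n. n \<ge> 3) sequentially" by (rule eventually_ge_at_top)
    show "eventually (\<lambda>n. 2 * k \<le> n) sequentially" by (rule eventually_ge_at_top)
    have "filterlim real at_top sequentially" by (rule filterlim_real_sequentially)
    thus "eventually (\<lambda>n. a + b \<le> real n) sequentially" by (simp add: filterlim_at_top)
    have "filterlim (\<lambda>n. sqrt (real n)) at_top sequentially" by real_asymp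
    thus "eventually (\<lambda>n. 6144 * real k \<le> sqrt (real n)) sequentially" by (simp add: filterlim_at_top)
    have "filterlim (\<lambda>n. ln (real n)) at_top sequentially" by real_asymp
    thus "eventually (\<lambda>n. 10 \<le> ln (real n)) sequentially" by (simp add: filterlim_at_top)
    have "eventually (\<lambda>n. 100 * (C + 4)\<^sup>2 * (ln (real n) ^ 3 / sqrt (real n)) < \<epsilon>) sequentially"
      using tendsto_mult_right_zero[OF ln_power_over_sqrt[of 3]] \<epsilon>(1) by (rule order_tendstoD)
    thus "eventually (\<lambda>n. 100 * (C + 4)\<^sup>2 * ln (real n) ^ 3 \<le> \<epsilon> * sqrt (real n)) sequentially"
      using eventually_ge_at_top[of 1] by eventually_elim (simp add: field_simps)
  qed
  have "W \<longlonglongrightarrow> (a * b / (3 * pi)) ^ k"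
  proof (rule tendsto_sandwich)
    show "eventually (\<lambda>n. (b0 n ^ k * q n ^ k - ns n * q n ^ k) * exp (- \<theta> n) \<le> W n) sequentially"
      using ev by eventually_elim (use bounds in \<open>auto simp: algebra_simps\<close>)
    show "eventually (\<lambda>n. W n \<le> (b0 n ^ k * q n ^ k) * exp (\<theta> n) + (ns n * (E n / (real n)\<^sup>2) ^ k + ns n * \<omega> n)) sequentially"
      using ev by eventually_elim (use bounds in \<open>auto simp: algebra_simps\<close>)
    have "(\<lambda>n. (b0 n ^ k * q n ^ k - ns n * q n ^ k) * exp (- \<theta> n)) \<longlonglongrightarrow> ((a * b / (3 * pi)) ^ k - 0) * exp (- 0)"
      by (intro tendsto_intros bq ns1 lim_\<theta>)
    thus "(\<lambda>n. (b0 n ^ k * q n ^ k - ns n * q n ^ k) * exp (- \<theta> n)) \<longlonglongrightarrow> (a * b / (3 * pi)) ^ k" by simp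
    have "(\<lambda>n. (b0 n ^ k * q n ^ k) * exp (\<theta> n) + (ns n * (E n / (real n)\<^sup>2) ^ k + ns n * \<omega> n)) \<longlonglongrightarrow> (a * b / (3 * pi)) ^ k * exp 0 + (0 + 0)"
      by (intro tendsto_intros bq ns2 ns3 lim_\<theta>)
    thus "(\<lambda>n. (b0 n ^ k * q n ^ k) * exp (\<theta> n) + (ns n * (E n / (real n)\<^sup>2) ^ k + ns n * \<omega> n)) \<longlonglongrightarrow> (a * b / (3 * pi)) ^ k" by simp
  qed
  thus ?thesis unfolding W_def .
qed

lemma no_cell_limit:
  assumes ab: "0 \<le> a" "0 \<le> b" "a < pi / 2"
  shows "(\<lambda>n. \<P>(x in gauss {..n}. \<forall>j\<in>bulk n. \<not> root_near n a b (grid n j) x))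
     \<longlonglongrightarrow> exp (- (a * b / (3 * pi)))"
proof -
  define A where "A n j = {x \<in> space (gauss {..n}). root_near n a b (grid n j) x}" for n j
  have eq: "{x \<in> space (gauss {..n}). \<forall>j\<in>S. x \<in> A n j} = {x \<in> space (gauss {..n}). \<forall>j\<in>S. root_near n a b (grid n j) x}" for n S
    by (auto simp: A_def)
  have eq': "{x \<in> space (gauss {..n}). \<forall>j\<in>S. x \<notin> A n j} = {x \<in> space (gauss {..n}). \<forall>j\<in>S. \<not> root_near n a b (grid n j) x}" for n S
    by (auto simp: A_def)
  have "A n j \<in> sets (gauss {..n})" for n j unfolding A_def by measurable
  from poisson_void_probability[of "\<lambda>n. gauss {..n}" bulk A "a * b / (3 * pi)", OF prob_space_gauss finite_bulk this]
  show ?thesis unfolding eq eq' using cell_factorial_moments[OF ab] by blast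
qed

lemma eventually_polylog:
  assumes "\<delta> > 0"
  shows "eventually (\<lambda>n. K * ln (real n) ^ p \<le> \<delta> * sqrt (real n)) sequentially"
proof -
  have "eventually (\<lambda>n. K * (ln (real n) ^ p / sqrt (real n)) < \<delta>) sequentially"
    using tendsto_mult_right_zero[OF ln_power_over_sqrt[of p]] assms by (rule order_tendstoD)
  thus ?thesis using eventually_ge_at_top[of 1] by eventually_elim (simp add: field_simps)
qed

lemma eventually_ln_ge: "eventually (\<lambda>n. K \<le> ln (real n)) sequentially"
proof -
  have "filterlim (\<lambda>n. ln (real n)) at_top sequentially" by real_asymp
  thus ?thesis by (simp add: filterlim_at_top)
qed

lemma eventually_le_real: "eventually (\<lambda>n. K \<le> real n) sequentially"
  using filterlim_real_sequentially by (simp add: filterlim_at_top)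

lemma bulk_ratio: "(\<lambda>n. real (card (bulk n)) / (real n)\<^sup>2) \<longlonglongrightarrow> 1"
proof (rule tendsto_sandwich)
  show "(\<lambda>n. ((real n)\<^sup>2 - 4 * (real n * sqrt (real n)) - 2) / (real n)\<^sup>2) \<longlonglongrightarrow> 1"
    by real_asymp
  show "(\<lambda>n. ((real n)\<^sup>2 + 1) / (real n)\<^sup>2) \<longlonglongrightarrow> 1" by real_asymp
  show "eventually (\<lambda>n. ((real n)\<^sup>2 - 4 * (real n * sqrt (real n)) - 2) / (real n)\<^sup>2 \<le> real (card (bulk n)) / (real n)\<^sup>2) sequentially"
    using eventually_ge_at_top[of 1] by eventually_elim (auto intro!: divide_right_mono card_bulk(2))
  show "eventually (\<lambda>n. real (card (bulk n)) / (real n)\<^sup>2 \<le> ((real n)\<^sup>2 + 1) / (real n)\<^sup>2) sequentially"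
    using eventually_ge_at_top[of 1] by eventually_elim (auto intro!: divide_right_mono card_bulk(1))
qed

text \<open>Single cells need no exclusivity, so \<open>a\<close> may exceed pi/2 here. The upper
  bound for the distance uses this with windows slightly wider than the cells.\<close>

lemma cell_first_moment:
  assumes ab: "0 \<le> a" "0 \<le> b"
  shows "(\<lambda>n. \<Sum>j\<in>bulk n. \<P>(x in gauss {..n}. root_near n a b (grid n j) x)) \<longlonglongrightarrow> a * b / (3 * pi)"
proof -
  define \<theta> where "\<theta> n = 19200 * real 1 * (9 + 40 * real 1) * ln (real n) ^ 2 / sqrt (real n)" for n
  have \<theta>: "\<theta> \<longlonglongrightarrow> 0"
    using tendsto_mult_right_zero[OF ln_power_over_sqrt[of 2], of "19200 * real 1 * (9 + 40 * real 1)"]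
      by (simp add: \<theta>_def[abs_def])
  let ?P = "\<lambda>n j. \<P>(x in gauss {..n}. root_near n a b (grid n j) x)"
  let ?q = "\<lambda>n. cell_prob n a b"
  have bq: "(\<lambda>n. real (card (bulk n)) * ?q n) \<longlonglongrightarrow> a * b / (3 * pi)"
  proof -
    have "(\<lambda>n. real (card (bulk n)) / (real n)\<^sup>2 * ((real n)\<^sup>2 * ?q n)) \<longlonglongrightarrow> 1 * (a * b / (3 * pi))"
      by (intro tendsto_mult bulk_ratio cell_prob_asymptotics ab)
    moreover have "eventually (\<lambda>n. real (card (bulk n)) / (real n)\<^sup>2 * ((real n)\<^sup>2 * ?q n) = real (card (bulk n)) * ?q n) sequentially"
      using eventually_ge_at_top[of 1] by eventually_elim simp
    ultimately show ?thesis by (simp add: tendsto_cong)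
  qed
  have ev: "eventually (\<lambda>n. n \<ge> 3 \<and> a + b \<le> real n \<and> 6144 * real 1 \<le> sqrt (real n)) sequentially"
    using eventually_ge_at_top[of 3] eventually_le_real[of "a + b"] eventually_polylog[OF zero_less_one, of "6144 * real 1" 0]
    by eventually_elim auto
  have bd: "exp (- \<theta> n) * ?q n \<le> ?P n j \<and> ?P n j \<le> exp (\<theta> n) * ?q n"
    if "n \<ge> 3 \<and> a + b \<le> real n \<and> 6144 * real 1 \<le> sqrt (real n)" "j \<in> bulk n" for n j
    using separated_cells[of n a b 1 "[j]", OF _ ab _ _ _ _ _ \<theta>_def] that by simp
  show ?thesis
  proof (rule tendsto_sandwich)
    show "eventually (\<lambda>n. (real (card (bulk n)) * ?q n) * exp (- \<theta> n) \<le> (\<Sum>j\<in>bulk n. ?P n j)) sequentially"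
      using ev
    proof eventually_elim
      case (elim n)
      have "(\<Sum>j\<in>bulk n. exp (- \<theta> n) * ?q n) \<le> (\<Sum>j\<in>bulk n. ?P n j)"
        by (intro sum_mono) (use bd elim in blast)
      thus ?case by (simp add: mult_ac)
    qed
    show "eventually (\<lambda>n. (\<Sum>j\<in>bulk n. ?P n j) \<le> (real (card (bulk n)) * ?q n) * exp (\<theta> n)) sequentially"
      using ev
    proof eventually_elim
      case (elim n)
      have "(\<Sum>j\<in>bulk n. ?P n j) \<le> (\<Sum>j\<in>bulk n. exp (\<theta> n) * ?q n)"
        by (intro sum_mono) (use bd elim in blast)
      thus ?case by (simp add: mult_ac)
    qed
    have "(\<lambda>n. (real (card (bulk n)) * ?q n) * exp (- \<theta> n)) \<longlonglongrightarrow> a * b / (3 * pi) * exp (- 0)"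
      by (intro tendsto_intros bq \<theta>)
    thus "(\<lambda>n. (real (card (bulk n)) * ?q n) * exp (- \<theta> n)) \<longlonglongrightarrow> a * b / (3 * pi)"
      by simp
    have "(\<lambda>n. (real (card (bulk n)) * ?q n) * exp (\<theta> n)) \<longlonglongrightarrow> a * b / (3 * pi) * exp 0"
      by (intro tendsto_intros bq \<theta>)
    thus "(\<lambda>n. (real (card (bulk n)) * ?q n) * exp (\<theta> n)) \<longlonglongrightarrow> a * b / (3 * pi)"
      by simp
  qed
qed

section \<open>Exceptional cells\<close>

definition U_form :: "nat \<Rightarrow> nat \<Rightarrow> (nat \<Rightarrow> real) \<Rightarrow> complex" where
  "U_form n j x = trig_form n x (grid n j) / of_real (sqrt (real n))"

definition H_form :: "nat \<Rightarrow> nat \<Rightarrow> (nat \<Rightarrow> real) \<Rightarrow> complex" where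
  "H_form n j x = trig_form n (\<lambda>k. (real k / real n - 1/2) * x k) (grid n j) / of_real (sqrt (real n))"

lemma UH_form_measurable [measurable]:
  "U_form n j \<in> borel_measurable (gauss {..n})" "H_form n j \<in> borel_measurable (gauss {..n})"
  unfolding U_form_def H_form_def by measurable

lemma gauss4_box_le:
  assumes r: "\<And>i. i < 4 \<Longrightarrow> r i \<ge> 0"
  shows "measure (gauss {..<4}) (Pi\<^sub>E {..<4::nat} (\<lambda>i. {t. \<bar>t\<bar> \<le> r i})) \<le> r 0 * r 1 * r 2 * r 3"
proof -
  have g: "measure std_normal_distribution {t. \<bar>t\<bar> \<le> R} \<le> R" if "R \<ge> 0" for R
  proof -
    have "2 \<le> sqrt (2 * pi)" using pi_gt3 by (intro real_le_rsqrt) auto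
    hence "2 * R / sqrt (2 * pi) \<le> R" using that by (simp add: divide_le_eq mult.commute[of R] mult_right_mono)
    thus ?thesis using std_normal_symmetric_interval(1)[OF that] by simp
  qed
  have four: "{..<4} = {0, 1, 2, 3::nat}" by auto
  have "measure (gauss {..<4}) (Pi\<^sub>E {..<4::nat} (\<lambda>i. {t. \<bar>t\<bar> \<le> r i})) = (\<Prod>i<4. measure std_normal_distribution {t. \<bar>t\<bar> \<le> r i})"
  proof (rule measure_eq_emeasure_eq_ennreal)
    show "emeasure (gauss {..<4}) (Pi\<^sub>E {..<4::nat} (\<lambda>i. {t. \<bar>t\<bar> \<le> r i})) = ennreal (\<Prod>i<4. measure std_normal_distribution {t. \<bar>t\<bar> \<le> r i})"
      unfolding gauss_def
        by (subst std_normal_prod.emeasure_PiM) (auto simp: std_normal.emeasure_eq_measure prod_ennreal)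
  qed (auto intro: prod_nonneg)
  also have "\<dots> \<le> (\<Prod>i<4. r i)" by (intro prod_mono) (auto simp: g r)
  also have "\<dots> = r 0 * r 1 * r 2 * r 3" by (simp add: four mult_ac)
  finally show ?thesis .
qed

text \<open>Two real constraints of size 1/L on H and two of size K/(nL) on U, nearly independent,
  have probability of order K^2/(n^2 L^4). Summed over about n^2 cells this is of order L^-4, hence
  negligible.\<close>

lemma small_derivative_prob:
  assumes n: "n \<ge> 3" and j: "j \<in> bulk n" and K: "0 \<le> K" "2 * K \<le> real n" and big: "6144 \<le> sqrt (real n)"
    and L: "L = ln (real n)" "L \<ge> 10"
  shows "\<P>(x in gauss {..n}. norm (H_form n j x) < 1 / L \<and> norm (U_form n j x) \<le> K / (real n * L))
     \<le> exp (940800 * L ^ 2 / sqrt (real n)) * (60 * K\<^sup>2 / ((real n)\<^sup>2 * L ^ 4))"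
proof -
  interpret prob_space "gauss {..n}" by (rule prob_space_gauss)
  note [measurable] = inner_on_measurable[OF finite_atMost]
  define \<Delta> where "\<Delta> = 1 / (2 * sqrt (real n))"
  have s0: "sqrt (real n) > 0" using n by simp
  have \<Delta>: "\<Delta> > 0" using s0 by (simp add: \<Delta>_def)
  have nD: "real n * \<Delta> = sqrt (real n) / 2"
    using s0 real_div_sqrt[of "real n"] by (simp add: \<Delta>_def)
  have sep2: "norm (cis (grid n j) - cis (- grid n j)) \<ge> \<Delta>"
  proof -
    have "\<Delta> \<le> 1 / sqrt (real n)" using s0 by (simp add: \<Delta>_def field_simps)
    thus ?thesis using grid_cis_sep(2)[OF j j] n by simp
  qed
  define y where "y = frame_vec n (grid n j)"
  have gram: "\<bar>inner_on {..n} (y i) (y m) - (if i = m then 1 else 0)\<bar> \<le> 96 / (real n * \<Delta>)"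
    if "i < 4" "m < 4" for i m
    using frame_gram[of 1 \<Delta> "\<lambda>_. grid n j" n i m] sep2 \<Delta> n that by (simp add: y_def)
  \<comment> \<open>The radii contain the frame scalings, rounded up: sqrt 24 \<le> 5 and sqrt 2
    \<le> 3/2.\<close>
  define r where "r i = (if i < 2 then 5 / L else 3/2 * (K / (real n * L)))" for i :: nat
  define B where "B = Pi\<^sub>E {..<4::nat} (\<lambda>i. {t. \<bar>t\<bar> \<le> r i})"
  have B: "B \<in> sets (gauss {..<4})" unfolding sets_gauss B_def by (intro sets_PiM_I_finite) auto
  have r0: "r i \<ge> 0" for i using K L by (simp add: r_def)
  have r5: "r i \<le> 5 * L" for i
  proof -
    have "5 / L \<le> 5 * L" using L(2) mult_mono[of 1 L 1 L] by (simp add: divide_le_eq mult.assoc)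
    moreover have "3/2 * (K / (real n * L)) \<le> 5 * L"
    proof -
      have "real n * 1 \<le> real n * L" using L(2) by (intro mult_left_mono) auto
      hence "K \<le> real n * L" using K by linarith
      hence "K / (real n * L) \<le> 1" using K L(2) n by (simp add: divide_le_eq)
      thus ?thesis using L(2) by linarith
    qed
    ultimately show ?thesis by (simp add: r_def)
  qed
  have "prob {x \<in> space (gauss {..n}). norm (H_form n j x) < 1 / L \<and> norm (U_form n j x) \<le> K / (real n * L)}
     \<le> prob {x \<in> space (gauss {..n}). (\<lambda>i\<in>{..<4}. inner_on {..n} (y i) x) \<in> B}"
  proof (rule finite_measure_mono)
    show "{x \<in> space (gauss {..n}). norm (H_form n j x) < 1 / L \<and> norm (U_form n j x) \<le> K / (real n * L)}
       \<subseteq> {x \<in> space (gauss {..n}). (\<lambda>i\<in>{..<4}. inner_on {..n} (y i) x) \<in> B}"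
    proof safe
      fix x assume H: "norm (H_form n j x) < 1 / L" and U: "norm (U_form n j x) \<le> K / (real n * L)"
      have n1: "n \<ge> 1" using n by simp
      have c: "\<bar>p\<bar> \<le> M * v \<and> \<bar>q\<bar> \<le> M * v"
        if "norm (Complex p q / of_real (sqrt c)) \<le> v" "sqrt c \<le> M" "0 < c" "0 \<le> v" for p q c v M
      proof -
        have "norm (Complex p q) \<le> v * sqrt c" using that by (simp add: norm_divide divide_le_eq)
        also have "\<dots> \<le> v * M" using that by (intro mult_left_mono) auto
        finally show ?thesis
          using abs_Re_le_cmod[of "Complex p q"] abs_Im_le_cmod[of "Complex p q"] by (auto simp: mult.commute)
      qed
      have s24: "sqrt 24 \<le> 5" by (rule real_le_lsqrt) (simp_all add: power2_eq_square)
      have s2: "sqrt 2 \<le> 3 / 2" by (rule real_le_lsqrt) (simp_all add: power2_eq_square)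
      have "\<bar>inner_on {..n} (y 0) x\<bar> \<le> 5 * (1 / L) \<and> \<bar>inner_on {..n} (y 1) x\<bar> \<le> 5 * (1 / L)"
        using H L(2) s24 s2 unfolding y_def H_form_def trig_form_frame(2)[OF n1] by (intro c) auto
      moreover have "\<bar>inner_on {..n} (y 2) x\<bar> \<le> 3/2 * (K / (real n * L)) \<and> \<bar>inner_on {..n} (y 3) x\<bar> \<le> 3/2 * (K / (real n * L))"
        using U K L(2) s24 s2 unfolding y_def U_form_def trig_form_frame(1)[OF n1] by (intro c) auto
      moreover have "i = 0 \<or> i = 1 \<or> i = 2 \<or> i = 3" if "i < 4" for i :: nat using that by linarith
      ultimately have "\<bar>inner_on {..n} (y i) x\<bar> \<le> r i" if "i < 4" for i
        using that by (fastforce simp: r_def)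
      thus "(\<lambda>i\<in>{..<4}. inner_on {..n} (y i) x) \<in> B" by (simp add: B_def PiE_iff)
    qed
    have "(\<lambda>x. \<lambda>i\<in>{..<4}. inner_on {..n} (y i) x) \<in> measurable (gauss {..n}) (gauss {..<4})"
      by measurable
    thus "{x \<in> space (gauss {..n}). (\<lambda>i\<in>{..<4}. inner_on {..n} (y i) x) \<in> B} \<in> events"
      using B by measurable
  qed
  also have "\<dots> \<le> exp (940800 * L ^ 2 / sqrt (real n)) * measure (gauss {..<4}) B"
  proof (rule gauss_near_identity_le[where y=y and d=4 and \<eta>="96 / (real n * \<Delta>)" and L="5 * L" and I="{..n}" and B=B])
    show "\<And>i m. i < 4 \<Longrightarrow> m < 4 \<Longrightarrow> \<bar>inner_on {..n} (y i) (y m) - (if i = m then 1 else 0)\<bar> \<le> 96 / (real n * \<Delta>)" by (rule gram)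
    show "\<bar>x i\<bar> \<le> 5 * L" if "x \<in> B" "i < 4" for x i
    proof -
      have "\<bar>x i\<bar> \<le> r i" using that by (simp add: B_def PiE_iff)
      thus ?thesis using r5[of i] by linarith
    qed
    show "8 * real 4 * (96 / (real n * \<Delta>)) \<le> 1" unfolding nD using big s0 by (simp add: field_simps)
    show "940800 * L ^ 2 / sqrt (real n) = real 4 * (9 + 10 * real 4) * (96 / (real n * \<Delta>)) * (5 * L)\<^sup>2"
      unfolding nD using s0 by (simp add: field_simps power_mult_distrib)
  qed (use \<Delta> L B in auto)
  also have "\<dots> \<le> exp (940800 * L ^ 2 / sqrt (real n)) * (r 0 * r 1 * r 2 * r 3)"
    unfolding B_def by (intro mult_left_mono gauss4_box_le r0) auto
  also have "r 0 * r 1 * r 2 * r 3 \<le> 60 * K\<^sup>2 / ((real n)\<^sup>2 * L ^ 4)"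
  proof -
    have "r 0 * r 1 * r 2 * r 3 = 225 / 4 * (K\<^sup>2 / ((real n)\<^sup>2 * L ^ 4))"
      by (simp add: r_def power2_eq_square power4_eq_xxxx)
    also have "\<dots> \<le> 60 * (K\<^sup>2 / ((real n)\<^sup>2 * L ^ 4))" using L(2) by (intro mult_right_mono) auto
    finally show ?thesis by simp
  qed
  finally show ?thesis by (simp add: mult_left_mono)
qed

lemma small_derivative_sum:
  assumes K: "K \<ge> 0"
  shows "(\<lambda>n. \<Sum>j\<in>bulk n. measure (gauss {..n}) {x \<in> space (gauss {..n}).
     norm (H_form n j x) < 1 / ln (real n) \<and> norm (U_form n j x) \<le> K / (real n * ln (real n))}) \<longlonglongrightarrow> 0"
proof (rule tendsto_sandwich[OF _ _ tendsto_const])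
  let ?P = "\<lambda>n j. measure (gauss {..n}) {x \<in> space (gauss {..n}).
     norm (H_form n j x) < 1 / ln (real n) \<and> norm (U_form n j x) \<le> K / (real n * ln (real n))}"
  show "eventually (\<lambda>n. 0 \<le> (\<Sum>j\<in>bulk n. ?P n j)) sequentially" by (simp add: sum_nonneg)
  show "eventually (\<lambda>n. (\<Sum>j\<in>bulk n. ?P n j) \<le> real (card (bulk n)) / (real n)\<^sup>2 *
     (exp (940800 * ln (real n) ^ 2 / sqrt (real n)) * (60 * K\<^sup>2 * (1 / ln (real n) ^ 4)))) sequentially"
    using eventually_ge_at_top[of 3] eventually_le_real[of "2 * K"] eventually_polylog[OF zero_less_one, of 6144 0] eventually_ln_ge[of 10]
  proof eventually_elim
    case (elim n)
    have "(\<Sum>j\<in>bulk n. ?P n j) \<le> (\<Sum>j\<in>bulk n. exp (940800 * ln (real n) ^ 2 / sqrt (real n)) * (60 * K\<^sup>2 / ((real n)\<^sup>2 * ln (real n) ^ 4)))"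
      using elim K by (intro sum_mono small_derivative_prob) auto
    also have "\<dots> = real (card (bulk n)) / (real n)\<^sup>2 * (exp (940800 * ln (real n) ^ 2 / sqrt (real n)) * (60 * K\<^sup>2 * (1 / ln (real n) ^ 4)))"
      by simp
    finally show ?case .
  qed
  have "(\<lambda>n. 940800 * ln (real n) ^ 2 / sqrt (real n)) \<longlonglongrightarrow> 0" by real_asymp
  moreover have "(\<lambda>n. 1 / ln (real n) ^ 4) \<longlonglongrightarrow> 0" by real_asymp
  ultimately have "(\<lambda>n. real (card (bulk n)) / (real n)\<^sup>2 *
     (exp (940800 * ln (real n) ^ 2 / sqrt (real n)) * (60 * K\<^sup>2 * (1 / ln (real n) ^ 4)))) \<longlonglongrightarrow> 1 * (exp 0 * (60 * K\<^sup>2 * 0))"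
    by (intro tendsto_mult bulk_ratio tendsto_exp tendsto_const)
  thus "(\<lambda>n. real (card (bulk n)) / (real n)\<^sup>2 *
     (exp (940800 * ln (real n) ^ 2 / sqrt (real n)) * (60 * K\<^sup>2 * (1 / ln (real n) ^ 4)))) \<longlonglongrightarrow> 0" by simp
qed

text \<open>Near the real axis the real and imaginary parts of the sum are strongly correlated. At distance at least
  \<open>1/(n L\<^sup>2)\<close> the small-ball estimate loses only powers of \<open>L = ln n\<close>; the few remaining cells are
  controlled by the real part alone.\<close>

lemma near_axis_prob:
  assumes n: "n \<ge> 2" and t: "1 / (real n * L\<^sup>2) \<le> t" "t \<le> pi - 1 / (real n * L\<^sup>2)" and L: "L \<ge> 1" and \<rho>: "\<rho> \<ge> 0"
  shows "\<P>(x in gauss {..n}. norm (trig_form n x t) \<le> \<rho>) \<le> 8 * 256\<^sup>2 * L ^ 8 * \<rho>\<^sup>2 / real n"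
proof -
  define \<Delta> where "\<Delta> = 1 / (real n * L\<^sup>2)"
  have L2: "L\<^sup>2 \<ge> 1" using L by simp
  have \<Delta>: "\<Delta> > 0" using n L by (simp add: \<Delta>_def)
  have sep: "norm (cis t - cis (- t)) \<ge> \<Delta>"
    using t \<Delta> by (intro cis_dist_conj_ge) (auto simp: \<Delta>_def)
  have nD: "real n * \<Delta> = 1 / L\<^sup>2" using n by (simp add: \<Delta>_def)
  have \<mu>: "1 / L\<^sup>2 = min 1 (real n * \<Delta>)" 
  proof -
    have "1 / L\<^sup>2 \<le> 1 / 1" using L2 by (intro divide_left_mono) auto
    thus ?thesis unfolding nD by linarith
  qed
  have "\<P>(x in gauss {..n}. \<forall>i<1::nat. norm (trig_form n x t) \<le> \<rho>)
     \<le> (8 * real 1 / real n * (256 * (real 1)\<^sup>2 / (1 / L\<^sup>2)\<^sup>2) ^ (2 * 1) * \<rho>\<^sup>2) ^ 1"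
    by (rule trig_small_ball[where t="\<lambda>_. t", OF _ _ \<Delta> _ _ \<mu> \<rho>]) (use sep n in auto)
  also have "(256 * (real 1)\<^sup>2 / (1 / L\<^sup>2)\<^sup>2) ^ (2 * 1) = 256\<^sup>2 * L ^ 8"
    by (simp add: power_divide power_mult_distrib flip: power_mult)
  finally show ?thesis by (simp add: mult_ac)
qed

lemma cos_ge_half: "\<bar>x\<bar> \<le> 1 \<Longrightarrow> 1 / 2 \<le> cos (x::real)"
proof -
  assume x: "\<bar>x\<bar> \<le> 1"
  have "cos (pi / 3) \<le> cos \<bar>x\<bar>" using x pi_gt3 by (intro cos_monotone_0_pi_le) auto
  thus ?thesis by (simp add: cos_60)
qed

text \<open>Within 1/n of 0 or pi all cosines cos (k t), k \<le> n, have modulus at least 1/2, so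
  the real part has variance at least n/4. Only this one real constraint is used, and the bound is
  therefore linear in \<rho>.\<close>

lemma axis_prob:
  assumes n: "n \<ge> 1" and t: "(0 \<le> t \<and> t \<le> 1 / real n) \<or> (pi - 1 / real n \<le> t \<and> t \<le> pi)" and \<rho>: "\<rho> \<ge> 0"
  shows "\<P>(x in gauss {..n}. norm (trig_form n x t) \<le> \<rho>) \<le> 2 * \<rho> / sqrt (real n)"
proof -
  interpret prob_space "gauss {..n}" by (rule prob_space_gauss)
  note [measurable] = inner_on_measurable[OF finite_atMost]
  define y where "y k = cos (real k * t)" for k
  have y: "(y k)\<^sup>2 \<ge> 1 / 4" if "k \<le> n" for k
  proof -
    have "\<exists>u. \<bar>u\<bar> \<le> 1 \<and> (cos (real k * t))\<^sup>2 = (cos u)\<^sup>2"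
    proof (cases "0 \<le> t \<and> t \<le> 1 / real n")
      case True
      have "real k * t \<le> real n * (1 / real n)" using that True by (intro mult_mono) auto
      thus ?thesis using True n by (intro exI[of _ "real k * t"]) auto
    next
      case False
      hence t: "0 \<le> pi - t" "pi - t \<le> 1 / real n" using t by auto
      have "real k * (pi - t) \<le> real n * (1 / real n)" using that t by (intro mult_mono) auto
      moreover have "cos (real k * (pi - t)) = (-1) ^ k * cos (real k * t)"
        by (simp add: right_diff_distrib cos_diff mult.commute[of _ pi] cos_npi2 sin_npi2)
      hence "(cos (real k * (pi - t)))\<^sup>2 = (cos (real k * t))\<^sup>2"
        by (simp add: power_mult_distrib flip: power_mult)
      ultimately show ?thesis using t n by (intro exI[of _ "real k * (pi - t)"]) auto
    qed
    then obtain u where u: "\<bar>u\<bar> \<le> 1" "(cos (real k * t))\<^sup>2 = (cos u)\<^sup>2" by blast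
    have "(1 / 2)\<^sup>2 \<le> (cos u)\<^sup>2" using cos_ge_half[OF u(1)] by (intro power_mono) auto
    thus ?thesis using u(2) by (simp add: y_def power_divide)
  qed
  define Y where "Y = inner_on {..n} y y"
  have "(\<Sum>k\<le>n. 1 / 4) \<le> Y"
    unfolding Y_def inner_on_def by (intro sum_mono) (use y in \<open>auto simp: power2_eq_square\<close>)
  hence Y: "real n / 4 \<le> Y" by simp
  have Y0: "Y > 0" using Y n by linarith
  have "prob {x \<in> space (gauss {..n}). norm (trig_form n x t) \<le> \<rho>} \<le> prob {x \<in> space (gauss {..n}). \<forall>j\<in>{..<1::nat}. \<bar>inner_on {..n} y x\<bar> \<le> \<rho>}"
  proof (rule finite_measure_mono)
    show "{x \<in> space (gauss {..n}). norm (trig_form n x t) \<le> \<rho>} \<subseteq> {x \<in> space (gauss {..n}). \<forall>j\<in>{..<1::nat}. \<bar>inner_on {..n} y x\<bar> \<le> \<rho>}"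
    proof safe
      fix x assume "norm (trig_form n x t) \<le> \<rho>"
      thus "\<bar>inner_on {..n} y x\<bar> \<le> \<rho>"
        using abs_Re_le_cmod[of "trig_form n x t"] by (simp add: Re_trig_form y_def[abs_def])
    qed
  qed measurable
  also have "\<dots> \<le> (\<Prod>j<1::nat. (2 / sqrt (real n)) * \<rho>)"
    unfolding Ball_def lessThan_iff
  proof (rule gauss_small_ball[where y="\<lambda>_. y"])
    fix j :: nat assume "j < 1"
    \<comment> \<open>y/Y is the shortest vector pairing to 1 with y; its squared norm 1/Y is at
      most 4/n.\<close>
    have "inner_on {..n} (\<lambda>k. (1 / Y) * y k) y = 1" using Y0 unfolding inner_on_linear by (simp flip: Y_def)
    moreover have "inner_on {..n} (\<lambda>k. (1 / Y) * y k) (\<lambda>k. (1 / Y) * y k) \<le> (2 / sqrt (real n))\<^sup>2"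
    proof -
      have "inner_on {..n} (\<lambda>k. (1 / Y) * y k) (\<lambda>k. (1 / Y) * y k) = 1 / Y"
        using Y0 unfolding inner_on_linear by (simp flip: Y_def)
      also have "\<dots> \<le> 1 / (real n / 4)" using Y Y0 n by (intro divide_left_mono) auto
      finally show ?thesis by (simp add: power_divide)
    qed
    ultimately show "\<exists>w. (\<forall>l<j. inner_on {..n} w y = 0) \<and> inner_on {..n} w y = 1 \<and> inner_on {..n} w w \<le> (2 / sqrt (real n))\<^sup>2"
      using \<open>j < 1\<close> by blast
  qed (use n \<rho> in auto)
  finally show ?thesis by simp
qed

lemma card_grid_ends:
  assumes n: "n \<ge> 1" and d: "d \<ge> 0"
  shows "real (card {j. j \<le> n\<^sup>2 \<and> (grid n j < d \<or> grid n j > pi - d)}) \<le> 4 * (d * (real n)\<^sup>2) + 2"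
proof -
  have g0: "grid n 0 = 0" "grid n (n\<^sup>2) = pi" using n by (simp_all add: grid_def)
  let ?r = "d * (real n)\<^sup>2"
  have r0: "?r \<ge> 0" using d by simp
  have "{j. j \<le> n\<^sup>2 \<and> (grid n j < d \<or> grid n j > pi - d)} \<subseteq> {m. \<bar>real 0 - real m\<bar> < ?r} \<union> {m. \<bar>real (n\<^sup>2) - real m\<bar> < ?r}"
  proof
    fix m assume m: "m \<in> {j. j \<le> n\<^sup>2 \<and> (grid n j < d \<or> grid n j > pi - d)}"
    have "real m \<le> real (n\<^sup>2)" using m by (simp only: of_nat_le_iff mem_Collect_eq)
    hence "grid n m \<le> grid n (n\<^sup>2)" unfolding grid_def by (intro divide_right_mono mult_left_mono) auto
    hence le: "0 \<le> grid n m" "grid n m \<le> pi" using g0 by (auto simp: grid_def)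
    show "m \<in> {m. \<bar>real 0 - real m\<bar> < ?r} \<union> {m. \<bar>real (n\<^sup>2) - real m\<bar> < ?r}"
    proof (cases "grid n m < d")
      case True
      hence "\<bar>grid n 0 - grid n m\<bar> < d" using g0 le by simp
      from grid_diff[OF this n] show ?thesis by simp
    next
      case False
      hence "\<bar>grid n (n\<^sup>2) - grid n m\<bar> < d" using g0 le m by simp
      from grid_diff[OF this n] show ?thesis by simp
    qed
  qed
  hence "card {j. j \<le> n\<^sup>2 \<and> (grid n j < d \<or> grid n j > pi - d)} \<le> card ({m. \<bar>real 0 - real m\<bar> < ?r} \<union> {m. \<bar>real (n\<^sup>2) - real m\<bar> < ?r})"
    by (rule card_mono[rotated]) (use card_nat_near(1)[OF r0] in blast)
  also have "\<dots> \<le> card {m. \<bar>real 0 - real m\<bar> < ?r} + card {m. \<bar>real (n\<^sup>2) - real m\<bar> < ?r}"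
    by (rule card_Un_le)
  finally have "real (card {j. j \<le> n\<^sup>2 \<and> (grid n j < d \<or> grid n j > pi - d)}) \<le> real (card {m. \<bar>real 0 - real m\<bar> < ?r} + card {m. \<bar>real (n\<^sup>2) - real m\<bar> < ?r})"
    by (rule of_nat_mono)
  thus ?thesis using card_nat_near(2)[OF r0, of 0] card_nat_near(2)[OF r0, of "n\<^sup>2"] by simp
qed

text \<open>The roughly n^(3/2) cells outside the bulk cost about L^10/n^2 each in the
  two-dimensional bound. The roughly n/L^2 cells next to the real axis cost about L/n each in the
  one-dimensional bound. Both products tend to 0.\<close>

lemma near_axis_sum:
  assumes K: "K \<ge> 0"
  shows "(\<lambda>n. \<Sum>j\<in>{..n\<^sup>2} - bulk n. measure (gauss {..n}) {x \<in> space (gauss {..n}).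
     norm (U_form n j x) \<le> K * ln (real n) / real n}) \<longlonglongrightarrow> 0"
proof (rule tendsto_sandwich[OF _ _ tendsto_const])
  let ?P = "\<lambda>n j. \<P>(x in gauss {..n}. norm (U_form n j x) \<le> K * ln (real n) / real n)"
  let ?b = "\<lambda>n. (4 * (real n * sqrt (real n)) + 2) * (8 * 256\<^sup>2 * ln (real n) ^ 8 * (K * ln (real n) / sqrt (real n))\<^sup>2 / real n)
     + (4 * (1 / (real n * (ln (real n))\<^sup>2) * (real n)\<^sup>2) + 2) * (2 * (K * ln (real n) / sqrt (real n)) / sqrt (real n))"
  show "eventually (\<lambda>n. 0 \<le> (\<Sum>j\<in>{..n\<^sup>2} - bulk n. ?P n j)) sequentially"
    by (simp add: sum_nonneg)
  show "eventually (\<lambda>n. (\<Sum>j\<in>{..n\<^sup>2} - bulk n. ?P n j) \<le> ?b n) sequentially"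
    using eventually_ge_at_top[of 2] eventually_ln_ge[of 1]
  proof eventually_elim
    case (elim n)
    define L where "L = ln (real n)"
    define \<rho> where "\<rho> = K * L / sqrt (real n)"
    \<comment> \<open>The factor L^-2 must outweigh the factor L in the one-dimensional bound, and
      in the two-dimensional bound it costs only powers of L.\<close>
    define d where "d = 1 / (real n * L\<^sup>2)"
    have L: "L \<ge> 1" using elim by (simp add: L_def)
    have L2: "L\<^sup>2 \<ge> 1" using L by simp
    have n: "n \<ge> 1" "n \<ge> 2" using elim by auto
    have s0: "sqrt (real n) > 0" using n by simp
    have \<rho>: "\<rho> \<ge> 0" using K L by (simp add: \<rho>_def)
    have P: "?P n j = \<P>(x in gauss {..n}. norm (trig_form n x (grid n j)) \<le> \<rho>)" for j
    proof -
      have "norm (U_form n j x) \<le> K * ln (real n) / real n \<longleftrightarrow> norm (trig_form n x (grid n j)) \<le> \<rho>" for x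
      proof -
        have "K * ln (real n) / real n * sqrt (real n) = \<rho>"
          using s0 unfolding \<rho>_def L_def by (simp add: field_simps)
        thus ?thesis using s0 by (simp add: U_form_def norm_divide divide_le_eq)
      qed
      thus ?thesis by simp
    qed
    let ?E1 = "{j. j \<le> n\<^sup>2 \<and> (grid n j < 1 / sqrt (real n) \<or> grid n j > pi - 1 / sqrt (real n))}"
    let ?E2 = "{j. j \<le> n\<^sup>2 \<and> (grid n j < d \<or> grid n j > pi - d)}"
    have E: "{..n\<^sup>2} - bulk n = ?E1" by (auto simp: bulk_def)
    have fE: "finite ?E1" "finite ?E2" by auto
    have "(\<Sum>j\<in>?E1. ?P n j) \<le> (\<Sum>j\<in>?E1. (if j \<in> ?E2 then 2 * \<rho> / sqrt (real n) else 0) + 8 * 256\<^sup>2 * L ^ 8 * \<rho>\<^sup>2 / real n)"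
    proof (rule sum_mono)
      fix j assume j: "j \<in> ?E1"
      have "real j \<le> real (n\<^sup>2)" using j by (simp only: of_nat_le_iff mem_Collect_eq)
      hence "grid n j \<le> grid n (n\<^sup>2)" unfolding grid_def by (intro divide_right_mono mult_left_mono) auto
      hence g: "0 \<le> grid n j" "grid n j \<le> pi" using n by (auto simp: grid_def)
      show "?P n j \<le> (if j \<in> ?E2 then 2 * \<rho> / sqrt (real n) else 0) + 8 * 256\<^sup>2 * L ^ 8 * \<rho>\<^sup>2 / real n"
      proof (cases "j \<in> ?E2")
        case True
        have "real n * 1 \<le> real n * L\<^sup>2" using L2 by (intro mult_left_mono) auto
        hence "d \<le> 1 / real n" unfolding d_def using n by (intro divide_left_mono mult_pos_pos) auto
        hence "?P n j \<le> 2 * \<rho> / sqrt (real n)" unfolding P using True g by (intro axis_prob n \<rho>) auto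
        moreover have "0 \<le> 8 * 256\<^sup>2 * L ^ 8 * \<rho>\<^sup>2 / real n" using L by simp
        ultimately show ?thesis using True unfolding if_P[OF True] by linarith
      next
        case False
        hence "d \<le> grid n j" "grid n j \<le> pi - d" using j by auto
        hence "?P n j \<le> 8 * 256\<^sup>2 * L ^ 8 * \<rho>\<^sup>2 / real n"
          unfolding P by (intro near_axis_prob n L \<rho>) (auto simp: d_def)
        thus ?thesis unfolding if_not_P[OF False] by linarith
      qed
    qed
    also have "\<dots> = (\<Sum>j\<in>?E1. if j \<in> ?E2 then 2 * \<rho> / sqrt (real n) else 0) + real (card ?E1) * (8 * 256\<^sup>2 * L ^ 8 * \<rho>\<^sup>2 / real n)"
      by (simp only: sum.distrib sum_constant)
    also have "(\<Sum>j\<in>?E1. if j \<in> ?E2 then 2 * \<rho> / sqrt (real n) else 0) = (\<Sum>j\<in>?E1 \<inter> ?E2. 2 * \<rho> / sqrt (real n))"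
      by (rule sum.inter_restrict[symmetric, OF fE(1)])
    also have "\<dots> \<le> (\<Sum>j\<in>?E2. 2 * \<rho> / sqrt (real n))" using \<rho> by (intro sum_mono2 fE) auto
    also have "\<dots> = real (card ?E2) * (2 * \<rho> / sqrt (real n))" by simp
    also have "\<dots> \<le> (4 * (d * (real n)\<^sup>2) + 2) * (2 * \<rho> / sqrt (real n))"
      using \<rho> L by (intro mult_right_mono card_grid_ends n) (auto simp: d_def)
    also have "real (card ?E1) * (8 * 256\<^sup>2 * L ^ 8 * \<rho>\<^sup>2 / real n) \<le> (4 * (1 / sqrt (real n) * (real n)\<^sup>2) + 2) * (8 * 256\<^sup>2 * L ^ 8 * \<rho>\<^sup>2 / real n)"
      using L by (intro mult_right_mono card_grid_ends n) auto
    finally show ?case unfolding E sq_over_sqrt by (simp add: L_def \<rho>_def d_def)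
  qed
  have "(\<lambda>n. (4 * (real n * sqrt (real n)) + 2) * (8 * 256\<^sup>2 * ln (real n) ^ 8 * (ln (real n) / sqrt (real n))\<^sup>2 / real n)) \<longlonglongrightarrow> 0"
    by real_asymp
  moreover have "(\<lambda>n. (4 * (1 / (real n * (ln (real n))\<^sup>2) * (real n)\<^sup>2) + 2) * (2 * (ln (real n) / sqrt (real n)) / sqrt (real n))) \<longlonglongrightarrow> 0"
    by real_asymp
  ultimately have "(\<lambda>n. K\<^sup>2 * ((4 * (real n * sqrt (real n)) + 2) * (8 * 256\<^sup>2 * ln (real n) ^ 8 * (ln (real n) / sqrt (real n))\<^sup>2 / real n))
     + K * ((4 * (1 / (real n * (ln (real n))\<^sup>2) * (real n)\<^sup>2) + 2) * (2 * (ln (real n) / sqrt (real n)) / sqrt (real n)))) \<longlonglongrightarrow> K\<^sup>2 * 0 + K * 0"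
    by (intro tendsto_add tendsto_mult tendsto_const)
  thus "?b \<longlonglongrightarrow> 0" by (simp add: power_mult_distrib power_divide mult_ac)
qed

section \<open>The distance from the zeros to the circle\<close>

lemma setdist_unit_sphere_le:
  fixes z :: complex
  assumes "z \<in> S"
  shows "setdist S (sphere 0 1) \<le> \<bar>norm z - 1\<bar>"
proof -
  have "\<exists>y. norm y = 1 \<and> dist z y = \<bar>norm z - 1\<bar>"
  proof (cases "z = 0")
    case True thus ?thesis by (intro exI[of _ 1]) simp
  next
    case False
    have "z - z / of_real (norm z) = of_real ((norm z - 1) / norm z) * z"
      using False by (simp add: field_simps)
    hence "dist z (z / of_real (norm z)) = \<bar>(norm z - 1) / norm z\<bar> * norm z"
      by (simp only: dist_norm norm_mult norm_of_real)
    thus ?thesis using False by (intro exI[of _ "z / of_real (norm z)"]) (simp add: norm_divide abs_divide)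
  qed
  then obtain y where "norm y = 1" "dist z y = \<bar>norm z - 1\<bar>" by blast
  thus ?thesis using setdist_le_dist[OF assms, of y "sphere 0 1"] by simp
qed

text \<open>The distance is attained because one set is closed and the other compact. The empty set
  appears separately because \<open>setdist\<close> is 0 for it.\<close>

lemma setdist_unit_sphere_le_iff:
  fixes S :: "complex set"
  assumes "closed S" "r \<ge> 0"
  shows "setdist S (sphere 0 1) \<le> r \<longleftrightarrow> S = {} \<or> (\<exists>z\<in>S. \<bar>norm z - 1\<bar> \<le> r)"
proof (cases "S = {}")
  case False
  have ne: "sphere (0::complex) 1 \<noteq> {}" by (metis norm_one mem_sphere_0 empty_iff)
  obtain z y where zy: "z \<in> S" "y \<in> sphere 0 1" "dist z y = setdist S (sphere 0 1)"
    using setdist_closed_compact[OF assms(1) _ False ne] by auto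
  have "\<bar>norm z - norm y\<bar> \<le> dist z y" unfolding dist_norm by (rule norm_triangle_ineq3)
  hence "\<bar>norm z - 1\<bar> \<le> setdist S (sphere 0 1)" using zy by simp
  thus ?thesis using False zy(1) setdist_unit_sphere_le by (meson order_trans)
qed (use assms in simp)

text \<open>By compactness the modulus attains its minimum on \<open>K\<close>, so a zero exists
  exactly when the modulus takes arbitrarily small values, and by continuity these can be sought on
  a countable dense set. The uncountable quantifier thus becomes countable.\<close>

lemma zero_in_compact_measurable:
  fixes f :: "'a \<Rightarrow> complex \<Rightarrow> complex"
  assumes K: "compact K" and cont: "\<And>x. continuous_on K (f x)"
    and meas [measurable]: "\<And>z. (\<lambda>x. f x z) \<in> borel_measurable M"
  shows "{x \<in> space M. \<exists>z\<in>K. f x z = 0} \<in> sets M"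
proof -
  obtain D where D: "countable D" "D \<subseteq> K" "K \<subseteq> closure D" using separable[of K] by blast
  have "(\<exists>z\<in>K. f x z = 0) \<longleftrightarrow> (\<forall>m::nat. \<exists>d\<in>D. norm (f x d) < 1 / real (Suc m))" for x
  proof
    assume "\<exists>z\<in>K. f x z = 0"
    then obtain z where z: "z \<in> K" "f x z = 0" by blast
    show "\<forall>m::nat. \<exists>d\<in>D. norm (f x d) < 1 / real (Suc m)"
    proof
      fix m :: nat
      have e: "1 / real (Suc m) > 0" by simp
      then obtain \<delta> where \<delta>: "\<delta> > 0" "\<And>w. w \<in> K \<Longrightarrow> dist w z < \<delta> \<Longrightarrow> dist (f x w) (f x z) < 1 / real (Suc m)"
        using cont[of x] z(1) unfolding continuous_on_iff by metis
      obtain d where "d \<in> D" "dist d z < \<delta>"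
        using D(3) z(1) \<delta>(1) by (meson closure_approachable subsetD)
      thus "\<exists>d\<in>D. norm (f x d) < 1 / real (Suc m)"
        using \<delta>(2)[of d] D(2) z(2) by (intro bexI[of _ d]) auto
    qed
  next
    assume R: "\<forall>m::nat. \<exists>d\<in>D. norm (f x d) < 1 / real (Suc m)"
    hence "K \<noteq> {}" using D(2) by blast
    then obtain z where z: "z \<in> K" "\<And>y. y \<in> K \<Longrightarrow> norm (f x z) \<le> norm (f x y)"
      using continuous_attains_inf[OF K _ continuous_on_norm[OF cont[of x]]] by blast
    have "norm (f x z) < 1 / real (Suc m)" for m
    proof -
      obtain d where "d \<in> D" "norm (f x d) < 1 / real (Suc m)" using R by blast
      thus ?thesis using z(2)[of d] D(2) by auto
    qed
    hence "\<not> norm (f x z) > 0" using nat_approx_posE by (metis less_asym)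
    thus "\<exists>z\<in>K. f x z = 0" using z(1) by auto
  qed
  hence "{x \<in> space M. \<exists>z\<in>K. f x z = 0} = {x \<in> space M. \<forall>m::nat. \<exists>d\<in>D. norm (f x d) < 1 / real (Suc m)}" by simp
  also have "\<dots> \<in> sets M"
    by (intro sets.sets_Collect_countable_All sets.sets_Collect_countable_Ex' D(1)) measurable
  finally show ?thesis .
qed

definition zeros :: "nat \<Rightarrow> (nat \<Rightarrow> real) \<Rightarrow> complex set" where
  "zeros n x = {z. (\<Sum>k\<le>n. complex_of_real (x k) * z ^ k) = 0}"

definition zero_gap :: "nat \<Rightarrow> (nat \<Rightarrow> real) \<Rightarrow> real" where
  "zero_gap n x = (real n)\<^sup>2 * setdist (zeros n x) (sphere 0 1)"

lemma closed_zeros: "closed (zeros n x)"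
  unfolding zeros_def by (intro closed_Collect_eq continuous_intros)

lemma zero_gap_le_iff:
  assumes "n \<ge> 1" "y \<ge> 0"
  shows "zero_gap n x \<le> y \<longleftrightarrow> zeros n x = {} \<or> (\<exists>z\<in>zeros n x. \<bar>norm z - 1\<bar> \<le> y / (real n)\<^sup>2)"
proof -
  have "zero_gap n x \<le> y \<longleftrightarrow> setdist (zeros n x) (sphere 0 1) \<le> y / (real n)\<^sup>2"
    using assms by (simp add: zero_gap_def pos_le_divide_eq mult.commute)
  thus ?thesis using setdist_unit_sphere_le_iff[OF closed_zeros, of "y / (real n)\<^sup>2"] assms by simp
qed

lemma zero_gap_measurable:
  assumes n: "n \<ge> 1"
  shows "zero_gap n \<in> borel_measurable (gauss {..n})"
  unfolding borel_measurable_iff_le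
proof
  fix y :: real
  have xk [measurable]: "(\<lambda>x. x k) \<in> borel_measurable (gauss {..n})" if "k \<in> {..n}" for k
    using that by (simp add: measurable_cong_sets[OF sets_gauss refl])
  have f: "(\<lambda>x. \<Sum>k\<le>n. complex_of_real (x k) * z ^ k) \<in> borel_measurable (gauss {..n})" for z
    by (intro borel_measurable_sum borel_measurable_times borel_measurable_const borel_measurable_of_real; measurable)+
  have Z: "{x \<in> space (gauss {..n}). \<exists>z\<in>K. z \<in> zeros n x} \<in> sets (gauss {..n})"
    if "compact K" for K
    unfolding zeros_def mem_Collect_eq
    by (intro zero_in_compact_measurable that f continuous_intros)
  show "{x \<in> space (gauss {..n}). zero_gap n x \<le> y} \<in> sets (gauss {..n})"
  proof (cases "y \<ge> 0")
    case True
    define K where "K = {z::complex. \<bar>norm z - 1\<bar> \<le> y / (real n)\<^sup>2}"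
    have "closed K" unfolding K_def by (intro closed_Collect_le continuous_intros)
    moreover have "bounded K" unfolding bounded_iff K_def by (rule exI[of _ "1 + y / (real n)\<^sup>2"]) auto
    ultimately have K: "compact K" by (simp add: compact_eq_bounded_closed)
    \<comment> \<open>The plane is not compact, so absence of zeros is tested on the balls of
      integer radius.\<close>
    have "zeros n x = {} \<longleftrightarrow> (\<forall>m::nat. \<not> (\<exists>z\<in>cball 0 (real m). z \<in> zeros n x))" for x
    proof -
      have "\<exists>m. z \<in> cball 0 (real m)" for z :: complex using real_arch_simple[of "norm z"] by simp
      thus ?thesis by blast
    qed
    hence "{x \<in> space (gauss {..n}). zero_gap n x \<le> y} =
       {x \<in> space (gauss {..n}). (\<forall>m::nat. \<not> (\<exists>z\<in>cball 0 (real m). z \<in> zeros n x)) \<or> (\<exists>z\<in>K. z \<in> zeros n x)}"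
      unfolding zero_gap_le_iff[OF n True] K_def by auto
    also have "\<dots> \<in> sets (gauss {..n})"
      by (intro sets.sets_Collect_disj sets.sets_Collect_countable_All sets.sets_Collect_neg Z K compact_cball)
    finally show ?thesis .
  next
    case False
    have "zero_gap n x \<ge> 0" for x by (simp add: zero_gap_def setdist_pos_le)
    hence "{x \<in> space (gauss {..n}). zero_gap n x \<le> y} = {}"
      using False by (auto simp: not_le intro: less_le_trans)
    thus ?thesis by (simp only: sets.empty_sets)
  qed
qed

lemma exp_form_eq_0_iff: "exp_form n x w = 0 \<longleftrightarrow> exp (\<i> * w) \<in> zeros n x"
  by (simp add: exp_form_def zeros_def exp_of_nat_mult[symmetric] mult_ac)

lemma cnj_zeros: "z \<in> zeros n x \<Longrightarrow> cnj z \<in> zeros n x"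
proof -
  assume "z \<in> zeros n x"
  hence "cnj (\<Sum>k\<le>n. complex_of_real (x k) * z ^ k) = 0" by (simp add: zeros_def)
  thus ?thesis by (simp add: zeros_def)
qed

context good_sample
begin

lemma root_near_iff: "root_near n a b t x \<longleftrightarrow> root_cond n a b (U t) (H t)"
  by (simp add: root_near_def U_def H_def)

lemma C_sq_le: "(C + 4)\<^sup>2 \<le> \<epsilon> * (real n)\<^sup>2 / 100"
proof -
  have "100 * (C + 4)\<^sup>2 * 1 \<le> 100 * (C + 4)\<^sup>2 * L ^ 3" using L_powers by (intro mult_left_mono) auto
  moreover have "\<epsilon> * real n \<le> \<epsilon> * (real n)\<^sup>2"
    using n0 \<epsilon> by (intro mult_left_mono) (auto simp: power2_eq_square)
  ultimately show ?thesis using n_large(1) by simp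
qed

text \<open>The modulus of exp (\<i> w) is exp (- Im w). One \<epsilon> comes from the position of
  the root, the other covers the quadratic error of the exponential.\<close>

lemma zero_gap_le_of_root_near:
  assumes j: "j \<in> bulk n" and rn: "root_near n a b (grid n j) x" and ab: "0 \<le> a" "0 \<le> b" "a + b + 1 \<le> C"
  shows "zero_gap n x \<le> b + 2 * \<epsilon>"
proof -
  obtain w where w: "g w = 0" "\<bar>Im w\<bar> \<le> (b + \<epsilon>) / (real n)\<^sup>2"
    using root_exists[of j a b] j rn ab unfolding bulk_def root_near_iff by blast
  have z: "exp (\<i> * w) \<in> zeros n x" using w(1) unfolding g_def exp_form_eq_0_iff .
  define v where "v = (b + \<epsilon>) / (real n)\<^sup>2"
  have n2: "(real n)\<^sup>2 > 0" using n0 by simp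
  have bC: "(b + \<epsilon>)\<^sup>2 \<le> (C + 4)\<^sup>2" using ab \<epsilon> by (intro power_mono) auto
  have bn: "(b + \<epsilon>)\<^sup>2 \<le> \<epsilon> * (real n)\<^sup>2"
    using bC C_sq_le mult_pos_pos[OF \<epsilon>(1) n2] by linarith
  have v0: "v \<ge> 0" using ab \<epsilon> by (simp add: v_def)
  have "b + \<epsilon> \<le> (C + 4)\<^sup>2" using C_plus_4 ab \<epsilon> by linarith
  moreover have "\<epsilon> * (real n)\<^sup>2 \<le> 1 * (real n)\<^sup>2"
    using \<epsilon> by (intro mult_right_mono) auto
  ultimately have "b + \<epsilon> \<le> (real n)\<^sup>2" using C_sq_le n2 by linarith
  hence v1: "v \<le> 1" using n2 by (simp add: v_def)
  have e: "\<bar>exp s - 1\<bar> \<le> v + v\<^sup>2" if "\<bar>s\<bar> \<le> v" for s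
  proof -
    have "exp s \<le> exp v" using that by simp
    also have "\<dots> \<le> 1 + v + v\<^sup>2" by (rule exp_bound[OF v0 v1])
    finally have "exp s \<le> 1 + v + v\<^sup>2" .
    moreover have "1 + s \<le> exp s" by (rule exp_ge_add_one_self)
    ultimately show ?thesis using that zero_le_power2[of v] by linarith
  qed
  have "norm (exp (\<i> * w)) = exp (- Im w)" by simp
  hence "\<bar>norm (exp (\<i> * w)) - 1\<bar> \<le> v + v\<^sup>2" using e[of "- Im w"] w(2) by (simp add: v_def)
  also have "v + v\<^sup>2 \<le> (b + 2 * \<epsilon>) / (real n)\<^sup>2"
  proof -
    have "v\<^sup>2 = (b + \<epsilon>)\<^sup>2 / (real n)\<^sup>2 / (real n)\<^sup>2"
      by (simp add: v_def power2_eq_square)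
    also have "\<dots> \<le> \<epsilon> * (real n)\<^sup>2 / (real n)\<^sup>2 / (real n)\<^sup>2"
      using bn by (intro divide_right_mono) auto
    also have "\<dots> = \<epsilon> / (real n)\<^sup>2" using n2 by simp
    finally show ?thesis by (simp add: v_def add_divide_distrib)
  qed
  finally have "\<bar>norm (exp (\<i> * w)) - 1\<bar> \<le> (b + 2 * \<epsilon>) / (real n)\<^sup>2" .
  moreover have "0 \<le> b + 2 * \<epsilon>" using ab \<epsilon> by simp
  ultimately show ?thesis using z zero_gap_le_iff[OF n0(2)] by blast
qed

text \<open>A zero close to the circle is written as exp (\<i> w) by the logarithm. One \<epsilon>
  covers the quadratic error of ln |z|, the other the error of the linear prediction in
  \<open>root_detected\<close>.\<close>

lemma root_near_of_zero_gap_le: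
  assumes ne: "zeros n x \<noteq> {}" and gap: "zero_gap n x \<le> y" and y: "0 \<le> y" "y + 1 \<le> C"
  shows "\<exists>j\<le>n\<^sup>2. norm (U_form n j x) \<le> 4 * L * (C + 4) / real n \<and>
     (root_near n (pi / 2 + \<epsilon>) (y + 2 * \<epsilon>) (grid n j) x \<or>
      norm (H_form n j x) < 1 / L \<and> norm (U_form n j x) \<le> 2 * (C + 4) / (real n * L))"
proof -
  have n2: "(real n)\<^sup>2 > 0" using n0 by simp
  obtain z where z: "z \<in> zeros n x" "\<bar>norm z - 1\<bar> \<le> y / (real n)\<^sup>2"
    using gap ne unfolding zero_gap_le_iff[OF n0(2) y(1)] by blast
  define v where "v = y / (real n)\<^sup>2"
  have "y\<^sup>2 \<le> (C + 4)\<^sup>2" using y by (intro power_mono) auto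
  hence yn: "2 * y\<^sup>2 \<le> \<epsilon> * (real n)\<^sup>2"
    using C_sq_le mult_pos_pos[OF \<epsilon>(1) n2] by linarith
  have "2 * y \<le> 2 * (C + 4)\<^sup>2" using C_plus_4 y by linarith
  moreover have "\<epsilon> * (real n)\<^sup>2 \<le> 1 * (real n)\<^sup>2"
    using \<epsilon> by (intro mult_right_mono) auto
  ultimately have "2 * y \<le> (real n)\<^sup>2" using C_sq_le n2 by linarith
  hence v1: "v \<le> 1 / 2" using n2 by (simp add: v_def divide_le_eq)
  have z0: "z \<noteq> 0" using z(2) v1 by (auto simp flip: v_def)
  have "\<bar>ln (1 + (norm z - 1)) - (norm z - 1)\<bar> \<le> 2 * (norm z - 1)\<^sup>2"
    using z(2) v1 by (intro abs_ln_one_plus_x_minus_x_bound) (simp flip: v_def)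
  moreover have "(norm z - 1)\<^sup>2 \<le> v\<^sup>2" using z(2) by (simp add: abs_le_square_iff[symmetric] v_def y)
  moreover have "\<bar>norm z - 1\<bar> \<le> v" using z(2) by (simp add: v_def)
  ultimately have "\<bar>ln (norm z)\<bar> \<le> v + 2 * v\<^sup>2" by simp
  also have "2 * v\<^sup>2 = 2 * y\<^sup>2 / (real n)\<^sup>2 / (real n)\<^sup>2" by (simp add: v_def power2_eq_square)
  also have "\<dots> \<le> \<epsilon> * (real n)\<^sup>2 / (real n)\<^sup>2 / (real n)\<^sup>2"
    using yn by (intro divide_right_mono) auto
  also have "\<dots> = \<epsilon> / (real n)\<^sup>2" using n2 by simp
  finally have lnz: "\<bar>ln (norm z)\<bar> \<le> (y + \<epsilon>) / (real n)\<^sup>2"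
    by (simp add: v_def add_divide_distrib)
  define w0 where "w0 = - \<i> * Ln z"
  have w0: "exp (\<i> * w0) = z" "Re w0 = Im (Ln z)" "Im w0 = - ln (norm z)" using z0 by (simp_all add: w0_def)
  \<comment> \<open>Reflection of \<open>w0\<close> in the imaginary axis conjugates the zero; as
    zeros of a real polynomial come in conjugate pairs, the angle may be placed in [0, pi].\<close>
  define w where "w = (if Re w0 \<ge> 0 then w0 else - cnj w0)"
  have "\<i> * - cnj w0 = cnj (\<i> * w0)" by (simp add: complex_eq_iff)
  hence "exp (\<i> * - cnj w0) = cnj z" using w0(1) by (simp only: exp_cnj[symmetric])
  hence "exp (\<i> * w) \<in> zeros n x" using z(1) cnj_zeros[OF z(1)] w0(1) by (simp add: w_def)
  hence "g w = 0" unfolding g_def exp_form_eq_0_iff .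
  moreover have "0 \<le> Re w" "Re w \<le> pi"
    using Im_Ln_le_pi[OF z0] mpi_less_Im_Ln[OF z0] by (auto simp: w_def w0(2))
  moreover have "\<bar>Im w\<bar> \<le> (y + \<epsilon>) / (real n)\<^sup>2" using lnz by (auto simp: w_def w0(3))
  moreover have "0 \<le> y + \<epsilon>" "y + \<epsilon> \<le> C" using y \<epsilon> by auto
  ultimately obtain j where "j \<le> n\<^sup>2" "norm (U (grid n j)) \<le> 4 * L * (C + 4) / real n"
     "root_cond n (pi / 2 + \<epsilon>) (y + \<epsilon> + \<epsilon>) (U (grid n j)) (H (grid n j)) \<or>
      norm (H (grid n j)) < 1 / L \<and> norm (U (grid n j)) \<le> 2 * (C + 4) / (real n * L)"
    using root_detected by blast
  moreover have "U_form n j x = U (grid n j)" "H_form n j x = H (grid n j)" for j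
    by (simp_all add: U_form_def H_form_def U_def H_def)
  moreover have "y + \<epsilon> + \<epsilon> = y + 2 * \<epsilon>" by simp
  ultimately show ?thesis unfolding root_near_iff by metis
qed

end

text \<open>Without zeros the leading coefficient must vanish, by the fundamental theorem of
  algebra; this has probability 0, as a small ball of radius 0.\<close>

lemma zeros_empty_null:
  assumes n: "n \<ge> 1"
  shows "{x \<in> space (gauss {..n}). x n = 0} \<in> sets (gauss {..n})"
    and "\<P>(x in gauss {..n}. x n = 0) = 0"
    and "zeros n x = {} \<Longrightarrow> x n = 0"
proof -
  note [measurable] = inner_on_measurable[OF finite_atMost]
  define e where "e k = (if k = n then 1 else 0 :: real)" for k
  have ie: "inner_on {..n} e x = x n" for x
    by (simp add: inner_on_def e_def if_distrib[of "\<lambda>u. u * _"] cong: if_cong)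
  have "{x \<in> space (gauss {..n}). inner_on {..n} e x = 0} \<in> sets (gauss {..n})" by measurable
  thus "{x \<in> space (gauss {..n}). x n = 0} \<in> sets (gauss {..n})" by (simp add: ie)
  have "\<P>(x in gauss {..n}. \<forall>j<1::nat. \<bar>inner_on {..n} e x\<bar> \<le> 0) \<le> (\<Prod>j<1::nat. 1 * 0)"
  proof (rule gauss_small_ball[where y="\<lambda>_. e"])
    fix j :: nat assume "j < 1"
    have "inner_on {..n} e e = 1" by (simp add: ie) (simp add: e_def)
    thus "\<exists>w. (\<forall>l<j. inner_on {..n} w e = 0) \<and> inner_on {..n} w e = 1 \<and> inner_on {..n} w w \<le> 1\<^sup>2"
      using \<open>j < 1\<close> by (intro exI[of _ e]) auto
  qed auto
  hence "\<P>(x in gauss {..n}. x n = 0) \<le> 0" by (simp add: ie)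
  thus "\<P>(x in gauss {..n}. x n = 0) = 0" by (simp add: measure_le_0_iff)
  assume Z: "zeros n x = {}"
  show "x n = 0"
  proof (rule ccontr)
    assume "x n \<noteq> 0"
    hence "\<exists>i\<in>{1..n}. complex_of_real (x i) \<noteq> 0" using n by (intro bexI[of _ n]) auto
    then obtain z where "(\<Sum>k\<le>n. complex_of_real (x k) * z ^ k) = 0"
      using fundamental_theorem_of_algebra[of "\<lambda>k. complex_of_real (x k)" n] by blast
    hence "z \<in> zeros n x" by (simp add: zeros_def)
    thus False using Z by simp
  qed
qed

lemma good_event_prob_limit:
  "(\<lambda>n. \<P>(x in gauss {..n}. \<not> good_event n x)) \<longlonglongrightarrow> 0"
proof (rule tendsto_sandwich[OF _ _ tendsto_const])
  show "eventually (\<lambda>n. \<P>(x in gauss {..n}. \<not> good_event n x) \<le> 28 * (real n)\<^sup>2 * exp (- (ln (real n))\<^sup>2 / 32)) sequentially"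
    using eventually_ge_at_top[of 1] by eventually_elim (rule good_event_prob)
  show "(\<lambda>n. 28 * (real n)\<^sup>2 * exp (- (ln (real n))\<^sup>2 / 32)) \<longlonglongrightarrow> 0"
    by real_asymp
qed simp

lemma eventually_good_sample:
  assumes "C \<ge> 1" "0 < \<epsilon>" "\<epsilon> \<le> 1"
  shows "eventually (\<lambda>n. \<forall>x. good_event n x \<longrightarrow> good_sample n x C \<epsilon> (ln (real n))) sequentially"
  using eventually_ln_ge[of 10] eventually_polylog[OF assms(2), of "100 * (C + 4)\<^sup>2" 3]
  by eventually_elim (use assms in \<open>auto intro!: good_sample.intro\<close>)

section \<open>The distribution function of the rescaled distance between two bounds\<close>

lemma zero_gap_prob_ge:
  assumes \<epsilon>: "0 < \<epsilon>" "\<epsilon> \<le> 1 / 4" "2 * \<epsilon> \<le> y"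
  shows "eventually (\<lambda>n. 1 - \<P>(x in gauss {..n}. \<forall>j\<in>bulk n. \<not> root_near n (pi / 2 - 2 * \<epsilon>) (y - 2 * \<epsilon>) (grid n j) x)
       - \<P>(x in gauss {..n}. \<not> good_event n x)
     \<le> \<P>(x in gauss {..n}. zero_gap n x \<le> y)) sequentially"
proof -
  \<comment> \<open>The height leaves room for the 2\<epsilon> lost in
    \<open>zero_gap_le_of_root_near\<close>; the half-width stays below pi/2, as
    \<open>no_cell_limit\<close> requires.\<close>
  define a b where "a = pi / 2 - 2 * \<epsilon>" and "b = y - 2 * \<epsilon>"
  have ab: "0 \<le> a" "0 \<le> b" "a + b + 1 \<le> y + 4" using \<epsilon> pi_gt3 pi_less_4 by (auto simp: a_def b_def)
  have "eventually (\<lambda>n. \<forall>x. good_event n x \<longrightarrow> good_sample n x (y + 4) \<epsilon> (ln (real n))) sequentially"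
    using \<epsilon> by (intro eventually_good_sample) auto
  thus ?thesis unfolding a_def[symmetric] b_def[symmetric] using eventually_ge_at_top[of 1]
  proof eventually_elim
    case (elim n)
    interpret prob_space "gauss {..n}" by (rule prob_space_gauss)
    let ?V = "{x \<in> space (gauss {..n}). \<forall>j\<in>bulk n. \<not> root_near n a b (grid n j) x}"
    let ?G = "{x \<in> space (gauss {..n}). \<not> good_event n x}"
    let ?P = "{x \<in> space (gauss {..n}). zero_gap n x \<le> y}"
    have [measurable]: "?V \<in> events" using finite_bulk[of n] by measurable
    have [measurable]: "?G \<in> events" by measurable
    have [measurable]: "?P \<in> events" using zero_gap_measurable elim(2) by measurable
    have "space (gauss {..n}) \<subseteq> ?V \<union> (?G \<union> ?P)"
    proof
      fix x assume x: "x \<in> space (gauss {..n})"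
      have "zero_gap n x \<le> y" if "good_event n x" "j \<in> bulk n" "root_near n a b (grid n j) x" for j
        using good_sample.zero_gap_le_of_root_near[OF elim(1)[rule_format, OF that(1)] that(2,3) ab]
          by (simp add: b_def)
      thus "x \<in> ?V \<union> (?G \<union> ?P)" using x by blast
    qed
    hence "prob (space (gauss {..n})) \<le> prob (?V \<union> (?G \<union> ?P))" by (intro finite_measure_mono) auto
    also have "\<dots> \<le> prob ?V + prob (?G \<union> ?P)" by (rule measure_Un_le) auto
    also have "prob (?G \<union> ?P) \<le> prob ?G + prob ?P" by (rule measure_Un_le) auto
    finally show ?case by (simp add: prob_space)
  qed
qed

lemma root_cond_mono: "root_cond n a b U H \<Longrightarrow> a \<le> a' \<Longrightarrow> root_cond n a' b U H"
  unfolding root_cond_def by (meson divide_right_mono of_nat_0_le_iff order_trans)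

text \<open>A close zero is detected by a window of half-width pi/2 + \<epsilon>, for which no void
  probability is available. Either the narrower window of half-width pi/2 - \<epsilon> already
  detects it, or some cell lies in the difference of the two nested events, whose probability is the
  difference of the first moments. The last three terms cover flat cells, cells near the real axis
  and bad samples; a vanishing leading coefficient is a null event.\<close>

lemma zero_gap_prob_le:
  assumes \<epsilon>: "0 < \<epsilon>" "\<epsilon> \<le> 1" and y: "0 \<le> y"
  shows "eventually (\<lambda>n. \<P>(x in gauss {..n}. zero_gap n x \<le> y) \<le>
     (1 - \<P>(x in gauss {..n}. \<forall>j\<in>bulk n. \<not> root_near n (pi / 2 - \<epsilon>) (y + 2 * \<epsilon>) (grid n j) x))
     + ((\<Sum>j\<in>bulk n. \<P>(x in gauss {..n}. root_near n (pi / 2 + \<epsilon>) (y + 2 * \<epsilon>) (grid n j) x))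
        - (\<Sum>j\<in>bulk n. \<P>(x in gauss {..n}. root_near n (pi / 2 - \<epsilon>) (y + 2 * \<epsilon>) (grid n j) x)))
     + (\<Sum>j\<in>bulk n. measure (gauss {..n}) {x \<in> space (gauss {..n}).
          norm (H_form n j x) < 1 / ln (real n) \<and> norm (U_form n j x) \<le> 2 * (y + 5) / (real n * ln (real n))})
     + (\<Sum>j\<in>{..n\<^sup>2} - bulk n. measure (gauss {..n}) {x \<in> space (gauss {..n}).
          norm (U_form n j x) \<le> 4 * (y + 5) * ln (real n) / real n})
     + \<P>(x in gauss {..n}. \<not> good_event n x)) sequentially"
proof -
  define a a' b where "a = pi / 2 - \<epsilon>" and "a' = pi / 2 + \<epsilon>" and "b = y + 2 * \<epsilon>"
  have "eventually (\<lambda>n. \<forall>x. good_event n x \<longrightarrow> good_sample n x (y + 1) \<epsilon> (ln (real n))) sequentially"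
    using \<epsilon> y by (intro eventually_good_sample) auto
  thus ?thesis unfolding a_def[symmetric] a'_def[symmetric] b_def[symmetric] using eventually_ge_at_top[of 1]
  proof eventually_elim
    case (elim n)
    interpret prob_space "gauss {..n}" by (rule prob_space_gauss)
    let ?M = "gauss {..n}"
    let ?P = "{x \<in> space ?M. zero_gap n x \<le> y}"
    let ?V = "{x \<in> space ?M. \<forall>j\<in>bulk n. \<not> root_near n a b (grid n j) x}"
    let ?E = "{x \<in> space ?M. \<exists>j\<in>bulk n. root_near n a b (grid n j) x}"
    let ?A = "\<lambda>a j. {x \<in> space ?M. root_near n a b (grid n j) x}"
    let ?S = "\<lambda>j. {x \<in> space ?M. norm (H_form n j x) < 1 / ln (real n) \<and> norm (U_form n j x) \<le> 2 * (y + 5) / (real n * ln (real n))}"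
    let ?N = "\<lambda>j. {x \<in> space ?M. norm (U_form n j x) \<le> 4 * (y + 5) * ln (real n) / real n}"
    let ?G = "{x \<in> space ?M. \<not> good_event n x}"
    let ?Z = "{x \<in> space ?M. x n = 0}"
    have [measurable]: "?V \<in> events" "?E \<in> events" using finite_bulk[of n] by measurable
    have [measurable]: "?G \<in> events" "?A c j \<in> events" "?S j \<in> events" "?N j \<in> events" for c j
      by measurable
    have [measurable]: "?Z \<in> events" using zeros_empty_null(1) elim(2) by blast
    have fin: "finite (bulk n)" "finite ({..n\<^sup>2} - bulk n)" by (simp_all add: finite_bulk)
    let ?D = "\<Union>j\<in>bulk n. ?A a' j - ?A a j" and ?SS = "\<Union>j\<in>bulk n. ?S j" and ?NN = "\<Union>j\<in>{..n\<^sup>2} - bulk n. ?N j"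
    have [measurable]: "?D \<in> events" "?SS \<in> events" "?NN \<in> events"
      using fin by (auto intro!: sets.finite_UN sets.Diff)
    have "?P \<subseteq> ?E \<union> (?D \<union> (?SS \<union> (?NN \<union> (?G \<union> ?Z))))"
    proof
      fix x assume "x \<in> ?P"
      hence x: "x \<in> space ?M" and gap: "zero_gap n x \<le> y" by auto
      show "x \<in> ?E \<union> (?D \<union> (?SS \<union> (?NN \<union> (?G \<union> ?Z))))"
      proof (cases "good_event n x \<and> x n \<noteq> 0")
        case True
        hence gs: "good_sample n x (y + 1) \<epsilon> (ln (real n))" and ne: "zeros n x \<noteq> {}"
          using elim(1) zeros_empty_null(3)[OF elim(2)] by auto
        obtain j where j: "j \<le> n\<^sup>2" "norm (U_form n j x) \<le> 4 * ln (real n) * (y + 1 + 4) / real n"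
          "root_near n a' b (grid n j) x \<or> norm (H_form n j x) < 1 / ln (real n) \<and> norm (U_form n j x) \<le> 2 * (y + 1 + 4) / (real n * ln (real n))"
          using good_sample.root_near_of_zero_gap_le[OF gs ne gap y] unfolding a'_def b_def by auto
        have y5: "y + 1 + 4 = y + 5" by simp
        have N: "x \<in> ?N j" using x j(2) by (simp add: y5 mult_ac)
        show ?thesis
        proof (cases "j \<in> bulk n")
          case False
          thus ?thesis using N j(1) by blast
        next
          case jb: True
          from j(3) show ?thesis
          proof
            assume "root_near n a' b (grid n j) x"
            thus ?thesis using jb x by blast
          next
            assume "norm (H_form n j x) < 1 / ln (real n) \<and> norm (U_form n j x) \<le> 2 * (y + 1 + 4) / (real n * ln (real n))"
            thus ?thesis using jb x unfolding y5 by blast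
          qed
        qed
      qed (use x in blast)
    qed
    hence "prob ?P \<le> prob (?E \<union> (?D \<union> (?SS \<union> (?NN \<union> (?G \<union> ?Z)))))"
      by (rule finite_measure_mono) measurable
    also have "\<dots> \<le> prob ?E + (prob ?D + (prob ?SS + (prob ?NN + (prob ?G + prob ?Z))))"
    proof -
      have s: "prob (A \<union> B) \<le> prob A + r" if "prob B \<le> r" "A \<in> events" "B \<in> events" for A B r
        using measure_Un_le[OF that(2,3)] that(1) by linarith
      show ?thesis by (intro s order_refl) measurable
    qed
    also have "prob ?Z = 0" by (rule zeros_empty_null(2)[OF elim(2)])
    also have "prob ?SS \<le> (\<Sum>j\<in>bulk n. prob (?S j))"
      by (rule finite_measure_subadditive_finite[OF fin(1)]) auto
    also have "prob ?NN \<le> (\<Sum>j\<in>{..n\<^sup>2} - bulk n. prob (?N j))"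
      by (rule finite_measure_subadditive_finite[OF fin(2)]) auto
    also have "prob ?D \<le> (\<Sum>j\<in>bulk n. prob (?A a' j - ?A a j))"
      by (rule finite_measure_subadditive_finite[OF fin(1)]) auto
    also have "\<dots> = (\<Sum>j\<in>bulk n. prob (?A a' j) - prob (?A a j))"
    proof (rule sum.cong[OF refl])
      fix j
      have "?A a j \<subseteq> ?A a' j"
        using \<epsilon> by (auto simp: root_near_def a_def a'_def elim!: root_cond_mono)
      thus "prob (?A a' j - ?A a j) = prob (?A a' j) - prob (?A a j)" by (intro finite_measure_Diff) auto
    qed
    also have "\<dots> = (\<Sum>j\<in>bulk n. prob (?A a' j)) - (\<Sum>j\<in>bulk n. prob (?A a j))"
      by (rule sum_subtractf)
    also have "prob ?E = 1 - prob ?V"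
    proof -
      have "?E = space ?M - ?V" by auto
      thus ?thesis using prob_compl[of ?V] by simp
    qed
    finally show ?case by simp
  qed
qed

text \<open>With half-width near pi/2 and height near y the exponent ab/(3 pi) is near y/6. In the
  upper bound the surplus of first moments tends to 2\<epsilon> (y + 2\<epsilon>)/(3 pi). Both
  bounds are continuous in \<epsilon> with the right value at 0, so \<epsilon> is chosen before
  n.\<close>

lemma zero_gap_limit:
  assumes y: "y > 0"
  shows "(\<lambda>n. \<P>(x in gauss {..n}. zero_gap n x \<le> y)) \<longlonglongrightarrow> 1 - exp (- y / 6)"
proof (rule order_tendstoI)
  fix l assume l: "l < 1 - exp (- y / 6)"
  define F where "F \<epsilon> = 1 - exp (- ((pi / 2 - 2 * \<epsilon>) * (y - 2 * \<epsilon>) / (3 * pi)))" for \<epsilon> :: real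
  have "(F \<longlongrightarrow> F 0) (at_right 0)" unfolding F_def by (intro tendsto_intros) auto
  moreover have "F 0 = 1 - exp (- y / 6)" by (simp add: F_def)
  ultimately have "eventually (\<lambda>\<epsilon>. l < F \<epsilon>) (at_right 0)" using l by (metis order_tendstoD(1))
  moreover have "eventually (\<lambda>\<epsilon>::real. \<epsilon> < min (1/4) (y / 2)) (at_right 0)"
    using y by (intro eventually_at_right_less order_tendstoD(2)[OF tendsto_ident_at]) auto
  moreover have "eventually (\<lambda>\<epsilon>::real. 0 < \<epsilon>) (at_right 0)" by (rule eventually_at_right_less)
  ultimately have "eventually (\<lambda>\<epsilon>. l < F \<epsilon> \<and> \<epsilon> < min (1/4) (y / 2) \<and> 0 < \<epsilon>) (at_right 0)" by eventually_elim auto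
  then obtain \<epsilon> where \<epsilon>: "l < F \<epsilon>" "\<epsilon> < min (1/4) (y / 2)" "0 < \<epsilon>"
    using eventually_happens'[OF trivial_limit_at_right_real] by blast
  have "(\<lambda>n. 1 - \<P>(x in gauss {..n}. \<forall>j\<in>bulk n. \<not> root_near n (pi / 2 - 2 * \<epsilon>) (y - 2 * \<epsilon>) (grid n j) x)
       - \<P>(x in gauss {..n}. \<not> good_event n x)) \<longlonglongrightarrow> F \<epsilon> - 0"
    unfolding F_def
      using \<epsilon> pi_gt3 by (intro tendsto_diff tendsto_const no_cell_limit good_event_prob_limit) auto
  hence "eventually (\<lambda>n. l < 1 - \<P>(x in gauss {..n}. \<forall>j\<in>bulk n. \<not> root_near n (pi / 2 - 2 * \<epsilon>) (y - 2 * \<epsilon>) (grid n j) x)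
       - \<P>(x in gauss {..n}. \<not> good_event n x)) sequentially"
    using \<epsilon>(1) by (intro order_tendstoD(1)) auto
  moreover have "\<epsilon> \<le> 1 / 4" "2 * \<epsilon> \<le> y" using \<epsilon> by auto
  note zero_gap_prob_ge[OF \<epsilon>(3) this]
  ultimately show "eventually (\<lambda>n. l < \<P>(x in gauss {..n}. zero_gap n x \<le> y)) sequentially"
    by eventually_elim linarith
next
  fix u assume u: "1 - exp (- y / 6) < u"
  define F where "F \<epsilon> = (1 - exp (- ((pi / 2 - \<epsilon>) * (y + 2 * \<epsilon>) / (3 * pi))))
     + ((pi / 2 + \<epsilon>) * (y + 2 * \<epsilon>) / (3 * pi) - (pi / 2 - \<epsilon>) * (y + 2 * \<epsilon>) / (3 * pi))" for \<epsilon> :: real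
  have "(F \<longlongrightarrow> F 0) (at_right 0)" unfolding F_def by (intro tendsto_intros) auto
  moreover have "F 0 = 1 - exp (- y / 6)" by (simp add: F_def)
  ultimately have "eventually (\<lambda>\<epsilon>. F \<epsilon> < u) (at_right 0)" using u by (metis order_tendstoD(2))
  moreover have "eventually (\<lambda>\<epsilon>::real. \<epsilon> < 1) (at_right 0)"
    by (intro order_tendstoD(2)[OF tendsto_ident_at]) auto
  moreover have "eventually (\<lambda>\<epsilon>::real. 0 < \<epsilon>) (at_right 0)" by (rule eventually_at_right_less)
  ultimately have "eventually (\<lambda>\<epsilon>. F \<epsilon> < u \<and> \<epsilon> < 1 \<and> 0 < \<epsilon>) (at_right 0)" by eventually_elim auto
  then obtain \<epsilon> where \<epsilon>: "F \<epsilon> < u" "\<epsilon> < 1" "0 < \<epsilon>"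
    using eventually_happens'[OF trivial_limit_at_right_real] by blast
  let ?R = "\<lambda>n. (1 - \<P>(x in gauss {..n}. \<forall>j\<in>bulk n. \<not> root_near n (pi / 2 - \<epsilon>) (y + 2 * \<epsilon>) (grid n j) x))
     + ((\<Sum>j\<in>bulk n. \<P>(x in gauss {..n}. root_near n (pi / 2 + \<epsilon>) (y + 2 * \<epsilon>) (grid n j) x))
        - (\<Sum>j\<in>bulk n. \<P>(x in gauss {..n}. root_near n (pi / 2 - \<epsilon>) (y + 2 * \<epsilon>) (grid n j) x)))
     + (\<Sum>j\<in>bulk n. measure (gauss {..n}) {x \<in> space (gauss {..n}).
          norm (H_form n j x) < 1 / ln (real n) \<and> norm (U_form n j x) \<le> 2 * (y + 5) / (real n * ln (real n))})
     + (\<Sum>j\<in>{..n\<^sup>2} - bulk n. measure (gauss {..n}) {x \<in> space (gauss {..n}).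
          norm (U_form n j x) \<le> 4 * (y + 5) * ln (real n) / real n})
     + \<P>(x in gauss {..n}. \<not> good_event n x)"
  have "?R \<longlonglongrightarrow> F \<epsilon> + 0 + 0 + 0"
    unfolding F_def using \<epsilon> y pi_gt3
    by (intro tendsto_add tendsto_diff tendsto_const no_cell_limit cell_first_moment good_event_prob_limit
        small_derivative_sum near_axis_sum) auto
  hence "eventually (\<lambda>n. ?R n < u) sequentially"
    using \<epsilon>(1) by (intro order_tendstoD(2)) auto
  moreover have "\<epsilon> \<le> 1" "0 \<le> y" using \<epsilon> y by auto
  note zero_gap_prob_le[OF \<epsilon>(3) this]
  ultimately show "eventually (\<lambda>n. \<P>(x in gauss {..n}. zero_gap n x \<le> y) < u) sequentially"
    by eventually_elim (rule le_less_trans)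
qed

section \<open>Transfer to the given coefficients and convergence in distribution\<close>

lemma zero_set_rand_poly: "zero_set (rand_poly \<epsilon> n \<omega>) = zeros n (\<lambda>k\<in>{..n}. \<epsilon> k \<omega>)"
  by (simp add: zero_set_def rand_poly_def zeros_def)

lemma (in prob_space) iid_normal_distr:
  assumes ind: "indep_vars (\<lambda>_. borel) X {..n::nat}"
    and dist: "\<And>k. k \<le> n \<Longrightarrow> distributed M lborel (X k) std_normal_density"
  shows "(\<lambda>\<omega>. \<lambda>k\<in>{..n}. X k \<omega>) \<in> measurable M (gauss {..n})"
    and "distr M (gauss {..n}) (\<lambda>\<omega>. \<lambda>k\<in>{..n}. X k \<omega>) = gauss {..n}"
proof -
  have rv: "random_variable borel (X k)" if "k \<in> {..n}" for k using ind that by (simp add: indep_vars_def)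
  have sg: "sets (gauss {..n}) = sets (\<Pi>\<^sub>M k\<in>{..n}. borel)"
    unfolding gauss_def by (intro sets_PiM_cong) auto
  have "(\<lambda>\<omega>. \<lambda>k\<in>{..n}. X k \<omega>) \<in> measurable M (\<Pi>\<^sub>M k\<in>{..n}. borel)"
    by (intro measurable_restrict rv)
  thus "(\<lambda>\<omega>. \<lambda>k\<in>{..n}. X k \<omega>) \<in> measurable M (gauss {..n})"
    by (simp add: measurable_cong_sets[OF refl sg])
  have "distr M (gauss {..n}) (\<lambda>\<omega>. \<lambda>k\<in>{..n}. X k \<omega>) = distr M (\<Pi>\<^sub>M k\<in>{..n}. borel) (\<lambda>\<omega>. \<lambda>k\<in>{..n}. X k \<omega>)"
    by (rule distr_cong[OF refl sg refl])
  also have "\<dots> = (\<Pi>\<^sub>M k\<in>{..n}. distr M borel (X k))"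
    using ind rv by (subst (asm) indep_vars_iff_distr_eq_PiM') auto
  also have "\<dots> = gauss {..n}"
    unfolding gauss_def
  proof (rule PiM_cong[OF refl])
    fix k assume "k \<in> {..n}"
    hence "distr M lborel (X k) = std_normal_distribution" using dist by (intro distributed_distr_eq_density) auto
    moreover have "distr M lborel (X k) = distr M borel (X k)" by (rule distr_cong) auto
    ultimately show "distr M borel (X k) = std_normal_distribution" by simp
  qed
  finally show "distr M (gauss {..n}) (\<lambda>\<omega>. \<lambda>k\<in>{..n}. X k \<omega>) = gauss {..n}" .
qed

theorem corollary2:
  fixes M :: "nat \<Rightarrow> 'a measure"
    and \<epsilon> :: "nat \<Rightarrow> nat \<Rightarrow> 'a \<Rightarrow> real"
  assumes "\<And>n. n \<ge> 1 \<Longrightarrow> prob_space (M n)"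
    and "\<And>n. n \<ge> 1 \<Longrightarrow> prob_space.indep_vars (M n) (\<lambda>_. borel) (\<epsilon> n) {..n}"
    and "\<And>n k. n \<ge> 1 \<Longrightarrow> k \<le> n \<Longrightarrow> distributed (M n) lborel (\<epsilon> n k) std_normal_density"
  shows "weak_conv_m
    (\<lambda>n. distr (M n) borel
       (\<lambda>\<omega>. (real n)\<^sup>2 * setdist (zero_set (rand_poly (\<epsilon> n) n \<omega>)) (sphere 0 1)))
    (density lborel (exponential_density (1/6)))"
proof -
  let ?\<mu> = "\<lambda>n. distr (M n) borel (\<lambda>\<omega>. (real n)\<^sup>2 * setdist (zero_set (rand_poly (\<epsilon> n) n \<omega>)) (sphere 0 1))"
  let ?G = "\<lambda>n y. \<P>(x in gauss {..n}. zero_gap n x \<le> y)"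
  \<comment> \<open>The law of the distance depends only on the joint law of the coefficients, so
    the probability space may change with n.\<close>
  have cdf_eq: "cdf (?\<mu> n) y = ?G n y" if n: "n \<ge> 1" for n y
  proof -
    interpret prob_space "M n" by (rule assms(1)[OF n])
    let ?X = "\<lambda>\<omega>. \<lambda>k\<in>{..n}. \<epsilon> n k \<omega>"
    note X = iid_normal_distr[OF assms(2)[OF n] assms(3)[OF n]]
    have "?\<mu> n = distr (M n) borel (zero_gap n \<circ> ?X)"
      by (simp add: zero_set_rand_poly zero_gap_def o_def)
    also have "\<dots> = distr (distr (M n) (gauss {..n}) ?X) borel (zero_gap n)"
      using distr_distr[OF zero_gap_measurable[OF n] X(1)] by simp
    also have "\<dots> = distr (gauss {..n}) borel (zero_gap n)" by (subst X(2)) auto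
    finally have "cdf (?\<mu> n) y = measure (distr (gauss {..n}) borel (zero_gap n)) {..y}" by (simp add: cdf_def)
    also have "\<dots> = measure (gauss {..n}) (zero_gap n -` {..y} \<inter> space (gauss {..n}))"
      by (rule measure_distr[OF zero_gap_measurable[OF n]]) simp
    also have "zero_gap n -` {..y} \<inter> space (gauss {..n}) = {x \<in> space (gauss {..n}). zero_gap n x \<le> y}"
      by auto
    finally show ?thesis .
  qed
  have exp_cdf: "cdf (density lborel (exponential_density (1/6))) y = (if 0 \<le> y then 1 - exp (- y / 6) else 0)" for y :: real
  proof -
    have "emeasure (density lborel (exponential_density (1/6))) {..y} = ennreal (erlang_CDF 0 (1/6) y)"
      by (rule emeasure_erlang_density) simp
    thus ?thesis by (simp add: cdf_def measure_def erlang_CDF_0)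
  qed
  have pos: "(\<lambda>n. ?G n y) \<longlonglongrightarrow> 1 - exp (- y / 6)" if "y > 0" for y
    using that by (rule zero_gap_limit)
  have neg: "?G n y = 0" if "y < 0" for n y
  proof -
    have "zero_gap n x \<ge> 0" for x by (simp add: zero_gap_def setdist_pos_le)
    hence "{x \<in> space (gauss {..n}). zero_gap n x \<le> y} = {}"
      using that by (auto simp: not_le intro: less_le_trans)
    thus ?thesis by (simp only: measure_empty)
  qed
  \<comment> \<open>The limit theorem covers y > 0 only; at 0 monotonicity bounds the probability by
    the one at any small y > 0, whose limit is close to 0.\<close>
  have zero: "(\<lambda>n. ?G n 0) \<longlonglongrightarrow> 0"
  proof (rule order_tendstoI)
    fix u :: real assume u: "0 < u"
    have "((\<lambda>y::real. 1 - exp (- y / 6)) \<longlongrightarrow> 1 - exp (- 0 / 6)) (at_right 0)"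
      by (intro tendsto_intros) auto
    hence "eventually (\<lambda>y. 1 - exp (- y / 6) < u) (at_right (0::real))"
      using u by (intro order_tendstoD(2)) auto
    moreover have "eventually (\<lambda>y::real. 0 < y) (at_right 0)" by (rule eventually_at_right_less)
    ultimately have "eventually (\<lambda>y::real. 1 - exp (- y / 6) < u \<and> 0 < y) (at_right 0)"
      by eventually_elim auto
    then obtain y :: real where y: "1 - exp (- y / 6) < u" "y > 0"
      using eventually_happens'[OF trivial_limit_at_right_real] by blast
    have "eventually (\<lambda>n. ?G n y < u) sequentially" using order_tendstoD(2)[OF pos[OF y(2)] y(1)] .
    thus "eventually (\<lambda>n. ?G n 0 < u) sequentially" using eventually_ge_at_top[of 1]
    proof eventually_elim
      case (elim n)
      interpret prob_space "gauss {..n}" by (rule prob_space_gauss)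
      have "?G n 0 \<le> ?G n y"
        using zero_gap_measurable[OF elim(2)] y(2) by (intro finite_measure_mono) auto
      thus ?case using elim by simp
    qed
  qed (auto intro!: always_eventually less_le_trans[OF _ measure_nonneg])
  have "(\<lambda>n. cdf (?\<mu> n) y) \<longlonglongrightarrow> cdf (density lborel (exponential_density (1/6))) y" for y
  proof -
    have "(\<lambda>n. ?G n y) \<longlonglongrightarrow> (if 0 \<le> y then 1 - exp (- y / 6) else 0)"
      using pos[of y] neg[of y] zero by (cases "y = 0") auto
    moreover have "eventually (\<lambda>n. ?G n y = cdf (?\<mu> n) y) sequentially"
      using eventually_ge_at_top[of 1] by eventually_elim (simp add: cdf_eq)
    ultimately show ?thesis unfolding exp_cdf by (rule Lim_transform_eventually)
  qed
  thus ?thesis unfolding weak_conv_m_def weak_conv_def by blast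
qed

end
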